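(* Let $k>5/2$, let $\eta>0$ be a fixed constant, and suppose $w(0)\in\mathcal N_{L^2}^{\eta\varepsilon^{k-2}}$. Then, locally in time (as long as $w(t)\in\mathcal N_{L^2}^{C\varepsilon^{k-2}}$, $C$ a fixed constant), the noise-induced terms $$d\mathcal A_t=A^{-1}\Big[\tfrac12(v,\partial_\xi^3u)-\tfrac32(\partial_\xi^2u,\partial_\xi u)\Big](\mathcal Q\sigma,\sigma)\,dt+A^{-1}(\sigma,\mathcal Q\,\partial_\xi^2u)\,dt+A^{-1}(\partial_\xi u,dW),$$ with $A:=\|\partial_\xi u\|^2-(v,\partial_\xi^2u)$ and $\sigma=A^{-1}\partial_\xi u$, satisfy $$d\mathcal A_t=\mathcal O(\eta_1)\,dt+\big(\mathcal O_{L^2}(\varepsilon^{1/2}),dW\big),$$ where $\eta_1=\|\mathcal Q\|$. Moreover, the $\mathcal O(\eta_1)$ term (the total $dt$-coefficient) equals $$A^{-2}(\partial_\xi u,\mathcal Q\,\partial_\xi^2u)+\mathcal O\big(\eta_1\varepsilon^{\min\{1,\,k-5/2\}}\big).$$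
   Context: Setting. $\Omega\subset\mathbb R^2$ is a bounded domain with smooth boundary, $\delta>0$ is small and fixed, $\Omega_\delta=\delta^{-1}\Omega$, $f(u)=u^3-u=F'(u)$ with $F(u)=\frac14(u^2-1)^2$, and $0<\varepsilon\le\frac12C_1^*\delta^2$ is small, $C_1^*=\frac{8\pi f'(1)}{3\sqrt6\,|\Omega|\int_{-1}^1\sqrt{F(s)}\,ds}$. $(\cdot,\cdot)$ and $\|\cdot\|$ are the inner product and norm of $L^2(\Omega_\delta)$. $\mathcal L^\varepsilon(v)=\varepsilon^2\Delta v-f(v)+\frac1{|\Omega_\delta|}\int_{\Omega_\delta}f(v)\,dx$ with $\partial_nv=0$ on $\partial\Omega_\delta$. $\mathcal O$-terms are as $\varepsilon\to0^+$, with constants uniform in $\varepsilon$, $\xi$ and $t$ ($\delta$ is fixed; where $\delta$ occurs inside $\mathcal O$ it records the dependence on $\delta$). $\mathcal O_{L^\infty}$, $\mathcal O_{L^2}$ mean bounded in $L^\infty$, $L^2(\Omega_\delta)$. Droplets (construction of Alikakos, Chen and Fusco). Fix a large integer $K>k$. For $\xi$ the arc-length parameter of $\partial\Omega_\delta$ (taken periodically) there are a smooth function $u=u(\cdot,\xi,\varepsilon)$ on $\Omega_\delta$ and a scalar $c=c(\xi,\varepsilon)=\mathcal O(\delta^2)$ with $\mathcal L^\varepsilon(u)=\varepsilon^2c\,\partial_\xi u+\mathcal O_{L^\infty}(\varepsilon^K)$ in $\Omega_\delta$, $\partial_nu=0$ on $\partial\Omega_\delta$, $\int_{\Omega_\delta}u=|\Omega_\delta|-\pi$;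 $\partial_\xi^lu$ is the $l$-th derivative in $\xi$ at fixed $x$. Structure: there is a nearly semicircular curve $\Gamma$ of radius approximately $1$, centred near the boundary point with parameter $\xi$ and meeting $\partial\Omega_\delta$ orthogonally. Let $r$ be the signed distance to $\Gamma$ (negative inside), $s$ the arc length on $\Gamma$, $R=r/\varepsilon$; $r_\xi=-\cos(\pi s/|\Gamma|)+\mathcal O(\delta)$ and all $\xi$-derivatives of $r,s$ are bounded uniformly in $\varepsilon$. Let $U$ solve $\ddot U=f(U)$, $U(\pm\infty)=\pm1$, $\int_{\mathbb R}R\dot U^2dR=0$. Near $\Gamma$, $u=u^I+u^B$ with $u^I=U(R)+\varepsilon\sum_{j\ge0}\varepsilon^ju^I_j$ and corner-layer corrections $u^B=\sum_{j\ge1}\varepsilon^ju^{B\pm}_j$ at the two end points of $\Gamma$ (finite sums with length depending on $K$); all derivatives of $u_j^I,u_j^{B\pm}$ in $(R,s,\xi)$ are bounded uniformly in $\varepsilon$. Globally, $u^I$ is replaced by $(1-\zeta^+-\zeta^-)u^I+\zeta^+u^++\zeta^-u^-$ with $\zeta^\pm=\zeta(\pm\frac r{\varepsilon\ln^2\varepsilon}-1)$, $\zeta$ a smooth monotone cut-off ($0$ on $s<0$, $1$ on $s>1$), $u^\pm=\pm1+\varepsilon\sum_{j\ge0}\varepsilon^ju^\pm_j$ with smooth $u_j^\pm$ bounded with all derivatives; $u^B$ is cut off analogously. Manifold. $\mathcal M=\{u(\cdot,\xi,\varepsilon):\xi\in[0,|\partial\Omega_\delta|]\}$; $\mathcal N_{L^2}^\rho=\{v\in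 L^2(\Omega_\delta):d_{L^2}(v,\mathcal M)<\rho\}$. Noise. $W(t)=\sum_ka_k\beta_k(t)e_k$ is a $\mathcal Q$-Wiener process in $L^2(\Omega_\delta)$: $\beta_k$ independent real Brownian motions, $(e_k)$ an orthonormal basis with $\mathcal Qe_k=a_k^2e_k$, $\int_{\Omega_\delta}W(t)\,dx=0$; $\eta_0=\mathrm{trace}(\mathcal Q)=\sum a_k^2<\infty$, $\eta_1=\|\mathcal Q\|$ (operator norm), $\eta_2=\sum a_k^2\|\nabla e_k\|^2<\infty$; these may depend on $\varepsilon$. $(g,dW)=\sum_ka_k(g,e_k)\,d\beta_k$. Equation and decomposition. $w$ solves $dw=\mathcal L^\varepsilon(w)\,dt+dW$ with Neumann boundary conditions and $\int_{\Omega_\delta}w=|\Omega_\delta|-\pi$. While $w(t)$ is in a small tube around $\mathcal M$, write $w(t)=u(\cdot,\xi(t),\varepsilon)+v(t)$ with $v(t)\perp\partial_\xi u(\cdot,\xi(t),\varepsilon)$ in $L^2(\Omega_\delta)$; $u$ and its $\xi$-derivatives are evaluated at $\xi(t)$. Here $\xi$ is a diffusion $d\xi=b\,dt+(\sigma,dW)$. *)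

theory Defs
  imports "HOL-Analysis.Analysis" "HOL-Probability.Probability"
begin

section \<open>Smooth functions of several variables\<close>

definition dir_deriv :: "'a \<Rightarrow> ('a::euclidean_space \<Rightarrow> 'b::real_normed_vector) \<Rightarrow> 'a \<Rightarrow> 'b" where
  "dir_deriv v f x = frechet_derivative f (at x) v"

primrec iter_deriv :: "'a list \<Rightarrow> ('a::euclidean_space \<Rightarrow> 'b::real_normed_vector) \<Rightarrow> 'a \<Rightarrow> 'b" where
  "iter_deriv [] f = f"
| "iter_deriv (v # vs) f = dir_deriv v (iter_deriv vs f)"

text \<open>\<open>C\<^sup>\<infinity>\<close> on an open set: every iterated partial derivative is again differentiable.\<close>

definition smooth_on :: "'a::euclidean_space set \<Rightarrow> ('a \<Rightarrow> 'b::real_normed_vector) \<Rightarrow> bool" where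
  "smooth_on S f \<longleftrightarrow> open S \<and>
     (\<forall>vs. set vs \<subseteq> Basis \<longrightarrow> (\<forall>x\<in>S. iter_deriv vs f differentiable (at x)))"

text \<open>A family indexed by \<open>\<epsilon> \<in> I\<close>, smooth with all derivatives bounded uniformly in \<open>\<epsilon>\<close>.\<close>

definition smooth_bounded :: "real set \<Rightarrow> (real \<Rightarrow> 'a::euclidean_space set) \<Rightarrow> (real \<Rightarrow> 'a \<Rightarrow> real) \<Rightarrow> bool" where
  "smooth_bounded I S g \<longleftrightarrow>
     (\<forall>\<epsilon>\<in>I. smooth_on (S \<epsilon>) (g \<epsilon>)) \<and>
     (\<forall>vs. set vs \<subseteq> Basis \<longrightarrow> (\<exists>B. \<forall>\<epsilon>\<in>I. \<forall>x\<in>S \<epsilon>. \<bar>iter_deriv vs (g \<epsilon>) x\<bar> \<le> B))"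

definition laplacian :: "('a::euclidean_space \<Rightarrow> real) \<Rightarrow> 'a \<Rightarrow> real" where
  "laplacian g x = (\<Sum>i\<in>Basis. iter_deriv [i, i] g x)"

text \<open>\<open>l\<close>-th derivative in the parameter \<open>\<xi>\<close> at fixed \<open>x\<close>.\<close>

definition dxi :: "nat \<Rightarrow> (real \<Rightarrow> 'a \<Rightarrow> real) \<Rightarrow> real \<Rightarrow> 'a \<Rightarrow> real" where
  "dxi l u \<xi> x = (deriv ^^ l) (\<lambda>\<xi>'. u \<xi>' x) \<xi>"

section \<open>The space \<open>L\<^sup>2(D)\<close>, by representatives\<close>

definition L2 :: "'a::euclidean_space set \<Rightarrow> ('a \<Rightarrow> real) set" where
  "L2 D = {g. g \<in> borel_measurable (lebesgue_on D) \<and> integrable (lebesgue_on D) (\<lambda>x. (g x)\<^sup>2)}"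

definition ip :: "'a::euclidean_space set \<Rightarrow> ('a \<Rightarrow> real) \<Rightarrow> ('a \<Rightarrow> real) \<Rightarrow> real" where
  "ip D g h = (LINT x|lebesgue_on D. g x * h x)"

definition L2norm :: "'a::euclidean_space set \<Rightarrow> ('a \<Rightarrow> real) \<Rightarrow> real" where
  "L2norm D g = sqrt (ip D g g)"

definition integral_on :: "'a::euclidean_space set \<Rightarrow> ('a \<Rightarrow> real) \<Rightarrow> real" where
  "integral_on D g = (LINT x|lebesgue_on D. g x)"

definition op_norm :: "'a::euclidean_space set \<Rightarrow> (('a \<Rightarrow> real) \<Rightarrow> ('a \<Rightarrow> real)) \<Rightarrow> real" where
  "op_norm D Q = Sup {L2norm D (Q g) | g. g \<in> L2 D \<and> L2norm D g \<le> 1}"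

definition has_weak_gradient :: "'a::euclidean_space set \<Rightarrow> ('a \<Rightarrow> real) \<Rightarrow> ('a \<Rightarrow> 'a) \<Rightarrow> bool" where
  "has_weak_gradient D g grad \<longleftrightarrow>
     (\<forall>i\<in>Basis. (\<lambda>x. grad x \<bullet> i) \<in> L2 D) \<and>
     (\<forall>\<phi> C. smooth_on UNIV \<phi> \<and> compact C \<and> C \<subseteq> D \<and> (\<forall>x. x \<notin> C \<longrightarrow> \<phi> x = 0) \<longrightarrow>
        (\<forall>i\<in>Basis. ip D g (dir_deriv i \<phi>) = - ip D (\<lambda>x. grad x \<bullet> i) \<phi>))"

section \<open>The mass-conserving Allen--Cahn operator\<close>

definition nonlin :: "real \<Rightarrow> real" where
  "nonlin u = u ^ 3 - u"

definition potential :: "real \<Rightarrow> real" where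
  "potential u = (u\<^sup>2 - 1)\<^sup>2 / 4"

definition C1star :: "(real^2) set \<Rightarrow> real" where
  "C1star \<Omega> = 8 * pi * deriv nonlin 1 /
     (3 * sqrt 6 * measure lebesgue \<Omega> * integral {-1..1} (\<lambda>s. sqrt (potential s)))"

definition AC_op :: "(real^2) set \<Rightarrow> real \<Rightarrow> (real^2 \<Rightarrow> real) \<Rightarrow> real^2 \<Rightarrow> real" where
  "AC_op D \<epsilon> v x = \<epsilon>\<^sup>2 * laplacian v x - nonlin (v x)
     + integral_on D (\<lambda>y. nonlin (v y)) / measure lebesgue D"

definition AC_profile :: "(real \<Rightarrow> real) \<Rightarrow> bool" where
  "AC_profile U \<longleftrightarrow>
     (\<forall>R. (U has_real_derivative deriv U R) (at R)) \<and>
     (\<forall>R. (deriv U has_real_derivative nonlin (U R)) (at R)) \<and>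
     (U \<longlongrightarrow> 1) at_top \<and> (U \<longlongrightarrow> -1) at_bot \<and>
     integrable lborel (\<lambda>R. R * (deriv U R)\<^sup>2) \<and>
     (LINT R|lborel. R * (deriv U R)\<^sup>2) = 0"

definition cutoff :: "(real \<Rightarrow> real) \<Rightarrow> bool" where
  "cutoff \<zeta> \<longleftrightarrow> smooth_on UNIV \<zeta> \<and> mono \<zeta> \<and> (\<forall>s<0. \<zeta> s = 0) \<and> (\<forall>s>1. \<zeta> s = 1)"

section \<open>The domain\<close>

text \<open>\<open>p\<close> is an arc-length parametrisation of the smooth closed curve \<open>\<partial>\<Omega>\<close>, continued periodically,
  \<open>L = \<bar>\<partial>\<Omega>\<bar>\<close>, and \<open>n\<close> is the inward unit normal along it (no orientation is fixed).\<close>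

definition smooth_domain :: "(real^2) set \<Rightarrow> (real \<Rightarrow> real^2) \<Rightarrow> (real \<Rightarrow> real^2) \<Rightarrow> real \<Rightarrow> bool" where
  "smooth_domain \<Omega> p n L \<longleftrightarrow>
     open \<Omega> \<and> connected \<Omega> \<and> bounded \<Omega> \<and> \<Omega> \<noteq> {} \<and> L > 0 \<and>
     smooth_on UNIV p \<and> (\<forall>\<xi>. p (\<xi> + L) = p \<xi>) \<and> inj_on p {0..<L} \<and> p ` {0..<L} = frontier \<Omega> \<and>
     (\<forall>\<xi>. norm (vector_derivative p (at \<xi>)) = 1) \<and>
     (\<forall>\<xi>. norm (n \<xi>) = 1 \<and> n \<xi> \<bullet> vector_derivative p (at \<xi>) = 0 \<and>
          (\<exists>h>0. \<forall>t\<in>{0<..<h}. p \<xi> + t *\<^sub>R n \<xi> \<in> \<Omega>))"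

definition scaled_dom :: "real \<Rightarrow> (real^2) set \<Rightarrow> (real^2) set" where
  "scaled_dom \<delta> \<Omega> = (\<lambda>x. (1 / \<delta>) *\<^sub>R x) ` \<Omega>"

definition scaled_par :: "real \<Rightarrow> (real \<Rightarrow> real^2) \<Rightarrow> real \<Rightarrow> real^2" where
  "scaled_par \<delta> p \<xi> = (1 / \<delta>) *\<^sub>R p (\<delta> * \<xi>)"

definition scaled_normal :: "real \<Rightarrow> (real \<Rightarrow> real^2) \<Rightarrow> real \<Rightarrow> real^2" where
  "scaled_normal \<delta> n \<xi> = n (\<delta> * \<xi>)"

section \<open>Droplets\<close>

text \<open>
  Here \<open>D = \<Omega>\<^sub>\<delta>\<close>, \<open>p, n\<close> are the arc-length parametrisation and inward normal of \<open>\<partial>D\<close>, and \<open>I\<close> is the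
  range of \<open>\<epsilon>\<close>. The interface \<open>\<Gamma>\<close> is \<open>\<gamma> \<epsilon> \<xi> ` {0..\<l> \<epsilon> \<xi>}\<close>, with \<open>\<gamma>\<close> parametrised by arc length
  and continued by \<open>a\<close> beyond its end points, so that every point of \<open>D\<close> near \<open>\<Gamma>\<close> (also near
  a corner) has coordinates \<open>(r, s)\<close>, namely \<open>x = \<gamma>(s) + r \<nu>(s)\<close>.
  \<open>\<Lambda>\<close> is the constant in the \<open>O(\<delta>)\<close> terms; it does not depend on \<open>\<delta>\<close>.
\<close>

definition tube_par :: "real \<Rightarrow> real \<Rightarrow> real \<Rightarrow> (real \<times> real) set" where
  "tube_par a r0 len = {-r0<..<r0} \<times> {-a<..<len + a}"

definition droplet_curve ::
  "(real^2) set \<Rightarrow> (real \<Rightarrow> real^2) \<Rightarrow> (real \<Rightarrow> real^2) \<Rightarrow> real \<Rightarrow> real \<Rightarrow> real set \<Rightarrow> real \<Rightarrow>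
   (real \<Rightarrow> real \<Rightarrow> real \<Rightarrow> real^2) \<Rightarrow> (real \<Rightarrow> real \<Rightarrow> real \<Rightarrow> real^2) \<Rightarrow> (real \<Rightarrow> real \<Rightarrow> real) \<Rightarrow> bool" where
  "droplet_curve D p n \<Lambda> \<delta> I a \<gamma> \<nu> len \<longleftrightarrow> (\<forall>\<epsilon>\<in>I.
     smooth_on {(\<sigma>, \<xi>). -a < \<sigma> \<and> \<sigma> < len \<epsilon> \<xi> + a} (\<lambda>(\<sigma>, \<xi>). \<gamma> \<epsilon> \<xi> \<sigma>) \<and>
     smooth_on {(\<sigma>, \<xi>). -a < \<sigma> \<and> \<sigma> < len \<epsilon> \<xi> + a} (\<lambda>(\<sigma>, \<xi>). \<nu> \<epsilon> \<xi> \<sigma>) \<and>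
     smooth_on UNIV (len \<epsilon>) \<and>
     (\<forall>\<xi>. \<bar>len \<epsilon> \<xi> - pi\<bar> \<le> \<Lambda> * \<delta> \<and>
       \<comment> \<open>orthogonal contact with \<open>\<partial>D\<close> at both end points\<close>
       (\<forall>\<sigma>\<in>{0, len \<epsilon> \<xi>}. \<exists>q. \<gamma> \<epsilon> \<xi> \<sigma> = p q \<and>
          vector_derivative (\<gamma> \<epsilon> \<xi>) (at \<sigma>) \<bullet> vector_derivative p (at q) = 0) \<and>
       (\<forall>\<sigma>\<in>{-a<..<len \<epsilon> \<xi> + a}.
          (let T = vector_derivative p (at \<xi>);
               \<gamma>' = vector_derivative (\<gamma> \<epsilon> \<xi>);
               \<gamma>\<^sub>s = (\<lambda>\<sigma>. \<gamma>' (at \<sigma>)) in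
            \<comment> \<open>arc length; \<open>\<nu>\<close> is the unit normal pointing out of the droplet\<close>
            norm (\<gamma>\<^sub>s \<sigma>) = 1 \<and> norm (\<nu> \<epsilon> \<xi> \<sigma>) = 1 \<and> \<nu> \<epsilon> \<xi> \<sigma> \<bullet> \<gamma>\<^sub>s \<sigma> = 0 \<and>
            \<nu> \<epsilon> \<xi> \<sigma> \<bullet> (\<gamma> \<epsilon> \<xi> \<sigma> - p \<xi>) > 0 \<and>
            \<comment> \<open>up to \<open>O(\<delta>)\<close>, the unit semicircle about \<open>p \<xi>\<close>\<close>
            norm (\<gamma> \<epsilon> \<xi> \<sigma> - (p \<xi> + cos \<sigma> *\<^sub>R T + sin \<sigma> *\<^sub>R n \<xi>)) \<le> \<Lambda> * \<delta> \<and>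
            norm (\<gamma>\<^sub>s \<sigma> - (- sin \<sigma> *\<^sub>R T + cos \<sigma> *\<^sub>R n \<xi>)) \<le> \<Lambda> * \<delta> \<and>
            norm (vector_derivative \<gamma>\<^sub>s (at \<sigma>) + (cos \<sigma> *\<^sub>R T + sin \<sigma> *\<^sub>R n \<xi>)) \<le> \<Lambda> * \<delta>))))"

text \<open>
  The signed distance \<open>r\<close> is defined on all of \<open>D\<close>; its sign (negative inside) is determined
  by the coordinates near \<open>\<Gamma>\<close> and by continuity. In the coordinates \<open>(r, s)\<close> the boundary \<open>\<partial>D\<close> near the
  two corners consists of graphs over \<open>r\<close> tangent to \<open>s = 0\<close> and \<open>s = \<bar>\<Gamma>\<bar>\<close> at
  \<open>r = 0\<close>: this is the orthogonal contact, quantified uniformly in \<open>\<epsilon>\<close> and \<open>\<xi>\<close>.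
\<close>

definition droplet_coords ::
  "(real^2) set \<Rightarrow> real \<Rightarrow> real \<Rightarrow> real set \<Rightarrow> real \<Rightarrow> real \<Rightarrow>
   (real \<Rightarrow> real \<Rightarrow> real \<Rightarrow> real^2) \<Rightarrow> (real \<Rightarrow> real \<Rightarrow> real \<Rightarrow> real^2) \<Rightarrow> (real \<Rightarrow> real \<Rightarrow> real) \<Rightarrow>
   (real \<Rightarrow> real \<Rightarrow> real^2 \<Rightarrow> real) \<Rightarrow> (real \<Rightarrow> real \<Rightarrow> real^2 \<Rightarrow> real) \<Rightarrow> bool" where
  "droplet_coords D \<Lambda> \<delta> I a r0 \<gamma> \<nu> len r s \<longleftrightarrow>
     (\<forall>\<epsilon>\<in>I.
       (let tube = (\<lambda>\<xi>. (\<lambda>(\<rho>, \<sigma>). \<gamma> \<epsilon> \<xi> \<sigma> + \<rho> *\<^sub>R \<nu> \<epsilon> \<xi> \<sigma>) ` tube_par a r0 (len \<epsilon> \<xi>)) in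
         smooth_on {(x, \<xi>). x \<in> tube \<xi>} (\<lambda>(x, \<xi>). r \<epsilon> \<xi> x) \<and>
         smooth_on {(x, \<xi>). x \<in> tube \<xi>} (\<lambda>(x, \<xi>). s \<epsilon> \<xi> x) \<and>
         (\<forall>\<xi>. \<forall>(\<rho>, \<sigma>)\<in>tube_par a r0 (len \<epsilon> \<xi>).
            r \<epsilon> \<xi> (\<gamma> \<epsilon> \<xi> \<sigma> + \<rho> *\<^sub>R \<nu> \<epsilon> \<xi> \<sigma>) = \<rho> \<and> s \<epsilon> \<xi> (\<gamma> \<epsilon> \<xi> \<sigma> + \<rho> *\<^sub>R \<nu> \<epsilon> \<xi> \<sigma>) = \<sigma>) \<and>
         continuous_on (D \<times> UNIV) (\<lambda>(x, \<xi>). r \<epsilon> \<xi> x) \<and>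
         (\<forall>\<xi>. \<forall>x\<in>D. \<bar>r \<epsilon> \<xi> x\<bar> = infdist x (\<gamma> \<epsilon> \<xi> ` {-a<..<len \<epsilon> \<xi> + a}) \<and>
            (\<bar>r \<epsilon> \<xi> x\<bar> < r0 \<longrightarrow> x \<in> tube \<xi> \<and>
              \<bar>dxi 1 (r \<epsilon>) \<xi> x + cos (pi * s \<epsilon> \<xi> x / len \<epsilon> \<xi>)\<bar> \<le> \<Lambda> * \<delta>)))) \<and>
     (\<exists>B. \<forall>\<epsilon>\<in>I. \<forall>\<xi>. \<exists>s1 s2. (\<forall>\<rho>\<in>{-r0<..<r0}.
        \<bar>s1 \<rho>\<bar> \<le> B * \<rho>\<^sup>2 \<and> \<bar>s2 \<rho> - len \<epsilon> \<xi>\<bar> \<le> B * \<rho>\<^sup>2 \<and>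
        (\<forall>\<sigma>\<in>{-a<..<len \<epsilon> \<xi> + a}.
           \<gamma> \<epsilon> \<xi> \<sigma> + \<rho> *\<^sub>R \<nu> \<epsilon> \<xi> \<sigma> \<in> D \<longleftrightarrow> s1 \<rho> < \<sigma> \<and> \<sigma> < s2 \<rho>))) \<and>
     (\<forall>l. \<exists>B. \<forall>\<epsilon>\<in>I. \<forall>\<xi>. \<bar>(deriv ^^ l) (len \<epsilon>) \<xi>\<bar> \<le> B \<and>
        (\<forall>x\<in>D. \<bar>r \<epsilon> \<xi> x\<bar> < r0 \<longrightarrow> \<bar>dxi l (r \<epsilon>) \<xi> x\<bar> \<le> B \<and> \<bar>dxi l (s \<epsilon>) \<xi> x\<bar> \<le> B))"

text \<open>
  The matched expansion. The corner layers \<open>uB1, uB2\<close> live at the end points \<open>s = 0\<close> and \<open>s = \<bar>\<Gamma>\<bar>\<close>;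
  their second argument is the stretched arc length to that end point, \<open>s / \<epsilon>\<close> resp. \<open>(\<bar>\<Gamma>\<bar> - s) / \<epsilon>\<close>.
  This covers corner layers that are functions of \<open>(R, s, \<xi>)\<close> with bounded derivatives, for which
  derivatives in the stretched variable are bounded a fortiori. Outside the tube, where \<open>s\<close> is not
  determined, the terms containing \<open>s\<close> are cancelled by the factor \<open>1 - \<zeta>p - \<zeta>m\<close>, which vanishes
  for \<open>\<bar>r\<bar> > 2 \<epsilon> ln\<^sup>2 \<epsilon>\<close>.
\<close>

definition droplet_expansion ::
  "(real^2) set \<Rightarrow> (real \<Rightarrow> real) \<Rightarrow> (real \<Rightarrow> real) \<Rightarrow> real set \<Rightarrow> real \<Rightarrow> (real \<Rightarrow> real \<Rightarrow> real) \<Rightarrow>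
   (real \<Rightarrow> real \<Rightarrow> real^2 \<Rightarrow> real) \<Rightarrow> (real \<Rightarrow> real \<Rightarrow> real^2 \<Rightarrow> real) \<Rightarrow>
   nat \<Rightarrow> (nat \<Rightarrow> real \<Rightarrow> real \<times> real \<times> real \<Rightarrow> real) \<Rightarrow>
   (nat \<Rightarrow> real \<Rightarrow> real \<times> real \<times> real \<Rightarrow> real) \<Rightarrow> (nat \<Rightarrow> real \<Rightarrow> real \<times> real \<times> real \<Rightarrow> real) \<Rightarrow>
   (nat \<Rightarrow> real \<Rightarrow> (real^2) \<times> real \<Rightarrow> real) \<Rightarrow> (nat \<Rightarrow> real \<Rightarrow> (real^2) \<times> real \<Rightarrow> real) \<Rightarrow>
   (real \<Rightarrow> real \<Rightarrow> real^2 \<Rightarrow> real) \<Rightarrow> bool" where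
  "droplet_expansion D U \<zeta> I a len r s J uI uB1 uB2 up um u \<longleftrightarrow>
     (\<forall>j\<le>J.
       smooth_bounded I (\<lambda>\<epsilon>. {(R, \<sigma>, \<xi>). -a < \<sigma> \<and> \<sigma> < len \<epsilon> \<xi> + a}) (uI j) \<and>
       smooth_bounded I (\<lambda>\<epsilon>. {(R, S, \<xi>). -a < \<epsilon> * S \<and> \<epsilon> * S < len \<epsilon> \<xi> + a}) (uB1 j) \<and>
       smooth_bounded I (\<lambda>\<epsilon>. {(R, S, \<xi>). -a < \<epsilon> * S \<and> \<epsilon> * S < len \<epsilon> \<xi> + a}) (uB2 j) \<and>
       smooth_bounded I (\<lambda>\<epsilon>. D \<times> UNIV) (up j) \<and>
       smooth_bounded I (\<lambda>\<epsilon>. D \<times> UNIV) (um j)) \<and>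
     (\<forall>\<epsilon>\<in>I. \<forall>\<xi>. \<forall>x\<in>D. u \<epsilon> \<xi> x =
       (let h = \<epsilon> * (ln \<epsilon>)\<^sup>2;
            \<rho> = r \<epsilon> \<xi> x; \<sigma> = s \<epsilon> \<xi> x; R = \<rho> / \<epsilon>;
            S1 = \<sigma> / \<epsilon>; S2 = (len \<epsilon> \<xi> - \<sigma>) / \<epsilon>;
            \<zeta>p = \<zeta> (\<rho> / h - 1); \<zeta>m = \<zeta> (- \<rho> / h - 1);
            \<chi>1 = 1 - \<zeta> (\<sigma> / h - 1); \<chi>2 = 1 - \<zeta> ((len \<epsilon> \<xi> - \<sigma>) / h - 1);
            vI = U R + \<epsilon> * (\<Sum>j\<le>J. \<epsilon> ^ j * uI j \<epsilon> (R, \<sigma>, \<xi>));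
            vB = (\<Sum>j=1..J. \<epsilon> ^ j * (\<chi>1 * uB1 j \<epsilon> (R, S1, \<xi>) + \<chi>2 * uB2 j \<epsilon> (R, S2, \<xi>)));
            vp = 1 + \<epsilon> * (\<Sum>j\<le>J. \<epsilon> ^ j * up j \<epsilon> (x, \<xi>));
            vm = - 1 + \<epsilon> * (\<Sum>j\<le>J. \<epsilon> ^ j * um j \<epsilon> (x, \<xi>))
        in (1 - \<zeta>p - \<zeta>m) * (vI + vB) + \<zeta>p * vp + \<zeta>m * vm))"

text \<open>Smoothness of \<open>u\<close> up to \<open>\<partial>D\<close> is expressed by an extension to a neighbourhood of \<open>closure D\<close>.\<close>

definition droplet_family ::
  "(real^2) set \<Rightarrow> (real \<Rightarrow> real^2) \<Rightarrow> (real \<Rightarrow> real^2) \<Rightarrow> real \<Rightarrow> (real \<Rightarrow> real) \<Rightarrow> (real \<Rightarrow> real) \<Rightarrow>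
   real \<Rightarrow> nat \<Rightarrow> real \<Rightarrow> real \<Rightarrow> (real \<Rightarrow> real \<Rightarrow> real^2 \<Rightarrow> real) \<Rightarrow> (real \<Rightarrow> real \<Rightarrow> real) \<Rightarrow> bool" where
  "droplet_family D p n L U \<zeta> \<Lambda> K \<delta> \<epsilon>0 u c \<longleftrightarrow>
     (\<forall>\<epsilon>\<in>{0<..\<epsilon>0}.
       (\<exists>G. open G \<and> closure D \<subseteq> G \<and> smooth_on (G \<times> UNIV) (\<lambda>(x, \<xi>). u \<epsilon> \<xi> x)) \<and>
       (\<forall>\<xi>. (\<forall>x. u \<epsilon> (\<xi> + L) x = u \<epsilon> \<xi> x) \<and> c \<epsilon> (\<xi> + L) = c \<epsilon> \<xi> \<and>
          \<bar>c \<epsilon> \<xi>\<bar> \<le> \<Lambda> * \<delta>\<^sup>2 \<and>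
          (\<forall>q. dir_deriv (n q) (u \<epsilon> \<xi>) (p q) = 0) \<and>
          integral_on D (u \<epsilon> \<xi>) = measure lebesgue D - pi)) \<and>
     (\<exists>B. \<forall>\<epsilon>\<in>{0<..\<epsilon>0}. \<forall>\<xi>. \<forall>x\<in>D.
        \<bar>AC_op D \<epsilon> (u \<epsilon> \<xi>) x - \<epsilon>\<^sup>2 * c \<epsilon> \<xi> * dxi 1 (u \<epsilon>) \<xi> x\<bar> \<le> B * \<epsilon> ^ K) \<and>
     (\<exists>a r0 \<gamma> \<nu> len r s J uI uB1 uB2 up um. 0 < a \<and> 0 < r0 \<and>
        droplet_curve D p n \<Lambda> \<delta> {0<..\<epsilon>0} a \<gamma> \<nu> len \<and>
        droplet_coords D \<Lambda> \<delta> {0<..\<epsilon>0} a r0 \<gamma> \<nu> len r s \<and>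
        droplet_expansion D U \<zeta> {0<..\<epsilon>0} a len r s J uI uB1 uB2 up um u)"

text \<open>\<open>d\<^bsub>L\<^sup>2\<^esub>(v, \<M>)\<close> and the tube around \<open>\<M> = {u(\<xi>) : \<xi> \<in> [0, L]}\<close>, at fixed \<open>\<epsilon>\<close>.\<close>

definition dist_mfd :: "(real^2) set \<Rightarrow> real \<Rightarrow> (real \<Rightarrow> real^2 \<Rightarrow> real) \<Rightarrow> (real^2 \<Rightarrow> real) \<Rightarrow> real" where
  "dist_mfd D L u v = (INF \<xi>\<in>{0..L}. L2norm D (\<lambda>x. v x - u \<xi> x))"

definition mfd_tube :: "(real^2) set \<Rightarrow> real \<Rightarrow> (real \<Rightarrow> real^2 \<Rightarrow> real) \<Rightarrow> real \<Rightarrow> (real^2 \<Rightarrow> real) set" where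
  "mfd_tube D L u \<rho> = {v \<in> L2 D. dist_mfd D L u v < \<rho>}"

section \<open>Noise, stochastic integrals and the equation, on a time horizon \<open>[0, T]\<close>\<close>

definition brownian :: "'w measure \<Rightarrow> (real \<Rightarrow> 'w measure) \<Rightarrow> real \<Rightarrow> (real \<Rightarrow> 'w \<Rightarrow> real) \<Rightarrow> bool" where
  "brownian M F T \<beta> \<longleftrightarrow>
     (\<forall>t\<in>{0..T}. \<beta> t \<in> borel_measurable (F t)) \<and>
     (AE \<omega> in M. \<beta> 0 \<omega> = 0) \<and>
     (\<forall>\<omega>\<in>space M. continuous_on {0..T} (\<lambda>t. \<beta> t \<omega>)) \<and>
     (\<forall>s t. 0 \<le> s \<and> s < t \<and> t \<le> T \<longrightarrow>
        distributed M lborel (\<lambda>\<omega>. \<beta> t \<omega> - \<beta> s \<omega>) (normal_density 0 (sqrt (t - s))) \<and>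
        prob_space.indep_set M (sets (F s))
          {(\<lambda>\<omega>. \<beta> t \<omega> - \<beta> s \<omega>) -` A \<inter> space M | A. A \<in> sets borel})"

definition L2_basis :: "(real^2) set \<Rightarrow> (nat \<Rightarrow> real^2 \<Rightarrow> real) \<Rightarrow> bool" where
  "L2_basis D e \<longleftrightarrow> (\<forall>k. e k \<in> L2 D) \<and> (\<forall>i j. ip D (e i) (e j) = (if i = j then 1 else 0)) \<and>
     (\<forall>g\<in>L2 D. (\<forall>k. ip D g (e k) = 0) \<longrightarrow> (AE x in lebesgue_on D. g x = 0))"

definition covariance_op ::
  "(real^2) set \<Rightarrow> (nat \<Rightarrow> real) \<Rightarrow> (nat \<Rightarrow> real^2 \<Rightarrow> real) \<Rightarrow> ((real^2 \<Rightarrow> real) \<Rightarrow> (real^2 \<Rightarrow> real)) \<Rightarrow> bool" where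
  "covariance_op D a e Q \<longleftrightarrow>
     (\<forall>g\<in>L2 D. Q g \<in> L2 D) \<and>
     (\<forall>g\<in>L2 D. \<forall>h\<in>L2 D. \<forall>b c. AE x in lebesgue_on D.
        Q (\<lambda>y. b * g y + c * h y) x = b * Q g x + c * Q h x) \<and>
     (\<exists>B. \<forall>g\<in>L2 D. L2norm D (Q g) \<le> B * L2norm D g) \<and>
     (\<forall>k. AE x in lebesgue_on D. Q (e k) x = (a k)\<^sup>2 * e k x)"

text \<open>The two summability conditions are \<open>\<eta>\<^sub>0 < \<infinity>\<close> and \<open>\<eta>\<^sub>2 < \<infinity>\<close>; a gradient is only required of those \<open>e\<^sub>k\<close>
  that occur in the noise.\<close>

definition Q_Wiener ::
  "'w measure \<Rightarrow> (real \<Rightarrow> 'w measure) \<Rightarrow> real \<Rightarrow> (real^2) set \<Rightarrow> (nat \<Rightarrow> real) \<Rightarrow> (nat \<Rightarrow> real^2 \<Rightarrow> real) \<Rightarrow>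
   (nat \<Rightarrow> real \<Rightarrow> 'w \<Rightarrow> real) \<Rightarrow> ((real^2 \<Rightarrow> real) \<Rightarrow> (real^2 \<Rightarrow> real)) \<Rightarrow> (real \<Rightarrow> 'w \<Rightarrow> real^2 \<Rightarrow> real) \<Rightarrow> bool" where
  "Q_Wiener M F T D a e \<beta> Q W \<longleftrightarrow>
     (\<forall>k. brownian M F T (\<beta> k)) \<and>
     prob_space.indep_vars M (\<lambda>k. \<Pi>\<^sub>M t\<in>{0..T}. borel) (\<lambda>k \<omega>. \<lambda>t\<in>{0..T}. \<beta> k t \<omega>) UNIV \<and>
     L2_basis D e \<and> covariance_op D a e Q \<and>
     summable (\<lambda>k. (a k)\<^sup>2) \<and>
     (\<exists>grad. (\<forall>k. a k \<noteq> 0 \<longrightarrow> has_weak_gradient D (e k) (grad k)) \<and>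
        summable (\<lambda>k. (a k)\<^sup>2 * integral_on D (\<lambda>x. (norm (grad k x))\<^sup>2))) \<and>
     (\<forall>t\<in>{0..T}. \<forall>\<omega>\<in>space M. W t \<omega> \<in> L2 D) \<and>
     (AE \<omega> in M. \<forall>t\<in>{0..T}.
        (\<lambda>m. L2norm D (\<lambda>x. W t \<omega> x - (\<Sum>k<m. a k * \<beta> k t \<omega> * e k x))) \<longlonglongrightarrow> 0 \<and>
        ((\<lambda>t'. L2norm D (\<lambda>x. W t' \<omega> x - W t \<omega> x)) \<longlongrightarrow> 0) (at t within {0..T}) \<and>
        integral_on D (W t \<omega>) = 0)"

definition tendsto_in_prob :: "'w measure \<Rightarrow> (nat \<Rightarrow> 'w \<Rightarrow> real) \<Rightarrow> ('w \<Rightarrow> real) \<Rightarrow> bool" where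
  "tendsto_in_prob M X Y \<longleftrightarrow>
     (\<forall>m. X m \<in> borel_measurable M) \<and> Y \<in> borel_measurable M \<and>
     (\<forall>h>0. (\<lambda>m. measure M {\<omega> \<in> space M. \<bar>X m \<omega> - Y \<omega>\<bar> > h}) \<longlonglongrightarrow> 0)"

text \<open>
  \<open>dX = \<alpha> dt + (g, dW)\<close> up to the stopping time \<open>\<tau>\<close>, where \<open>(g, dW) = \<Sum>\<^sub>k a\<^sub>k (g, e\<^sub>k) d\<beta>\<^sub>k\<close>. The integrands of
  interest are adapted and continuous in \<open>t < \<tau>\<close>, so each scalar Ito integral over \<open>[0, min t \<tau>]\<close> is the limit
  in probability of its left-point Riemann sums.
\<close>

definition ito_differential ::
  "'w measure \<Rightarrow> real \<Rightarrow> (real^2) set \<Rightarrow> (nat \<Rightarrow> real) \<Rightarrow> (nat \<Rightarrow> real^2 \<Rightarrow> real) \<Rightarrow> (nat \<Rightarrow> real \<Rightarrow> 'w \<Rightarrow> real) \<Rightarrow>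
   ('w \<Rightarrow> real) \<Rightarrow> (real \<Rightarrow> 'w \<Rightarrow> real) \<Rightarrow> (real \<Rightarrow> 'w \<Rightarrow> real) \<Rightarrow> (real \<Rightarrow> 'w \<Rightarrow> real^2 \<Rightarrow> real) \<Rightarrow> bool" where
  "ito_differential M T D a e \<beta> \<tau> X \<alpha> g \<longleftrightarrow> (\<forall>t\<in>{0..T}. \<exists>Y Z.
     (\<forall>k. tendsto_in_prob M
        (\<lambda>m \<omega>. \<Sum>i<m. (let t0 = t * real i / real m; t1 = t * real (Suc i) / real m in
           (if t0 < \<tau> \<omega> then ip D (g t0 \<omega>) (e k) else 0)
             * (\<beta> k (min t1 (\<tau> \<omega>)) \<omega> - \<beta> k (min t0 (\<tau> \<omega>)) \<omega>))) (Y k)) \<and>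
     tendsto_in_prob M (\<lambda>m \<omega>. \<Sum>k<m. a k * Y k \<omega>) Z \<and>
     (AE \<omega> in M. set_integrable lborel {0..min t (\<tau> \<omega>)} (\<lambda>r. \<alpha> r \<omega>) \<and>
        X (min t (\<tau> \<omega>)) \<omega> = X 0 \<omega> + (LINT r:{0..min t (\<tau> \<omega>)}|lborel. \<alpha> r \<omega>) + Z \<omega>))"

text \<open>
  Solutions of \<open>dw = AC_op(w) dt + dW\<close> in the analytically weak sense: the Laplacian and the Neumann condition are
  carried by test functions \<open>\<phi>\<close>, smooth up to the boundary, with \<open>\<partial>\<^sub>n \<phi> = 0\<close>.
\<close>

definition neumann_test :: "(real^2) set \<Rightarrow> (real \<Rightarrow> real^2) \<Rightarrow> (real \<Rightarrow> real^2) \<Rightarrow> (real^2 \<Rightarrow> real) \<Rightarrow> bool" where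
  "neumann_test D p n \<phi> \<longleftrightarrow> (\<exists>G. closure D \<subseteq> G \<and> smooth_on G \<phi>) \<and> (\<forall>q. dir_deriv (n q) \<phi> (p q) = 0)"

definition SPDE_solution ::
  "'w measure \<Rightarrow> (real \<Rightarrow> 'w measure) \<Rightarrow> real \<Rightarrow> (real^2) set \<Rightarrow> (real \<Rightarrow> real^2) \<Rightarrow> (real \<Rightarrow> real^2) \<Rightarrow> real \<Rightarrow>
   (real \<Rightarrow> 'w \<Rightarrow> real^2 \<Rightarrow> real) \<Rightarrow> (real \<Rightarrow> 'w \<Rightarrow> real^2 \<Rightarrow> real) \<Rightarrow> bool" where
  "SPDE_solution M F T D p n \<epsilon> W w \<longleftrightarrow>
     (\<forall>t\<in>{0..T}. (\<forall>\<omega>\<in>space M. w t \<omega> \<in> L2 D) \<and>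
        (\<forall>g\<in>L2 D. (\<lambda>\<omega>. ip D (w t \<omega>) g) \<in> borel_measurable (F t))) \<and>
     (AE \<omega> in M.
        integrable (lebesgue_on ({0..T} \<times> D)) (\<lambda>(t, x). (w t \<omega> x) ^ 3) \<and>
        (\<forall>t\<in>{0..T}.
          ((\<lambda>t'. L2norm D (\<lambda>x. w t' \<omega> x - w t \<omega> x)) \<longlongrightarrow> 0) (at t within {0..T}) \<and>
          integral_on D (w t \<omega>) = measure lebesgue D - pi \<and>
          (\<forall>\<phi>. neumann_test D p n \<phi> \<longrightarrow>
             ip D (w t \<omega>) \<phi> = ip D (w 0 \<omega>) \<phi>
               + (LINT r:{0..t}|lborel.
                    \<epsilon>\<^sup>2 * ip D (w r \<omega>) (laplacian \<phi>) - ip D (\<lambda>x. nonlin (w r \<omega> x)) \<phi>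
                    + integral_on D (\<lambda>x. nonlin (w r \<omega> x)) / measure lebesgue D * integral_on D \<phi>)
               + ip D (W t \<omega>) \<phi>)))"

section \<open>The terms of the theorem, at fixed \<open>\<epsilon>\<close> and at a state \<open>w = u(\<xi>) + v\<close>\<close>

definition A_coef :: "(real^2) set \<Rightarrow> (real \<Rightarrow> real^2 \<Rightarrow> real) \<Rightarrow> real \<Rightarrow> (real^2 \<Rightarrow> real) \<Rightarrow> real" where
  "A_coef D u \<xi> v = (L2norm D (dxi 1 u \<xi>))\<^sup>2 - ip D v (dxi 2 u \<xi>)"

definition sigma_coef :: "(real^2) set \<Rightarrow> (real \<Rightarrow> real^2 \<Rightarrow> real) \<Rightarrow> real \<Rightarrow> (real^2 \<Rightarrow> real) \<Rightarrow> real^2 \<Rightarrow> real" where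
  "sigma_coef D u \<xi> v x = inverse (A_coef D u \<xi> v) * dxi 1 u \<xi> x"

definition dA_drift ::
  "(real^2) set \<Rightarrow> ((real^2 \<Rightarrow> real) \<Rightarrow> (real^2 \<Rightarrow> real)) \<Rightarrow> (real \<Rightarrow> real^2 \<Rightarrow> real) \<Rightarrow> real \<Rightarrow> (real^2 \<Rightarrow> real) \<Rightarrow> real" where
  "dA_drift D Q u \<xi> v =
     (let A = A_coef D u \<xi> v; \<sigma> = sigma_coef D u \<xi> v in
       inverse A * (1/2 * ip D v (dxi 3 u \<xi>) - 3/2 * ip D (dxi 2 u \<xi>) (dxi 1 u \<xi>)) * ip D (Q \<sigma>) \<sigma>
       + inverse A * ip D \<sigma> (Q (dxi 2 u \<xi>)))"

definition dA_noise :: "(real^2) set \<Rightarrow> (real \<Rightarrow> real^2 \<Rightarrow> real) \<Rightarrow> real \<Rightarrow> (real^2 \<Rightarrow> real) \<Rightarrow> real^2 \<Rightarrow> real" where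
  "dA_noise D u \<xi> v x = inverse (A_coef D u \<xi> v) * dxi 1 u \<xi> x"

text \<open>
  The decomposition \<open>w(t) = u(\<xi>(t)) + v(t)\<close>, \<open>v(t) \<bottom> \<partial>\<^sub>\<xi>u\<close>, for \<open>t < \<tau>\<close>. It is the decomposition along the normal
  bundle of \<open>\<M>\<close>: \<open>u(\<xi>(t))\<close> is the point of \<open>\<M>\<close> closest to \<open>w(t)\<close>. (Orthogonality alone also
  holds at critical points of the distance far away from \<open>w(t)\<close>.)
\<close>

definition fermi_decomposition ::
  "'w measure \<Rightarrow> (real \<Rightarrow> 'w measure) \<Rightarrow> real \<Rightarrow> (real^2) set \<Rightarrow> real \<Rightarrow> (real \<Rightarrow> real^2 \<Rightarrow> real) \<Rightarrow> ('w \<Rightarrow> real) \<Rightarrow>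
   (real \<Rightarrow> 'w \<Rightarrow> real^2 \<Rightarrow> real) \<Rightarrow> (real \<Rightarrow> 'w \<Rightarrow> real) \<Rightarrow> (real \<Rightarrow> 'w \<Rightarrow> real^2 \<Rightarrow> real) \<Rightarrow> bool" where
  "fermi_decomposition M F T D L u \<tau> w \<xi> v \<longleftrightarrow>
     (\<forall>t\<in>{0..T}. \<xi> t \<in> borel_measurable (F t)) \<and>
     (AE \<omega> in M. continuous_on {0..<\<tau> \<omega>} (\<lambda>t. \<xi> t \<omega>) \<and>
        (\<forall>t\<in>{0..<\<tau> \<omega>}. (\<forall>x. w t \<omega> x = u (\<xi> t \<omega>) x + v t \<omega> x) \<and>
           ip D (v t \<omega>) (dxi 1 u (\<xi> t \<omega>)) = 0 \<and>
           L2norm D (v t \<omega>) = dist_mfd D L u (w t \<omega>)))"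

end

theory Submission
  imports Defs
begin

text \<open>
  The noise terms are explicit functions of the state \<open>(\<xi>, v)\<close>, so the claim is a deterministic
  estimate at each time with constants uniform in \<open>\<epsilon>\<close> and \<open>\<xi>\<close>; the coefficients of \<open>d\<A>\<close> are the given
  ones. Write \<open>u\<close> for \<open>u(\<cdot>, \<xi>, \<epsilon>)\<close>, \<open>\<partial>\<close> for \<open>\<partial>\<^sub>\<xi>\<close>, and \<open>\<eta>\<^sub>1\<close> for the operator norm of \<open>Q\<close>. The estimate rests on

    \<^item> \<open>\<parallel>\<partial>\<^sup>l u\<parallel> = O(\<epsilon>\<^bsup>1/2 - l\<^esup>)\<close> for \<open>l = 1, 2, 3\<close>,
    \<^item> \<open>\<parallel>\<partial>u\<parallel>\<^sup>2 \<ge> c / \<epsilon>\<close> with \<open>c > 0\<close>,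
    \<^item> \<open>(\<partial>\<^sup>2u, \<partial>u) = O(1 / \<epsilon>)\<close>.

  In the tube \<open>\<parallel>v\<parallel> = O(\<epsilon>\<^bsup>k - 2\<^esup>)\<close>, hence \<open>(v, \<partial>\<^sup>2u) = O(\<epsilon>\<^bsup>k - 7/2\<^esup>)\<close>, which is small against \<open>1 / \<epsilon>\<close> because
  \<open>k > 5/2\<close>. Therefore \<open>A \<ge> c / (2 \<epsilon>)\<close>, and \<open>\<sigma> = A\<^bsup>-1\<^esup> \<partial>u\<close>, which is also the noise coefficient, has norm
  \<open>O(\<epsilon>\<^bsup>1/2\<^esup>)\<close>. The square bracket in the drift is \<open>O(\<epsilon>\<^bsup>k - 9/2\<^esup> + \<epsilon>\<^bsup>-1\<^esup>)\<close> and its factor \<open>A\<^bsup>-1\<^esup> (Q\<sigma>, \<sigma>)\<close> is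
  \<open>O(\<eta>\<^sub>1 \<epsilon>\<^sup>2)\<close>, so this term is \<open>O(\<eta>\<^sub>1 \<epsilon>\<^bsup>min{1, k - 5/2}\<^esup>)\<close>. The other drift term is exactly
  \<open>A\<^bsup>-2\<^esup> (\<partial>u, Q \<partial>\<^sup>2u) = O(\<eta>\<^sub>1)\<close>. This is \<open>drift_and_noise_bounds\<close>.

  The three bounds (\<open>derivative_norms\<close>) come from the matched expansion. Near \<open>\<Gamma>\<close> one has
  \<open>u = U(r / \<epsilon>) + O(\<epsilon>)\<close>, where every \<open>\<xi>\<close>-derivative of the remainder costs a factor \<open>1 / \<epsilon>\<close>
  (\<open>near_expansion\<close>). This calculus of scaled bounds is the predicate \<open>jet\<close>, which is closed under sums,
  products and compositions; the cut-offs do no harm because \<open>U\<close> tends to \<open>\<plusminus>1\<close> exponentially, with all its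
  derivatives. So near \<open>\<Gamma>\<close>, up to lower order, \<open>\<partial>u\<close> is \<open>U'(r / \<epsilon>) r\<^sub>\<xi> / \<epsilon>\<close> and \<open>\<partial>\<^sup>2u\<close> is
  \<open>U''(r / \<epsilon>) r\<^sub>\<xi>\<^sup>2 / \<epsilon>\<^sup>2\<close>, while away from \<open>\<Gamma>\<close> only the remainder survives (\<open>pointwise_expansion\<close>). Since
  \<open>U'(r / \<epsilon>)\<close> has integral \<open>O(\<epsilon>)\<close> this gives the upper bounds; the lower one holds because
  \<open>r\<^sub>\<xi> \<approx> - cos (\<pi> s / \<bar>\<Gamma>\<bar>)\<close> stays away from \<open>0\<close> on part of \<open>\<Gamma>\<close> (\<open>layer_energy_lower\<close>).

  For the product \<open>(\<partial>\<^sup>2u, \<partial>u)\<close> the norms alone give only \<open>O(\<epsilon>\<^bsup>-2\<^esup>)\<close>, and a cancellation has to be used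
  (\<open>layer_cancellation\<close>). Its leading part is \<open>\<epsilon>\<^bsup>-3\<^esup>\<close> times the integral of \<open>U' U'' r\<^sub>\<xi>\<^sup>3\<close>. As \<open>r\<close> is a
  signed distance, \<open>r\<^sub>\<xi>\<close> is, up to sign, the normal velocity of the curves \<open>r = const\<close> and constant along each normal
  (\<open>r_xi_constant_on_normals\<close>). In normal coordinates \<open>(\<rho>, \<sigma>)\<close> the integral thus factorises, up to errors
  with an additional weight \<open>\<bar>\<rho>\<bar>\<close>, and the factor in \<open>\<rho>\<close> is that of the exact derivative
  \<open>U' U'' = (U'\<^sup>2 / 2)'\<close>. Both parts are \<open>O(\<epsilon>\<^sup>2)\<close>, which gives the bound \<open>O(1 / \<epsilon>)\<close>.
\<close>

section \<open>Square-integrable functions\<close>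

lemma L2_measurable: "g \<in> L2 D \<Longrightarrow> g \<in> borel_measurable (lebesgue_on D)"
  by (simp add: L2_def)

lemma L2_mult_integrable:
  assumes g: "g \<in> L2 D" and h: "h \<in> L2 D"
  shows "integrable (lebesgue_on D) (\<lambda>x. g x * h x)"
proof (rule Bochner_Integration.integrable_bound)
  show "integrable (lebesgue_on D) (\<lambda>x. (g x)\<^sup>2 + (h x)\<^sup>2)"
    using g h by (simp add: L2_def)
  show "(\<lambda>x. g x * h x) \<in> borel_measurable (lebesgue_on D)"
    using g h by (auto simp: L2_def)
  have "\<bar>a * b\<bar> \<le> a\<^sup>2 + b\<^sup>2" for a b :: real
    using sum_squares_bound[of "\<bar>a\<bar>" "\<bar>b\<bar>"] zero_le_mult_iff[of "\<bar>a\<bar>" "\<bar>b\<bar>"]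
    unfolding abs_mult power2_abs by linarith
  then show "AE x in lebesgue_on D. norm (g x * h x) \<le> norm ((g x)\<^sup>2 + (h x)\<^sup>2)"
    by (simp add: abs_mult)
qed

lemma L2_lincomb:
  assumes g: "g \<in> L2 D" and h: "h \<in> L2 D"
  shows "(\<lambda>x. b * g x + c * h x) \<in> L2 D"
proof -
  have "integrable (lebesgue_on D) (\<lambda>x. b\<^sup>2 * (g x * g x) + 2 * b * c * (g x * h x) + c\<^sup>2 * (h x * h x))"
    using L2_mult_integrable[OF g g] L2_mult_integrable[OF g h] L2_mult_integrable[OF h h]
    by (intro Bochner_Integration.integrable_add integrable_mult_right) auto
  moreover have "(\<lambda>x. b\<^sup>2 * (g x * g x) + 2 * b * c * (g x * h x) + c\<^sup>2 * (h x * h x))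
      = (\<lambda>x. (b * g x + c * h x)\<^sup>2)"
    by (auto simp: power2_eq_square algebra_simps)
  ultimately show ?thesis
    using L2_measurable[OF g] L2_measurable[OF h] by (simp add: L2_def)
qed

lemma L2_cmult: "g \<in> L2 D \<Longrightarrow> (\<lambda>x. c * g x) \<in> L2 D"
  using L2_lincomb[of g D g c 0] by simp

lemma L2_diff: "g \<in> L2 D \<Longrightarrow> h \<in> L2 D \<Longrightarrow> (\<lambda>x. g x - h x) \<in> L2 D"
  using L2_lincomb[of g D h 1 "-1"] by simp

lemma ip_self_nonneg: "0 \<le> ip D g g"
  by (simp add: ip_def)

lemma L2norm_nonneg: "0 \<le> L2norm D g"
  by (simp add: L2norm_def ip_self_nonneg)

lemma L2norm_sq: "(L2norm D g)\<^sup>2 = ip D g g"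
  by (simp add: L2norm_def ip_self_nonneg)

lemma ip_commute: "ip D g h = ip D h g"
  by (simp add: ip_def mult.commute)

lemma ip_cmult: "ip D (\<lambda>x. c * g x) h = c * ip D g h"
  by (simp add: ip_def mult.assoc)

lemma L2norm_cmult: "L2norm D (\<lambda>x. c * g x) = \<bar>c\<bar> * L2norm D g"
proof -
  have "ip D (\<lambda>x. c * g x) (\<lambda>x. c * g x) = c\<^sup>2 * ip D g g"
    unfolding ip_cmult ip_commute[of D g "\<lambda>x. c * g x"] by (simp add: power2_eq_square)
  then show ?thesis
    by (simp add: L2norm_def real_sqrt_mult)
qed

lemma ip_lincomb_self:
  assumes g: "g \<in> L2 D" and h: "h \<in> L2 D"
  shows "ip D (\<lambda>x. t * g x + h x) (\<lambda>x. t * g x + h x) = t\<^sup>2 * ip D g g + 2 * t * ip D g h + ip D h h"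
proof -
  have "ip D (\<lambda>x. t * g x + h x) (\<lambda>x. t * g x + h x)
      = (LINT x|lebesgue_on D. t\<^sup>2 * (g x * g x) + 2 * t * (g x * h x) + h x * h x)"
    unfolding ip_def by (rule Bochner_Integration.integral_cong) (auto simp: power2_eq_square algebra_simps)
  also have "\<dots> = t\<^sup>2 * ip D g g + 2 * t * ip D g h + ip D h h"
    unfolding ip_def
    using L2_mult_integrable[OF g g] L2_mult_integrable[OF g h] L2_mult_integrable[OF h h]
    by simp
  finally show ?thesis .
qed

lemma ip_Cauchy_Schwarz:
  assumes g: "g \<in> L2 D" and h: "h \<in> L2 D"
  shows "\<bar>ip D g h\<bar> \<le> L2norm D g * L2norm D h"
proof -
  define G P H where "G = ip D g g" and "P = ip D g h" and "H = ip D h h"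
  have quad: "0 \<le> t\<^sup>2 * G + 2 * t * P + H" for t
    using ip_self_nonneg[of D "\<lambda>x. t * g x + h x"] ip_lincomb_self[OF g h, of t]
    by (simp add: G_def P_def H_def)
  have G: "0 \<le> G" by (simp add: G_def ip_self_nonneg)
  have "P\<^sup>2 \<le> G * H"
  proof (cases "G = 0")
    case True
    have "P = 0"
    proof (rule ccontr)
      assume "P \<noteq> 0"
      then show False using quad[of "- (H + 1) / (2 * P)"] True by (simp add: field_simps)
    qed
    then show ?thesis using True by simp
  next
    case False
    then have "0 \<le> H - P\<^sup>2 / G"
      using quad[of "- P / G"] by (simp add: field_simps power2_eq_square)
    then show ?thesis using False G by (simp add: field_simps)
  qed
  then have "sqrt (P\<^sup>2) \<le> sqrt (G * H)" by (rule real_sqrt_le_mono)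
  then show ?thesis by (simp add: real_sqrt_mult L2norm_def G_def P_def H_def)
qed

lemma L2norm_cong_AE:
  assumes "AE x in lebesgue_on D. g x = h x"
    and "g \<in> borel_measurable (lebesgue_on D)" and "h \<in> borel_measurable (lebesgue_on D)"
  shows "L2norm D g = L2norm D h"
proof -
  have "ip D g g = ip D h h"
    unfolding ip_def
  proof (rule integral_cong_AE)
    show "AE x in lebesgue_on D. g x * g x = h x * h x"
      using assms(1) by eventually_elim simp
  qed (use assms in measurable)
  then show ?thesis by (simp add: L2norm_def)
qed

lemma bounded_in_L2:
  fixes g :: "'a::euclidean_space \<Rightarrow> real"
  assumes "D \<in> lmeasurable" and "g \<in> borel_measurable (lebesgue_on D)" and "\<And>x. x \<in> D \<Longrightarrow> \<bar>g x\<bar> \<le> B"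
  shows "g \<in> L2 D"
proof -
  have "integrable (lebesgue_on D) (\<lambda>x. (g x)\<^sup>2)"
  proof (rule Bochner_Integration.integrable_bound)
    show "integrable (lebesgue_on D) (\<lambda>_. B\<^sup>2)"
      using assms(1) by (intro finite_measure.integrable_const finite_measure_lebesgue_on)
    have "AE x in lebesgue_on D. (g x)\<^sup>2 \<le> B\<^sup>2"
      using assms(3) by (intro AE_I2) (force simp: space_restrict_space abs_le_square_iff[symmetric])
    then show "AE x in lebesgue_on D. norm ((g x)\<^sup>2) \<le> norm (B\<^sup>2)"
      by simp
  qed (use assms(2) in simp)
  then show ?thesis using assms(2) by (simp add: L2_def)
qed

section \<open>The covariance operator\<close>

lemma op_norm_bdd_above:
  assumes Q: "covariance_op D a e Q"
  shows "bdd_above {L2norm D (Q g) | g. g \<in> L2 D \<and> L2norm D g \<le> 1}"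
proof -
  obtain B where B: "\<forall>g\<in>L2 D. L2norm D (Q g) \<le> B * L2norm D g"
    using Q unfolding covariance_op_def by blast
  show ?thesis
  proof (rule bdd_aboveI)
    fix y assume "y \<in> {L2norm D (Q g) | g. g \<in> L2 D \<and> L2norm D g \<le> 1}"
    then obtain f where f: "f \<in> L2 D" "L2norm D f \<le> 1" "y = L2norm D (Q f)" by auto
    have "y \<le> B * L2norm D f" using B f by auto
    also have "\<dots> \<le> \<bar>B\<bar> * 1"
      by (intro mult_mono) (use f L2norm_nonneg[of D f] in auto)
    finally show "y \<le> \<bar>B\<bar>" by simp
  qed
qed

text \<open>A covariance operator is homogeneous only almost everywhere, so the normalisation of \<open>g\<close> is carried out
  under the norm; for \<open>\<parallel>g\<parallel> = 0\<close> the boundedness of \<open>Q\<close> gives \<open>\<parallel>Q g\<parallel> = 0\<close>.\<close>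
lemma op_norm_bound:
  assumes Q: "covariance_op D a e Q" and g: "g \<in> L2 D"
  shows "L2norm D (Q g) \<le> op_norm D Q * L2norm D g"
proof -
  note bdd = op_norm_bdd_above[OF Q]
  obtain B where B: "\<forall>g\<in>L2 D. L2norm D (Q g) \<le> B * L2norm D g"
    using Q unfolding covariance_op_def by blast
  show ?thesis
  proof (cases "L2norm D g = 0")
    case True
    then show ?thesis using B g by fastforce
  next
    case False
    then have pos: "0 < L2norm D g" using L2norm_nonneg[of D g] by simp
    define c where "c = inverse (L2norm D g)"
    have c: "0 < c" using pos by (simp add: c_def)
    have cg: "(\<lambda>x. c * g x) \<in> L2 D" using g by (rule L2_cmult)
    have "AE x in lebesgue_on D. Q (\<lambda>y. c * g y + 0 * g y) x = c * Q g x + 0 * Q g x"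
      using Q g unfolding covariance_op_def by blast
    then have "AE x in lebesgue_on D. Q (\<lambda>y. c * g y) x = c * Q g x" by simp
    moreover have "Q (\<lambda>y. c * g y) \<in> L2 D" "Q g \<in> L2 D"
      using Q g cg unfolding covariance_op_def by auto
    ultimately have "L2norm D (Q (\<lambda>y. c * g y)) = L2norm D (\<lambda>x. c * Q g x)"
      by (intro L2norm_cong_AE) (auto simp: L2_def)
    then have eq: "L2norm D (Q (\<lambda>y. c * g y)) = c * L2norm D (Q g)"
      using c by (simp add: L2norm_cmult)
    have "L2norm D (\<lambda>x. c * g x) \<le> 1"
      using pos c by (simp add: L2norm_cmult) (simp add: c_def)
    then have "L2norm D (Q (\<lambda>y. c * g y)) \<le> op_norm D Q"
      unfolding op_norm_def using cg by (intro cSup_upper bdd) auto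
    then have "L2norm D (Q g) / L2norm D g \<le> op_norm D Q"
      using eq by (simp add: c_def divide_inverse mult.commute)
    then show ?thesis by (simp only: pos_divide_le_eq[OF pos])
  qed
qed

lemma op_norm_nonneg:
  assumes Q: "covariance_op D a e Q"
  shows "0 \<le> op_norm D Q"
proof -
  note bdd = op_norm_bdd_above[OF Q]
  have z: "(\<lambda>_. 0) \<in> L2 D" by (simp add: L2_def)
  have "0 \<le> L2norm D (Q (\<lambda>_. 0))" by (rule L2norm_nonneg)
  also have "\<dots> \<le> op_norm D Q"
    unfolding op_norm_def using z by (intro cSup_upper bdd) (auto simp: L2norm_def ip_def)
  finally show ?thesis .
qed

section \<open>Families with scaled derivative bounds\<close>

text \<open>
  The family \<open>f\<close>, with indices \<open>i\<close> such as pairs \<open>(\<epsilon>, x)\<close> and parameter \<open>t\<close> in \<open>T i\<close>, has size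
  \<open>w i\<close>, and each of \<open>m\<close> derivatives costs a factor \<open>1 / \<kappa> i\<close>. The constants are uniform in \<open>i\<close> and \<open>t\<close>; an
  index with \<open>T i = {}\<close> imposes nothing. The recursion on \<open>m\<close> lets product and chain rule be handled by induction,
  without formulas for higher derivatives.
\<close>
primrec jet ::
  "('i \<Rightarrow> real) \<Rightarrow> ('i \<Rightarrow> real set) \<Rightarrow> nat \<Rightarrow> ('i \<Rightarrow> real) \<Rightarrow> ('i \<Rightarrow> real \<Rightarrow> real) \<Rightarrow> bool" where
  "jet \<kappa> T 0 w f \<longleftrightarrow> (\<exists>C\<ge>0. \<forall>i. \<forall>t\<in>T i. \<bar>f i t\<bar> \<le> C * w i)"
| "jet \<kappa> T (Suc m) w f \<longleftrightarrow> (\<exists>C\<ge>0. \<forall>i. \<forall>t\<in>T i. \<bar>f i t\<bar> \<le> C * w i) \<and>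
     (\<forall>i. \<forall>t\<in>T i. (f i has_real_derivative deriv (f i) t) (at t)) \<and>
     jet \<kappa> T m (\<lambda>i. w i / \<kappa> i) (\<lambda>i. deriv (f i))"

lemma jet_boundE:
  assumes "jet \<kappa> T m w f"
  obtains C where "0 \<le> C" "\<And>i t. t \<in> T i \<Longrightarrow> \<bar>f i t\<bar> \<le> C * w i"
  using assms by (cases m) auto

lemma jet_0I:
  assumes "0 \<le> C" "\<And>i t. t \<in> T i \<Longrightarrow> \<bar>f i t\<bar> \<le> C * w i"
  shows "jet \<kappa> T 0 w f"
  using assms by auto

lemma jet_Suc_iff:
  "jet \<kappa> T (Suc m) w f \<longleftrightarrow> jet \<kappa> T 0 w f \<and>
     (\<forall>i. \<forall>t\<in>T i. (f i has_real_derivative deriv (f i) t) (at t)) \<and>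
     jet \<kappa> T m (\<lambda>i. w i / \<kappa> i) (\<lambda>i. deriv (f i))"
  by simp

declare jet.simps [simp del]

lemma jet_SucD:
  assumes "jet \<kappa> T (Suc m) w f"
  shows "jet \<kappa> T 0 w f" "t \<in> T i \<Longrightarrow> (f i has_real_derivative deriv (f i) t) (at t)"
    "jet \<kappa> T m (\<lambda>i. w i / \<kappa> i) (\<lambda>i. deriv (f i))"
  using assms by (simp_all only: jet_Suc_iff)

lemma jet_Suc_imp: "jet \<kappa> T (Suc m) w f \<Longrightarrow> jet \<kappa> T m w f"
proof (induction m arbitrary: w f)
  case 0
  then show ?case by (rule jet_SucD(1))
next
  case (Suc m)
  have "jet \<kappa> T m (\<lambda>i. w i / \<kappa> i) (\<lambda>i. deriv (f i))"
    by (rule Suc.IH[OF jet_SucD(3)[OF Suc.prems]])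
  then show ?case using Suc.prems by (subst jet_Suc_iff) (auto dest: jet_SucD)
qed

lemma jet_le: "jet \<kappa> T m w f \<Longrightarrow> l \<le> m \<Longrightarrow> jet \<kappa> T l w f"
  by (induction m) (auto simp: le_Suc_eq dest: jet_Suc_imp)

lemma jet_subset:
  assumes "\<And>i. T' i \<subseteq> T i"
  shows "jet \<kappa> T m w f \<Longrightarrow> jet \<kappa> T' m w f"
proof (induction m arbitrary: w f)
  case 0
  then obtain C where "0 \<le> C" "\<And>i t. t \<in> T i \<Longrightarrow> \<bar>f i t\<bar> \<le> C * w i" by (metis jet_boundE)
  then show ?case using assms by (intro jet_0I[of C]) auto
next
  case (Suc m)
  obtain C where C: "0 \<le> C" "\<And>i t. t \<in> T i \<Longrightarrow> \<bar>f i t\<bar> \<le> C * w i"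
    using Suc.prems by (metis jet_boundE)
  have "jet \<kappa> T' 0 w f" using assms C by (intro jet_0I[of C]) auto
  moreover have "jet \<kappa> T' m (\<lambda>i. w i / \<kappa> i) (\<lambda>i. deriv (f i))"
    by (intro Suc.IH jet_SucD(3)[OF Suc.prems])
  ultimately show ?case using jet_SucD(2)[OF Suc.prems] assms
    by (subst jet_Suc_iff) blast
qed

lemma jet_derivative_bound:
  assumes "jet \<kappa> T m w f" and "l \<le> m"
  shows "\<exists>C\<ge>0. \<forall>i. \<forall>t\<in>T i. \<bar>(deriv ^^ l) (f i) t\<bar> \<le> C * (w i / \<kappa> i ^ l)"
  using assms
proof (induction l arbitrary: m w f)
  case 0
  then obtain C where "0 \<le> C" "\<And>i t. t \<in> T i \<Longrightarrow> \<bar>f i t\<bar> \<le> C * w i" by (metis jet_boundE)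
  then show ?case by (intro exI[of _ C]) simp
next
  case (Suc l)
  then obtain m' where m': "m = Suc m'" "l \<le> m'" by (cases m) auto
  have "jet \<kappa> T m' (\<lambda>i. w i / \<kappa> i) (\<lambda>i. deriv (f i))"
    using Suc.prems(1) jet_SucD(3) unfolding m'(1) by blast
  from Suc.IH[OF this m'(2)] show ?case
    by (simp add: funpow_Suc_right del: funpow.simps(2))
qed

context
  fixes \<kappa> :: "'i \<Rightarrow> real" and T :: "'i \<Rightarrow> real set"
  assumes opn: "\<And>i. open (T i)" and \<kappa>: "\<And>i. T i \<noteq> {} \<Longrightarrow> 0 < \<kappa> i"
begin

lemma jet_cong:
  assumes "jet \<kappa> T m w f" and "\<And>i t. t \<in> T i \<Longrightarrow> f i t = g i t"
  shows "jet \<kappa> T m w g"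
  using assms
proof (induction m arbitrary: w f g)
  case 0
  then obtain C where "0 \<le> C" "\<And>i t. t \<in> T i \<Longrightarrow> \<bar>f i t\<bar> \<le> C * w i" by (metis jet_boundE)
  then show ?case using 0(2) by (intro jet_0I[of C]) auto
next
  case (Suc m)
  obtain C where C: "0 \<le> C" "\<And>i t. t \<in> T i \<Longrightarrow> \<bar>f i t\<bar> \<le> C * w i"
    using Suc.prems(1) by (metis jet_boundE)
  have D: "(g i has_real_derivative deriv (f i) t) (at t)" if "t \<in> T i" for i t
    by (rule has_field_derivative_transform_within_open
        [OF jet_SucD(2)[OF Suc.prems(1) that] opn that Suc.prems(2)])
  then have eq: "deriv (g i) t = deriv (f i) t" if "t \<in> T i" for i t
    using that DERIV_imp_deriv by blast
  have "jet \<kappa> T m (\<lambda>i. w i / \<kappa> i) (\<lambda>i. deriv (g i))"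
    by (rule Suc.IH[OF jet_SucD(3)[OF Suc.prems(1)]]) (simp add: eq)
  moreover have "jet \<kappa> T 0 w g"
    using C Suc.prems(2) by (intro jet_0I[of C]) auto
  ultimately show ?case using D eq by (subst jet_Suc_iff) auto
qed

lemma jet_SucI:
  assumes "jet \<kappa> T 0 w f" and "\<And>i t. t \<in> T i \<Longrightarrow> (f i has_real_derivative f' i t) (at t)"
    and "jet \<kappa> T m (\<lambda>i. w i / \<kappa> i) f'"
  shows "jet \<kappa> T (Suc m) w f"
proof -
  have eq: "deriv (f i) t = f' i t" if "t \<in> T i" for i t
    using assms(2)[OF that] by (rule DERIV_imp_deriv)
  have "jet \<kappa> T m (\<lambda>i. w i / \<kappa> i) (\<lambda>i. deriv (f i))"
    by (rule jet_cong[OF assms(3)]) (simp add: eq)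
  then show ?thesis using assms(1,2) eq by (subst jet_Suc_iff) auto
qed

lemma div_scale_nonneg: "(\<And>i. T i \<noteq> {} \<Longrightarrow> 0 \<le> w i) \<Longrightarrow> T i \<noteq> {} \<Longrightarrow> 0 \<le> w i / \<kappa> i"
  by (rule divide_nonneg_pos) (simp_all add: \<kappa>)

lemma jet_weight_mono:
  assumes "\<And>i. T i \<noteq> {} \<Longrightarrow> w i \<le> B * w' i" and "0 \<le> B" and "jet \<kappa> T m w f"
  shows "jet \<kappa> T m w' f"
  using assms(1,3)
proof (induction m arbitrary: w w' f)
  case 0
  then obtain C where C: "0 \<le> C" "\<And>i t. t \<in> T i \<Longrightarrow> \<bar>f i t\<bar> \<le> C * w i" by (metis jet_boundE)
  have "\<bar>f i t\<bar> \<le> (C * B) * w' i" if "t \<in> T i" for i t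
  proof -
    have "C * w i \<le> C * (B * w' i)" using 0(1)[of i] that C(1) by (intro mult_left_mono) auto
    then show ?thesis using C(2)[OF that] by (simp add: mult.assoc)
  qed
  then show ?case using C(1) \<open>0 \<le> B\<close> by (intro jet_0I[of "C * B"]) auto
next
  case (Suc m)
  obtain C where C: "0 \<le> C" "\<And>i t. t \<in> T i \<Longrightarrow> \<bar>f i t\<bar> \<le> C * w i"
    using Suc.prems(2) by (metis jet_boundE)
  have b: "\<bar>f i t\<bar> \<le> (C * B) * w' i" if "t \<in> T i" for i t
  proof -
    have "C * w i \<le> C * (B * w' i)" using Suc.prems(1)[of i] that C(1) by (intro mult_left_mono) auto
    then show ?thesis using C(2)[OF that] by (simp add: mult.assoc)
  qed
  show ?case
  proof (rule jet_SucI)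
    show "jet \<kappa> T 0 w' f" using C(1) \<open>0 \<le> B\<close> b by (intro jet_0I[of "C * B"]) auto
    show "jet \<kappa> T m (\<lambda>i. w' i / \<kappa> i) (\<lambda>i. deriv (f i))"
    proof (rule Suc.IH)
      show "w i / \<kappa> i \<le> B * (w' i / \<kappa> i)" if "T i \<noteq> {}" for i
        using divide_right_mono[OF Suc.prems(1)[OF that], of "\<kappa> i"] \<kappa>[OF that] by simp
      show "jet \<kappa> T m (\<lambda>i. w i / \<kappa> i) (\<lambda>i. deriv (f i))"
        by (rule jet_SucD(3)[OF Suc.prems(2)])
    qed
  qed (rule jet_SucD(2)[OF Suc.prems(2)])
qed

lemma jet_zero:
  assumes "\<And>i. T i \<noteq> {} \<Longrightarrow> 0 \<le> w i"
  shows "jet \<kappa> T m w (\<lambda>i _. 0)"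
  using assms
proof (induction m arbitrary: w)
  case 0
  show ?case by (rule jet_0I[of 0]) auto
next
  case (Suc m)
  show ?case
  proof (rule jet_SucI)
    show "jet \<kappa> T 0 w (\<lambda>i _. 0)" by (rule jet_0I[of 0]) auto
    show "((\<lambda>_. 0) has_real_derivative 0) (at t)" for t by simp
    show "jet \<kappa> T m (\<lambda>i. w i / \<kappa> i) (\<lambda>i _. 0)"
      by (rule Suc.IH) (rule div_scale_nonneg[OF Suc.prems])
  qed
qed

lemma jet_const:
  assumes b: "\<And>i. T i \<noteq> {} \<Longrightarrow> \<bar>c i\<bar> \<le> B * w i" and w: "\<And>i. T i \<noteq> {} \<Longrightarrow> 0 \<le> w i"
  shows "jet \<kappa> T m w (\<lambda>i _. c i)"
proof -
  have "\<bar>c i\<bar> \<le> \<bar>B\<bar> * w i" if "T i \<noteq> {}" for i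
    using b[OF that] mult_right_mono[OF abs_ge_self[of B] w[OF that]] by linarith
  then have b0: "jet \<kappa> T 0 w (\<lambda>i _. c i)"
    by (intro jet_0I[of "\<bar>B\<bar>"]) auto
  show ?thesis
  proof (cases m)
    case 0
    then show ?thesis using b0 by simp
  next
    case (Suc m')
    show ?thesis unfolding Suc
    proof (rule jet_SucI[where f'="\<lambda>_ _. 0"])
      show "jet \<kappa> T 0 w (\<lambda>i _. c i)" by (rule b0)
      show "((\<lambda>_. c i) has_real_derivative 0) (at t)" if "t \<in> T i" for i t by (rule DERIV_const)
      show "jet \<kappa> T m' (\<lambda>i. w i / \<kappa> i) (\<lambda>i _. 0)"
        by (rule jet_zero) (rule div_scale_nonneg[OF w])
    qed
  qed
qed

lemma jet_add:
  assumes "jet \<kappa> T m w f" "jet \<kappa> T m w g"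
  shows "jet \<kappa> T m w (\<lambda>i t. f i t + g i t)"
  using assms
proof (induction m arbitrary: w f g)
  case 0
  obtain C1 where C1: "0 \<le> C1" "\<And>i t. t \<in> T i \<Longrightarrow> \<bar>f i t\<bar> \<le> C1 * w i"
    using 0(1) by (metis jet_boundE)
  obtain C2 where C2: "0 \<le> C2" "\<And>i t. t \<in> T i \<Longrightarrow> \<bar>g i t\<bar> \<le> C2 * w i"
    using 0(2) by (metis jet_boundE)
  show ?case using C1 C2
    by (intro jet_0I[of "C1 + C2"])
      (auto simp: distrib_right intro!: order_trans[OF abs_triangle_ineq] add_mono)
next
  case (Suc m)
  show ?case
  proof (rule jet_SucI)
    obtain C1 where C1: "0 \<le> C1" "\<And>i t. t \<in> T i \<Longrightarrow> \<bar>f i t\<bar> \<le> C1 * w i"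
      using Suc.prems(1) by (metis jet_boundE)
    obtain C2 where C2: "0 \<le> C2" "\<And>i t. t \<in> T i \<Longrightarrow> \<bar>g i t\<bar> \<le> C2 * w i"
      using Suc.prems(2) by (metis jet_boundE)
    show "jet \<kappa> T 0 w (\<lambda>i t. f i t + g i t)" using C1 C2
      by (intro jet_0I[of "C1 + C2"])
        (auto simp: distrib_right intro!: order_trans[OF abs_triangle_ineq] add_mono)
    show "((\<lambda>t. f i t + g i t) has_real_derivative deriv (f i) t + deriv (g i) t) (at t)"
      if "t \<in> T i" for i t
      using jet_SucD(2)[OF Suc.prems(1) that] jet_SucD(2)[OF Suc.prems(2) that] by (rule DERIV_add)
    show "jet \<kappa> T m (\<lambda>i. w i / \<kappa> i) (\<lambda>i t. deriv (f i) t + deriv (g i) t)"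
      by (intro Suc.IH jet_SucD(3) Suc.prems)
  qed
qed

lemma jet_mult:
  assumes "\<And>i. T i \<noteq> {} \<Longrightarrow> 0 \<le> w1 i" and "\<And>i. T i \<noteq> {} \<Longrightarrow> 0 \<le> w2 i"
    and "jet \<kappa> T m w1 f" "jet \<kappa> T m w2 g"
  shows "jet \<kappa> T m (\<lambda>i. w1 i * w2 i) (\<lambda>i t. f i t * g i t)"
  using assms
proof (induction m arbitrary: w1 w2 f g)
  case (0 w1 w2 f g)
  obtain C1 where C1: "0 \<le> C1" "\<And>i t. t \<in> T i \<Longrightarrow> \<bar>f i t\<bar> \<le> C1 * w1 i"
    using 0(3) by (metis jet_boundE)
  obtain C2 where C2: "0 \<le> C2" "\<And>i t. t \<in> T i \<Longrightarrow> \<bar>g i t\<bar> \<le> C2 * w2 i"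
    using 0(4) by (metis jet_boundE)
  show ?case
  proof (rule jet_0I[of "C1 * C2"])
    fix i t assume t: "t \<in> T i"
    then have w: "0 \<le> w1 i" using 0(1) by blast
    have "\<bar>f i t\<bar> * \<bar>g i t\<bar> \<le> (C1 * w1 i) * (C2 * w2 i)"
      by (rule mult_mono) (use t w C1 C2 in auto)
    then show "\<bar>f i t * g i t\<bar> \<le> (C1 * C2) * (w1 i * w2 i)" by (simp add: abs_mult mult_ac)
  qed (use C1 C2 in simp)
next
  case (Suc m w1 w2 f g)
  show ?case
  proof (rule jet_SucI)
    obtain C1 where C1: "0 \<le> C1" "\<And>i t. t \<in> T i \<Longrightarrow> \<bar>f i t\<bar> \<le> C1 * w1 i"
      using Suc.prems(3) by (metis jet_boundE)
    obtain C2 where C2: "0 \<le> C2" "\<And>i t. t \<in> T i \<Longrightarrow> \<bar>g i t\<bar> \<le> C2 * w2 i"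
      using Suc.prems(4) by (metis jet_boundE)
    show "jet \<kappa> T 0 (\<lambda>i. w1 i * w2 i) (\<lambda>i t. f i t * g i t)"
    proof (rule jet_0I[of "C1 * C2"])
      fix i t assume t: "t \<in> T i"
      then have w: "0 \<le> w1 i" using Suc.prems(1) by blast
      have "\<bar>f i t\<bar> * \<bar>g i t\<bar> \<le> (C1 * w1 i) * (C2 * w2 i)"
        by (rule mult_mono) (use t w C1 C2 in auto)
      then show "\<bar>f i t * g i t\<bar> \<le> (C1 * C2) * (w1 i * w2 i)" by (simp add: abs_mult mult_ac)
    qed (use C1 C2 in simp)
    show "((\<lambda>t. f i t * g i t) has_real_derivative f i t * deriv (g i) t + deriv (f i) t * g i t) (at t)"
      if "t \<in> T i" for i t
      using jet_SucD(2)[OF Suc.prems(3) that] jet_SucD(2)[OF Suc.prems(4) that] by (rule DERIV_mult')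
    note w1 = div_scale_nonneg[of w1, OF Suc.prems(1)] and w2 = div_scale_nonneg[of w2, OF Suc.prems(2)]
    have "jet \<kappa> T m (\<lambda>i. w1 i * (w2 i / \<kappa> i)) (\<lambda>i t. f i t * deriv (g i) t)"
      by (rule Suc.IH[OF Suc.prems(1) w2 jet_Suc_imp[OF Suc.prems(3)] jet_SucD(3)[OF Suc.prems(4)]])
    moreover have "jet \<kappa> T m (\<lambda>i. (w1 i / \<kappa> i) * w2 i) (\<lambda>i t. deriv (f i) t * g i t)"
      by (rule Suc.IH[OF w1 Suc.prems(2) jet_SucD(3)[OF Suc.prems(3)] jet_Suc_imp[OF Suc.prems(4)]])
    ultimately show "jet \<kappa> T m (\<lambda>i. w1 i * w2 i / \<kappa> i) (\<lambda>i t. f i t * deriv (g i) t + deriv (f i) t * g i t)"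
      by (intro jet_add) (simp_all add: mult.commute)
  qed
qed

lemma jet_cmult:
  assumes w: "\<And>i. T i \<noteq> {} \<Longrightarrow> 0 \<le> w i" and "jet \<kappa> T m w f"
  shows "jet \<kappa> T m (\<lambda>i. \<bar>c i\<bar> * w i) (\<lambda>i t. c i * f i t)"
proof (rule jet_mult[OF _ w _ assms(2)])
  show "jet \<kappa> T m (\<lambda>i. \<bar>c i\<bar>) (\<lambda>i _. c i)"
    by (rule jet_const[where B=1]) auto
qed simp_all

lemma jet_minus:
  assumes "\<And>i. T i \<noteq> {} \<Longrightarrow> 0 \<le> w i" and "jet \<kappa> T m w f" "jet \<kappa> T m w g"
  shows "jet \<kappa> T m w (\<lambda>i t. f i t - g i t)"
proof -
  have "jet \<kappa> T m w (\<lambda>i t. - g i t)"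
    using jet_cmult[OF assms(1,3), of "\<lambda>_. -1"] by simp
  from jet_add[OF assms(2) this] show ?thesis by simp
qed

lemma jet_sum:
  assumes "\<And>i. T i \<noteq> {} \<Longrightarrow> 0 \<le> w i" and "finite J" and "\<And>j. j \<in> J \<Longrightarrow> jet \<kappa> T m w (f j)"
  shows "jet \<kappa> T m w (\<lambda>i t. \<Sum>j\<in>J. f j i t)"
  using assms(2,3)
proof (induction J rule: finite_induct)
  case empty
  then show ?case using jet_zero[OF assms(1)] by simp
next
  case (insert a J)
  have "jet \<kappa> T m w (\<lambda>i t. f a i t + (\<Sum>j\<in>J. f j i t))"
    by (rule jet_add) (auto intro: insert)
  then show ?case using insert.hyps by simp
qed

text \<open>Only derivatives of the inner function \<open>g\<close> are controlled: \<open>g\<close> may be a stretched variable \<open>r / \<epsilon>\<close>, which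
  is unbounded. The outer function varies on the unit scale, so the scale \<open>\<kappa>\<close> enters through \<open>g'\<close> alone.\<close>
lemma jet_compose:
  assumes F: "jet (\<lambda>_. 1) S m w F"
    and g: "\<And>i t. t \<in> T i \<Longrightarrow> (g i has_real_derivative deriv (g i) t) (at t)"
    and g': "jet \<kappa> T m (\<lambda>i. 1 / \<kappa> i) (\<lambda>i. deriv (g i))"
    and S: "\<And>i t. t \<in> T i \<Longrightarrow> g i t \<in> S (e i)"
    and w: "\<And>i. T i \<noteq> {} \<Longrightarrow> 0 \<le> w (e i)"
  shows "jet \<kappa> T m (\<lambda>i. w (e i)) (\<lambda>i t. F (e i) (g i t))"
  using assms(1,3)
proof (induction m arbitrary: F)
  case (0 F)
  then obtain C where "0 \<le> C" "\<And>i t. t \<in> S i \<Longrightarrow> \<bar>F i t\<bar> \<le> C * w i" by (metis jet_boundE)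
  then show ?case using S by (intro jet_0I[of C]) auto
next
  case (Suc m F)
  obtain C where C: "0 \<le> C" "\<And>i t. t \<in> S i \<Longrightarrow> \<bar>F i t\<bar> \<le> C * w i"
    using Suc.prems(1) by (metis jet_boundE)
  show ?case
  proof (rule jet_SucI)
    show "jet \<kappa> T 0 (\<lambda>i. w (e i)) (\<lambda>i t. F (e i) (g i t))"
      using C S by (intro jet_0I[of C]) auto
    show "((\<lambda>t. F (e i) (g i t)) has_real_derivative deriv (F (e i)) (g i t) * deriv (g i) t) (at t)"
      if "t \<in> T i" for i t
      by (rule DERIV_chain2[OF jet_SucD(2)[OF Suc.prems(1) S[OF that]] g[OF that]])
    have g'm: "jet \<kappa> T m (\<lambda>i. 1 / \<kappa> i) (\<lambda>i. deriv (g i))"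
      by (rule jet_Suc_imp[OF Suc.prems(2)])
    have "jet (\<lambda>_. 1) S m w (\<lambda>i. deriv (F i))"
      using jet_SucD(3)[OF Suc.prems(1)] by simp
    from Suc.IH[OF this g'm]
    have "jet \<kappa> T m (\<lambda>i. w (e i)) (\<lambda>i t. deriv (F (e i)) (g i t))" .
    from jet_mult[OF w _ this g'm]
    show "jet \<kappa> T m (\<lambda>i. w (e i) / \<kappa> i) (\<lambda>i t. deriv (F (e i)) (g i t) * deriv (g i) t)"
      using \<kappa> by (simp add: less_imp_le)
  qed
qed

text \<open>Derivatives that are bounded on the unit scale satisfy the bounds on any smaller scale.\<close>
lemma jet_of_derivatives:
  assumes \<kappa>1: "\<And>i. T i \<noteq> {} \<Longrightarrow> \<kappa> i \<le> 1" and w: "\<And>i. T i \<noteq> {} \<Longrightarrow> 0 \<le> w i"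
    and b: "\<And>l. \<exists>C. \<forall>i. \<forall>t\<in>T i. \<bar>(deriv ^^ l) (f i) t\<bar> \<le> C * w i"
    and d: "\<And>l i t. t \<in> T i \<Longrightarrow> ((deriv ^^ l) (f i) has_real_derivative (deriv ^^ Suc l) (f i) t) (at t)"
  shows "jet \<kappa> T m w f"
  using b d
proof (induction m arbitrary: f)
  have base: "jet \<kappa> T 0 w f" if b: "\<exists>C. \<forall>i. \<forall>t\<in>T i. \<bar>f i t\<bar> \<le> C * w i" for f
  proof -
    obtain C where C: "\<And>i t. t \<in> T i \<Longrightarrow> \<bar>f i t\<bar> \<le> C * w i" using b by auto
    have "\<bar>f i t\<bar> \<le> \<bar>C\<bar> * w i" if "t \<in> T i" for i t
      using C[OF that] mult_right_mono[OF abs_ge_self[of C], of "w i"] w[of i] that by force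
    then show ?thesis by (intro jet_0I[of "\<bar>C\<bar>"]) auto
  qed
  case (0 f)
  show ?case using 0(1)[of 0] by (intro base) simp
next
  case (Suc m f)
  have base: "jet \<kappa> T 0 w f"
  proof -
    obtain C where C: "\<And>i t. t \<in> T i \<Longrightarrow> \<bar>f i t\<bar> \<le> C * w i" using Suc.prems(1)[of 0] by auto
    have "\<bar>f i t\<bar> \<le> \<bar>C\<bar> * w i" if "t \<in> T i" for i t
      using C[OF that] mult_right_mono[OF abs_ge_self[of C], of "w i"] w[of i] that by force
    then show ?thesis by (intro jet_0I[of "\<bar>C\<bar>"]) auto
  qed
  show ?case
  proof (rule jet_SucI[OF base])
    show "(f i has_real_derivative deriv (f i) t) (at t)" if "t \<in> T i" for i t
      using Suc.prems(2)[OF that, of 0] by simp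
    have "jet \<kappa> T m w (\<lambda>i. deriv (f i))"
    proof (rule Suc.IH)
      show "\<exists>C. \<forall>i. \<forall>t\<in>T i. \<bar>(deriv ^^ l) (deriv (f i)) t\<bar> \<le> C * w i" for l
        using Suc.prems(1)[of "Suc l"] by (simp add: funpow_Suc_right del: funpow.simps(2))
      show "((deriv ^^ l) (deriv (f i)) has_real_derivative (deriv ^^ Suc l) (deriv (f i)) t) (at t)"
        if "t \<in> T i" for l i t
        using Suc.prems(2)[OF that, of "Suc l"] by (simp add: funpow_Suc_right del: funpow.simps(2))
    qed
    moreover have "w i \<le> 1 * (w i / \<kappa> i)" if "T i \<noteq> {}" for i
      using \<kappa>[OF that] \<kappa>1[OF that] w[OF that]
      by (simp add: pos_le_divide_eq mult_left_le)
    ultimately show "jet \<kappa> T m (\<lambda>i. w i / \<kappa> i) (\<lambda>i. deriv (f i))"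
      by (intro jet_weight_mono[where w=w and B=1 and w'="\<lambda>i. w i / \<kappa> i"]) simp_all
  qed
qed

end

text \<open>Allows different reasons for smallness on two overlapping sets of parameters.\<close>
lemma jet_Un:
  assumes opn: "\<And>i. open (T1 i)" "\<And>i. open (T2 i)" 
    and w: "\<And>i. T1 i \<union> T2 i \<noteq> {} \<Longrightarrow> 0 \<le> w i" and \<kappa>: "\<And>i. T1 i \<union> T2 i \<noteq> {} \<Longrightarrow> 0 < \<kappa> i"
    and "jet \<kappa> T1 m w f" "jet \<kappa> T2 m w f"
  shows "jet \<kappa> (\<lambda>i. T1 i \<union> T2 i) m w f"
  using assms(3,5,6)
proof (induction m arbitrary: w f)
  have base: "jet \<kappa> (\<lambda>i. T1 i \<union> T2 i) 0 w f"
    if w: "\<And>i. T1 i \<union> T2 i \<noteq> {} \<Longrightarrow> 0 \<le> w i" and j1: "jet \<kappa> T1 m w f" and j2: "jet \<kappa> T2 m w f" for m w f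
  proof -
    obtain C1 where C1: "0 \<le> C1" "\<And>i t. t \<in> T1 i \<Longrightarrow> \<bar>f i t\<bar> \<le> C1 * w i"
      using j1 by (metis jet_boundE)
    obtain C2 where C2: "0 \<le> C2" "\<And>i t. t \<in> T2 i \<Longrightarrow> \<bar>f i t\<bar> \<le> C2 * w i"
      using j2 by (metis jet_boundE)
    show ?thesis
    proof (rule jet_0I[of "C1 + C2"])
      fix i t assume t: "t \<in> T1 i \<union> T2 i"
      then have "0 \<le> w i" using w by blast
      then have "0 \<le> C1 * w i" "0 \<le> C2 * w i" using C1 C2 by auto
      then show "\<bar>f i t\<bar> \<le> (C1 + C2) * w i"
        using t C1(2)[of t i] C2(2)[of t i] by (auto simp: distrib_right)
    qed (use C1 C2 in simp)
  qed
  {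
    case 0
    then show ?case by (rule base)
  next
    case (Suc m)
    have "jet \<kappa> (\<lambda>i. T1 i \<union> T2 i) m (\<lambda>i. w i / \<kappa> i) (\<lambda>i. deriv (f i))"
    proof (rule Suc.IH)
      show "0 \<le> w i / \<kappa> i" if "T1 i \<union> T2 i \<noteq> {}" for i
        using Suc.prems(1)[OF that] \<kappa>[OF that] by simp
    qed (intro jet_SucD(3) Suc.prems)+
    then show ?case
      using base[OF Suc.prems] jet_SucD(2)[OF Suc.prems(2)] jet_SucD(2)[OF Suc.prems(3)]
      by (subst jet_Suc_iff) blast
  }
qed

section \<open>The heteroclinic profile\<close>

text \<open>With an antiderivative \<open>g\<close> of \<open>a\<close>, the function \<open>y e\<^bsup>-g\<^esup>\<close> is constant.\<close>
lemma linear_ode_zero: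
  fixes y a :: "real \<Rightarrow> real"
  assumes y: "\<And>x. (y has_real_derivative a x * y x) (at x)"
    and a: "continuous_on UNIV a" and "y x0 = 0"
  shows "y x = 0"
proof -
  define l r where "l = min x x0" and "r = max x x0"
  have lr: "l \<le> r" "x \<in> {l..r}" "x0 \<in> {l..r}" by (auto simp: l_def r_def)
  have "continuous_on {l..r} a" using a by (rule continuous_on_subset) simp
  from antiderivative_continuous[OF this]
  obtain g where g: "\<And>t. t \<in> {l..r} \<Longrightarrow> (g has_vector_derivative a t) (at t within {l..r})"
    by blast
  have "\<exists>c. \<forall>t\<in>{l..r}. y t * exp (- g t) = c"
  proof (rule has_field_derivative_zero_constant)
    fix t assume t: "t \<in> {l..r}"
    have g': "(g has_real_derivative a t) (at t within {l..r})"
      using g[OF t] by (simp add: has_real_derivative_iff_has_vector_derivative)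
    have y': "(y has_real_derivative a t * y t) (at t within {l..r})"
      using y by (rule has_field_derivative_at_within)
    show "((\<lambda>t. y t * exp (- g t)) has_real_derivative 0) (at t within {l..r})"
      by (rule derivative_eq_intros g' y' refl | simp)+
  qed simp
  then have "y x * exp (- g x) = y x0 * exp (- g x0)" using lr by metis
  then show ?thesis using assms(3) by simp
qed

text \<open>The energy \<open>U'\<^sup>2 / 2 - (U\<^sup>2 - 1)\<^sup>2 / 4\<close> is conserved. The definition of the profile says nothing about the limits of
  \<open>U'\<close>, but the mean value theorem provides points tending to infinity along which \<open>U'\<close> tends to \<open>0\<close>, and
  there the energy tends to \<open>0\<close>.\<close>
lemma AC_profile_first_integral:
  assumes "AC_profile U"
  shows "(deriv U R)\<^sup>2 = (1 - (U R)\<^sup>2)\<^sup>2 / 2"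
proof -
  define V where "V = deriv U"
  define E where "E R = (V R)\<^sup>2 - (1 - (U R)\<^sup>2)\<^sup>2 / 2" for R
  have U: "(U has_real_derivative V R) (at R)" and V: "(V has_real_derivative nonlin (U R)) (at R)" for R
    using assms by (auto simp: AC_profile_def V_def)
  have "(E has_real_derivative 0) (at R)" for R
  proof -
    have "(E has_real_derivative 2 * (nonlin (U R) * V R) - (2 * ((- (2 * (V R * U R))) * (1 - (U R)\<^sup>2))) / 2) (at R)"
      unfolding E_def[abs_def] by (rule derivative_eq_intros U V refl | simp)+
    then show ?thesis by (simp add: nonlin_def power2_eq_square power3_eq_cube field_simps)
  qed
  then have "\<exists>c. \<forall>R. E R = c"
    using has_field_derivative_zero_constant[of UNIV E] by simp
  then obtain c where c: "\<And>R. E R = c" by blast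
  have lim: "(U \<longlongrightarrow> 1) at_top" using assms by (simp add: AC_profile_def)
  have "\<exists>z. real n < z \<and> z < real n + 1 \<and> U (real n + 1) - U (real n) = V z" for n
    using MVT2[of "real n" "real n + 1" U V] U by auto
  then obtain z where z: "\<And>n. real n < z n" "\<And>n. U (real n + 1) - U (real n) = V (z n)"
    by metis
  have l1: "filterlim (\<lambda>n. real n) at_top sequentially" by (rule filterlim_real_sequentially)
  have l2: "filterlim (\<lambda>n. real n + 1) at_top sequentially"
    by (rule filterlim_at_top_mono[OF l1]) auto
  have l3: "filterlim z at_top sequentially"
    by (rule filterlim_at_top_mono[OF l1]) (auto intro!: always_eventually less_imp_le z)
  have "(\<lambda>n. U (real n + 1) - U (real n)) \<longlonglongrightarrow> 1 - 1"
    by (intro tendsto_diff filterlim_compose[OF lim] l1 l2)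
  then have "(\<lambda>n. V (z n)) \<longlonglongrightarrow> 0" using z(2) by simp
  moreover have "(\<lambda>n. U (z n)) \<longlonglongrightarrow> 1" by (intro filterlim_compose[OF lim] l3)
  ultimately have "(\<lambda>n. E (z n)) \<longlonglongrightarrow> 0\<^sup>2 - (1 - 1\<^sup>2)\<^sup>2 / 2"
    unfolding E_def by (intro tendsto_intros) auto
  then have "c = 0" using c by (simp add: LIMSEQ_const_iff)
  then show ?thesis using c[of R] by (simp add: E_def V_def)
qed

text \<open>\<open>1 - U\<close> and \<open>1 + U\<close> solve linear equations, so if \<open>U\<close> reaches \<open>1\<close> or \<open>-1\<close> it is constant, against its
  limits; connectedness then confines \<open>U\<close> to \<open>(-1, 1)\<close>.\<close>
lemma first_order_profile_bounded:
  fixes U :: "real \<Rightarrow> real"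
  assumes U: "\<And>R. (U has_real_derivative c * (1 - (U R)\<^sup>2)) (at R)"
    and top: "(U \<longlongrightarrow> 1) at_top" and bot: "(U \<longlongrightarrow> -1) at_bot"
  shows "\<bar>U R\<bar> < 1"
proof -
  have cont: "continuous_on S U" for S
    using U by (auto intro!: continuous_at_imp_continuous_on dest: DERIV_isCont)
  have ne1: "U R \<noteq> 1" for R
  proof
    assume "U R = 1"
    have "1 - U x = 0" for x
    proof (rule linear_ode_zero[where y="\<lambda>R. 1 - U R" and a="\<lambda>x. - c * (1 + U x)" and ?x0.0=R])
      show "((\<lambda>R. 1 - U R) has_real_derivative (- c * (1 + U x)) * (1 - U x)) (at x)" for x
        using DERIV_diff[OF DERIV_const[of 1] U[of x]] by (simp add: power2_eq_square algebra_simps)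
      show "continuous_on UNIV (\<lambda>x. - c * (1 + U x))" by (intro continuous_intros cont)
    qed (simp add: \<open>U R = 1\<close>)
    then have "U = (\<lambda>_. 1)" by auto
    then show False using bot by (simp add: tendsto_const_iff)
  qed
  have ne2: "U R \<noteq> -1" for R
  proof
    assume "U R = -1"
    have "1 + U x = 0" for x
    proof (rule linear_ode_zero[where y="\<lambda>R. 1 + U R" and a="\<lambda>x. c * (1 - U x)" and ?x0.0=R])
      show "((\<lambda>R. 1 + U R) has_real_derivative (c * (1 - U x)) * (1 + U x)) (at x)" for x
        using DERIV_add[OF DERIV_const[of 1] U[of x]] by (simp add: power2_eq_square algebra_simps)
      show "continuous_on UNIV (\<lambda>x. c * (1 - U x))" by (intro continuous_intros cont)
    qed (simp add: \<open>U R = -1\<close>)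
    then have "U = (\<lambda>_. -1)" by (auto simp: fun_eq_iff add_eq_0_iff)
    then show False using top by (simp add: tendsto_const_iff)
  qed
  have "eventually (\<lambda>R. U R > -1) at_top" by (rule order_tendstoD(1)[OF top]) simp
  then obtain b where b: "U b > -1" by (meson eventually_at_top_linorder order_refl)
  have "eventually (\<lambda>R. U R < 1) at_bot" by (rule order_tendstoD(2)[OF bot]) simp
  then obtain a where a: "U a < 1" by (meson eventually_at_bot_linorder order_refl)
  have conn: "connected (range U)" by (intro connected_continuous_image cont) auto
  have "U R < 1"
  proof (rule ccontr)
    assume "\<not> U R < 1"
    then have "1 \<in> range U"
      using connectedD_interval[OF conn, of "U a" "U R" 1] a by auto
    then show False using ne1 by auto
  qed
  moreover have "U R > -1"
  proof (rule ccontr)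
    assume "\<not> U R > -1"
    then have "-1 \<in> range U"
      using connectedD_interval[OF conn, of "U R" "U b" "-1"] b by auto
    then show False using ne2 by (metis rangeE)
  qed
  ultimately show ?thesis by auto
qed

text \<open>The first integral is a product \<open>y z = 0\<close>, where \<open>y\<close> solves a linear equation and hence vanishes everywhere
  or nowhere; in the latter case \<open>z = 0\<close> everywhere. So the sign in \<open>U' = \<plusminus> (1 - U\<^sup>2) / \<surd>2\<close> does not depend on
  the point, and the limits of \<open>U\<close> decide that it is positive.\<close>
lemma AC_profile_ode:
  assumes prof: "AC_profile U"
  shows "deriv U R = (1 - (U R)\<^sup>2) / sqrt 2" and "\<bar>U R\<bar> < 1"
proof -
  define V where "V = deriv U"
  have U: "(U has_real_derivative V R) (at R)" and V: "(V has_real_derivative nonlin (U R)) (at R)" for R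
    using prof by (auto simp: AC_profile_def V_def)
  have top: "(U \<longlongrightarrow> 1) at_top" and bot: "(U \<longlongrightarrow> -1) at_bot" using prof by (auto simp: AC_profile_def)
  have cont: "continuous_on UNIV U"
    using U by (auto intro!: continuous_at_imp_continuous_on dest: DERIV_isCont)
  define y z where "y R = V R - (1 - (U R)\<^sup>2) / sqrt 2" and "z R = V R + (1 - (U R)\<^sup>2) / sqrt 2" for R
  have s: "x / sqrt 2 * 2 = sqrt 2 * x" for x by (simp add: field_simps)
  have ydz: "y R * z R = 0" for R
    using AC_profile_first_integral[OF prof, of R]
    by (simp add: y_def z_def V_def algebra_simps power2_eq_square)
  have y': "(y has_real_derivative (sqrt 2 * U R) * y R) (at R)" for R
  proof -
    have "(y has_real_derivative nonlin (U R) - (- (2 * (V R * U R))) / sqrt 2) (at R)"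
      unfolding y_def[abs_def] by (rule derivative_eq_intros U V refl | simp add: field_simps)+
    moreover have "nonlin (U R) - (- (2 * (V R * U R))) / sqrt 2 = (sqrt 2 * U R) * y R"
      by (simp add: y_def nonlin_def field_simps power2_eq_square power3_eq_cube)
    ultimately show ?thesis by simp
  qed
  have "(\<forall>R. y R = 0) \<or> (\<forall>R. z R = 0)"
  proof (cases "\<exists>R0. y R0 = 0")
    case True
    then obtain R0 where "y R0 = 0" by blast
    then show ?thesis
      using linear_ode_zero[of y "\<lambda>R. sqrt 2 * U R" R0, OF y' continuous_on_mult[OF continuous_on_const cont]]
      by blast
  next
    case False
    then show ?thesis using ydz by auto
  qed
  then have "\<exists>s\<in>{1,-1}. \<forall>R. V R = s / sqrt 2 * (1 - (U R)\<^sup>2)"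
  proof
    assume "\<forall>R. y R = 0" then show ?thesis by (intro bexI[of _ 1]) (auto simp: y_def)
  next
    assume "\<forall>R. z R = 0" then show ?thesis
      by (intro bexI[of _ "-1"]) (auto simp: z_def eq_neg_iff_add_eq_0)
  qed
  then obtain s where s: "s \<in> {1, -1}" "\<And>R. V R = s / sqrt 2 * (1 - (U R)\<^sup>2)" by blast
  have bd: "\<bar>U R\<bar> < 1" for R
    by (rule first_order_profile_bounded[of U "s / sqrt 2"]) (use U s(2) top bot in auto)
  then show "\<bar>U R\<bar> < 1" .
  have pos: "0 < 1 - (U R)\<^sup>2" for R using bd[of R] by (simp add: abs_square_less_1)
  have "s = 1"
  proof (rule ccontr)
    assume "s \<noteq> 1"
    then have V0: "V R \<le> 0" for R using s pos[of R] by (auto simp: mult_less_0_iff divide_less_0_iff)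
    have mono: "U x \<ge> U 0" if "x \<le> 0" for x
      by (rule DERIV_nonpos_imp_nonincreasing[OF that]) (use U V0 in blast)
    have "eventually (\<lambda>R. U R < U 0) at_bot"
      by (rule order_tendstoD(2)[OF bot]) (use bd[of 0] in auto)
    then obtain a where a: "\<And>x. x \<le> a \<Longrightarrow> U x < U 0" by (auto simp: eventually_at_bot_linorder)
    show False using a[of "min a 0"] mono[of "min a 0"] by force
  qed
  then show "deriv U R = (1 - (U R)\<^sup>2) / sqrt 2" using s(2)[of R] by (simp add: V_def)
qed

lemma AC_profile_deriv_pos: "AC_profile U \<Longrightarrow> 0 < deriv U R"
  using AC_profile_ode[of U R] by (simp add: abs_square_less_1)

lemma AC_profile_deriv_le_1:
  assumes "AC_profile U" shows "deriv U R \<le> 1"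
proof -
  have "deriv U R \<le> 1 / sqrt 2"
    unfolding AC_profile_ode(1)[OF assms] by (rule divide_right_mono) auto
  also have "\<dots> \<le> 1" by simp
  finally show ?thesis .
qed

lemma AC_profile_second_deriv_le:
  assumes prof: "AC_profile U" shows "\<bar>nonlin (U R)\<bar> \<le> 2 * deriv U R"
proof -
  have "nonlin (U R) = - (sqrt 2 * U R * deriv U R)"
    by (simp add: nonlin_def AC_profile_ode(1)[OF prof] eval_nat_numeral field_simps)
  then have "\<bar>nonlin (U R)\<bar> = sqrt 2 * \<bar>U R\<bar> * deriv U R"
    using AC_profile_deriv_pos[OF prof, of R] by (simp add: abs_mult)
  also have "\<dots> \<le> 2 * deriv U R"
  proof (rule mult_right_mono)
    have "sqrt 2 \<le> 2" by (rule real_le_lsqrt) auto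
    then show "sqrt 2 * \<bar>U R\<bar> \<le> 2"
      using mult_mono[of "sqrt 2" 2 "\<bar>U R\<bar>" 1] AC_profile_ode(2)[OF prof, of R] by simp
  qed (use AC_profile_deriv_pos[OF prof, of R] in simp)
  finally show ?thesis .
qed

text \<open>\<open>(1 - U) e\<^bsup>R / \<surd>2\<^esup>\<close> is nonincreasing as soon as \<open>U \<ge> 0\<close>.\<close>
lemma first_order_profile_tail:
  fixes U :: "real \<Rightarrow> real"
  assumes U: "\<And>R. (U has_real_derivative (1 - (U R)\<^sup>2) / sqrt 2) (at R)"
    and bd: "\<And>R. \<bar>U R\<bar> < 1" and top: "(U \<longlongrightarrow> 1) at_top"
  shows "\<exists>C\<ge>0. \<forall>R. 1 - U R \<le> C * exp (- R / sqrt 2)"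
proof -
  have pos: "0 < (1 - (U R)\<^sup>2) / sqrt 2" for R using bd[of R] by (simp add: abs_square_less_1)
  have mono: "U x \<le> U y" if "x \<le> y" for x y
    by (rule DERIV_nonneg_imp_nondecreasing[OF that]) (use U pos less_imp_le in blast)
  have "eventually (\<lambda>R. U R > 0) at_top" by (rule order_tendstoD(1)[OF top]) simp
  then obtain R0 where R0: "U R0 > 0" by (meson eventually_at_top_linorder order_refl)
  let ?\<phi> = "\<lambda>R. (1 - U R) * exp (R / sqrt 2)"
  have "1 - U R \<le> 2 * exp (R0 / sqrt 2) * exp (- R / sqrt 2)" for R
  proof (cases "R0 \<le> R")
    case True
    have "?\<phi> R \<le> ?\<phi> R0"
    proof (rule DERIV_nonpos_imp_nonincreasing[OF True])
      fix x assume "R0 \<le> x" "x \<le> R"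
      then have "0 \<le> U x" using mono[of R0 x] R0 by simp
      have "(?\<phi> has_real_derivative - (U x * (1 - U x) * exp (x / sqrt 2) / sqrt 2)) (at x)"
      proof -
        have "(?\<phi> has_real_derivative (1 - U x) * (exp (x / sqrt 2) * (1 / sqrt 2))
            + (0 - (1 - (U x)\<^sup>2) / sqrt 2) * exp (x / sqrt 2)) (at x)"
          by (intro DERIV_mult' DERIV_diff DERIV_const U) (auto intro!: derivative_eq_intros simp: field_simps)
        moreover have "(1 - U x) * (exp (x / sqrt 2) * (1 / sqrt 2))
            + (0 - (1 - (U x)\<^sup>2) / sqrt 2) * exp (x / sqrt 2)
            = exp (x / sqrt 2) / sqrt 2 * ((1 - U x) - (1 - (U x)\<^sup>2))"
          by (simp add: diff_divide_distrib algebra_simps)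
        moreover have "(1 - U x) - (1 - (U x)\<^sup>2) = - (U x * (1 - U x))"
          by (simp add: power2_eq_square algebra_simps)
        ultimately show ?thesis by (simp add: mult_ac)
      qed
      moreover have "- (U x * (1 - U x) * exp (x / sqrt 2) / sqrt 2) \<le> 0"
        using \<open>0 \<le> U x\<close> bd[of x] by simp
      ultimately show "\<exists>y. (?\<phi> has_real_derivative y) (at x) \<and> y \<le> 0" by blast
    qed
    also have "\<dots> \<le> 2 * exp (R0 / sqrt 2)"
      using bd[of R0] by (intro mult_right_mono) auto
    finally have "?\<phi> R * exp (- R / sqrt 2) \<le> 2 * exp (R0 / sqrt 2) * exp (- R / sqrt 2)"
      by (rule mult_right_mono) simp
    then show ?thesis by (simp add: mult.assoc exp_minus)
  next
    case False
    then have "R / sqrt 2 \<le> R0 / sqrt 2" by (intro divide_right_mono) auto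
    then have "1 \<le> exp (R0 / sqrt 2) * exp (- R / sqrt 2)"
      by (simp flip: exp_add)
    then show ?thesis using bd[of R] by (simp add: mult.assoc)
  qed
  then show ?thesis by (intro exI[of _ "2 * exp (R0 / sqrt 2)"]) auto
qed

lemma AC_profile_tails:
  assumes prof: "AC_profile U"
  shows "\<exists>C\<ge>0. \<forall>R. 1 - U R \<le> C * exp (- R / sqrt 2) \<and> 1 + U R \<le> C * exp (R / sqrt 2)"
proof -
  have U: "(U has_real_derivative (1 - (U R)\<^sup>2) / sqrt 2) (at R)" for R
    unfolding AC_profile_ode(1)[OF prof, symmetric] using prof by (simp add: AC_profile_def)
  have lims: "(U \<longlongrightarrow> 1) at_top" "(U \<longlongrightarrow> -1) at_bot" using prof by (auto simp: AC_profile_def)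
  obtain C1 where C1: "C1 \<ge> 0" "\<And>R. 1 - U R \<le> C1 * exp (- R / sqrt 2)"
    using first_order_profile_tail[OF U AC_profile_ode(2)[OF prof] lims(1)] by blast
  have "((\<lambda>R. - U (- R)) has_real_derivative (1 - (- U (- R))\<^sup>2) / sqrt 2) (at R)" for R
  proof -
    have "((\<lambda>R. U (- R)) has_real_derivative (1 - (U (- R))\<^sup>2) / sqrt 2 * (-1)) (at R)"
      by (rule DERIV_chain2[OF U]) (rule derivative_eq_intros refl | simp)+
    from DERIV_minus[OF this] show ?thesis by simp
  qed
  moreover have "((\<lambda>R. - U (- R)) \<longlongrightarrow> 1) at_top"
    using tendsto_minus[OF filterlim_compose[OF lims(2) filterlim_uminus_at_bot_at_top]] by simp
  ultimately obtain C2 where C2: "C2 \<ge> 0" "\<And>R. 1 - (- U (- R)) \<le> C2 * exp (- R / sqrt 2)"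
    using first_order_profile_tail[of "\<lambda>R. - U (- R)"] AC_profile_ode(2)[OF prof] by auto
  have "1 - U R \<le> (C1 + C2) * exp (- R / sqrt 2)" for R
    using C1(2)[of R] mult_nonneg_nonneg[OF C2(1) exp_ge_zero[of "- R / sqrt 2"]] unfolding distrib_right by linarith
  moreover have "1 + U R \<le> (C1 + C2) * exp (R / sqrt 2)" for R
    using C2(2)[of "- R"] mult_nonneg_nonneg[OF C1(1) exp_ge_zero[of "R / sqrt 2"]] unfolding distrib_right by simp
  ultimately show ?thesis using C1(1) C2(1) by (intro exI[of _ "C1 + C2"]) auto
qed

lemma AC_profile_deriv_decay:
  assumes prof: "AC_profile U"
  shows "\<exists>C\<ge>0. \<forall>R. \<bar>R\<bar> * deriv U R \<le> C"
proof -
  obtain C where C: "C \<ge> 0" "\<And>R. 1 - U R \<le> C * exp (- R / sqrt 2)" "\<And>R. 1 + U R \<le> C * exp (R / sqrt 2)"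
    using AC_profile_tails[OF prof] by blast
  have xe: "x * exp (- x / sqrt 2) \<le> 2" if "0 \<le> x" for x :: real
  proof -
    have "x / 2 \<le> x / sqrt 2" using that real_sqrt_le_mono[of 2 4] by (intro divide_left_mono) auto
    also have "\<dots> \<le> exp (x / sqrt 2)" using exp_ge_add_one_self[of "x / sqrt 2"] by linarith
    finally have "x / 2 * exp (- x / sqrt 2) \<le> exp (x / sqrt 2) * exp (- x / sqrt 2)"
      by (rule mult_right_mono) simp
    then show ?thesis by (simp flip: exp_add)
  qed
  have "\<bar>R\<bar> * deriv U R \<le> 4 * C" for R
  proof -
    have b: "\<bar>U R\<bar> < 1" by (rule AC_profile_ode(2)[OF prof])
    have "deriv U R \<le> (1 - (U R)\<^sup>2) / 1"
      unfolding AC_profile_ode(1)[OF prof] using b abs_square_less_1[of "U R"]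
      by (intro divide_left_mono) auto
    also have "\<dots> = (1 - U R) * (1 + U R)" by (simp add: power2_eq_square algebra_simps)
    finally have d: "deriv U R \<le> (1 - U R) * (1 + U R)" .
    have "deriv U R \<le> 2 * (C * exp (- \<bar>R\<bar> / sqrt 2))"
    proof (cases "0 \<le> R")
      case True
      have "(1 - U R) * (1 + U R) \<le> (C * exp (- R / sqrt 2)) * 2"
        using b C(2)[of R] by (intro mult_mono) auto
      then show ?thesis using d True by simp
    next
      case False
      have "(1 - U R) * (1 + U R) \<le> 2 * (C * exp (R / sqrt 2))"
        using b C(3)[of R] by (intro mult_mono) auto
      then show ?thesis using d False by simp
    qed
    then have "\<bar>R\<bar> * deriv U R \<le> \<bar>R\<bar> * (2 * (C * exp (- \<bar>R\<bar> / sqrt 2)))"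
      by (rule mult_left_mono) simp
    also have "\<dots> = 2 * C * (\<bar>R\<bar> * exp (- \<bar>R\<bar> / sqrt 2))" by simp
    also have "\<dots> \<le> 2 * C * 2" using C(1) xe[of "\<bar>R\<bar>"] by (intro mult_left_mono) auto
    finally show ?thesis by simp
  qed
  then show ?thesis using C(1) by (intro exI[of _ "4 * C"]) auto
qed

section \<open>Smooth functions and their partial derivatives\<close>

lemma iter_deriv_append: "iter_deriv (vs @ ws) f = iter_deriv vs (iter_deriv ws f)"
  by (induction vs) auto

lemma smooth_on_open: "smooth_on S f \<Longrightarrow> open S"
  by (simp add: smooth_on_def)

lemma smooth_on_iter_deriv_differentiable:
  "smooth_on S f \<Longrightarrow> set vs \<subseteq> Basis \<Longrightarrow> x \<in> S \<Longrightarrow> iter_deriv vs f differentiable (at x)"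
  by (simp add: smooth_on_def)

lemma smooth_on_differentiable: "smooth_on S f \<Longrightarrow> x \<in> S \<Longrightarrow> f differentiable (at x)"
  using smooth_on_iter_deriv_differentiable[of S f "[]"] by simp

lemma smooth_on_iter_deriv_continuous:
  "smooth_on S f \<Longrightarrow> set vs \<subseteq> Basis \<Longrightarrow> continuous_on S (iter_deriv vs f)"
  by (meson continuous_at_imp_continuous_on differentiable_imp_continuous_within
      smooth_on_iter_deriv_differentiable)

lemma smooth_on_dir_deriv:
  assumes "smooth_on S f" "b \<in> Basis" shows "smooth_on S (dir_deriv b f)"
  unfolding smooth_on_def
proof (intro conjI allI impI ballI)
  show "open S" using assms by (simp add: smooth_on_def)
  fix vs x assume "set vs \<subseteq> (Basis :: 'a set)" "x \<in> S"
  then show "iter_deriv vs (dir_deriv b f) differentiable at x"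
    using smooth_on_iter_deriv_differentiable[OF assms(1), of "vs @ [b]" x] assms(2)
    by (simp add: iter_deriv_append)
qed

lemma smooth_bounded_dir_deriv:
  assumes F: "smooth_bounded E S F" and b: "b \<in> Basis"
  shows "smooth_bounded E S (\<lambda>\<epsilon>. dir_deriv b (F \<epsilon>))"
  unfolding smooth_bounded_def
proof (intro conjI ballI allI impI)
  show "smooth_on (S \<epsilon>) (dir_deriv b (F \<epsilon>))" if "\<epsilon> \<in> E" for \<epsilon>
    using F b that by (auto simp: smooth_bounded_def intro: smooth_on_dir_deriv)
  fix vs assume "set vs \<subseteq> (Basis :: 'a set)"
  then have "set (vs @ [b]) \<subseteq> Basis" using b by auto
  then have "\<exists>B. \<forall>\<epsilon>\<in>E. \<forall>x\<in>S \<epsilon>. \<bar>iter_deriv (vs @ [b]) (F \<epsilon>) x\<bar> \<le> B"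
    using F unfolding smooth_bounded_def by blast
  then show "\<exists>B. \<forall>\<epsilon>\<in>E. \<forall>x\<in>S \<epsilon>. \<bar>iter_deriv vs (dir_deriv b (F \<epsilon>)) x\<bar> \<le> B"
    by (simp add: iter_deriv_append)
qed

lemma frechet_derivative_Basis_sum:
  assumes "f differentiable (at x)"
  shows "frechet_derivative f (at x) h = (\<Sum>b\<in>Basis. (h \<bullet> b) *\<^sub>R dir_deriv b f x)"
proof -
  have lin: "linear (frechet_derivative f (at x))"
    using assms by (rule linear_frechet_derivative)
  have "frechet_derivative f (at x) h = frechet_derivative f (at x) (\<Sum>b\<in>Basis. (h \<bullet> b) *\<^sub>R b)"
    by (simp add: euclidean_representation)
  then show ?thesis
    by (simp add: linear_sum[OF lin] linear_cmul[OF lin] dir_deriv_def)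
qed

lemma chain_rule_curve:
  fixes f :: "'a::euclidean_space \<Rightarrow> 'b::real_normed_vector"
  assumes f: "f differentiable (at (g t))" and g: "(g has_vector_derivative g') (at t)"
  shows "((\<lambda>t. f (g t)) has_vector_derivative (\<Sum>b\<in>Basis. (g' \<bullet> b) *\<^sub>R dir_deriv b f (g t))) (at t)"
proof -
  have "(f has_derivative frechet_derivative f (at (g t))) (at (g t))"
    using f by (simp add: frechet_derivative_works)
  from diff_chain_at[OF g[unfolded has_vector_derivative_def] this]
  have "((f \<circ> g) has_derivative (\<lambda>h. frechet_derivative f (at (g t)) (h *\<^sub>R g'))) (at t)"
    by (simp add: o_def)
  moreover have "frechet_derivative f (at (g t)) (h *\<^sub>R g')
      = h *\<^sub>R (\<Sum>b\<in>Basis. (g' \<bullet> b) *\<^sub>R dir_deriv b f (g t))" for h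
    using linear_cmul[OF linear_frechet_derivative[OF f]] frechet_derivative_Basis_sum[OF f] by simp
  ultimately show ?thesis by (simp add: has_vector_derivative_def o_def)
qed

lemma dir_deriv_has_vector_derivative:
  assumes "f differentiable (at (g t))" and "(g has_vector_derivative b) (at t)"
  shows "((\<lambda>t. f (g t)) has_vector_derivative dir_deriv b f (g t)) (at t)"
proof -
  have "(f has_derivative frechet_derivative f (at (g t))) (at (g t))"
    using assms(1) by (simp add: frechet_derivative_works)
  from diff_chain_at[OF assms(2)[unfolded has_vector_derivative_def] this]
  show ?thesis
    using linear_cmul[OF linear_frechet_derivative[OF assms(1)]]
    by (simp add: has_vector_derivative_def dir_deriv_def o_def)
qed

text \<open>Links the iterated derivatives in the last variable, by which \<open>dxi\<close> is defined, with iterated partial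
  derivatives, which are differentiable in all variables jointly.\<close>
lemma partial_derivatives:
  fixes f :: "'a::euclidean_space \<times> real \<Rightarrow> real"
  assumes f: "smooth_on S f" and "(x, t) \<in> S"
  shows "(deriv ^^ l) (\<lambda>t. f (x, t)) t = iter_deriv (replicate l (0, 1)) f (x, t)"
    and "((deriv ^^ l) (\<lambda>t. f (x, t)) has_real_derivative (deriv ^^ Suc l) (\<lambda>t. f (x, t)) t) (at t)"
proof -
  let ?T = "{t. (x, t) \<in> S}"
  have S: "open S" using f by (rule smooth_on_open)
  have "?T = (\<lambda>t. (x, t)) -` S" by auto
  then have T: "open ?T" using S by (simp add: open_vimage continuous_on_Pair)
  have B: "set (replicate l (0, 1)) \<subseteq> (Basis :: ('a \<times> real) set)" for l
    by (auto simp: Basis_prod_def)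
  have d: "((\<lambda>t. iter_deriv (replicate l (0, 1)) f (x, t)) has_real_derivative
      iter_deriv (replicate (Suc l) (0, 1)) f (x, t)) (at t)" if "t \<in> ?T" for l t
  proof -
    have "((\<lambda>t. (x, t)) has_vector_derivative (0, 1)) (at t)"
      by (auto intro!: derivative_eq_intros)
    from dir_deriv_has_vector_derivative[of "iter_deriv (replicate l (0, 1)) f" "\<lambda>t. (x, t)", OF _ this]
    show ?thesis
      using smooth_on_iter_deriv_differentiable[OF f B, of "(x, t)" l] that
      by (simp add: has_real_derivative_iff_has_vector_derivative)
  qed
  have eq: "\<forall>t\<in>?T. (deriv ^^ l) (\<lambda>t. f (x, t)) t = iter_deriv (replicate l (0, 1)) f (x, t)" for l
  proof (induction l)
    case 0
    then show ?case by simp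
  next
    case (Suc l)
    show ?case
    proof
      fix t assume t: "t \<in> ?T"
      have "((deriv ^^ l) (\<lambda>t. f (x, t)) has_real_derivative iter_deriv (replicate (Suc l) (0, 1)) f (x, t)) (at t)"
        by (rule has_field_derivative_transform_within_open[OF d[OF t] T t]) (use Suc in auto)
      then show "(deriv ^^ Suc l) (\<lambda>t. f (x, t)) t = iter_deriv (replicate (Suc l) (0, 1)) f (x, t)"
        by (simp add: DERIV_imp_deriv)
    qed
  qed
  have t: "t \<in> ?T" using assms by simp
  show "(deriv ^^ l) (\<lambda>t. f (x, t)) t = iter_deriv (replicate l (0, 1)) f (x, t)"
    using eq t by blast
  have "((deriv ^^ l) (\<lambda>t. f (x, t)) has_real_derivative iter_deriv (replicate (Suc l) (0, 1)) f (x, t)) (at t)"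
    by (rule has_field_derivative_transform_within_open[OF d[OF t] T t]) (use eq in auto)
  then show "((deriv ^^ l) (\<lambda>t. f (x, t)) has_real_derivative (deriv ^^ Suc l) (\<lambda>t. f (x, t)) t) (at t)"
    using eq[of "Suc l"] t by simp
qed

lemma dxi_derivatives:
  fixes u :: "real \<Rightarrow> 'a::euclidean_space \<Rightarrow> real"
  assumes "smooth_on S (\<lambda>(x, \<xi>). u \<xi> x)" and "(x, \<xi>) \<in> S"
  shows "dxi l u \<xi> x = iter_deriv (replicate l (0, 1)) (\<lambda>(x, \<xi>). u \<xi> x) (x, \<xi>)"
    and "((deriv ^^ l) (\<lambda>\<xi>. u \<xi> x) has_real_derivative (deriv ^^ Suc l) (\<lambda>\<xi>. u \<xi> x) \<xi>) (at \<xi>)"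
  using partial_derivatives[OF assms, of l] by (simp_all add: dxi_def)

lemma dxi_continuous_on:
  fixes u :: "real \<Rightarrow> 'a::euclidean_space \<Rightarrow> real"
  assumes u: "smooth_on S (\<lambda>(x, \<xi>). u \<xi> x)" and X: "\<And>x. x \<in> X \<Longrightarrow> (x, \<xi>) \<in> S"
  shows "continuous_on X (dxi l u \<xi>)"
proof -
  have "continuous_on S (iter_deriv (replicate l (0, 1)) (\<lambda>(x, \<xi>). u \<xi> x))"
    by (rule smooth_on_iter_deriv_continuous[OF u]) (auto simp: Basis_prod_def)
  then have "continuous_on X (\<lambda>x. iter_deriv (replicate l (0, 1)) (\<lambda>(x, \<xi>). u \<xi> x) (x, \<xi>))"
    by (rule continuous_on_compose2) (use X in \<open>auto intro!: continuous_intros\<close>)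
  then show ?thesis
    by (rule continuous_on_eq) (simp add: dxi_derivatives(1)[OF u X])
qed

lemma smooth_on_real_derivatives:
  fixes f :: "real \<Rightarrow> real"
  assumes f: "smooth_on UNIV f"
  shows "((deriv ^^ l) f has_real_derivative (deriv ^^ Suc l) f t) (at t)"
proof -
  have eq: "(deriv ^^ l) f = iter_deriv (replicate l 1) f" for l
  proof (induction l)
    case (Suc l)
    have "dir_deriv 1 (iter_deriv (replicate l 1) f) t = deriv (iter_deriv (replicate l 1) f) t" for t
    proof -
      have "((\<lambda>t. iter_deriv (replicate l 1) f t) has_vector_derivative
          dir_deriv 1 (iter_deriv (replicate l 1) f) t) (at t)"
        by (rule dir_deriv_has_vector_derivative[of _ "\<lambda>t. t"])
          (auto intro!: smooth_on_iter_deriv_differentiable[OF f] derivative_eq_intros)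
      then show ?thesis
        by (simp add: has_real_derivative_iff_has_vector_derivative[symmetric] DERIV_imp_deriv)
    qed
    then show ?case using Suc by auto
  qed simp
  have "iter_deriv (replicate l 1) f differentiable (at t)"
    by (rule smooth_on_iter_deriv_differentiable[OF f]) auto
  then show ?thesis
    by (simp add: eq[of l, symmetric] real_differentiable_def DERIV_imp_deriv) (metis DERIV_imp_deriv)
qed

lemma higher_deriv_cong_open:
  assumes "open S" and "\<And>x. x \<in> S \<Longrightarrow> f x = g x" and "x \<in> S"
  shows "(deriv ^^ l) f x = (deriv ^^ l) g x"
  using assms(3)
proof (induction l arbitrary: x)
  case (Suc l)
  have "deriv ((deriv ^^ l) f) x = deriv ((deriv ^^ l) g) x"
    by (rule deriv_cong_ev) (use Suc assms(1) in \<open>auto simp: eventually_nhds\<close>)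
  then show ?case by simp
qed (use assms in simp)

lemma higher_deriv_const: "(deriv ^^ l) (\<lambda>_. c :: real) x = (if l = 0 then c else 0)"
proof -
  have "(deriv ^^ l) (\<lambda>_. c) = (\<lambda>_. if l = 0 then c else 0)"
    by (induction l) auto
  then show ?thesis by simp
qed

section \<open>Building blocks of the expansion\<close>

text \<open>All derivatives of the cut-off vanish outside \<open>[0, 1]\<close>, so compactness bounds them.\<close>
lemma jet_cutoff:
  assumes \<zeta>: "cutoff \<zeta>"
  shows "jet (\<lambda>_. 1) (\<lambda>_. UNIV) m (\<lambda>_. 1) (\<lambda>_. \<zeta>)"
proof (rule jet_of_derivatives)
  have sm: "smooth_on UNIV \<zeta>" and z: "\<And>s. s < 0 \<Longrightarrow> \<zeta> s = 0" "\<And>s. s > 1 \<Longrightarrow> \<zeta> s = 1"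
    using \<zeta> by (auto simp: cutoff_def)
  note d = smooth_on_real_derivatives[OF sm]
  show "((deriv ^^ l) \<zeta> has_real_derivative (deriv ^^ Suc l) \<zeta> t) (at t)" for l t by (rule d)
  have "\<exists>C. \<forall>t. \<bar>(deriv ^^ l) \<zeta> t\<bar> \<le> C" for l
  proof -
    have "continuous_on {0..1} ((deriv ^^ l) \<zeta>)"
      by (meson DERIV_isCont d continuous_at_imp_continuous_on)
    then have "bounded ((deriv ^^ l) \<zeta> ` {0..1})"
      by (intro compact_imp_bounded compact_continuous_image) auto
    then obtain C where C: "\<forall>t\<in>{0..1}. \<bar>(deriv ^^ l) \<zeta> t\<bar> \<le> C"
      unfolding bounded_iff by auto
    have "\<bar>(deriv ^^ l) \<zeta> t\<bar> \<le> max C 1" for t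
    proof -
      consider "t < 0" | "t \<in> {0..1}" | "t > 1" by force
      then show ?thesis
      proof cases
        case 1
        then have "(deriv ^^ l) \<zeta> t = (deriv ^^ l) (\<lambda>_. 0) t"
          by (intro higher_deriv_cong_open[of "{..<0}"]) (auto simp: z)
        then show ?thesis by (simp add: higher_deriv_const le_max_iff_disj)
      next
        case 2
        then show ?thesis using C by force
      next
        case 3
        then have "(deriv ^^ l) \<zeta> t = (deriv ^^ l) (\<lambda>_. 1) t"
          by (intro higher_deriv_cong_open[of "{1<..}"]) (auto simp: z)
        then show ?thesis by (simp add: higher_deriv_const le_max_iff_disj)
      qed
    qed
    then show ?thesis by blast
  qed
  then show "\<exists>C. \<forall>i. \<forall>t\<in>UNIV. \<bar>(deriv ^^ l) \<zeta> t\<bar> \<le> C * 1" for l by simp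
qed auto

text \<open>The first-order equation makes the derivative a polynomial in \<open>U\<close>, so the bounds propagate by induction.\<close>
lemma jet_profile:
  assumes prof: "AC_profile U"
  shows "jet (\<lambda>_::'i. 1) (\<lambda>_. UNIV) m (\<lambda>_. 1) (\<lambda>_. U)"
proof (induction m)
  have base: "jet (\<lambda>_::'i. 1) (\<lambda>_. UNIV) 0 (\<lambda>_. 1) (\<lambda>_. U)"
    using AC_profile_ode(2)[OF prof] by (intro jet_0I[of 1]) (auto intro: less_imp_le)
  case 0
  show ?case by (rule base)
next
  case (Suc m)
  have "jet (\<lambda>_::'i. 1) (\<lambda>_. UNIV) m (\<lambda>_. 1) (\<lambda>_ R. 1 / sqrt 2 - 1 / sqrt 2 * (U R * U R))"
  proof (rule jet_minus)
    have "jet (\<lambda>_::'i. 1) (\<lambda>_. UNIV) m (\<lambda>_. 1 * 1) (\<lambda>_ R. U R * U R)"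
      by (rule jet_mult[OF _ _ _ _ Suc.IH Suc.IH]) auto
    then have "jet (\<lambda>_::'i. 1) (\<lambda>_. UNIV) m (\<lambda>_. \<bar>1 / sqrt 2\<bar> * 1) (\<lambda>_ R. 1 / sqrt 2 * (U R * U R))"
      by (intro jet_cmult) auto
    then show "jet (\<lambda>_::'i. 1) (\<lambda>_. UNIV) m (\<lambda>_. 1) (\<lambda>_ R. 1 / sqrt 2 * (U R * U R))"
      by (rule jet_weight_mono[where B=1, rotated 4]) auto
  qed (auto intro!: jet_const[where B=1])
  moreover have "deriv U = (\<lambda>R. 1 / sqrt 2 - 1 / sqrt 2 * (U R * U R))"
    by (auto simp: AC_profile_ode(1)[OF prof] power2_eq_square diff_divide_distrib)
  ultimately have "jet (\<lambda>_::'i. 1) (\<lambda>_. UNIV) m (\<lambda>_. 1) (\<lambda>_. deriv U)" by simp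
  moreover have "jet (\<lambda>_::'i. 1) (\<lambda>_. UNIV) 0 (\<lambda>_. 1) (\<lambda>_. U)" using Suc.IH by (rule jet_le) simp
  ultimately show ?case using prof by (subst jet_Suc_iff) (auto simp: AC_profile_def)
qed

text \<open>The derivative of \<open>y\<close> is \<open>a y\<close>, again a bounded multiple of \<open>y\<close>: a small solution has small derivatives.\<close>
lemma jet_linear_ode:
  assumes opn: "\<And>i. open (T i)" and w: "\<And>i. T i \<noteq> {} \<Longrightarrow> 0 \<le> w i"
    and a: "\<And>m. jet (\<lambda>_. 1) T m (\<lambda>_. 1) a"
    and y: "\<And>i t. t \<in> T i \<Longrightarrow> (y i has_real_derivative a i t * y i t) (at t)"
    and b: "jet (\<lambda>_. 1) T 0 w y"
  shows "jet (\<lambda>_. 1) T m w y"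
proof (induction m)
  case 0
  show ?case by (rule b)
next
  case (Suc m)
  have "jet (\<lambda>_. 1) T m (\<lambda>i. 1 * w i) (\<lambda>i t. a i t * y i t)"
    by (rule jet_mult[OF opn _ _ w a Suc.IH]) auto
  then show ?case
    by (intro jet_SucI[OF opn _ b y]) auto
qed

text \<open>The profile differs from its limits by \<open>O(\<epsilon>)\<close> from the stretched distance \<open>ln\<^sup>2 \<epsilon> / 2\<close> on.\<close>
lemma exp_log_square_le:
  assumes "0 < \<epsilon>" shows "exp (- ((ln \<epsilon>)\<^sup>2 / 2) / sqrt 2) \<le> exp 1 * \<epsilon>"
proof -
  let ?L = "- ln \<epsilon>"
  have "sqrt 2 \<le> 3/2" by (rule real_le_lsqrt) (auto simp: power2_eq_square)
  then have "?L\<^sup>2 / 3 \<le> ?L\<^sup>2 / (2 * sqrt 2)" by (intro divide_left_mono) auto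
  moreover have "?L \<le> ?L\<^sup>2 / 3 + 1"
    using zero_le_power2[of "?L - 3/2"] by (simp add: power2_eq_square field_simps)
  ultimately have "- (?L\<^sup>2 / (2 * sqrt 2)) \<le> 1 + ln \<epsilon>" by linarith
  then have "exp (- (?L\<^sup>2 / (2 * sqrt 2))) \<le> exp (1 + ln \<epsilon>)" by simp
  then show ?thesis using assms by (simp add: exp_add)
qed

text \<open>
  The cut-offs act at stretched distances above \<open>ln\<^sup>2 \<epsilon>\<close>; the factor \<open>1/2\<close> makes the tail overlap the set
  where they vanish.
\<close>
definition tail_set :: "real \<Rightarrow> real set" where
  "tail_set \<epsilon> = (if 0 < \<epsilon> then {(ln \<epsilon>)\<^sup>2 / 2<..} else {})"

text \<open>Both functions solve linear first-order equations, so their smallness passes to all derivatives.\<close>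
lemma jet_profile_tail:
  assumes prof: "AC_profile U"
  shows "jet (\<lambda>_. 1) tail_set m (\<lambda>\<epsilon>. \<epsilon>) (\<lambda>_ R. 1 - U R)"
    and "jet (\<lambda>_. 1) tail_set m (\<lambda>\<epsilon>. \<epsilon>) (\<lambda>_ R. 1 + U (- R))"
proof -
  have opn: "open (tail_set \<epsilon>)" for \<epsilon> by (simp add: tail_set_def)
  have eps: "0 < \<epsilon>" if "tail_set \<epsilon> \<noteq> {}" for \<epsilon> using that by (auto simp: tail_set_def split: if_splits)
  have w0: "0 \<le> \<epsilon>" if "tail_set \<epsilon> \<noteq> {}" for \<epsilon> using eps[OF that] by simp
  obtain C where C: "C \<ge> 0" "\<And>R. 1 - U R \<le> C * exp (- R / sqrt 2)" "\<And>R. 1 + U R \<le> C * exp (R / sqrt 2)"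
    using AC_profile_tails[OF prof] by blast
  have small: "C * exp (- R / sqrt 2) \<le> C * exp 1 * \<epsilon>" if "R \<in> tail_set \<epsilon>" for R \<epsilon>
  proof -
    have e: "0 < \<epsilon>" "(ln \<epsilon>)\<^sup>2 / 2 < R" using that by (auto simp: tail_set_def split: if_splits)
    then have "- R / sqrt 2 \<le> - ((ln \<epsilon>)\<^sup>2 / 2) / sqrt 2" by (intro divide_right_mono) auto
    then have "exp (- R / sqrt 2) \<le> exp 1 * \<epsilon>"
      using exp_log_square_le[OF e(1)] by (meson exp_le_cancel_iff order_trans)
    then have "C * exp (- R / sqrt 2) \<le> C * (exp 1 * \<epsilon>)" using C(1) by (rule mult_left_mono)
    then show ?thesis by (simp add: mult.assoc)
  qed
  have bd: "\<bar>U R\<bar> < 1" for R by (rule AC_profile_ode(2)[OF prof])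
  have U': "(U has_real_derivative (1 - (U R)\<^sup>2) / sqrt 2) (at R)" for R
    unfolding AC_profile_ode(1)[OF prof, symmetric] using prof by (simp add: AC_profile_def)
  have Um': "((\<lambda>R. U (- R)) has_real_derivative (1 - (U (- R))\<^sup>2) / sqrt 2 * (-1)) (at R)" for R
    by (rule DERIV_chain2[OF U']) (auto intro!: derivative_eq_intros)
  have jU: "jet (\<lambda>_. 1) tail_set m (\<lambda>_. 1) (\<lambda>_. U)" for m
  proof -
    have "jet (\<lambda>_. 1) (\<lambda>_::real. UNIV) m (\<lambda>_. 1) (\<lambda>_. U)" by (rule jet_profile[OF prof])
    then show ?thesis by (rule jet_subset[rotated]) simp
  qed
  have jUm: "jet (\<lambda>_. 1) tail_set m (\<lambda>_. 1) (\<lambda>_ R. U (- R))" for m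
  proof -
    have dm: "deriv uminus = (\<lambda>_::real. -1)"
      by (rule ext) (auto intro!: DERIV_imp_deriv derivative_eq_intros)
    have "jet (\<lambda>_. 1) tail_set m (\<lambda>i. (\<lambda>_::real. 1) (id i)) (\<lambda>i t. (\<lambda>_::real. U) (id i) (uminus t))"
    proof (rule jet_compose[where S="\<lambda>_. UNIV" and g="\<lambda>_. uminus" and w="\<lambda>_. 1" and F="\<lambda>_. U"])
      show "jet (\<lambda>_. 1) (\<lambda>_. UNIV) m (\<lambda>_::real. 1) (\<lambda>_. U)" by (rule jet_profile[OF prof])
      show "jet (\<lambda>_. 1) tail_set m (\<lambda>_. 1 / 1) (\<lambda>_. deriv uminus)"
        unfolding dm by (rule jet_const[where B=1]) (auto simp: opn)
    qed (auto simp: opn dm intro!: derivative_eq_intros)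
    then show ?thesis by simp
  qed
  have c1: "jet (\<lambda>_. 1) tail_set m (\<lambda>_. 1) (\<lambda>_ R. c)" for m and c :: real
    by (rule jet_const[where B="\<bar>c\<bar>"]) (auto simp: opn)
  have sc: "jet (\<lambda>_. 1) tail_set m (\<lambda>_. 1) (\<lambda>_ R. - 1 / sqrt 2 * (1 + V R))"
    if "jet (\<lambda>_. 1) tail_set m (\<lambda>_. 1) (\<lambda>_. V)" for V m
  proof -
    have "jet (\<lambda>_. 1) tail_set m (\<lambda>_. 1 * 1) (\<lambda>_ R. - 1 / sqrt 2 * (1 + V R))"
      by (rule jet_mult[OF opn]) (auto intro!: c1 that jet_add[OF opn])
    then show ?thesis by simp
  qed
  show "jet (\<lambda>_. 1) tail_set m (\<lambda>\<epsilon>. \<epsilon>) (\<lambda>_ R. 1 - U R)"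
  proof (rule jet_linear_ode[OF opn w0 sc[OF jU]])
    show "((\<lambda>R. 1 - U R) has_real_derivative - 1 / sqrt 2 * (1 + U R) * (1 - U R)) (at R)" for R
      using DERIV_diff[OF DERIV_const[of 1] U'[of R]] by (simp add: power2_eq_square algebra_simps)
    show "jet (\<lambda>_. 1) tail_set 0 (\<lambda>\<epsilon>. \<epsilon>) (\<lambda>_ R. 1 - U R)"
    proof (rule jet_0I[of "C * exp 1"])
      fix \<epsilon> R assume "R \<in> tail_set \<epsilon>"
      then show "\<bar>1 - U R\<bar> \<le> C * exp 1 * \<epsilon>" using small[of R \<epsilon>] C(2)[of R] bd[of R] by linarith
    qed (use C in simp)
  qed
  have jneg: "jet (\<lambda>_. 1) tail_set m (\<lambda>_. 1) (\<lambda>_ R. - U (- R))" for m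
    using jet_minus[OF opn _ _ c1[of m 0] jUm[of m]] by simp
  show "jet (\<lambda>_. 1) tail_set m (\<lambda>\<epsilon>. \<epsilon>) (\<lambda>_ R. 1 + U (- R))"
  proof (rule jet_linear_ode[OF opn w0 sc[OF jneg]])
    show "((\<lambda>R. 1 + U (- R)) has_real_derivative - 1 / sqrt 2 * (1 + - U (- R)) * (1 + U (- R))) (at R)" for R
    proof -
      have "- 1 / sqrt 2 * (1 + - U (- R)) * (1 + U (- R)) = 0 + (1 - (U (- R))\<^sup>2) / sqrt 2 * (-1)"
        by (simp add: field_simps power2_eq_square)
      then show ?thesis using DERIV_add[OF DERIV_const[of 1] Um'[of R]] by (simp only:)
    qed
    show "jet (\<lambda>_. 1) tail_set 0 (\<lambda>\<epsilon>. \<epsilon>) (\<lambda>_ R. 1 + U (- R))"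
    proof (rule jet_0I[of "C * exp 1"])
      fix \<epsilon> R assume "R \<in> tail_set \<epsilon>"
      then show "\<bar>1 + U (- R)\<bar> \<le> C * exp 1 * \<epsilon>" using small[of R \<epsilon>] C(3)[of "-R"] bd[of "-R"] by simp
    qed (use C in simp)
  qed
qed

text \<open>
  The chain rule expresses the derivative by functions \<open>dir_deriv b (F \<epsilon>)\<close> of the same kind as \<open>F\<close>, which
  closes the induction.
\<close>

lemma jet_compose_smooth:
  fixes F :: "real \<Rightarrow> 'a::euclidean_space \<Rightarrow> real"
  assumes opn: "\<And>i. open (T i)" and \<kappa>: "\<And>i. T i \<noteq> {} \<Longrightarrow> 0 < \<kappa> i"
    and F: "smooth_bounded E S F" and e: "\<And>i. T i \<noteq> {} \<Longrightarrow> e i \<in> E"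
    and S: "\<And>i t. t \<in> T i \<Longrightarrow> g i t \<in> S (e i)"
    and g: "\<And>i t. t \<in> T i \<Longrightarrow> (g i has_vector_derivative g' i t) (at t)"
    and g': "\<And>b. b \<in> Basis \<Longrightarrow> jet \<kappa> T m (\<lambda>i. 1 / \<kappa> i) (\<lambda>i t. g' i t \<bullet> b)"
  shows "jet \<kappa> T m (\<lambda>_. 1) (\<lambda>i t. F (e i) (g i t))"
  using F g'
proof (induction m arbitrary: F)
  have base: "jet \<kappa> T 0 (\<lambda>_. 1) (\<lambda>i t. F (e i) (g i t))" if F: "smooth_bounded E S F" for F
  proof -
    have "\<exists>B. \<forall>\<epsilon>\<in>E. \<forall>x\<in>S \<epsilon>. \<bar>iter_deriv [] (F \<epsilon>) x\<bar> \<le> B"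
      using F unfolding smooth_bounded_def by (metis empty_subsetI list.set(1))
    then obtain B where B: "\<And>\<epsilon> x. \<epsilon> \<in> E \<Longrightarrow> x \<in> S \<epsilon> \<Longrightarrow> \<bar>F \<epsilon> x\<bar> \<le> B" by auto
    have "\<bar>F (e i) (g i t)\<bar> \<le> \<bar>B\<bar> * 1" if "t \<in> T i" for i t
      using B[OF e S[OF that]] that by force
    then show ?thesis by (intro jet_0I[of "\<bar>B\<bar>"]) auto
  qed
  {
    case (0 F)
    then show ?case by (intro base)
  next
    case (Suc m F)
    show ?case
    proof (rule jet_SucI[OF opn \<kappa> base[OF Suc.prems(1)]])
      fix i t assume t: "t \<in> T i"
      have "F (e i) differentiable (at (g i t))"
        using Suc.prems(1) e[of i] S[OF t] t unfolding smooth_bounded_def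
        by (intro smooth_on_differentiable[of "S (e i)"]) blast+
      from chain_rule_curve[OF this g[OF t]]
      show "((\<lambda>t. F (e i) (g i t)) has_real_derivative
          (\<Sum>b\<in>Basis. (g' i t \<bullet> b) * dir_deriv b (F (e i)) (g i t))) (at t)"
        by (simp add: has_real_derivative_iff_has_vector_derivative)
    next
      have nn: "0 \<le> 1 / \<kappa> i" if "T i \<noteq> {}" for i using \<kappa>[OF that] by simp
      show "jet \<kappa> T m (\<lambda>i. 1 / \<kappa> i) (\<lambda>i t. \<Sum>b\<in>Basis. (g' i t \<bullet> b) * dir_deriv b (F (e i)) (g i t))"
      proof (rule jet_sum[OF opn \<kappa>])
        fix b :: 'a assume b: "b \<in> Basis"
        have "jet \<kappa> T m (\<lambda>_. 1) (\<lambda>i t. dir_deriv b (F (e i)) (g i t))"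
        proof (rule Suc.IH)
          show "smooth_bounded E S (\<lambda>\<epsilon>. dir_deriv b (F \<epsilon>))"
            by (rule smooth_bounded_dir_deriv[OF Suc.prems(1) b])
          show "jet \<kappa> T m (\<lambda>i. 1 / \<kappa> i) (\<lambda>i t. g' i t \<bullet> b)" if "b \<in> Basis" for b
            by (rule jet_Suc_imp[OF Suc.prems(2)[OF that]])
        qed
        from jet_mult[OF opn \<kappa> nn _ jet_Suc_imp[OF Suc.prems(2)[OF b]] this]
        show "jet \<kappa> T m (\<lambda>i. 1 / \<kappa> i) (\<lambda>i t. (g' i t \<bullet> b) * dir_deriv b (F (e i)) (g i t))"
          by simp
      qed (use nn in auto)
    qed
  }
qed

section \<open>Pointwise expansion of the droplet and its parameter derivatives\<close>

lemma deriv_diff_const: "deriv (\<lambda>t. f t - c) = deriv (f :: real \<Rightarrow> real)"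
proof -
  have "((\<lambda>t. f t - c) has_real_derivative d) (at t) \<longleftrightarrow> (f has_real_derivative d) (at t)" for d t
    using DERIV_diff[of "\<lambda>t. f t - c" d t UNIV "\<lambda>_. - c" 0] DERIV_diff[of f d t UNIV "\<lambda>_. c" 0] by auto
  then show ?thesis by (auto simp: deriv_def)
qed

lemma higher_deriv_diff_const:
  "1 \<le> l \<Longrightarrow> (deriv ^^ l) (\<lambda>t. f t - c) = (deriv ^^ l) (f :: real \<Rightarrow> real)"
  by (cases l) (simp_all add: funpow_Suc_right deriv_diff_const del: funpow.simps(2))

text \<open>
  The index is a pair of the scale \<open>\<epsilon>\<close> and a further label, such as the point \<open>x\<close>. The bound \<open>\<epsilon> \<le> 1 / e\<close> makes
  \<open>ln\<^sup>2 \<epsilon> \<ge> 1\<close>, so that cut-offs at distance \<open>\<epsilon> ln\<^sup>2 \<epsilon>\<close> vary no faster than on the scale \<open>\<epsilon>\<close>.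
\<close>
locale scale_family =
  fixes T :: "real \<times> 'x \<Rightarrow> real set"
  assumes open_T: "open (T i)"
    and eps: "T i \<noteq> {} \<Longrightarrow> 0 < fst i" "T i \<noteq> {} \<Longrightarrow> fst i \<le> exp (- 1)"
begin

lemma ln_eps: "T i \<noteq> {} \<Longrightarrow> ln (fst i) \<le> - 1"
  using eps[of i] ln_le_cancel_iff[of "fst i" "exp (- 1)"] by simp

lemma eps_lt_1: "T i \<noteq> {} \<Longrightarrow> fst i < 1"
  using ln_eps[of i] eps(1)[of i] ln_less_zero_iff[of "fst i"] by linarith

lemma log_sq_ge_1: "T i \<noteq> {} \<Longrightarrow> 1 \<le> (ln (fst i))\<^sup>2"
  using ln_eps[of i] abs_le_square_iff[of 1 "ln (fst i)"] by simp

text \<open>Families that are \<open>O(1)\<close>, respectively \<open>O(\<epsilon>)\<close>, each derivative costing a factor \<open>1 / \<epsilon>\<close>.\<close>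

definition bdd :: "(real \<times> 'x \<Rightarrow> real \<Rightarrow> real) \<Rightarrow> bool" where
  "bdd f \<longleftrightarrow> (\<forall>m. jet fst T m (\<lambda>_. 1) f)"

definition sml :: "(real \<times> 'x \<Rightarrow> real \<Rightarrow> real) \<Rightarrow> bool" where
  "sml f \<longleftrightarrow> (\<forall>m. jet fst T m fst f)"

text \<open>Families whose derivative is \<open>O(1)\<close>, respectively \<open>O(1 / \<epsilon>)\<close>, in this sense.\<close>

definition coord :: "(real \<times> 'x \<Rightarrow> real \<Rightarrow> real) \<Rightarrow> bool" where
  "coord f \<longleftrightarrow> (\<forall>i. \<forall>t\<in>T i. (f i has_real_derivative deriv (f i) t) (at t)) \<and> bdd (\<lambda>i. deriv (f i))"

definition stretched :: "(real \<times> 'x \<Rightarrow> real \<Rightarrow> real) \<Rightarrow> bool" where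
  "stretched f \<longleftrightarrow> (\<forall>i. \<forall>t\<in>T i. (f i has_real_derivative deriv (f i) t) (at t)) \<and>
     (\<forall>m. jet fst T m (\<lambda>i. 1 / fst i) (\<lambda>i. deriv (f i)))"

lemma eps_nonneg: "T i \<noteq> {} \<Longrightarrow> 0 \<le> fst i"
  using eps(1)[of i] by simp

lemma bddD: "bdd f \<Longrightarrow> jet fst T m (\<lambda>_. 1) f"
  by (simp add: bdd_def)

lemma smlD: "sml f \<Longrightarrow> jet fst T m fst f"
  by (simp add: sml_def)

lemma bddI: "(\<And>m. jet fst T m (\<lambda>_. 1) f) \<Longrightarrow> bdd f"
  by (simp add: bdd_def)

lemma smlI: "(\<And>m. jet fst T m fst f) \<Longrightarrow> sml f"
  by (simp add: sml_def)

lemma bdd_cong: "bdd f \<Longrightarrow> (\<And>i t. t \<in> T i \<Longrightarrow> f i t = g i t) \<Longrightarrow> bdd g"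
  by (rule bddI) (rule jet_cong[OF open_T eps(1) bddD])

lemma sml_cong: "sml f \<Longrightarrow> (\<And>i t. t \<in> T i \<Longrightarrow> f i t = g i t) \<Longrightarrow> sml g"
  by (rule smlI) (rule jet_cong[OF open_T eps(1) smlD])

lemma bdd_const:
  assumes "\<And>i. T i \<noteq> {} \<Longrightarrow> \<bar>c i\<bar> \<le> B" shows "bdd (\<lambda>i _. c i)"
  by (rule bddI, rule jet_const[OF open_T eps(1), where B=B]) (simp_all add: assms)

lemma bdd_add: "bdd f \<Longrightarrow> bdd g \<Longrightarrow> bdd (\<lambda>i t. f i t + g i t)"
  by (rule bddI) (rule jet_add[OF open_T eps(1) bddD bddD])

lemma bdd_minus: "bdd f \<Longrightarrow> bdd g \<Longrightarrow> bdd (\<lambda>i t. f i t - g i t)"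
  by (rule bddI) (rule jet_minus[OF open_T eps(1) zero_le_one bddD bddD])

lemma bdd_mult:
  assumes "bdd f" "bdd g" shows "bdd (\<lambda>i t. f i t * g i t)"
  by (rule bddI)
    (rule jet_mult[OF open_T eps(1) zero_le_one zero_le_one bddD[OF assms(1)] bddD[OF assms(2)],
        unfolded mult_1_left])

lemma bdd_sum: "finite J \<Longrightarrow> (\<And>j. j \<in> J \<Longrightarrow> bdd (f j)) \<Longrightarrow> bdd (\<lambda>i t. \<Sum>j\<in>J. f j i t)"
  by (rule bddI) (rule jet_sum[OF open_T eps(1) zero_le_one _ bddD])

lemma bdd_eps_power: "bdd (\<lambda>i _. fst i ^ j)"
proof (rule bdd_const[of _ 1])
  fix i assume "T i \<noteq> {}"
  then show "\<bar>fst i ^ j\<bar> \<le> 1"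
    using eps_lt_1[of i] eps(1)[of i] by (simp add: power_le_one)
qed

lemma sml_add: "sml f \<Longrightarrow> sml g \<Longrightarrow> sml (\<lambda>i t. f i t + g i t)"
  by (rule smlI) (rule jet_add[OF open_T eps(1) smlD smlD])

lemma sml_minus: "sml f \<Longrightarrow> sml g \<Longrightarrow> sml (\<lambda>i t. f i t - g i t)"
  by (rule smlI) (rule jet_minus[OF open_T eps(1) eps_nonneg smlD smlD])

lemma bdd_mult_sml:
  assumes "bdd f" "sml g" shows "sml (\<lambda>i t. f i t * g i t)"
  by (rule smlI)
    (rule jet_mult[OF open_T eps(1) zero_le_one eps_nonneg bddD[OF assms(1)] smlD[OF assms(2)],
        unfolded mult_1_left])

lemma sml_sum: "finite J \<Longrightarrow> (\<And>j. j \<in> J \<Longrightarrow> sml (f j)) \<Longrightarrow> sml (\<lambda>i t. \<Sum>j\<in>J. f j i t)"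
  by (rule smlI) (rule jet_sum[OF open_T eps(1) eps_nonneg _ smlD])

lemma sml_eps: "sml (\<lambda>i _. fst i)"
  by (rule smlI, rule jet_const[OF open_T eps(1), where B=1]) (simp_all add: eps_nonneg)

lemma sml_eps_mult: "bdd f \<Longrightarrow> sml (\<lambda>i t. fst i * f i t)"
  using bdd_mult_sml[OF _ sml_eps, of f] by (simp add: mult.commute)

lemma sml_eps_power_mult:
  assumes "bdd f" "1 \<le> j" shows "sml (\<lambda>i t. fst i ^ j * f i t)"
proof -
  have "sml (\<lambda>i t. fst i * (fst i ^ (j - 1) * f i t))"
    by (intro sml_eps_mult bdd_mult bdd_eps_power assms)
  then show ?thesis using assms(2) by (cases j) (simp_all add: mult.assoc)
qed

lemma coordD:
  assumes "coord f"
  shows "t \<in> T i \<Longrightarrow> (f i has_real_derivative deriv (f i) t) (at t)" and "bdd (\<lambda>i. deriv (f i))"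
  using assms unfolding coord_def by blast+

lemma stretchedD:
  assumes "stretched f"
  shows "t \<in> T i \<Longrightarrow> (f i has_real_derivative deriv (f i) t) (at t)"
    and "jet fst T m (\<lambda>i. 1 / fst i) (\<lambda>i. deriv (f i))"
  using assms unfolding stretched_def by blast+

lemma coordI:
  assumes b: "\<And>l. \<exists>C. \<forall>i. \<forall>t\<in>T i. \<bar>(deriv ^^ l) (f i) t\<bar> \<le> C"
    and d: "\<And>l i t. t \<in> T i \<Longrightarrow> ((deriv ^^ l) (f i) has_real_derivative (deriv ^^ Suc l) (f i) t) (at t)"
  shows "coord f"
proof -
  have "jet fst T m (\<lambda>_. 1) (\<lambda>i. deriv (f i))" for m
  proof (rule jet_of_derivatives[OF open_T eps(1) less_imp_le[OF eps_lt_1]])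
    show "\<exists>C. \<forall>i. \<forall>t\<in>T i. \<bar>(deriv ^^ l) (deriv (f i)) t\<bar> \<le> C * 1" for l
      using b[of "Suc l"] by (simp add: funpow_Suc_right del: funpow.simps(2))
    show "((deriv ^^ l) (deriv (f i)) has_real_derivative (deriv ^^ Suc l) (deriv (f i)) t) (at t)"
      if "t \<in> T i" for l i t
      using d[OF that, of "Suc l"] by (simp add: funpow_Suc_right del: funpow.simps(2))
  qed auto
  then show ?thesis using d[of _ _ 0] by (simp add: coord_def bdd_def)
qed

lemma coord_id: "coord (\<lambda>_ t. t)"
  unfolding coord_def using bdd_const[of "\<lambda>_. 1" 1] by simp

lemma coord_diff:
  assumes "coord f" "coord g" shows "coord (\<lambda>i t. f i t - g i t)"
proof -
  have d: "((\<lambda>t. f i t - g i t) has_real_derivative deriv (f i) t - deriv (g i) t) (at t)" if "t \<in> T i" for i t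
    by (intro DERIV_diff coordD(1) assms that)
  then have e: "deriv (\<lambda>t. f i t - g i t) t = deriv (f i) t - deriv (g i) t" if "t \<in> T i" for i t
    using that DERIV_imp_deriv by blast
  have "bdd (\<lambda>i t. deriv (f i) t - deriv (g i) t)"
    by (rule bdd_minus) (use assms in \<open>auto simp: coord_def\<close>)
  then have "bdd (\<lambda>i. deriv (\<lambda>t. f i t - g i t))"
    by (rule bdd_cong) (simp add: e)
  then show ?thesis using d e by (simp add: coord_def)
qed

lemma stretched_affine:
  assumes f: "coord f" and c: "\<And>i. T i \<noteq> {} \<Longrightarrow> \<bar>c i\<bar> \<le> B / fst i"
  shows "stretched (\<lambda>i t. c i * f i t + d i)"
proof -
  have D: "((\<lambda>t. c i * f i t + d i) has_real_derivative c i * deriv (f i) t) (at t)" if "t \<in> T i" for i t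
    using coordD(1)[OF f that] by (auto intro!: derivative_eq_intros)
  then have e: "deriv (\<lambda>t. c i * f i t + d i) t = c i * deriv (f i) t" if "t \<in> T i" for i t
    using that DERIV_imp_deriv by blast
  have nn: "0 \<le> 1 / fst i" if "T i \<noteq> {}" for i using eps_nonneg[OF that] by simp
  have "jet fst T m (\<lambda>i. 1 / fst i * 1) (\<lambda>i t. c i * deriv (f i) t)" for m
  proof (rule jet_mult[OF open_T eps(1) nn])
    show "jet fst T m (\<lambda>i. 1 / fst i) (\<lambda>i _. c i)"
      by (rule jet_const[OF open_T eps(1) _ nn, where B=B]) (use c in auto)
    show "jet fst T m (\<lambda>_. 1) (\<lambda>i. deriv (f i))" by (rule bddD[OF coordD(2)[OF f]])
  qed auto
  then have jt: "jet fst T m (\<lambda>i. 1 / fst i) (\<lambda>i t. c i * deriv (f i) t)" for m by simp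
  have "jet fst T m (\<lambda>i. 1 / fst i) (\<lambda>i. deriv (\<lambda>t. c i * f i t + d i))" for m
    by (rule jet_cong[OF open_T eps(1) jt]) (simp_all add: e)
  then show ?thesis using D e by (simp add: stretched_def)
qed

lemma stretched_coord:
  assumes "coord f" shows "stretched f"
proof -
  have "stretched (\<lambda>i t. (\<lambda>_. 1) i * f i t + (\<lambda>_. 0) i)"
  proof (rule stretched_affine[OF assms, of _ 1])
    fix i assume "T i \<noteq> {}"
    then show "\<bar>1\<bar> \<le> 1 / fst i" using eps_lt_1[of i] eps(1)[of i] by (simp add: field_simps)
  qed
  then show ?thesis by simp
qed

lemma stretched_scaled:
  assumes "coord f" shows "stretched (\<lambda>i t. f i t / fst i)"
  using stretched_affine[OF assms, of "\<lambda>i. 1 / fst i" 1 "\<lambda>_. 0"] eps_nonneg by simp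

lemma bdd_cutoff_compose:
  assumes "cutoff \<zeta>" and g: "stretched g"
  shows "bdd (\<lambda>i t. \<zeta> (g i t))"
proof -
  have "jet fst T m (\<lambda>_. 1) (\<lambda>i t. \<zeta> (g i t))" for m
    by (rule jet_compose[OF open_T eps(1), where g=g and e="\<lambda>_. ()" and S="\<lambda>_. UNIV"
          and w="\<lambda>_. 1" and F="\<lambda>_. \<zeta>"])
      (use g jet_cutoff[OF assms(1)] in \<open>auto simp: stretched_def\<close>)
  then show ?thesis by (simp add: bdd_def)
qed

lemma bdd_compose_smooth3:
  assumes F: "smooth_bounded E S F" and E: "\<And>i. T i \<noteq> {} \<Longrightarrow> fst i \<in> E"
    and g: "stretched g1" "stretched g2" "stretched g3"
    and S: "\<And>i t. t \<in> T i \<Longrightarrow> (g1 i t, g2 i t, g3 i t) \<in> S (fst i)"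
  shows "bdd (\<lambda>i t. F (fst i) (g1 i t, g2 i t, g3 i t))"
proof -
  have "jet fst T m (\<lambda>_. 1) (\<lambda>i t. F (fst i) (g1 i t, g2 i t, g3 i t))" for m
  proof (rule jet_compose_smooth[OF open_T eps(1) F])
    show "((\<lambda>t. (g1 i t, g2 i t, g3 i t)) has_vector_derivative
        (deriv (g1 i) t, deriv (g2 i) t, deriv (g3 i) t)) (at t)" if "t \<in> T i" for i t
      by (intro has_vector_derivative_Pair stretchedD(1)[unfolded has_real_derivative_iff_has_vector_derivative] g that)
    show "jet fst T m (\<lambda>i. 1 / fst i) (\<lambda>i t. (deriv (g1 i) t, deriv (g2 i) t, deriv (g3 i) t) \<bullet> b)"
      if "b \<in> Basis" for b
      using that stretchedD(2)[OF g(1)] stretchedD(2)[OF g(2)] stretchedD(2)[OF g(3)]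
      by (auto simp: Basis_prod_def)
  qed (use E S in auto)
  then show ?thesis by (simp add: bdd_def)
qed

lemma bdd_compose_smooth_param:
  fixes F :: "real \<Rightarrow> 'a::euclidean_space \<times> real \<Rightarrow> real" and p :: "real \<times> 'x \<Rightarrow> 'a"
  assumes F: "smooth_bounded E S F" and E: "\<And>i. T i \<noteq> {} \<Longrightarrow> fst i \<in> E"
    and S: "\<And>i t. t \<in> T i \<Longrightarrow> (p i, t) \<in> S (fst i)"
  shows "bdd (\<lambda>i t. F (fst i) (p i, t))"
proof -
  have nn: "0 \<le> 1 / fst i" if "T i \<noteq> {}" for i using eps_nonneg[OF that] by simp
  have c: "jet fst T m (\<lambda>i. 1 / fst i) (\<lambda>_ _. c)" for m and c :: real
  proof (rule jet_const[OF open_T eps(1) _ nn, where B="\<bar>c\<bar>"])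
    fix i assume "T i \<noteq> {}"
    then show "\<bar>c\<bar> \<le> \<bar>c\<bar> * (1 / fst i)"
      using eps_lt_1[of i] eps(1)[of i] by (simp add: field_simps mult_left_le)
  qed auto
  have "jet fst T m (\<lambda>_. 1) (\<lambda>i t. F (fst i) (p i, t))" for m
  proof (rule jet_compose_smooth[OF open_T eps(1) F, where g'="\<lambda>_ _. (0, 1)"])
    show "((\<lambda>t. (p i, t)) has_vector_derivative (0, 1)) (at t)" for i t
      by (auto intro!: derivative_eq_intros)
  qed (use E S c in auto)
  then show ?thesis by (simp add: bdd_def)
qed

lemma stretched_continuous: "stretched g \<Longrightarrow> continuous_on (T i) (g i)"
  unfolding stretched_def by (blast intro: continuous_at_imp_continuous_on DERIV_isCont)

text \<open>
  Where the cut-off does not vanish, the stretched distance \<open>g\<close> is at least \<open>ln\<^sup>2 \<epsilon>\<close>, and there the tail \<open>F\<close>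
  is \<open>O(\<epsilon>)\<close>.
\<close>

lemma sml_cutoff_tail:
  assumes \<zeta>: "cutoff \<zeta>" and g: "stretched g"
    and F: "\<And>m. jet (\<lambda>_. 1) tail_set m (\<lambda>\<epsilon>. \<epsilon>) (\<lambda>_. F)"
  shows "sml (\<lambda>i t. \<zeta> (g i t / (ln (fst i))\<^sup>2 - 1) * F (g i t))"
proof -
  let ?L = "\<lambda>i. (ln (fst i))\<^sup>2"
  \<comment> \<open>overlapping open sets: the tail is small on \<open>T1\<close>, the cut-off vanishes on \<open>T2\<close>\<close>
  define T1 where "T1 i = {t\<in>T i. g i t > ?L i / 2}" for i
  define T2 where "T2 i = {t\<in>T i. g i t < ?L i}" for i
  have T12: "T i = T1 i \<union> T2 i" for i
  proof -
    have "?L i / 2 < ?L i" if "T i \<noteq> {}" using log_sq_ge_1[OF that] by linarith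
    then have "g i t > ?L i / 2 \<or> g i t < ?L i" if "t \<in> T i" for t
    proof -
      have "T i \<noteq> {}" using that by blast
      then show ?thesis using log_sq_ge_1[of i] by linarith
    qed
    then show ?thesis by (auto simp: T1_def T2_def)
  qed
  have o1: "open (T1 i)" for i
    using continuous_open_preimage[OF stretched_continuous[OF g, of i] open_T, of "{?L i / 2<..}"]
    by (simp add: T1_def vimage_def Int_def)
  have o2: "open (T2 i)" for i
    using continuous_open_preimage[OF stretched_continuous[OF g, of i] open_T, of "{..<?L i}"]
    by (simp add: T2_def vimage_def Int_def)
  have "stretched (\<lambda>i t. g i t / ?L i - 1)"
  proof -
    have D: "((\<lambda>t. g i t / ?L i - 1) has_real_derivative 1 / ?L i * deriv (g i) t) (at t)" if "t \<in> T i" for i t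
      using DERIV_diff[OF DERIV_cdivide[OF stretchedD(1)[OF g that], of "?L i"] DERIV_const[of 1]] by simp
    then have e: "deriv (\<lambda>t. g i t / ?L i - 1) t = 1 / ?L i * deriv (g i) t" if "t \<in> T i" for i t
      using that DERIV_imp_deriv by blast
    have nn: "0 \<le> 1 / fst i" if "T i \<noteq> {}" for i using eps_nonneg[OF that] by simp
    have "bdd (\<lambda>i _. 1 / ?L i)"
    proof (rule bdd_const[of _ 1])
      fix i assume "T i \<noteq> {}"
      then have L: "1 \<le> ?L i" by (rule log_sq_ge_1)
      then have "1 / ?L i \<le> 1 / 1" by (intro divide_left_mono) auto
      then show "\<bar>1 / ?L i\<bar> \<le> 1" using L by (simp add: abs_of_nonneg)
    qed
    then have "jet fst T m (\<lambda>i. 1 * (1 / fst i)) (\<lambda>i t. 1 / ?L i * deriv (g i) t)" for m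
      by (intro jet_mult[OF open_T eps(1) zero_le_one nn] bddD stretchedD(2) g)
    then have jt: "jet fst T m (\<lambda>i. 1 / fst i) (\<lambda>i t. 1 / ?L i * deriv (g i) t)" for m by simp
    have "jet fst T m (\<lambda>i. 1 / fst i) (\<lambda>i. deriv (\<lambda>t. g i t / ?L i - 1))" for m
      by (rule jet_cong[OF open_T eps(1) jt]) (simp_all add: e)
    then show ?thesis using D e by (simp add: stretched_def)
  qed
  from bdd_cutoff_compose[OF \<zeta> this] have z: "bdd (\<lambda>i t. \<zeta> (g i t / ?L i - 1))" .
  have "jet fst (\<lambda>i. T1 i \<union> T2 i) m fst (\<lambda>i t. \<zeta> (g i t / ?L i - 1) * F (g i t))" for m
  proof (rule jet_Un[OF o1 o2])
    have n1: "T i \<noteq> {}" if "T1 i \<noteq> {}" for i using that by (auto simp: T1_def)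
    have F1: "jet fst T1 m (\<lambda>i. fst i) (\<lambda>i t. F (g i t))"
    proof (rule jet_compose[OF o1 eps(1)[OF n1] F])
      show "(g i has_real_derivative deriv (g i) t) (at t)" if "t \<in> T1 i" for i t
        using stretchedD(1)[OF g] that by (simp add: T1_def)
      have "jet fst T m (\<lambda>i. 1 / fst i) (\<lambda>i. deriv (g i))" using g by (simp add: stretched_def)
      then show "jet fst T1 m (\<lambda>i. 1 / fst i) (\<lambda>i. deriv (g i))"
        by (rule jet_subset[rotated]) (auto simp: T1_def)
      show "g i t \<in> tail_set (fst i)" if "t \<in> T1 i" for i t
        using that eps(1)[OF n1, of i] by (auto simp: T1_def tail_set_def)
    qed (use eps_nonneg n1 in auto)
    have "jet fst T m (\<lambda>_. 1) (\<lambda>i t. \<zeta> (g i t / ?L i - 1))" using z by (simp add: bdd_def)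
    then have Z1: "jet fst T1 m (\<lambda>_. 1) (\<lambda>i t. \<zeta> (g i t / ?L i - 1))"
      by (rule jet_subset[rotated]) (auto simp: T1_def)
    have "jet fst T1 m (\<lambda>i. 1 * fst i) (\<lambda>i t. \<zeta> (g i t / ?L i - 1) * F (g i t))"
      by (rule jet_mult[OF o1 eps(1)[OF n1] _ _ Z1 F1]) (use eps_nonneg n1 in auto)
    then show "jet fst T1 m fst (\<lambda>i t. \<zeta> (g i t / ?L i - 1) * F (g i t))" by simp
    have n2: "T i \<noteq> {}" if "T2 i \<noteq> {}" for i using that by (auto simp: T2_def)
    show "jet fst T2 m fst (\<lambda>i t. \<zeta> (g i t / ?L i - 1) * F (g i t))"
    proof (rule jet_cong[OF o2 eps(1)[OF n2]])
      show "jet fst T2 m fst (\<lambda>i _. 0)"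
        by (rule jet_zero[OF o2 eps(1)[OF n2]]) (use eps_nonneg n2 in auto)
      show "0 = \<zeta> (g i t / ?L i - 1) * F (g i t)" if "t \<in> T2 i" for i t
      proof -
        have "g i t < ?L i" "1 \<le> ?L i" using that log_sq_ge_1[OF n2, of i] by (auto simp: T2_def)
        then have "g i t / ?L i < 1" by (subst divide_less_eq_1_pos) auto
        then have "g i t / ?L i - 1 < 0" by simp
        then show ?thesis using \<zeta> by (simp add: cutoff_def)
      qed
    qed
  qed (use eps_nonneg eps(1) T12 in auto)
  then show ?thesis by (simp add: sml_def T12[symmetric])
qed

end

text \<open>The cut-off zone \<open>\<bar>r\<bar> \<le> 2 \<epsilon> ln\<^sup>2 \<epsilon>\<close> shrinks to the interface. With \<open>q = \<epsilon>\<^bsup>1/4\<^esup>\<close> the estimate reduces to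
  \<open>q \<bar>ln q\<bar> \<le> 1\<close>.\<close>
lemma eps_log_square_le:
  assumes "0 < \<epsilon>" "\<epsilon> \<le> 1" shows "\<epsilon> * (ln \<epsilon>)\<^sup>2 \<le> 16 * sqrt \<epsilon>"
proof -
  define q where "q = sqrt (sqrt \<epsilon>)"
  have q: "0 < q" "q \<le> 1" "q ^ 2 = sqrt \<epsilon>" using assms by (auto simp: q_def)
  have q4: "q ^ 4 = \<epsilon>"
  proof -
    have "q ^ 4 = (q ^ 2) ^ 2" by (simp flip: power_mult)
    then show ?thesis using q(3) assms by simp
  qed
  have l: "ln \<epsilon> = 4 * ln q" using q4 q(1) ln_realpow[of q 4] by simp
  have "- ln q \<le> 1 / q" using ln_le_minus_one[of "1 / q"] q by (simp add: ln_div)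
  then have "q * \<bar>ln q\<bar> \<le> 1" using q by (simp add: field_simps abs_if)
  moreover have "0 \<le> q * \<bar>ln q\<bar>" using q by (intro mult_nonneg_nonneg) auto
  ultimately have "(q * \<bar>ln q\<bar>)\<^sup>2 \<le> 1" by (intro power_le_one)
  then have "q\<^sup>2 * (q * \<bar>ln q\<bar>)\<^sup>2 \<le> q\<^sup>2 * 1" by (intro mult_left_mono) auto
  then have "q ^ 4 * (ln q)\<^sup>2 \<le> q\<^sup>2" by (simp add: power_mult_distrib power4_eq_xxxx power2_eq_square mult_ac)
  then show ?thesis using q4 q(3) by (simp add: l power_mult_distrib)
qed

text \<open>One choice of the interface and of the expansion that a droplet family comes with.\<close>
locale droplet =
  fixes D :: "(real^2) set" and p n :: "real \<Rightarrow> real^2" and \<Lambda> \<delta> \<epsilon>0 a r0 :: real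
    and \<gamma> \<nu> :: "real \<Rightarrow> real \<Rightarrow> real \<Rightarrow> real^2" and len :: "real \<Rightarrow> real \<Rightarrow> real"
    and r s :: "real \<Rightarrow> real \<Rightarrow> real^2 \<Rightarrow> real" and J :: nat
    and uI uB1 uB2 :: "nat \<Rightarrow> real \<Rightarrow> real \<times> real \<times> real \<Rightarrow> real"
    and up um :: "nat \<Rightarrow> real \<Rightarrow> (real^2) \<times> real \<Rightarrow> real"
    and U \<zeta> :: "real \<Rightarrow> real" and u :: "real \<Rightarrow> real \<Rightarrow> real^2 \<Rightarrow> real"
  assumes profile: "AC_profile U" and cutoff: "cutoff \<zeta>"
    and pos: "0 < \<epsilon>0" "0 < a" "0 < r0"
    and curve: "droplet_curve D p n \<Lambda> \<delta> {0<..\<epsilon>0} a \<gamma> \<nu> len"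
    and coords: "droplet_coords D \<Lambda> \<delta> {0<..\<epsilon>0} a r0 \<gamma> \<nu> len r s"
    and expansion: "droplet_expansion D U \<zeta> {0<..\<epsilon>0} a len r s J uI uB1 uB2 up um u"
begin

definition tube :: "real \<Rightarrow> real \<Rightarrow> (real^2) set" where
  "tube \<epsilon> \<xi> = (\<lambda>(\<rho>, \<sigma>). \<gamma> \<epsilon> \<xi> \<sigma> + \<rho> *\<^sub>R \<nu> \<epsilon> \<xi> \<sigma>) ` tube_par a r0 (len \<epsilon> \<xi>)"

lemma coordsD:
  assumes "0 < \<epsilon>" "\<epsilon> \<le> \<epsilon>0"
  shows r_smooth: "smooth_on {(x, \<xi>). x \<in> tube \<epsilon> \<xi>} (\<lambda>(x, \<xi>). r \<epsilon> \<xi> x)"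
    and s_smooth: "smooth_on {(x, \<xi>). x \<in> tube \<epsilon> \<xi>} (\<lambda>(x, \<xi>). s \<epsilon> \<xi> x)"
    and rs_tube: "\<And>\<xi> \<rho> \<sigma>. (\<rho>, \<sigma>) \<in> tube_par a r0 (len \<epsilon> \<xi>) \<Longrightarrow>
       r \<epsilon> \<xi> (\<gamma> \<epsilon> \<xi> \<sigma> + \<rho> *\<^sub>R \<nu> \<epsilon> \<xi> \<sigma>) = \<rho> \<and> s \<epsilon> \<xi> (\<gamma> \<epsilon> \<xi> \<sigma> + \<rho> *\<^sub>R \<nu> \<epsilon> \<xi> \<sigma>) = \<sigma>"
    and r_continuous: "continuous_on (D \<times> UNIV) (\<lambda>(x, \<xi>). r \<epsilon> \<xi> x)"
    and near_tube: "\<And>\<xi> x. x \<in> D \<Longrightarrow> \<bar>r \<epsilon> \<xi> x\<bar> < r0 \<Longrightarrow> x \<in> tube \<epsilon> \<xi>"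
    and r_xi: "\<And>\<xi> x. x \<in> D \<Longrightarrow> \<bar>r \<epsilon> \<xi> x\<bar> < r0 \<Longrightarrow>
       \<bar>dxi 1 (r \<epsilon>) \<xi> x + cos (pi * s \<epsilon> \<xi> x / len \<epsilon> \<xi>)\<bar> \<le> \<Lambda> * \<delta>"
proof -
  have "\<epsilon> \<in> {0<..\<epsilon>0}" using assms by simp
  note X = bspec[OF coords[unfolded droplet_coords_def Let_def, THEN conjunct1] this, folded tube_def]
  show "smooth_on {(x, \<xi>). x \<in> tube \<epsilon> \<xi>} (\<lambda>(x, \<xi>). r \<epsilon> \<xi> x)" using X by blast
  show "smooth_on {(x, \<xi>). x \<in> tube \<epsilon> \<xi>} (\<lambda>(x, \<xi>). s \<epsilon> \<xi> x)" using X by blast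
  show "continuous_on (D \<times> UNIV) (\<lambda>(x, \<xi>). r \<epsilon> \<xi> x)" using X by blast
  show "r \<epsilon> \<xi> (\<gamma> \<epsilon> \<xi> \<sigma> + \<rho> *\<^sub>R \<nu> \<epsilon> \<xi> \<sigma>) = \<rho> \<and> s \<epsilon> \<xi> (\<gamma> \<epsilon> \<xi> \<sigma> + \<rho> *\<^sub>R \<nu> \<epsilon> \<xi> \<sigma>) = \<sigma>"
    if "(\<rho>, \<sigma>) \<in> tube_par a r0 (len \<epsilon> \<xi>)" for \<xi> \<rho> \<sigma>
    using bspec[OF spec[OF X[THEN conjunct2, THEN conjunct2, THEN conjunct1]] that] by simp
  show "x \<in> tube \<epsilon> \<xi>" if "x \<in> D" "\<bar>r \<epsilon> \<xi> x\<bar> < r0" for \<xi> x using X that by blast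
  show "\<bar>dxi 1 (r \<epsilon>) \<xi> x + cos (pi * s \<epsilon> \<xi> x / len \<epsilon> \<xi>)\<bar> \<le> \<Lambda> * \<delta>"
    if "x \<in> D" "\<bar>r \<epsilon> \<xi> x\<bar> < r0" for \<xi> x using X that by blast
qed

lemma derivative_bounds:
  "\<exists>B. \<forall>\<epsilon> \<xi>. 0 < \<epsilon> \<and> \<epsilon> \<le> \<epsilon>0 \<longrightarrow> \<bar>(deriv ^^ l) (len \<epsilon>) \<xi>\<bar> \<le> B \<and>
     (\<forall>x\<in>D. \<bar>r \<epsilon> \<xi> x\<bar> < r0 \<longrightarrow> \<bar>dxi l (r \<epsilon>) \<xi> x\<bar> \<le> B \<and> \<bar>dxi l (s \<epsilon>) \<xi> x\<bar> \<le> B)"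
proof -
  have "\<exists>B. \<forall>\<epsilon>\<in>{0<..\<epsilon>0}. \<forall>\<xi>. \<bar>(deriv ^^ l) (len \<epsilon>) \<xi>\<bar> \<le> B \<and>
        (\<forall>x\<in>D. \<bar>r \<epsilon> \<xi> x\<bar> < r0 \<longrightarrow> \<bar>dxi l (r \<epsilon>) \<xi> x\<bar> \<le> B \<and> \<bar>dxi l (s \<epsilon>) \<xi> x\<bar> \<le> B)"
    using coords unfolding droplet_coords_def by blast
  then show ?thesis by (metis greaterThanAtMost_iff)
qed

lemma len_smooth: "0 < \<epsilon> \<Longrightarrow> \<epsilon> \<le> \<epsilon>0 \<Longrightarrow> smooth_on UNIV (len \<epsilon>)"
  using curve unfolding droplet_curve_def by auto

lemma expansionD:
  assumes "j \<le> J"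
  shows "smooth_bounded {0<..\<epsilon>0} (\<lambda>\<epsilon>. {(R, \<sigma>, \<xi>). -a < \<sigma> \<and> \<sigma> < len \<epsilon> \<xi> + a}) (uI j)"
    and "smooth_bounded {0<..\<epsilon>0} (\<lambda>\<epsilon>. {(R, S, \<xi>). -a < \<epsilon> * S \<and> \<epsilon> * S < len \<epsilon> \<xi> + a}) (uB1 j)"
    and "smooth_bounded {0<..\<epsilon>0} (\<lambda>\<epsilon>. {(R, S, \<xi>). -a < \<epsilon> * S \<and> \<epsilon> * S < len \<epsilon> \<xi> + a}) (uB2 j)"
    and "smooth_bounded {0<..\<epsilon>0} (\<lambda>\<epsilon>. D \<times> UNIV) (up j)"
    and "smooth_bounded {0<..\<epsilon>0} (\<lambda>\<epsilon>. D \<times> UNIV) (um j)"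
  using expansion assms unfolding droplet_expansion_def by blast+

lemma u_expansion:
  assumes "0 < \<epsilon>" "\<epsilon> \<le> \<epsilon>0" "x \<in> D"
  shows "u \<epsilon> \<xi> x =
    (1 - \<zeta> (r \<epsilon> \<xi> x / (\<epsilon> * (ln \<epsilon>)\<^sup>2) - 1) - \<zeta> (- r \<epsilon> \<xi> x / (\<epsilon> * (ln \<epsilon>)\<^sup>2) - 1)) *
      (U (r \<epsilon> \<xi> x / \<epsilon>) + \<epsilon> * (\<Sum>j\<le>J. \<epsilon> ^ j * uI j \<epsilon> (r \<epsilon> \<xi> x / \<epsilon>, s \<epsilon> \<xi> x, \<xi>)) +
        (\<Sum>j=1..J. \<epsilon> ^ j *
          ((1 - \<zeta> (s \<epsilon> \<xi> x / (\<epsilon> * (ln \<epsilon>)\<^sup>2) - 1)) * uB1 j \<epsilon> (r \<epsilon> \<xi> x / \<epsilon>, s \<epsilon> \<xi> x / \<epsilon>, \<xi>) +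
           (1 - \<zeta> ((len \<epsilon> \<xi> - s \<epsilon> \<xi> x) / (\<epsilon> * (ln \<epsilon>)\<^sup>2) - 1)) *
             uB2 j \<epsilon> (r \<epsilon> \<xi> x / \<epsilon>, (len \<epsilon> \<xi> - s \<epsilon> \<xi> x) / \<epsilon>, \<xi>)))) +
    \<zeta> (r \<epsilon> \<xi> x / (\<epsilon> * (ln \<epsilon>)\<^sup>2) - 1) * (1 + \<epsilon> * (\<Sum>j\<le>J. \<epsilon> ^ j * up j \<epsilon> (x, \<xi>))) +
    \<zeta> (- r \<epsilon> \<xi> x / (\<epsilon> * (ln \<epsilon>)\<^sup>2) - 1) * (- 1 + \<epsilon> * (\<Sum>j\<le>J. \<epsilon> ^ j * um j \<epsilon> (x, \<xi>)))"
  using expansion assms unfolding droplet_expansion_def Let_def by auto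

text \<open>
  The parameters \<open>\<xi>\<close> for which the fixed point \<open>x\<close> has coordinates \<open>(r, s)\<close>: derivatives in \<open>\<xi>\<close> are taken at
  fixed \<open>x\<close>, while the interface moves.
\<close>

definition near :: "real \<times> (real^2) \<Rightarrow> real set" where
  "near = (\<lambda>(\<epsilon>, x). if 0 < \<epsilon> \<and> \<epsilon> \<le> min \<epsilon>0 (exp (-1)) \<and> x \<in> D then {\<xi>. \<bar>r \<epsilon> \<xi> x\<bar> < r0} else {})"

lemma r_continuous_xi:
  assumes "0 < \<epsilon>" "\<epsilon> \<le> \<epsilon>0" "x \<in> D" shows "continuous_on UNIV (\<lambda>\<xi>. r \<epsilon> \<xi> x)"
proof -
  have "continuous_on UNIV (\<lambda>\<xi>. case (x, \<xi>) of (x, \<xi>) \<Rightarrow> r \<epsilon> \<xi> x)"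
    by (rule continuous_on_compose2[OF r_continuous[OF assms(1,2)]])
      (use assms(3) in \<open>auto intro: continuous_on_Pair continuous_on_const continuous_on_id\<close>)
  then show ?thesis by simp
qed

lemma near_scale_family: "scale_family near"
proof
  show "open (near i)" for i
  proof (cases i)
    case (Pair \<epsilon> x)
    show ?thesis
      unfolding near_def Pair by (auto intro!: open_Collect_less continuous_intros r_continuous_xi)
  qed
qed (auto simp: near_def split: if_splits)

sublocale near: scale_family near by (rule near_scale_family)

lemma nearD:
  assumes "t \<in> near i"
  shows "0 < fst i" "fst i \<le> \<epsilon>0" "snd i \<in> D" "\<bar>r (fst i) t (snd i)\<bar> < r0" "snd i \<in> tube (fst i) t"
  using assms near_tube[of "fst i" "snd i" t] by (auto simp: near_def split: if_splits prod.splits)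

lemma near_nonempty: "near i \<noteq> {} \<Longrightarrow> fst i \<in> {0<..\<epsilon>0}"
  using nearD(1,2) by fastforce

lemma coord_r: "near.coord (\<lambda>i t. r (fst i) t (snd i))"
proof (rule near.coordI)
  show "\<exists>C. \<forall>i. \<forall>t\<in>near i. \<bar>(deriv ^^ l) (\<lambda>t. r (fst i) t (snd i)) t\<bar> \<le> C" for l
    using derivative_bounds[of l] nearD unfolding dxi_def by metis
  show "((deriv ^^ l) (\<lambda>t. r (fst i) t (snd i)) has_real_derivative
      (deriv ^^ Suc l) (\<lambda>t. r (fst i) t (snd i)) t) (at t)" if "t \<in> near i" for l i t
    by (rule dxi_derivatives(2)[OF r_smooth]) (use nearD[OF that] in auto)
qed

lemma coord_s: "near.coord (\<lambda>i t. s (fst i) t (snd i))"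
proof (rule near.coordI)
  show "\<exists>C. \<forall>i. \<forall>t\<in>near i. \<bar>(deriv ^^ l) (\<lambda>t. s (fst i) t (snd i)) t\<bar> \<le> C" for l
    using derivative_bounds[of l] nearD unfolding dxi_def by metis
  show "((deriv ^^ l) (\<lambda>t. s (fst i) t (snd i)) has_real_derivative
      (deriv ^^ Suc l) (\<lambda>t. s (fst i) t (snd i)) t) (at t)" if "t \<in> near i" for l i t
    by (rule dxi_derivatives(2)[OF s_smooth]) (use nearD[OF that] in auto)
qed

lemma coord_len: "near.coord (\<lambda>i. len (fst i))"
proof (rule near.coordI)
  show "\<exists>C. \<forall>i. \<forall>t\<in>near i. \<bar>(deriv ^^ l) (len (fst i)) t\<bar> \<le> C" for l
    using derivative_bounds[of l] nearD by metis
  show "((deriv ^^ l) (len (fst i)) has_real_derivative (deriv ^^ Suc l) (len (fst i)) t) (at t)"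
    if "t \<in> near i" for l i t
    by (rule smooth_on_real_derivatives[OF len_smooth]) (use nearD[OF that] in auto)
qed

lemma s_range:
  assumes "t \<in> near i"
  shows "- a < s (fst i) t (snd i)" "s (fst i) t (snd i) < len (fst i) t + a"
proof -
  obtain \<rho> \<sigma> where \<sigma>: "(\<rho>, \<sigma>) \<in> tube_par a r0 (len (fst i) t)"
      "snd i = \<gamma> (fst i) t \<sigma> + \<rho> *\<^sub>R \<nu> (fst i) t \<sigma>"
    using nearD(5)[OF assms] unfolding tube_def by auto
  then have "s (fst i) t (snd i) = \<sigma>" using rs_tube[OF nearD(1,2)[OF assms] \<sigma>(1)] by simp
  then show "- a < s (fst i) t (snd i)" "s (fst i) t (snd i) < len (fst i) t + a"
    using \<sigma>(1) by (auto simp: tube_par_def)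
qed

lemma near_cutoff_bdd:
  assumes "near.coord f"
  shows "near.bdd (\<lambda>i t. \<zeta> (f i t / (fst i * (ln (fst i))\<^sup>2) - 1))"
    and "near.bdd (\<lambda>i t. \<zeta> (- f i t / (fst i * (ln (fst i))\<^sup>2) - 1))"
proof -
  have b: "1 / (fst i * (ln (fst i))\<^sup>2) \<le> 1 / fst i" "0 \<le> 1 / (fst i * (ln (fst i))\<^sup>2)" if "near i \<noteq> {}" for i
  proof -
    have L: "1 \<le> (ln (fst i))\<^sup>2" "0 < fst i" using near.log_sq_ge_1[OF that] near.eps(1)[OF that] by auto
    then have "0 < fst i * (ln (fst i))\<^sup>2 * fst i" by (intro mult_pos_pos) linarith+
    moreover have "fst i \<le> fst i * (ln (fst i))\<^sup>2" using L by (simp add: mult_le_cancel_left1)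
    ultimately show "1 / (fst i * (ln (fst i))\<^sup>2) \<le> 1 / fst i" by (intro divide_left_mono) auto
    show "0 \<le> 1 / (fst i * (ln (fst i))\<^sup>2)" using L by simp
  qed
  have "near.stretched (\<lambda>i t. 1 / (fst i * (ln (fst i))\<^sup>2) * f i t + - 1)"
    by (rule near.stretched_affine[OF assms, where B=1]) (use b in simp)
  from near.bdd_cutoff_compose[OF cutoff this]
  show "near.bdd (\<lambda>i t. \<zeta> (f i t / (fst i * (ln (fst i))\<^sup>2) - 1))" by simp
  have "near.stretched (\<lambda>i t. (- 1 / (fst i * (ln (fst i))\<^sup>2)) * f i t + - 1)"
    by (rule near.stretched_affine[OF assms, where B=1]) (use b in simp)
  from near.bdd_cutoff_compose[OF cutoff this]
  show "near.bdd (\<lambda>i t. \<zeta> (- f i t / (fst i * (ln (fst i))\<^sup>2) - 1))" by simp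
qed

text \<open>In \<open>u - U(R)\<close> the terms without a factor \<open>\<epsilon>\<close> combine to \<open>\<zeta>\<^sub>+ (1 - U) - \<zeta>\<^sub>- (1 + U)\<close>, where \<open>\<zeta>\<^sub>+\<close> and
  \<open>\<zeta>\<^sub>-\<close> are the two cut-offs; these are small by the tails of the profile.\<close>
lemma near_expansion:
  "near.sml (\<lambda>i t. u (fst i) t (snd i) - U (r (fst i) t (snd i) / fst i))"
proof -
  let ?r = "\<lambda>i t. r (fst i) t (snd i)" and ?s = "\<lambda>i t. s (fst i) t (snd i)" and ?l = "\<lambda>i t. len (fst i) t"
  let ?R = "\<lambda>i t. ?r i t / fst i"
  let ?\<zeta>p = "\<lambda>i t. \<zeta> (?r i t / (fst i * (ln (fst i))\<^sup>2) - 1)"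
  let ?\<zeta>m = "\<lambda>i t. \<zeta> (- ?r i t / (fst i * (ln (fst i))\<^sup>2) - 1)"
  let ?\<chi>1 = "\<lambda>i t. 1 - \<zeta> (?s i t / (fst i * (ln (fst i))\<^sup>2) - 1)"
  let ?\<chi>2 = "\<lambda>i t. 1 - \<zeta> ((?l i t - ?s i t) / (fst i * (ln (fst i))\<^sup>2) - 1)"
  let ?I = "\<lambda>i t. \<Sum>j\<le>J. fst i ^ j * uI j (fst i) (?R i t, ?s i t, t)"
  let ?B = "\<lambda>i t. \<Sum>j=1..J. fst i ^ j * (?\<chi>1 i t * uB1 j (fst i) (?R i t, ?s i t / fst i, t) +
       ?\<chi>2 i t * uB2 j (fst i) (?R i t, (?l i t - ?s i t) / fst i, t))"
  let ?P = "\<lambda>i t. \<Sum>j\<le>J. fst i ^ j * up j (fst i) (snd i, t)"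
  let ?M = "\<lambda>i t. \<Sum>j\<le>J. fst i ^ j * um j (fst i) (snd i, t)"
  have c1: "near.bdd (\<lambda>_ _. 1)" by (rule near.bdd_const[of _ 1]) simp
  have R: "near.stretched ?R" by (rule near.stretched_scaled[OF coord_r])
  have ls: "near.coord (\<lambda>i t. ?l i t - ?s i t)" by (rule near.coord_diff[OF coord_len coord_s])
  have T: "near.stretched (\<lambda>_ t. t)" by (rule near.stretched_coord[OF near.coord_id])
  have I: "near.bdd ?I"
  proof (rule near.bdd_sum[OF finite_atMost])
    fix j assume "j \<in> {..J}"
    then have j: "j \<le> J" by simp
    have "near.bdd (\<lambda>i t. uI j (fst i) (?R i t, ?s i t, t))"
      by (rule near.bdd_compose_smooth3[OF expansionD(1)[OF j] near_nonempty R near.stretched_coord[OF coord_s] T])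
        (use s_range in auto)
    then show "near.bdd (\<lambda>i t. fst i ^ j * uI j (fst i) (?R i t, ?s i t, t))"
      by (intro near.bdd_mult near.bdd_eps_power)
  qed
  have rng1: "(?R i t, ?s i t / fst i, t)
      \<in> {(R, S, \<xi>). -a < fst i * S \<and> fst i * S < len (fst i) \<xi> + a}" if "t \<in> near i" for i t
    using s_range[OF that] nearD(1)[OF that] by simp
  have rng2: "(?R i t, (?l i t - ?s i t) / fst i, t)
      \<in> {(R, S, \<xi>). -a < fst i * S \<and> fst i * S < len (fst i) \<xi> + a}" if "t \<in> near i" for i t
    using s_range[OF that] nearD(1)[OF that] by simp
  have B: "near.sml ?B"
  proof (rule near.sml_sum[OF finite_atLeastAtMost])
    fix j assume "j \<in> {1..J}"
    then have j: "j \<le> J" "1 \<le> j" by auto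
    have "near.bdd (\<lambda>i t. uB1 j (fst i) (?R i t, ?s i t / fst i, t))"
      by (rule near.bdd_compose_smooth3[OF expansionD(2)[OF j(1)] near_nonempty R near.stretched_scaled[OF coord_s] T rng1])
    moreover have "near.bdd (\<lambda>i t. uB2 j (fst i) (?R i t, (?l i t - ?s i t) / fst i, t))"
      by (rule near.bdd_compose_smooth3[OF expansionD(3)[OF j(1)] near_nonempty R near.stretched_scaled[OF ls] T rng2])
    ultimately show "near.sml (\<lambda>i t. fst i ^ j * (?\<chi>1 i t * uB1 j (fst i) (?R i t, ?s i t / fst i, t) +
       ?\<chi>2 i t * uB2 j (fst i) (?R i t, (?l i t - ?s i t) / fst i, t)))"
      by (intro near.sml_eps_power_mult[OF _ j(2)] near.bdd_add near.bdd_mult near.bdd_minus c1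
          near_cutoff_bdd(1) coord_s ls)
  qed
  have P: "near.bdd ?P"
  proof (rule near.bdd_sum[OF finite_atMost])
    fix j assume "j \<in> {..J}"
    then have j: "j \<le> J" by simp
    have "near.bdd (\<lambda>i t. up j (fst i) (snd i, t))"
      by (rule near.bdd_compose_smooth_param[OF expansionD(4)[OF j] near_nonempty]) (use nearD(3) in auto)
    then show "near.bdd (\<lambda>i t. fst i ^ j * up j (fst i) (snd i, t))"
      by (intro near.bdd_mult near.bdd_eps_power)
  qed
  have M: "near.bdd ?M"
  proof (rule near.bdd_sum[OF finite_atMost])
    fix j assume "j \<in> {..J}"
    then have j: "j \<le> J" by simp
    have "near.bdd (\<lambda>i t. um j (fst i) (snd i, t))"
      by (rule near.bdd_compose_smooth_param[OF expansionD(5)[OF j] near_nonempty]) (use nearD(3) in auto)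
    then show "near.bdd (\<lambda>i t. fst i ^ j * um j (fst i) (snd i, t))"
      by (intro near.bdd_mult near.bdd_eps_power)
  qed
  have tp: "near.sml (\<lambda>i t. ?\<zeta>p i t * (1 - U (?R i t)))"
    using near.sml_cutoff_tail[OF cutoff R jet_profile_tail(1)[OF profile]] by simp
  have Rm: "near.stretched (\<lambda>i t. - ?R i t)"
  proof -
    have "near.stretched (\<lambda>i t. (- 1 / fst i) * ?r i t + 0)"
      by (rule near.stretched_affine[OF coord_r, where B=1]) (use near.eps_nonneg in simp)
    then show ?thesis by simp
  qed
  have tm: "near.sml (\<lambda>i t. ?\<zeta>m i t * (1 + U (?R i t)))"
    using near.sml_cutoff_tail[OF cutoff Rm jet_profile_tail(2)[OF profile]] by simp
  have "near.sml (\<lambda>i t. (1 - ?\<zeta>p i t - ?\<zeta>m i t) * (fst i * ?I i t + ?B i t)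
      + (?\<zeta>p i t * (fst i * ?P i t) + ?\<zeta>p i t * (1 - U (?R i t)))
      + (?\<zeta>m i t * (fst i * ?M i t) - ?\<zeta>m i t * (1 + U (?R i t))))"
    by (intro near.sml_add near.sml_minus near.bdd_mult_sml near.bdd_minus near.sml_eps_mult
        c1 near_cutoff_bdd coord_r I B P M tp tm)
  then show ?thesis
  proof (rule near.sml_cong)
    fix i t assume t: "t \<in> near i"
    have alg: "(1 - zp - zm) * (e * xI + xB) + (zp * (e * xP) + zp * (1 - x)) + (zm * (e * xM) - zm * (1 + x))
      = (1 - zp - zm) * (x + e * xI + xB) + zp * (1 + e * xP) + zm * (- 1 + e * xM) - x"
      for zp zm e xI xB xP xM x :: real by (simp add: algebra_simps)
    show "(1 - ?\<zeta>p i t - ?\<zeta>m i t) * (fst i * ?I i t + ?B i t)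
      + (?\<zeta>p i t * (fst i * ?P i t) + ?\<zeta>p i t * (1 - U (?R i t)))
      + (?\<zeta>m i t * (fst i * ?M i t) - ?\<zeta>m i t * (1 + U (?R i t))) = u (fst i) t (snd i) - U (?R i t)"
      unfolding u_expansion[OF nearD(1-3)[OF t]] by (rule alg)
  qed
qed

end

lemma higher_derivs_on_open:
  fixes f f1 f2 f3 :: "real \<Rightarrow> real"
  assumes S: "open S" and x: "x \<in> S"
    and f: "\<And>x. x \<in> S \<Longrightarrow> (f has_real_derivative f1 x) (at x)"
    and f1: "\<And>x. x \<in> S \<Longrightarrow> (f1 has_real_derivative f2 x) (at x)"
    and f2: "\<And>x. x \<in> S \<Longrightarrow> (f2 has_real_derivative f3 x) (at x)"
  shows "(deriv ^^ 1) f x = f1 x" "(deriv ^^ 2) f x = f2 x" "(deriv ^^ 3) f x = f3 x"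
proof -
  have 1: "deriv f y = f1 y" if "y \<in> S" for y using f[OF that] by (rule DERIV_imp_deriv)
  have 2: "deriv (deriv f) y = f2 y" if "y \<in> S" for y
  proof -
    have "(deriv ^^ 1) (deriv f) y = (deriv ^^ 1) f1 y" by (rule higher_deriv_cong_open[OF S 1 that])
    then show ?thesis using f1[OF that] by (simp add: DERIV_imp_deriv)
  qed
  have 3: "deriv (deriv (deriv f)) y = f3 y" if "y \<in> S" for y
  proof -
    have "(deriv ^^ 1) (deriv (deriv f)) y = (deriv ^^ 1) f2 y" by (rule higher_deriv_cong_open[OF S 2 that])
    then show ?thesis using f2[OF that] by (simp add: DERIV_imp_deriv)
  qed
  show "(deriv ^^ 1) f x = f1 x" "(deriv ^^ 2) f x = f2 x" "(deriv ^^ 3) f x = f3 x"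
    using 1[OF x] 2[OF x] 3[OF x] by (simp_all add: eval_nat_numeral)
qed

lemma (in scale_family) sml_derivative_bounds:
  assumes "sml f"
  shows "\<exists>C\<ge>0. \<forall>i. \<forall>t\<in>T i. \<forall>l\<le>m. \<bar>(deriv ^^ l) (f i) t\<bar> \<le> C * (fst i / fst i ^ l)"
proof -
  have "\<exists>C\<ge>0. \<forall>i. \<forall>t\<in>T i. \<bar>(deriv ^^ l) (f i) t\<bar> \<le> C * (fst i / fst i ^ l)" for l
    using jet_derivative_bound[OF smlD[OF assms, of l], of l] by simp
  then obtain C where C: "\<And>l. C l \<ge> 0"
    "\<And>l i t. t \<in> T i \<Longrightarrow> \<bar>(deriv ^^ l) (f i) t\<bar> \<le> C l * (fst i / fst i ^ l)" by metis
  have "\<bar>(deriv ^^ l) (f i) t\<bar> \<le> (\<Sum>l\<le>m. C l) * (fst i / fst i ^ l)" if "t \<in> T i" "l \<le> m" for l i t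
  proof -
    have "C l \<le> (\<Sum>l\<le>m. C l)" using that(2) C(1) by (intro member_le_sum) auto
    moreover have "0 \<le> fst i" using that(1) by (intro eps_nonneg) auto
    ultimately have "C l * (fst i / fst i ^ l) \<le> (\<Sum>l\<le>m. C l) * (fst i / fst i ^ l)"
      by (intro mult_right_mono) auto
    then show ?thesis using C(2)[OF that(1), of l] by linarith
  qed
  then show ?thesis using C(1) by (intro exI[of _ "\<Sum>l\<le>m. C l"]) (auto intro: sum_nonneg)
qed

lemma (in scale_family) sml_has_derivative:
  assumes "sml f" and "t \<in> T i"
  shows "((deriv ^^ l) (f i) has_real_derivative (deriv ^^ Suc l) (f i) t) (at t)"
proof -
  have "jet fst T (Suc l) w f \<Longrightarrow> ((deriv ^^ l) (f i) has_real_derivative (deriv ^^ Suc l) (f i) t) (at t)" for w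
  proof (induction l arbitrary: f w)
    case 0
    then show ?case using jet_SucD(2)[OF 0 assms(2)] by simp
  next
    case (Suc l)
    from Suc.IH[OF jet_SucD(3)[OF Suc.prems]] show ?case
      by (simp add: funpow_Suc_right del: funpow.simps(2))
  qed
  then show ?thesis using smlD[OF assms(1)] by blast
qed

context droplet
begin

text \<open>The derivatives of \<open>U(r / \<epsilon>)\<close> are computed exactly, those of the remainder are estimated. In the third one
  every term of the chain rule contains \<open>U'\<close> or \<open>U''\<close>, and \<open>\<bar>U''\<bar> \<le> 2 U'\<close>.\<close>
lemma near_derivative_bounds:
  "\<exists>C\<ge>0. \<forall>\<epsilon> x \<xi>. \<xi> \<in> near (\<epsilon>, x) \<longrightarrow>
     \<bar>dxi 1 (u \<epsilon>) \<xi> x - deriv U (r \<epsilon> \<xi> x / \<epsilon>) * dxi 1 (r \<epsilon>) \<xi> x / \<epsilon>\<bar> \<le> C \<and>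
     \<bar>dxi 2 (u \<epsilon>) \<xi> x - nonlin (U (r \<epsilon> \<xi> x / \<epsilon>)) * (dxi 1 (r \<epsilon>) \<xi> x)\<^sup>2 / \<epsilon>\<^sup>2\<bar> \<le> C / \<epsilon> \<and>
     \<bar>dxi 3 (u \<epsilon>) \<xi> x\<bar> \<le> C * (deriv U (r \<epsilon> \<xi> x / \<epsilon>) / \<epsilon> ^ 3 + 1 / \<epsilon>\<^sup>2)"
proof -
  let ?G = "\<lambda>i t. u (fst i) t (snd i) - U (r (fst i) t (snd i) / fst i)"
  obtain C where C: "C \<ge> 0"
    "\<And>i t l. t \<in> near i \<Longrightarrow> l \<le> 3 \<Longrightarrow> \<bar>(deriv ^^ l) (?G i) t\<bar> \<le> C * (fst i / fst i ^ l)"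
    using near.sml_derivative_bounds[OF near_expansion, of 3] by blast
  have "\<exists>B\<ge>0. \<forall>i. \<forall>t\<in>near i. \<bar>dxi l (r (fst i)) t (snd i)\<bar> \<le> B" for l
  proof -
    obtain B where B: "\<And>\<epsilon> \<xi> x. 0 < \<epsilon> \<Longrightarrow> \<epsilon> \<le> \<epsilon>0 \<Longrightarrow> x \<in> D \<Longrightarrow> \<bar>r \<epsilon> \<xi> x\<bar> < r0 \<Longrightarrow> \<bar>dxi l (r \<epsilon>) \<xi> x\<bar> \<le> B"
      using derivative_bounds[of l] by blast
    have "\<bar>dxi l (r (fst i)) t (snd i)\<bar> \<le> \<bar>B\<bar>" if "t \<in> near i" for i t
      using B[OF nearD(1-4)[OF that]] by linarith
    then show ?thesis by (intro exI[of _ "\<bar>B\<bar>"]) auto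
  qed
  then obtain Bl where Bl: "\<And>l. Bl l \<ge> 0" "\<And>l i t. t \<in> near i \<Longrightarrow> \<bar>dxi l (r (fst i)) t (snd i)\<bar> \<le> Bl l"
    by metis
  define B where "B = Bl 1 + Bl 2 + Bl 3"
  have B: "0 \<le> B" using Bl(1) by (simp add: B_def)
  have Bb: "\<bar>dxi l (r (fst i)) t (snd i)\<bar> \<le> B" if "t \<in> near i" "l \<in> {1,2,3}" for l i t
    using Bl(2)[OF that(1), of l] that(2) Bl(1)[of 1] Bl(1)[of 2] Bl(1)[of 3] by (auto simp: B_def)
  define K where "K = C + B + 2 * B ^ 3 + 6 * B\<^sup>2"
  have K: "0 \<le> K" "C \<le> K" "B + C \<le> K" using B C(1) by (auto simp: K_def)
  show ?thesis
  proof (intro exI[of _ K] conjI allI impI K(1))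
    fix \<epsilon> x \<xi> assume \<xi>: "\<xi> \<in> near (\<epsilon>, x)"
    define V where "V = deriv U"
    define \<rho> where "\<rho> l t = (deriv ^^ l) (\<lambda>t. r \<epsilon> t x) t" for l t
    define G where "G l t = (deriv ^^ l) (\<lambda>t. u \<epsilon> t x - U (r \<epsilon> t x / \<epsilon>)) t" for l t
    let ?N = "near (\<epsilon>, x)"
    have "?N \<noteq> {}" using \<xi> by blast
    from near.eps(1)[OF this] near.eps_lt_1[OF this] have eps: "0 < \<epsilon>" "\<epsilon> \<le> 1" by auto
    have \<rho>': "(\<rho> l has_real_derivative \<rho> (Suc l) t) (at t)" if "t \<in> ?N" for l t
    proof -
      have "((deriv ^^ l) (\<lambda>t. r \<epsilon> t x) has_real_derivative (deriv ^^ Suc l) (\<lambda>t. r \<epsilon> t x) t) (at t)"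
        by (rule dxi_derivatives(2)[OF r_smooth]) (use nearD[OF that] in auto)
      then show ?thesis by (simp add: \<rho>_def[abs_def])
    qed
    have G': "(G l has_real_derivative G (Suc l) t) (at t)" if "t \<in> ?N" for l t
      using near.sml_has_derivative[OF near_expansion that, of l] by (simp add: G_def[abs_def])
    have U': "(U has_real_derivative V R) (at R)" and V': "(V has_real_derivative nonlin (U R)) (at R)" for R
      using profile by (auto simp: AC_profile_def V_def)
    define R where "R t = \<rho> 0 t / \<epsilon>" for t
    have R': "(R has_real_derivative \<rho> 1 t / \<epsilon>) (at t)" if "t \<in> ?N" for t
      using DERIV_cdivide[OF \<rho>'[OF that, of 0], of \<epsilon>] by (simp add: R_def[abs_def])
    have UR: "((\<lambda>t. U (R t)) has_real_derivative V (R t) * (\<rho> 1 t / \<epsilon>)) (at t)" if "t \<in> ?N" for t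
      by (rule DERIV_chain2[OF U' R'[OF that]])
    have VR: "((\<lambda>t. V (R t)) has_real_derivative nonlin (U (R t)) * (\<rho> 1 t / \<epsilon>)) (at t)" if "t \<in> ?N" for t
      by (rule DERIV_chain2[OF V' R'[OF that]])
    have NR: "((\<lambda>t. nonlin (U (R t))) has_real_derivative
        (3 * (U (R t))\<^sup>2 - 1) * (V (R t) * (\<rho> 1 t / \<epsilon>))) (at t)" if "t \<in> ?N" for t
      unfolding nonlin_def
      by (rule derivative_eq_intros UR[OF that] refl)+ (simp add: algebra_simps eval_nat_numeral)
    define f1 where "f1 t = V (R t) * (\<rho> 1 t / \<epsilon>) + G 1 t" for t
    define f2 where "f2 t = nonlin (U (R t)) * (\<rho> 1 t / \<epsilon>)\<^sup>2 + V (R t) * (\<rho> 2 t / \<epsilon>) + G 2 t" for t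
    define f3 where "f3 t = (3 * (U (R t))\<^sup>2 - 1) * V (R t) * (\<rho> 1 t / \<epsilon>) ^ 3
       + 3 * nonlin (U (R t)) * (\<rho> 1 t * \<rho> 2 t / \<epsilon>\<^sup>2) + V (R t) * (\<rho> 3 t / \<epsilon>) + G 3 t" for t
    have d0: "((\<lambda>t. u \<epsilon> t x) has_real_derivative f1 t) (at t)" if "t \<in> ?N" for t
    proof -
      have "((\<lambda>t. U (R t) + G 0 t) has_real_derivative V (R t) * (\<rho> 1 t / \<epsilon>) + G (Suc 0) t) (at t)"
        by (rule DERIV_add[OF UR[OF that] G'[OF that]])
      moreover have "(\<lambda>t. U (R t) + G 0 t) = (\<lambda>t. u \<epsilon> t x)" by (simp add: G_def R_def \<rho>_def)
      ultimately show ?thesis by (simp add: f1_def)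
    qed
    have \<rho>d: "((\<lambda>t. \<rho> l t / \<epsilon>) has_real_derivative \<rho> (Suc l) t / \<epsilon>) (at t)" if "t \<in> ?N" for l t
      using DERIV_cdivide[OF \<rho>'[OF that]] .
    have d1: "(f1 has_real_derivative f2 t) (at t)" if "t \<in> ?N" for t
    proof -
      have "(f1 has_real_derivative (V (R t) * (\<rho> (Suc 1) t / \<epsilon>)
          + (nonlin (U (R t)) * (\<rho> 1 t / \<epsilon>)) * (\<rho> 1 t / \<epsilon>)) + G (Suc 1) t) (at t)"
        unfolding f1_def[abs_def] by (intro DERIV_add DERIV_mult' VR \<rho>d G' that)
      moreover have "(V (R t) * (\<rho> (Suc 1) t / \<epsilon>)
          + (nonlin (U (R t)) * (\<rho> 1 t / \<epsilon>)) * (\<rho> 1 t / \<epsilon>)) + G (Suc 1) t = f2 t"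
        by (simp add: f2_def numeral_2_eq_2 power2_eq_square)
      ultimately show ?thesis by simp
    qed
    have d2: "(f2 has_real_derivative f3 t) (at t)" if "t \<in> ?N" for t
    proof -
      have "((\<lambda>t. nonlin (U (R t)) * ((\<rho> 1 t / \<epsilon>) * (\<rho> 1 t / \<epsilon>)) + V (R t) * (\<rho> 2 t / \<epsilon>) + G 2 t)
        has_real_derivative
          (nonlin (U (R t)) * ((\<rho> 1 t / \<epsilon>) * (\<rho> (Suc 1) t / \<epsilon>) + (\<rho> (Suc 1) t / \<epsilon>) * (\<rho> 1 t / \<epsilon>))
           + (3 * (U (R t))\<^sup>2 - 1) * (V (R t) * (\<rho> 1 t / \<epsilon>)) * ((\<rho> 1 t / \<epsilon>) * (\<rho> 1 t / \<epsilon>)))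
          + (V (R t) * (\<rho> (Suc 2) t / \<epsilon>) + (nonlin (U (R t)) * (\<rho> 1 t / \<epsilon>)) * (\<rho> 2 t / \<epsilon>))
          + G (Suc 2) t) (at t)"
        by (intro DERIV_add DERIV_mult' VR NR \<rho>d G' that)
      moreover have "(nonlin (U (R t)) * ((\<rho> 1 t / \<epsilon>) * (\<rho> (Suc 1) t / \<epsilon>) + (\<rho> (Suc 1) t / \<epsilon>) * (\<rho> 1 t / \<epsilon>))
           + (3 * (U (R t))\<^sup>2 - 1) * (V (R t) * (\<rho> 1 t / \<epsilon>)) * ((\<rho> 1 t / \<epsilon>) * (\<rho> 1 t / \<epsilon>)))
          + (V (R t) * (\<rho> (Suc 2) t / \<epsilon>) + (nonlin (U (R t)) * (\<rho> 1 t / \<epsilon>)) * (\<rho> 2 t / \<epsilon>))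
          + G (Suc 2) t = f3 t"
      proof -
        have e: "\<rho> (Suc 1) t = \<rho> 2 t" "\<rho> (Suc 2) t = \<rho> 3 t" "G (Suc 2) t = G 3 t"
          by (simp_all add: eval_nat_numeral)
        have alg: "N * (x1 * x2 + x2 * x1) + c * (v * x1) * (x1 * x1) + (v * x3 + N * x1 * x2) + g
          = c * v * x1 ^ 3 + 3 * N * (x1 * x2) + v * x3 + g" for N x1 x2 x3 v c g :: real
          by (simp add: eval_nat_numeral algebra_simps)
        have pe: "\<rho> 1 t * \<rho> 2 t / \<epsilon>\<^sup>2 = (\<rho> 1 t / \<epsilon>) * (\<rho> 2 t / \<epsilon>)" by (simp add: power2_eq_square)
        show ?thesis unfolding f3_def e pe by (rule alg)
      qed
      ultimately show ?thesis unfolding f2_def[abs_def] power2_eq_square[of "\<rho> 1 _ / \<epsilon>"] by simp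
    qed
    note ders = higher_derivs_on_open[OF near.open_T \<xi> d0 d1 d2]
    have R\<xi>: "R \<xi> = r \<epsilon> \<xi> x / \<epsilon>" by (simp add: R_def \<rho>_def)
    have \<rho>b: "\<bar>\<rho> l \<xi>\<bar> \<le> B" if "l \<in> {1,2,3}" for l
      using Bb[OF \<xi> that] by (simp add: \<rho>_def dxi_def)
    have Gb: "\<bar>G l \<xi>\<bar> \<le> C * (\<epsilon> / \<epsilon> ^ l)" if "l \<le> 3" for l
      using C(2)[OF \<xi> that] by (simp add: G_def)
    have Vb: "0 < V (R \<xi>)" "V (R \<xi>) \<le> 1"
      using AC_profile_deriv_pos[OF profile] AC_profile_deriv_le_1[OF profile] by (auto simp: V_def)
    have Ub: "\<bar>U (R \<xi>)\<bar> \<le> 1" using AC_profile_ode(2)[OF profile, of "R \<xi>"] by simp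
    then have U2: "(U (R \<xi>))\<^sup>2 \<le> 1" by (simp add: abs_square_le_1)
    have Nb: "\<bar>nonlin (U (R \<xi>))\<bar> \<le> 2 * V (R \<xi>)"
      unfolding V_def by (rule AC_profile_second_deriv_le[OF profile])
    show "\<bar>dxi 1 (u \<epsilon>) \<xi> x - deriv U (r \<epsilon> \<xi> x / \<epsilon>) * dxi 1 (r \<epsilon>) \<xi> x / \<epsilon>\<bar> \<le> K"
    proof -
      have "dxi 1 (u \<epsilon>) \<xi> x - deriv U (r \<epsilon> \<xi> x / \<epsilon>) * dxi 1 (r \<epsilon>) \<xi> x / \<epsilon> = G 1 \<xi>"
      proof -
        have "dxi 1 (u \<epsilon>) \<xi> x = f1 \<xi>" using ders(1) by (simp add: dxi_def)
        moreover have "dxi 1 (r \<epsilon>) \<xi> x = \<rho> 1 \<xi>" by (simp add: \<rho>_def dxi_def)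
        ultimately show ?thesis by (simp add: f1_def R\<xi> V_def)
      qed
      then show ?thesis using Gb[of 1] eps K by simp
    qed
    show "\<bar>dxi 2 (u \<epsilon>) \<xi> x - nonlin (U (r \<epsilon> \<xi> x / \<epsilon>)) * (dxi 1 (r \<epsilon>) \<xi> x)\<^sup>2 / \<epsilon>\<^sup>2\<bar> \<le> K / \<epsilon>"
    proof -
      have "dxi 2 (u \<epsilon>) \<xi> x - nonlin (U (r \<epsilon> \<xi> x / \<epsilon>)) * (dxi 1 (r \<epsilon>) \<xi> x)\<^sup>2 / \<epsilon>\<^sup>2
          = V (R \<xi>) * (\<rho> 2 \<xi> / \<epsilon>) + G 2 \<xi>"
      proof -
        have "dxi 2 (u \<epsilon>) \<xi> x = f2 \<xi>" using ders(2) by (simp add: dxi_def)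
        moreover have "dxi 1 (r \<epsilon>) \<xi> x = \<rho> 1 \<xi>" by (simp add: \<rho>_def dxi_def)
        ultimately show ?thesis by (simp add: f2_def R\<xi> power_divide)
      qed
      moreover have "\<bar>V (R \<xi>) * (\<rho> 2 \<xi> / \<epsilon>)\<bar> \<le> 1 * (B / \<epsilon>)"
        unfolding abs_mult using Vb \<rho>b[of 2] eps by (intro mult_mono) (auto simp: divide_right_mono)
      moreover have "\<bar>G 2 \<xi>\<bar> \<le> C / \<epsilon>" using Gb[of 2] eps by (simp add: power2_eq_square)
      moreover have "B / \<epsilon> + C / \<epsilon> \<le> K / \<epsilon>"
        using K eps by (simp add: add_divide_distrib[symmetric] divide_right_mono)
      ultimately show ?thesis by linarith
    qed
    show "\<bar>dxi 3 (u \<epsilon>) \<xi> x\<bar> \<le> K * (deriv U (r \<epsilon> \<xi> x / \<epsilon>) / \<epsilon> ^ 3 + 1 / \<epsilon>\<^sup>2)"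
    proof -
      let ?v = "V (R \<xi>)"
      have e3: "1 / \<epsilon> \<le> 1 / \<epsilon> ^ 3" "1 / \<epsilon>\<^sup>2 \<le> 1 / \<epsilon> ^ 3"
        using eps power_decreasing[of 1 3 \<epsilon>] power_decreasing[of 2 3 \<epsilon>]
        by (auto intro!: divide_left_mono)
      have "\<bar>(3 * (U (R \<xi>))\<^sup>2 - 1) * ?v * (\<rho> 1 \<xi> / \<epsilon>) ^ 3\<bar> \<le> 2 * ?v * (B / \<epsilon>) ^ 3"
      proof -
        have "\<bar>3 * (U (R \<xi>))\<^sup>2 - 1\<bar> \<le> 2" using U2 zero_le_power2[of "U (R \<xi>)"] by linarith
        moreover have "\<bar>\<rho> 1 \<xi> / \<epsilon>\<bar> ^ 3 \<le> (B / \<epsilon>) ^ 3"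
          using \<rho>b[of 1] eps by (intro power_mono) (auto simp: divide_right_mono)
        ultimately show ?thesis unfolding abs_mult power_abs using Vb by (intro mult_mono) auto
      qed
      moreover have "\<bar>3 * nonlin (U (R \<xi>)) * (\<rho> 1 \<xi> * \<rho> 2 \<xi> / \<epsilon>\<^sup>2)\<bar> \<le> (3 * (2 * ?v)) * (B * B / \<epsilon>\<^sup>2)"
      proof -
        have "\<bar>\<rho> 1 \<xi>\<bar> * \<bar>\<rho> 2 \<xi>\<bar> \<le> B * B" using \<rho>b[of 1] \<rho>b[of 2] B by (intro mult_mono) auto
        then have "\<bar>\<rho> 1 \<xi> * \<rho> 2 \<xi> / \<epsilon>\<^sup>2\<bar> \<le> B * B / \<epsilon>\<^sup>2" by (simp add: abs_mult divide_right_mono)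
        moreover have "\<bar>3 * nonlin (U (R \<xi>))\<bar> \<le> 3 * (2 * ?v)" using Nb by (simp add: abs_mult)
        ultimately show ?thesis unfolding abs_mult[of "3 * _"] using Vb by (intro mult_mono) auto
      qed
      moreover have "\<bar>?v * (\<rho> 3 \<xi> / \<epsilon>)\<bar> \<le> ?v * (B / \<epsilon>)"
        unfolding abs_mult using Vb \<rho>b[of 3] eps by (intro mult_mono) (auto simp: divide_right_mono)
      moreover have "\<bar>G 3 \<xi>\<bar> \<le> C / \<epsilon>\<^sup>2" using Gb[of 3] eps by (simp add: eval_nat_numeral)
      ultimately have "\<bar>f3 \<xi>\<bar> \<le> 2 * ?v * (B / \<epsilon>) ^ 3 + (3 * (2 * ?v)) * (B * B / \<epsilon>\<^sup>2) + ?v * (B / \<epsilon>) + C / \<epsilon>\<^sup>2"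
        unfolding f3_def by linarith
      also have "\<dots> = ?v * (2 * B ^ 3) * (1 / \<epsilon> ^ 3) + ?v * (6 * B\<^sup>2) * (1 / \<epsilon>\<^sup>2) + ?v * B * (1 / \<epsilon>) + C * (1 / \<epsilon>\<^sup>2)"
        by (simp add: power_divide power2_eq_square mult_ac)
      also have "\<dots> \<le> ?v * (2 * B ^ 3) * (1 / \<epsilon> ^ 3) + ?v * (6 * B\<^sup>2) * (1 / \<epsilon> ^ 3) + ?v * B * (1 / \<epsilon> ^ 3) + C * (1 / \<epsilon>\<^sup>2)"
        using e3 Vb B by (intro add_mono mult_left_mono order_refl) auto
      also have "\<dots> = (2 * B ^ 3 + 6 * B\<^sup>2 + B) * (?v / \<epsilon> ^ 3) + C * (1 / \<epsilon>\<^sup>2)"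
        by (simp add: algebra_simps add_divide_distrib)
      also have "\<dots> \<le> K * (?v / \<epsilon> ^ 3) + K * (1 / \<epsilon>\<^sup>2)"
        using K Vb eps C(1) by (intro add_mono mult_right_mono) (auto simp: K_def)
      finally have "\<bar>f3 \<xi>\<bar> \<le> K * (?v / \<epsilon> ^ 3 + 1 / \<epsilon>\<^sup>2)" by (simp only: distrib_left)
      moreover have "dxi 3 (u \<epsilon>) \<xi> x = f3 \<xi>" using ders(3) by (simp add: dxi_def)
      ultimately show ?thesis by (simp add: R\<xi> V_def)
    qed
  qed
qed

text \<open>
  Beyond the cut-off zone the droplet is one of the outer expansions, which depends on \<open>\<xi>\<close> only through its
  terms of order \<open>\<epsilon>\<close>.
\<close>

lemma far_derivative_bounds:
  assumes h: "0 < h" and e2: "\<And>\<epsilon>. 0 < \<epsilon> \<Longrightarrow> \<epsilon> \<le> e2 \<Longrightarrow> 2 * (\<epsilon> * (ln \<epsilon>)\<^sup>2) < h"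
  shows "\<exists>C\<ge>0. \<forall>\<epsilon> x \<xi>. 0 < \<epsilon> \<and> \<epsilon> \<le> \<epsilon>0 \<and> \<epsilon> \<le> exp (-1) \<and> \<epsilon> \<le> e2 \<and> x \<in> D \<and> h < \<bar>r \<epsilon> \<xi> x\<bar> \<longrightarrow>
     (\<forall>l\<in>{1..3}. \<bar>dxi l (u \<epsilon>) \<xi> x\<bar> \<le> C * (\<epsilon> / \<epsilon> ^ l))"
proof -
  \<comment> \<open>the sign \<open>c\<close> selects the side of \<open>\<Gamma>\<close>, and is also the limit of the profile there\<close>
  have *: "\<exists>C\<ge>0. \<forall>\<epsilon> x \<xi>. 0 < \<epsilon> \<and> \<epsilon> \<le> \<epsilon>0 \<and> \<epsilon> \<le> exp (-1) \<and> \<epsilon> \<le> e2 \<and> x \<in> D \<and> h < c * r \<epsilon> \<xi> x \<longrightarrow>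
     (\<forall>l\<in>{1..3}. \<bar>dxi l (u \<epsilon>) \<xi> x\<bar> \<le> C * (\<epsilon> / \<epsilon> ^ l))"
    if c: "c \<in> {1, -1}" and uc: "\<And>j. j \<le> J \<Longrightarrow> smooth_bounded {0<..\<epsilon>0} (\<lambda>\<epsilon>. D \<times> UNIV) (uc j)"
      and cpm: "uc = (if c = 1 then up else um)" for c :: real and uc
  proof -
    define T where "T = (\<lambda>(\<epsilon>, x). if 0 < \<epsilon> \<and> \<epsilon> \<le> \<epsilon>0 \<and> \<epsilon> \<le> exp (-1) \<and> \<epsilon> \<le> e2 \<and> x \<in> D
        then {\<xi>. h < c * r \<epsilon> \<xi> x} else {})"
    interpret T: scale_family T
    proof
      show "open (T i)" for i
      proof (cases i)
        case (Pair \<epsilon> x)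
        show ?thesis
          unfolding T_def Pair by (auto intro!: open_Collect_less continuous_intros r_continuous_xi)
      qed
    qed (auto simp: T_def split: if_splits)
    have TD: "0 < fst i" "fst i \<le> \<epsilon>0" "snd i \<in> D" "fst i \<le> e2" "h < c * r (fst i) t (snd i)" if "t \<in> T i" for i t
      using that by (auto simp: T_def split: if_splits prod.splits)
    have T0: "fst i \<in> {0<..\<epsilon>0}" if "T i \<noteq> {}" for i using that TD(1,2) by fastforce
    have "T.bdd (\<lambda>i t. \<Sum>j\<le>J. fst i ^ j * uc j (fst i) (snd i, t))"
    proof (rule T.bdd_sum[OF finite_atMost])
      fix j assume "j \<in> {..J}"
      then have j: "j \<le> J" by simp
      have "T.bdd (\<lambda>i t. uc j (fst i) (snd i, t))"
        by (rule T.bdd_compose_smooth_param[OF uc[OF j] T0]) (use TD(3) in auto)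
      then show "T.bdd (\<lambda>i t. fst i ^ j * uc j (fst i) (snd i, t))"
        by (intro T.bdd_mult T.bdd_eps_power)
    qed
    from T.sml_eps_mult[OF this]
    have sm: "T.sml (\<lambda>i t. u (fst i) t (snd i) - c)"
    proof (rule T.sml_cong)
      fix i t assume t: "t \<in> T i"
      let ?\<rho> = "r (fst i) t (snd i)" and ?h = "fst i * (ln (fst i))\<^sup>2"
      have L: "1 \<le> (ln (fst i))\<^sup>2" using t by (intro T.log_sq_ge_1) auto
      have hp: "0 < ?h" using L TD(1)[OF t] by (intro mult_pos_pos) linarith+
      have "2 * ?h < c * ?\<rho>" using e2[OF TD(1,4)[OF t]] TD(5)[OF t] by linarith
      then have g: "c * ?\<rho> / ?h - 1 > 1" using hp by (simp add: less_divide_eq)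
      then have z: "\<zeta> (c * ?\<rho> / ?h - 1) = 1" "\<zeta> (- (c * ?\<rho>) / ?h - 1) = 0"
        using cutoff unfolding cutoff_def by auto
      show "fst i * (\<Sum>j\<le>J. fst i ^ j * uc j (fst i) (snd i, t)) = u (fst i) t (snd i) - c"
        unfolding u_expansion[OF TD(1-3)[OF t]] using c z by (auto simp: cpm)
    qed
    obtain C where C: "C \<ge> 0" "\<And>i t l. t \<in> T i \<Longrightarrow> l \<le> 3 \<Longrightarrow>
        \<bar>(deriv ^^ l) (\<lambda>t. u (fst i) t (snd i) - c) t\<bar> \<le> C * (fst i / fst i ^ l)"
      using T.sml_derivative_bounds[OF sm, of 3] by blast
    show ?thesis
    proof (intro exI[of _ C] conjI allI impI ballI C(1))
      fix \<epsilon> x \<xi> l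
      assume A: "0 < \<epsilon> \<and> \<epsilon> \<le> \<epsilon>0 \<and> \<epsilon> \<le> exp (-1) \<and> \<epsilon> \<le> e2 \<and> x \<in> D \<and> h < c * r \<epsilon> \<xi> x" and l: "l \<in> {1..3::nat}"
      have "\<xi> \<in> T (\<epsilon>, x)" using A by (simp add: T_def)
      from C(2)[OF this, of l] show "\<bar>dxi l (u \<epsilon>) \<xi> x\<bar> \<le> C * (\<epsilon> / \<epsilon> ^ l)"
        using l by (simp add: dxi_def higher_deriv_diff_const)
    qed
  qed
  obtain C1 where C1: "C1 \<ge> 0" "\<And>\<epsilon> x \<xi> l. 0 < \<epsilon> \<and> \<epsilon> \<le> \<epsilon>0 \<and> \<epsilon> \<le> exp (-1) \<and> \<epsilon> \<le> e2 \<and> x \<in> D \<and> h < 1 * r \<epsilon> \<xi> x \<Longrightarrow>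
     l\<in>{1..3} \<Longrightarrow> \<bar>dxi l (u \<epsilon>) \<xi> x\<bar> \<le> C1 * (\<epsilon> / \<epsilon> ^ l)"
    using *[of 1 up] expansionD(4) by auto
  obtain C2 where C2: "C2 \<ge> 0" "\<And>\<epsilon> x \<xi> l. 0 < \<epsilon> \<and> \<epsilon> \<le> \<epsilon>0 \<and> \<epsilon> \<le> exp (-1) \<and> \<epsilon> \<le> e2 \<and> x \<in> D \<and> h < -1 * r \<epsilon> \<xi> x \<Longrightarrow>
     l\<in>{1..3} \<Longrightarrow> \<bar>dxi l (u \<epsilon>) \<xi> x\<bar> \<le> C2 * (\<epsilon> / \<epsilon> ^ l)"
    using *[of "-1" um] expansionD(5) by auto
  show ?thesis
  proof (intro exI[of _ "C1 + C2"] conjI allI impI ballI)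
    fix \<epsilon> x \<xi> l
    assume A: "0 < \<epsilon> \<and> \<epsilon> \<le> \<epsilon>0 \<and> \<epsilon> \<le> exp (-1) \<and> \<epsilon> \<le> e2 \<and> x \<in> D \<and> h < \<bar>r \<epsilon> \<xi> x\<bar>" and l: "l \<in> {1..3::nat}"
    have nn: "0 \<le> \<epsilon> / \<epsilon> ^ l" using A by simp
    have "0 \<le> C1 * (\<epsilon> / \<epsilon> ^ l)" "0 \<le> C2 * (\<epsilon> / \<epsilon> ^ l)"
      by (rule mult_nonneg_nonneg[OF C1(1) nn], rule mult_nonneg_nonneg[OF C2(1) nn])
    moreover have "\<bar>dxi l (u \<epsilon>) \<xi> x\<bar> \<le> C1 * (\<epsilon> / \<epsilon> ^ l) \<or> \<bar>dxi l (u \<epsilon>) \<xi> x\<bar> \<le> C2 * (\<epsilon> / \<epsilon> ^ l)"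
    proof (cases "0 \<le> r \<epsilon> \<xi> x")
      case True
      then show ?thesis using C1(2)[of \<epsilon> x \<xi> l] A l by auto
    next
      case False
      then show ?thesis using C2(2)[of \<epsilon> x \<xi> l] A l by auto
    qed
    ultimately show "\<bar>dxi l (u \<epsilon>) \<xi> x\<bar> \<le> (C1 + C2) * (\<epsilon> / \<epsilon> ^ l)"
      unfolding distrib_right by linarith
  qed (use C1 C2 in simp)
qed

end

section \<open>Integration in normal coordinates\<close>

text \<open>
  The measure-preserving identification of pairs of coordinates, on which Fubini's theorem is used, with points
  of the plane, on which the change of variables is performed.
\<close>
definition vec2 :: "real \<times> real \<Rightarrow> real^2" where
  "vec2 z = (\<chi> i. if i = 1 then fst z else snd z)"

lemma vec2_nth [simp]: "vec2 z $ 1 = fst z" "vec2 z $ 2 = snd z"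
  by (simp_all add: vec2_def)

lemma continuous_on_vec2: "continuous_on S vec2"
  unfolding vec2_def[abs_def]
proof (rule continuous_on_vec_lambda)
  show "continuous_on S (\<lambda>z. if i = 1 then fst z else snd z)" for i :: 2
    by (cases "i = 1") (auto intro!: continuous_intros)
qed

lemma vec2_measurable [measurable]: "vec2 \<in> borel_measurable borel"
  by (rule borel_measurable_continuous_onI) (rule continuous_on_vec2)

lemma Basis_real2: "(Basis :: (real^2) set) = {axis 1 1, axis 2 1}"
  by (auto simp: Basis_vec_def UNIV_2)

lemma box_real_pair: "box (a, b) (c, d) = {a<..<c} \<times> {b<..<d}" for a b c d :: real
  by (auto simp: box_def Basis_prod_def)

lemma lborel_vec2: "distr lborel borel vec2 = lborel"
proof (rule lborel_eqI[symmetric])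
  fix l u :: "real^2"
  assume le: "\<And>b. b \<in> Basis \<Longrightarrow> l \<bullet> b \<le> u \<bullet> b"
  have ax: "axis (1::2) (1::real) \<noteq> axis 2 1" by (simp add: axis_eq_axis)
  have le2: "l $ 1 \<le> u $ 1" "l $ 2 \<le> u $ 2"
    using le[of "axis 1 1"] le[of "axis 2 1"] by (auto simp: Basis_real2 inner_axis)
  have pre: "vec2 -` box l u = box (l $ 1, l $ 2) (u $ 1, u $ 2)"
    by (auto simp: mem_box_cart forall_2 box_real_pair)
  have "emeasure (distr lborel borel vec2) (box l u) = emeasure lborel (box (l $ 1, l $ 2) (u $ 1, u $ 2))"
    by (subst emeasure_distr) (auto simp: pre)
  also have "\<dots> = emeasure (lborel \<Otimes>\<^sub>M lborel) ({l $ 1<..<u $ 1} \<times> {l $ 2<..<u $ 2})"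
    by (simp add: lborel_prod box_real_pair)
  also have "\<dots> = ennreal (u $ 1 - l $ 1) * ennreal (u $ 2 - l $ 2)"
    using le2 by (subst lborel.emeasure_pair_measure_Times) auto
  also have "\<dots> = (\<Prod>b\<in>Basis. (u - l) \<bullet> b)"
    using ax le2 by (simp add: Basis_real2 inner_axis ennreal_mult)
  finally show "emeasure (distr lborel borel vec2) (box l u) = (\<Prod>b\<in>Basis. (u - l) \<bullet> b)" .
qed simp

lemma integral_lborel_vec2:
  fixes f :: "real^2 \<Rightarrow> real"
  assumes [measurable]: "f \<in> borel_measurable borel"
  shows "integrable lborel (\<lambda>z. f (vec2 z)) \<longleftrightarrow> integrable lborel f"
    and "(LINT z|lborel. f (vec2 z)) = (LINT x|lborel. f x)"
proof -
  have "integrable (distr lborel borel vec2) f \<longleftrightarrow> integrable lborel (\<lambda>z. f (vec2 z))"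
    by (rule integrable_distr_eq) auto
  then show "integrable lborel (\<lambda>z. f (vec2 z)) \<longleftrightarrow> integrable lborel f" by (simp add: lborel_vec2)
  have "(LINT x|distr lborel borel vec2. f x) = (LINT z|lborel. f (vec2 z))"
    by (rule integral_distr) auto
  then show "(LINT z|lborel. f (vec2 z)) = (LINT x|lborel. f x)" by (simp add: lborel_vec2)
qed

lemma orthonormal_det:
  fixes a b :: "real^2"
  assumes "norm a = 1" "norm b = 1" "a \<bullet> b = 0"
  shows "\<bar>a $ 1 * b $ 2 - a $ 2 * b $ 1\<bar> = 1"
proof -
  have n: "(a $ 1)\<^sup>2 + (a $ 2)\<^sup>2 = 1" "(b $ 1)\<^sup>2 + (b $ 2)\<^sup>2 = 1" "a $ 1 * b $ 1 + a $ 2 * b $ 2 = 0"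
    using assms by (auto simp: norm_eq_1 inner_vec_def sum_2 power2_eq_square)
  have "(a $ 1 * b $ 2 - a $ 2 * b $ 1)\<^sup>2
      = ((a $ 1)\<^sup>2 + (a $ 2)\<^sup>2) * ((b $ 1)\<^sup>2 + (b $ 2)\<^sup>2) - (a $ 1 * b $ 1 + a $ 2 * b $ 2)\<^sup>2"
    by (simp add: power2_eq_square algebra_simps)
  then have "(a $ 1 * b $ 2 - a $ 2 * b $ 1)\<^sup>2 = 1" using n by simp
  then have "a $ 1 * b $ 2 - a $ 2 * b $ 1 = 1 \<or> a $ 1 * b $ 2 - a $ 2 * b $ 1 = - 1"
    by (simp only: power2_eq_1_iff)
  then show ?thesis by (elim disjE) (simp_all only: abs_one abs_minus_cancel)
qed

lemma orthonormal_expansion: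
  fixes a b h :: "real^2"
  assumes "norm a = 1" "norm b = 1" "a \<bullet> b = 0"
  shows "h = (h \<bullet> a) *\<^sub>R a + (h \<bullet> b) *\<^sub>R b"
proof -
  let ?d = "a $ 1 * b $ 2 - a $ 2 * b $ 1"
  have n: "(a $ 1)\<^sup>2 + (a $ 2)\<^sup>2 = 1" "(b $ 1)\<^sup>2 + (b $ 2)\<^sup>2 = 1" "a $ 1 * b $ 1 + a $ 2 * b $ 2 = 0"
    using assms by (auto simp: norm_eq_1 inner_vec_def sum_2 power2_eq_square)
  define w where "w = h - ((h \<bullet> a) *\<^sub>R a + (h \<bullet> b) *\<^sub>R b)"
  have "w \<bullet> a = 0" "w \<bullet> b = 0"
    using assms by (simp_all add: w_def inner_diff_left inner_add_left inner_commute[of b a] norm_eq_1)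
  then have o: "w $ 1 * a $ 1 + w $ 2 * a $ 2 = 0" "w $ 1 * b $ 1 + w $ 2 * b $ 2 = 0"
    by (auto simp: inner_vec_def sum_2)
  have "w $ 1 * ?d = b $ 2 * (w $ 1 * a $ 1 + w $ 2 * a $ 2) - a $ 2 * (w $ 1 * b $ 1 + w $ 2 * b $ 2)"
    "w $ 2 * ?d = a $ 1 * (w $ 1 * b $ 1 + w $ 2 * b $ 2) - b $ 1 * (w $ 1 * a $ 1 + w $ 2 * a $ 2)"
    by (simp_all add: algebra_simps)
  then have wd: "w $ 1 * ?d = 0" "w $ 2 * ?d = 0" by (simp_all only: o mult_zero_right diff_self)
  have "?d \<noteq> 0" using orthonormal_det[OF assms] by auto
  with wd have "w $ 1 = 0" "w $ 2 = 0" by (simp_all only: mult_eq_0_iff) blast+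
  then have "w = 0" by (simp add: vec_eq_iff forall_2)
  then show ?thesis by (simp add: w_def)
qed

text \<open>Because \<open>\<nu>' = k g'\<close>, the differential of \<open>\<Phi>\<close> maps the coordinate vectors to the orthogonal vectors \<open>\<nu>\<close> and
  \<open>(1 + \<rho> k) g'\<close>, whence the Jacobian \<open>1 + \<rho> k\<close>.\<close>
lemma normal_coordinates_integral:
  fixes g \<nu> g' \<nu>' :: "real \<Rightarrow> real^2" and k :: "real \<Rightarrow> real" and S :: "(real \<times> real) set"
    and f :: "real^2 \<Rightarrow> real"
  defines "\<Phi> \<equiv> \<lambda>z. g (snd z) + fst z *\<^sub>R \<nu> (snd z)"
  assumes S: "open S"
    and g: "\<And>z. z \<in> S \<Longrightarrow> (g has_vector_derivative g' (snd z)) (at (snd z))"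
    and \<nu>: "\<And>z. z \<in> S \<Longrightarrow> (\<nu> has_vector_derivative k (snd z) *\<^sub>R g' (snd z)) (at (snd z))"
    and orth: "\<And>z. z \<in> S \<Longrightarrow> norm (g' (snd z)) = 1" "\<And>z. z \<in> S \<Longrightarrow> norm (\<nu> (snd z)) = 1"
      "\<And>z. z \<in> S \<Longrightarrow> \<nu> (snd z) \<bullet> g' (snd z) = 0"
    and jac: "\<And>z. z \<in> S \<Longrightarrow> 0 \<le> 1 + fst z * k (snd z)"
    and inj: "inj_on \<Phi> S" and k: "continuous_on S (\<lambda>z. k (snd z))"
    and f: "continuous_on (\<Phi> ` S) f" and int: "set_integrable lebesgue (\<Phi> ` S) f"
  shows "integrable lborel (\<lambda>z. indicator S z * ((1 + fst z * k (snd z)) * f (\<Phi> z)))"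
    and "(LINT x:\<Phi> ` S|lebesgue. f x) = (LINT z|lborel. indicator S z * ((1 + fst z * k (snd z)) * f (\<Phi> z)))"
proof -
  define P where "P = (\<lambda>y::real^2. (y $ 1, y $ 2))"
  define S2 where "S2 = P -` S"
  have Pv: "P (vec2 z) = z" for z by (simp add: P_def)
  have contP: "continuous_on UNIV P" unfolding P_def by (intro continuous_intros)
  then have S2: "open S2" unfolding S2_def using S by (simp add: open_vimage)
  have img: "(\<lambda>y. \<Phi> (P y)) ` S2 = \<Phi> ` S"
    unfolding S2_def using Pv by (force simp: image_iff)
  define G' where "G' y h = (h $ 1) *\<^sub>R \<nu> (y $ 2) + (h $ 2) *\<^sub>R ((1 + y $ 1 * k (y $ 2)) *\<^sub>R g' (y $ 2))"
    for y h :: "real^2"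
  have der: "((\<lambda>y. \<Phi> (P y)) has_derivative G' y) (at y within S2)" if y: "y \<in> S2" for y
  proof -
    have yS: "P y \<in> S" using y by (simp add: S2_def)
    have n2: "((\<lambda>y::real^2. y $ 2) has_derivative (\<lambda>h. h $ 2)) (at y)"
      and n1: "((\<lambda>y::real^2. y $ 1) has_derivative (\<lambda>h. h $ 1)) (at y)"
      by (auto intro!: bounded_linear_imp_has_derivative bounded_linear_vec_nth)
    have "(g has_derivative (\<lambda>t. t *\<^sub>R g' (y $ 2))) (at (y $ 2))"
      using g[OF yS] by (simp add: P_def has_vector_derivative_def)
    from diff_chain_at[OF n2 this]
    have g2: "((\<lambda>y. g (y $ 2)) has_derivative (\<lambda>h. h $ 2 *\<^sub>R g' (y $ 2))) (at y)" by (simp add: o_def)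
    have "(\<nu> has_derivative (\<lambda>t. t *\<^sub>R (k (y $ 2) *\<^sub>R g' (y $ 2)))) (at (y $ 2))"
      using \<nu>[OF yS] by (simp add: P_def has_vector_derivative_def)
    from diff_chain_at[OF n2 this]
    have \<nu>2: "((\<lambda>y. \<nu> (y $ 2)) has_derivative (\<lambda>h. h $ 2 *\<^sub>R (k (y $ 2) *\<^sub>R g' (y $ 2)))) (at y)"
      by (simp add: o_def)
    have "((\<lambda>y. g (y $ 2) + y $ 1 *\<^sub>R \<nu> (y $ 2)) has_derivative
       (\<lambda>h. h $ 2 *\<^sub>R g' (y $ 2) + (y $ 1 *\<^sub>R (h $ 2 *\<^sub>R (k (y $ 2) *\<^sub>R g' (y $ 2))) + h $ 1 *\<^sub>R \<nu> (y $ 2)))) (at y)"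
      by (intro has_derivative_add has_derivative_scaleR g2 \<nu>2 n1)
    moreover have "(\<lambda>h. h $ 2 *\<^sub>R g' (y $ 2) + (y $ 1 *\<^sub>R (h $ 2 *\<^sub>R (k (y $ 2) *\<^sub>R g' (y $ 2))) + h $ 1 *\<^sub>R \<nu> (y $ 2))) = G' y"
      by (auto simp: G'_def fun_eq_iff scaleR_add_left algebra_simps)
    ultimately have "((\<lambda>y. \<Phi> (P y)) has_derivative G' y) (at y)"
      by (simp add: \<Phi>_def P_def)
    then show ?thesis by (rule has_derivative_at_withinI)
  qed
  have det: "\<bar>det (matrix (G' y))\<bar> = 1 + y $ 1 * k (y $ 2)" if y: "y \<in> S2" for y
  proof -
    have yS: "P y \<in> S" using y by (simp add: S2_def)
    let ?c = "1 + y $ 1 * k (y $ 2)" and ?n = "\<nu> (y $ 2)" and ?g = "g' (y $ 2)"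
    have "det (matrix (G' y)) = ?c * (?n $ 1 * ?g $ 2 - ?n $ 2 * ?g $ 1)"
      by (simp add: det_2 matrix_def G'_def axis_def algebra_simps)
    moreover have "\<bar>?n $ 1 * ?g $ 2 - ?n $ 2 * ?g $ 1\<bar> = 1"
      by (rule orthonormal_det) (use orth[OF yS] in \<open>auto simp: P_def\<close>)
    moreover have "0 \<le> ?c" using jac[OF yS] by (simp add: P_def)
    ultimately show ?thesis by (simp add: abs_mult)
  qed
  have inj2: "inj_on (\<lambda>y. \<Phi> (P y)) S2"
  proof (rule inj_onI)
    fix x y assume "x \<in> S2" "y \<in> S2" "\<Phi> (P x) = \<Phi> (P y)"
    then have "P x = P y" using inj by (auto simp: S2_def dest: inj_onD)
    then show "x = y" by (simp add: P_def vec_eq_iff forall_2)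
  qed
  have Sm: "S2 \<in> sets lebesgue" using S2 by (rule lebesgue_openin[of UNIV, simplified])
  let ?F = "\<lambda>y. (1 + y $ 1 * k (y $ 2)) * f (\<Phi> (P y))"
  have "(\<lambda>y. \<bar>det (matrix (G' y))\<bar> *\<^sub>R vec (f (\<Phi> (P y))) :: real ^ 1) absolutely_integrable_on S2 \<and>
      integral S2 (\<lambda>y. \<bar>det (matrix (G' y))\<bar> *\<^sub>R vec (f (\<Phi> (P y)))) = (vec b :: real ^ 1)
    \<longleftrightarrow> (\<lambda>x. vec (f x) :: real ^ 1) absolutely_integrable_on ((\<lambda>y. \<Phi> (P y)) ` S2) \<and>
      integral ((\<lambda>y. \<Phi> (P y)) ` S2) (\<lambda>x. vec (f x)) = (vec b :: real ^ 1)" for b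
    by (intro has_absolute_integral_change_of_variables Sm der inj2)
  then have cov: "(\<lambda>y. \<bar>det (matrix (G' y))\<bar> * f (\<Phi> (P y))) absolutely_integrable_on S2 \<and>
      integral S2 (\<lambda>y. \<bar>det (matrix (G' y))\<bar> * f (\<Phi> (P y))) = b
    \<longleftrightarrow> f absolutely_integrable_on (\<Phi> ` S) \<and> integral (\<Phi> ` S) f = b" for b
    by (simp add: absolutely_integrable_on_1_iff integral_on_1_eq img)
  from cov[of "integral (\<Phi> ` S) f"] int
  have ai: "(\<lambda>y. \<bar>det (matrix (G' y))\<bar> * f (\<Phi> (P y))) absolutely_integrable_on S2"
    and eq: "integral S2 (\<lambda>y. \<bar>det (matrix (G' y))\<bar> * f (\<Phi> (P y))) = integral (\<Phi> ` S) f" by auto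
  have aiF: "set_integrable lebesgue S2 ?F"
    using ai by (rule set_integrable_cong[THEN iffD1, rotated 3]) (auto simp: det)
  have eqF: "integral S2 ?F = integral (\<Phi> ` S) f"
    unfolding eq[symmetric] by (rule integral_cong) (simp add: det)
  have contF: "continuous_on S2 ?F"
  proof (intro continuous_intros)
    have PS: "continuous_on S2 P" "P ` S2 \<subseteq> S" using contP by (auto simp: S2_def intro: continuous_on_subset)
    have "continuous_on S2 (\<lambda>y. k (snd (P y)))"
      by (rule continuous_on_compose2[OF k PS])
    then show "continuous_on S2 (\<lambda>y. k (y $ 2))" by (simp add: P_def)
    have "continuous_on S2 (\<lambda>y. \<Phi> (P y))"
      using der by (meson has_derivative_continuous continuous_on_eq_continuous_within)
    then show "continuous_on S2 (\<lambda>y. f (\<Phi> (P y)))"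
      by (rule continuous_on_compose2[OF f]) (auto simp: S2_def)
  qed
  let ?G = "\<lambda>y. indicator S2 y *\<^sub>R ?F y"
  have mG: "?G \<in> borel_measurable borel"
    using S2 contF by (intro borel_measurable_continuous_on_indicator) auto
  have iG: "integrable lborel ?G"
    using aiF mG unfolding set_integrable_def by (simp add: integrable_completion)
  have vG: "?G (vec2 z) = indicator S z * ((1 + fst z * k (snd z)) * f (\<Phi> z))" for z
    by (simp add: Pv S2_def indicator_def)
  show "integrable lborel (\<lambda>z. indicator S z * ((1 + fst z * k (snd z)) * f (\<Phi> z)))"
    using integral_lborel_vec2(1)[OF mG] iG unfolding vG by blast
  have "(LINT x:\<Phi> ` S|lebesgue. f x) = integral (\<Phi> ` S) f"
    by (rule set_lebesgue_integral_eq_integral(2)[OF int])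
  also have "\<dots> = (LINT y:S2|lebesgue. ?F y)"
    unfolding eqF[symmetric] by (rule set_lebesgue_integral_eq_integral(2)[OF aiF, symmetric])
  also have "\<dots> = (LINT y|lborel. ?G y)"
    unfolding set_lebesgue_integral_def using mG by (simp add: integral_completion)
  also have "\<dots> = (LINT z|lborel. indicator S z * ((1 + fst z * k (snd z)) * f (\<Phi> z)))"
    using integral_lborel_vec2(2)[OF mG] unfolding vG by simp
  finally show "(LINT x:\<Phi> ` S|lebesgue. f x)
      = (LINT z|lborel. indicator S z * ((1 + fst z * k (snd z)) * f (\<Phi> z)))" .
qed

text \<open>Fubini: the section of the strip above \<open>\<rho>\<close> is an interval of length \<open>2 h \<rho>\<close>.\<close>
lemma strip_integral:
  fixes F h :: "real \<Rightarrow> real"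
  assumes [measurable]: "F \<in> borel_measurable borel" "h \<in> borel_measurable borel"
    and h: "\<And>x. 0 \<le> h x" and int: "integrable lborel (\<lambda>x. F x * (2 * h x))"
  shows "integrable lborel (\<lambda>z. F (fst z) * (if \<bar>snd z - c\<bar> \<le> h (fst z) then 1 else 0))" (is "integrable _ ?f")
    and "(LINT z|lborel. F (fst z) * (if \<bar>snd z - c\<bar> \<le> h (fst z) then 1 else 0)) = (LINT x|lborel. F x * (2 * h x))"
proof -
  have ind: "(if \<bar>y - c\<bar> \<le> h x then 1 else 0) = (indicator {c - h x..c + h x} y :: real)" for x y
    by (auto simp: indicator_def abs_le_iff)
  have in1: "integrable lborel (\<lambda>y. C * (if \<bar>y - c\<bar> \<le> h x then 1 else 0))" for x and C :: real
    unfolding ind by (intro integrable_mult_right) (auto simp: emeasure_lborel_Icc_eq)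
  have in2: "(LINT y|lborel. C * (if \<bar>y - c\<bar> \<le> h x then 1 else 0)) = C * (2 * h x)" for x and C :: real
    unfolding ind using h[of x] by simp
  have m: "?f \<in> borel_measurable (lborel \<Otimes>\<^sub>M lborel)" by measurable
  have i: "integrable (lborel \<Otimes>\<^sub>M lborel) ?f"
  proof (rule lborel_pair.Fubini_integrable[OF m])
    have "(LINT y|lborel. norm (?f (x, y))) = norm (F x * (2 * h x))" for x
    proof -
      have "(LINT y|lborel. norm (?f (x, y))) = (LINT y|lborel. \<bar>F x\<bar> * (if \<bar>y - c\<bar> \<le> h x then 1 else 0))"
        by (rule Bochner_Integration.integral_cong) (auto simp: abs_mult)
      then show ?thesis using h[of x] by (simp only: in2) (simp add: abs_mult)
    qed
    then show "integrable lborel (\<lambda>x. LINT y|lborel. norm (?f (x, y)))"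
      using integrable_norm[OF int] by simp
    show "AE x in lborel. integrable lborel (\<lambda>y. ?f (x, y))" using in1 by simp
  qed
  then show "integrable lborel ?f" by (simp add: lborel_prod)
  have "(LINT z|(lborel \<Otimes>\<^sub>M lborel). ?f z) = (LINT x|lborel. LINT y|lborel. ?f (x, y))"
    by (rule lborel_pair.integral_fst'[OF i, symmetric])
  also have "\<dots> = (LINT x|lborel. F x * (2 * h x))" by (simp only: in2 fst_conv snd_conv)
  finally show "(LINT z|lborel. ?f z) = (LINT x|lborel. F x * (2 * h x))" by (simp add: lborel_prod)
qed

section \<open>One-dimensional integrals of the profile\<close>

lemma profile_continuous:
  assumes "AC_profile U"
  shows "continuous_on S U" "continuous_on S (deriv U)"
  using assms unfolding AC_profile_def by (blast intro: continuous_at_imp_continuous_on DERIV_isCont)+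

lemma profile_scaled_continuous:
  assumes "AC_profile U"
  shows "continuous_on S (\<lambda>\<rho>. U (\<rho> / \<epsilon>))" "continuous_on S (\<lambda>\<rho>. deriv U (\<rho> / \<epsilon>))"
  by (rule continuous_on_compose2[OF profile_continuous(1)[OF assms, of UNIV]],
      auto simp: divide_inverse intro!: continuous_intros)
    (rule continuous_on_compose2[OF profile_continuous(2)[OF assms, of UNIV]],
      auto simp: divide_inverse intro!: continuous_intros)

text \<open>The integral is \<open>\<epsilon> (U (b / \<epsilon>) - U (- b / \<epsilon>))\<close>, and \<open>\<bar>U\<bar> < 1\<close>.\<close>
lemma profile_integral:
  assumes prof: "AC_profile U" and e: "0 < \<epsilon>" and b: "0 < b"
  shows "integrable lborel (\<lambda>\<rho>. indicator {-b..b} \<rho> * deriv U (\<rho> / \<epsilon>))"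
    and "(LINT \<rho>|lborel. indicator {-b..b} \<rho> * deriv U (\<rho> / \<epsilon>)) \<le> 2 * \<epsilon>"
proof -
  show "integrable lborel (\<lambda>\<rho>. indicator {-b..b} \<rho> * deriv U (\<rho> / \<epsilon>))"
    using borel_integrable_atLeastAtMost'[OF profile_scaled_continuous(2)[OF prof]]
    by (simp add: set_integrable_def)
  have U: "(U has_real_derivative deriv U R) (at R)" for R using prof by (simp add: AC_profile_def)
  have "((\<lambda>\<rho>. \<epsilon> * U (\<rho> / \<epsilon>)) has_real_derivative deriv U (\<rho> / \<epsilon>)) (at \<rho>)" for \<rho>
  proof -
    have "((\<lambda>\<rho>. U (\<rho> / \<epsilon>)) has_real_derivative deriv U (\<rho> / \<epsilon>) * (1 / \<epsilon>)) (at \<rho>)"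
      by (rule DERIV_chain2[OF U]) (use e in \<open>auto intro!: derivative_eq_intros\<close>)
    from DERIV_cmult[OF this, of \<epsilon>] show ?thesis using e by simp
  qed
  then have "(LINT \<rho>|lborel. indicator {-b..b} \<rho> *\<^sub>R deriv U (\<rho> / \<epsilon>)) = \<epsilon> * U (b / \<epsilon>) - \<epsilon> * U (- b / \<epsilon>)"
    using b by (intro integral_FTC_atLeastAtMost profile_scaled_continuous(2)[OF prof])
      (auto simp: has_real_derivative_iff_has_vector_derivative intro: has_vector_derivative_at_within)
  also have "\<dots> = \<epsilon> * (U (b / \<epsilon>) - U (- b / \<epsilon>))" by (simp add: right_diff_distrib)
  also have "\<dots> \<le> \<epsilon> * 2"
    using e AC_profile_ode(2)[OF prof, of "b / \<epsilon>"] AC_profile_ode(2)[OF prof, of "- b / \<epsilon>"]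
    by (intro mult_left_mono) auto
  finally show "(LINT \<rho>|lborel. indicator {-b..b} \<rho> * deriv U (\<rho> / \<epsilon>)) \<le> 2 * \<epsilon>" by simp
qed

lemma profile_first_moment:
  assumes prof: "AC_profile U"
  shows "\<exists>C\<ge>0. \<forall>\<epsilon>>0. integrable lborel (\<lambda>\<rho>. \<bar>\<rho>\<bar> * (deriv U (\<rho> / \<epsilon>))\<^sup>2) \<and>
     (LINT \<rho>|lborel. \<bar>\<rho>\<bar> * (deriv U (\<rho> / \<epsilon>))\<^sup>2) \<le> C * \<epsilon>\<^sup>2"
proof -
  let ?f = "\<lambda>R. \<bar>R\<bar> * (deriv U R)\<^sup>2"
  have "integrable lborel (\<lambda>R. R * (deriv U R)\<^sup>2)" using prof by (simp add: AC_profile_def)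
  from integrable_norm[OF this] have f: "integrable lborel ?f" by (simp add: abs_mult)
  have "integrable lborel (\<lambda>\<rho>. \<bar>\<rho>\<bar> * (deriv U (\<rho> / \<epsilon>))\<^sup>2) \<and>
     (LINT \<rho>|lborel. \<bar>\<rho>\<bar> * (deriv U (\<rho> / \<epsilon>))\<^sup>2) = (LINT R|lborel. ?f R) * \<epsilon>\<^sup>2" if e: "0 < \<epsilon>" for \<epsilon>
  proof
    have eq: "\<bar>\<rho>\<bar> * (deriv U (\<rho> / \<epsilon>))\<^sup>2 = \<epsilon> * ?f (0 + 1 / \<epsilon> * \<rho>)" for \<rho>
      using e by (simp add: abs_mult)
    show "integrable lborel (\<lambda>\<rho>. \<bar>\<rho>\<bar> * (deriv U (\<rho> / \<epsilon>))\<^sup>2)"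
      unfolding eq by (rule integrable_mult_right, rule lborel_integrable_real_affine[OF f]) (use e in simp)
    have "(LINT R|lborel. ?f R) = \<bar>1 / \<epsilon>\<bar> *\<^sub>R (LINT \<rho>|lborel. ?f (0 + 1 / \<epsilon> * \<rho>))"
      by (rule lborel_integral_real_affine) (use e in simp)
    then show "(LINT \<rho>|lborel. \<bar>\<rho>\<bar> * (deriv U (\<rho> / \<epsilon>))\<^sup>2) = (LINT R|lborel. ?f R) * \<epsilon>\<^sup>2"
      unfolding eq using e by (simp add: power2_eq_square)
  qed
  then show ?thesis by (intro exI[of _ "LINT R|lborel. ?f R"]) auto
qed

text \<open>The integrand is the derivative of \<open>\<epsilon> U' (\<rho> / \<epsilon>)\<^sup>2 / 2\<close>, so only boundary terms remain, and \<open>U'\<close> has decayed to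
  \<open>O(\<epsilon> / b)\<close> at \<open>\<rho> = \<plusminus>b\<close>.\<close>
lemma profile_product_integral:
  assumes prof: "AC_profile U"
  shows "\<exists>C\<ge>0. \<forall>\<epsilon>>0. \<forall>b>0.
     \<bar>LINT \<rho>|lborel. indicator {-b..b} \<rho> * (deriv U (\<rho> / \<epsilon>) * nonlin (U (\<rho> / \<epsilon>)))\<bar> \<le> C * \<epsilon>\<^sup>2 / b"
proof -
  obtain C where C: "C \<ge> 0" "\<And>R. \<bar>R\<bar> * deriv U R \<le> C" using AC_profile_deriv_decay[OF prof] by blast
  have V: "(deriv U has_real_derivative nonlin (U R)) (at R)" for R using prof by (simp add: AC_profile_def)
  have "\<bar>LINT \<rho>|lborel. indicator {-b..b} \<rho> * (deriv U (\<rho> / \<epsilon>) * nonlin (U (\<rho> / \<epsilon>)))\<bar> \<le> C * \<epsilon>\<^sup>2 / b"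
    if e: "0 < \<epsilon>" and b: "0 < b" for \<epsilon> b
  proof -
    let ?F = "\<lambda>\<rho>. \<epsilon> / 2 * (deriv U (\<rho> / \<epsilon>) * deriv U (\<rho> / \<epsilon>))"
    have "(?F has_real_derivative deriv U (\<rho> / \<epsilon>) * nonlin (U (\<rho> / \<epsilon>))) (at \<rho>)" for \<rho>
    proof -
      have v: "((\<lambda>\<rho>. deriv U (\<rho> / \<epsilon>)) has_real_derivative nonlin (U (\<rho> / \<epsilon>)) * (1 / \<epsilon>)) (at \<rho>)"
        by (rule DERIV_chain2[OF V]) (use e in \<open>auto intro!: derivative_eq_intros\<close>)
      from DERIV_cmult[OF DERIV_mult'[OF v v], of "\<epsilon> / 2"] show ?thesis using e by (simp add: mult.commute)
    qed
    then have "(LINT \<rho>|lborel. indicator {-b..b} \<rho> *\<^sub>R (deriv U (\<rho> / \<epsilon>) * nonlin (U (\<rho> / \<epsilon>)))) = ?F b - ?F (- b)"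
      using b unfolding nonlin_def
      by (intro integral_FTC_atLeastAtMost continuous_intros profile_scaled_continuous[OF prof])
        (auto simp: has_real_derivative_iff_has_vector_derivative intro: has_vector_derivative_at_within)
    moreover have F: "0 \<le> ?F \<rho> \<and> ?F \<rho> \<le> C * \<epsilon>\<^sup>2 / b" if "\<bar>\<rho>\<bar> = b" for \<rho>
    proof -
      let ?v = "deriv U (\<rho> / \<epsilon>)"
      have v: "0 < ?v" "?v \<le> 1" using AC_profile_deriv_pos[OF prof] AC_profile_deriv_le_1[OF prof] by auto
      have "b / \<epsilon> * ?v \<le> C" using C(2)[of "\<rho> / \<epsilon>"] that e by (simp add: abs_mult)
      then have "?v \<le> C * \<epsilon> / b" using e b by (simp add: field_simps)
      then have "?v * ?v \<le> C * \<epsilon> / b * 1" using v by (intro mult_mono) auto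
      then have "?F \<rho> \<le> \<epsilon> * (C * \<epsilon> / b)"
        using e v by (intro mult_mono) auto
      then show ?thesis using e v by (simp add: power2_eq_square mult_ac)
    qed
    moreover have "\<bar>?F b - ?F (- b)\<bar> \<le> C * \<epsilon>\<^sup>2 / b"
    proof -
      have "\<bar>b\<bar> = b" "\<bar>- b\<bar> = b" using b by auto
      from F[OF this(1)] F[OF this(2)] show ?thesis by linarith
    qed
    ultimately show ?thesis by simp
  qed
  then show ?thesis using C(1) by blast
qed

section \<open>Geometry of the interface\<close>

text \<open>
  The bound \<open>1/4\<close> on the geometric errors \<open>O(\<delta>)\<close> makes the length of \<open>\<Gamma>\<close> at least \<open>11/4\<close>, its curvature at most
  \<open>3\<close>, and \<open>\<bar>r\<^sub>\<xi>\<bar>\<close> at least \<open>1/4\<close> where the cosine in its expansion is at least \<open>1/2\<close>.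
\<close>
locale droplet_geometry = droplet +
  assumes D_open: "open D" and D_bounded: "bounded D"
    and frame: "\<And>\<xi>. norm (vector_derivative p (at \<xi>)) \<le> 1" "\<And>\<xi>. norm (n \<xi>) \<le> 1"
    and small: "\<Lambda> * \<delta> \<le> 1/4"
begin

abbreviation \<gamma>F where "\<gamma>F \<epsilon> \<equiv> (\<lambda>(\<sigma>, \<xi>). \<gamma> \<epsilon> \<xi> \<sigma>)"
abbreviation \<nu>F where "\<nu>F \<epsilon> \<equiv> (\<lambda>(\<sigma>, \<xi>). \<nu> \<epsilon> \<xi> \<sigma>)"

definition \<Gamma>dom :: "real \<Rightarrow> (real \<times> real) set" where
  "\<Gamma>dom \<epsilon> = {(\<sigma>, \<xi>). -a < \<sigma> \<and> \<sigma> < len \<epsilon> \<xi> + a}"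

definition \<gamma>s :: "real \<Rightarrow> real \<Rightarrow> real \<Rightarrow> real^2" where
  "\<gamma>s \<epsilon> \<xi> \<sigma> = dir_deriv (1, 0) (\<gamma>F \<epsilon>) (\<sigma>, \<xi>)"

definition \<nu>s :: "real \<Rightarrow> real \<Rightarrow> real \<Rightarrow> real^2" where
  "\<nu>s \<epsilon> \<xi> \<sigma> = dir_deriv (1, 0) (\<nu>F \<epsilon>) (\<sigma>, \<xi>)"

text \<open>The curvature of \<open>\<Gamma>\<close>, with the sign for which \<open>\<nu>\<^sub>s = \<kappa> \<gamma>\<^sub>s\<close>.\<close>
definition kap :: "real \<Rightarrow> real \<Rightarrow> real \<Rightarrow> real" where
  "kap \<epsilon> \<xi> \<sigma> = \<nu>s \<epsilon> \<xi> \<sigma> \<bullet> \<gamma>s \<epsilon> \<xi> \<sigma>"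

lemma curve_smooth:
  assumes "0 < \<epsilon>" "\<epsilon> \<le> \<epsilon>0"
  shows "smooth_on (\<Gamma>dom \<epsilon>) (\<gamma>F \<epsilon>)" "smooth_on (\<Gamma>dom \<epsilon>) (\<nu>F \<epsilon>)"
  using curve assms unfolding droplet_curve_def \<Gamma>dom_def by auto

lemma Basis_pair_real: "(1, 0) \<in> (Basis :: (real \<times> real) set)" "(0, 1) \<in> (Basis :: (real \<times> real) set)"
  by (auto simp: Basis_prod_def)

lemma section_derivatives:
  fixes F :: "real \<times> real \<Rightarrow> real^2"
  assumes F: "smooth_on S F" and z: "(\<sigma>, \<xi>) \<in> S"
  shows "((\<lambda>\<sigma>. F (\<sigma>, \<xi>)) has_vector_derivative dir_deriv (1, 0) F (\<sigma>, \<xi>)) (at \<sigma>)"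
    and "((\<lambda>\<xi>. F (\<sigma>, \<xi>)) has_vector_derivative dir_deriv (0, 1) F (\<sigma>, \<xi>)) (at \<xi>)"
proof -
  have d: "F differentiable (at (\<sigma>, \<xi>))" by (rule smooth_on_differentiable[OF F z])
  show "((\<lambda>\<sigma>. F (\<sigma>, \<xi>)) has_vector_derivative dir_deriv (1, 0) F (\<sigma>, \<xi>)) (at \<sigma>)"
    by (rule dir_deriv_has_vector_derivative[where g="\<lambda>\<sigma>. (\<sigma>, \<xi>)" and t=\<sigma>])
      (use d in \<open>auto intro!: derivative_eq_intros\<close>)
  show "((\<lambda>\<xi>. F (\<sigma>, \<xi>)) has_vector_derivative dir_deriv (0, 1) F (\<sigma>, \<xi>)) (at \<xi>)"
    by (rule dir_deriv_has_vector_derivative[where g="\<lambda>\<xi>. (\<sigma>, \<xi>)" and t=\<xi>])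
      (use d in \<open>auto intro!: derivative_eq_intros\<close>)
qed

lemma curve_derivatives:
  assumes "0 < \<epsilon>" "\<epsilon> \<le> \<epsilon>0" "- a < \<sigma>" "\<sigma> < len \<epsilon> \<xi> + a"
  shows "(\<gamma> \<epsilon> \<xi> has_vector_derivative \<gamma>s \<epsilon> \<xi> \<sigma>) (at \<sigma>)"
    and "(\<nu> \<epsilon> \<xi> has_vector_derivative \<nu>s \<epsilon> \<xi> \<sigma>) (at \<sigma>)"
    and "((\<lambda>\<xi>. \<gamma> \<epsilon> \<xi> \<sigma>) has_vector_derivative dir_deriv (0, 1) (\<gamma>F \<epsilon>) (\<sigma>, \<xi>)) (at \<xi>)"
    and "((\<lambda>\<xi>. \<nu> \<epsilon> \<xi> \<sigma>) has_vector_derivative dir_deriv (0, 1) (\<nu>F \<epsilon>) (\<sigma>, \<xi>)) (at \<xi>)"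
  using section_derivatives[OF curve_smooth(1)[OF assms(1,2)], of \<sigma> \<xi>]
    section_derivatives[OF curve_smooth(2)[OF assms(1,2)], of \<sigma> \<xi>] assms(3,4)
  by (simp_all add: \<Gamma>dom_def \<gamma>s_def \<nu>s_def)

lemma curve_frame:
  assumes "0 < \<epsilon>" "\<epsilon> \<le> \<epsilon>0" "- a < \<sigma>" "\<sigma> < len \<epsilon> \<xi> + a"
  shows "norm (\<gamma>s \<epsilon> \<xi> \<sigma>) = 1" "norm (\<nu> \<epsilon> \<xi> \<sigma>) = 1" "\<nu> \<epsilon> \<xi> \<sigma> \<bullet> \<gamma>s \<epsilon> \<xi> \<sigma> = 0"
    and "norm (vector_derivative (\<lambda>\<sigma>. vector_derivative (\<gamma> \<epsilon> \<xi>) (at \<sigma>)) (at \<sigma>)) \<le> 3"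
proof -
  have c: "norm (vector_derivative (\<gamma> \<epsilon> \<xi>) (at \<sigma>)) = 1 \<and> norm (\<nu> \<epsilon> \<xi> \<sigma>) = 1 \<and>
     \<nu> \<epsilon> \<xi> \<sigma> \<bullet> vector_derivative (\<gamma> \<epsilon> \<xi>) (at \<sigma>) = 0 \<and>
     norm (vector_derivative (\<lambda>\<sigma>. vector_derivative (\<gamma> \<epsilon> \<xi>) (at \<sigma>)) (at \<sigma>) +
       (cos \<sigma> *\<^sub>R vector_derivative p (at \<xi>) + sin \<sigma> *\<^sub>R n \<xi>)) \<le> \<Lambda> * \<delta>"
    using curve assms unfolding droplet_curve_def Let_def by auto
  have v: "vector_derivative (\<gamma> \<epsilon> \<xi>) (at \<sigma>) = \<gamma>s \<epsilon> \<xi> \<sigma>"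
    by (rule vector_derivative_at[OF curve_derivatives(1)[OF assms]])
  show "norm (\<gamma>s \<epsilon> \<xi> \<sigma>) = 1" "norm (\<nu> \<epsilon> \<xi> \<sigma>) = 1" "\<nu> \<epsilon> \<xi> \<sigma> \<bullet> \<gamma>s \<epsilon> \<xi> \<sigma> = 0"
    using c v by auto
  let ?w = "vector_derivative (\<lambda>\<sigma>. vector_derivative (\<gamma> \<epsilon> \<xi>) (at \<sigma>)) (at \<sigma>)"
  let ?c = "cos \<sigma> *\<^sub>R vector_derivative p (at \<xi>) + sin \<sigma> *\<^sub>R n \<xi>"
  have "norm ?c \<le> norm (cos \<sigma> *\<^sub>R vector_derivative p (at \<xi>)) + norm (sin \<sigma> *\<^sub>R n \<xi>)"
    by (rule norm_triangle_ineq)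
  also have "\<dots> \<le> 1 * 1 + 1 * 1"
    unfolding norm_scaleR real_norm_def
    by (intro add_mono mult_mono frame abs_cos_le_one abs_sin_le_one) auto
  finally have "norm ?c \<le> 2" by simp
  moreover have "norm ?w \<le> norm (?w + ?c) + norm ?c"
    using norm_triangle_ineq4[of "?w + ?c" ?c] by simp
  ultimately show "norm ?w \<le> 3" using c small by linarith
qed

lemma \<gamma>s_derivative:
  assumes "0 < \<epsilon>" "\<epsilon> \<le> \<epsilon>0" "- a < \<sigma>" "\<sigma> < len \<epsilon> \<xi> + a"
  shows "\<exists>w. (\<gamma>s \<epsilon> \<xi> has_vector_derivative w) (at \<sigma>) \<and> norm w \<le> 3"
proof -
  have sm: "smooth_on (\<Gamma>dom \<epsilon>) (dir_deriv (1, 0) (\<gamma>F \<epsilon>))"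
    by (rule smooth_on_dir_deriv[OF curve_smooth(1)[OF assms(1,2)] Basis_pair_real(1)])
  have z: "(\<sigma>, \<xi>) \<in> \<Gamma>dom \<epsilon>" using assms by (simp add: \<Gamma>dom_def)
  let ?w = "dir_deriv (1, 0) (dir_deriv (1, 0) (\<gamma>F \<epsilon>)) (\<sigma>, \<xi>)"
  have w: "(\<gamma>s \<epsilon> \<xi> has_vector_derivative ?w) (at \<sigma>)"
    using section_derivatives(1)[OF sm z] by (simp add: \<gamma>s_def[abs_def])
  have "((\<lambda>\<sigma>. vector_derivative (\<gamma> \<epsilon> \<xi>) (at \<sigma>)) has_vector_derivative ?w) (at \<sigma>)"
  proof (rule has_vector_derivative_transform_within_open[OF w, of "{-a<..<len \<epsilon> \<xi> + a}"])
    show "\<gamma>s \<epsilon> \<xi> \<sigma> = vector_derivative (\<gamma> \<epsilon> \<xi>) (at \<sigma>)" if "\<sigma> \<in> {-a<..<len \<epsilon> \<xi> + a}" for \<sigma>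
      using vector_derivative_at[OF curve_derivatives(1)[OF assms(1,2)], of \<sigma> \<xi>] that by simp
  qed (use assms in auto)
  then have "vector_derivative (\<lambda>\<sigma>. vector_derivative (\<gamma> \<epsilon> \<xi>) (at \<sigma>)) (at \<sigma>) = ?w"
    by (rule vector_derivative_at)
  then show ?thesis using w curve_frame(4)[OF assms] by auto
qed

text \<open>Differentiating \<open>\<bar>\<nu>\<bar>\<^sup>2 = 1\<close> shows that \<open>\<nu>\<^sub>s\<close> is tangential, and differentiating \<open>\<nu> \<bullet> \<gamma>\<^sub>s = 0\<close> that its
  length is at most that of \<open>\<gamma>\<^sub>s\<^sub>s\<close>.\<close>
lemma normal_derivative:
  assumes "0 < \<epsilon>" "\<epsilon> \<le> \<epsilon>0" "- a < \<sigma>" "\<sigma> < len \<epsilon> \<xi> + a"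
  shows "\<nu>s \<epsilon> \<xi> \<sigma> = kap \<epsilon> \<xi> \<sigma> *\<^sub>R \<gamma>s \<epsilon> \<xi> \<sigma>" and "\<bar>kap \<epsilon> \<xi> \<sigma>\<bar> \<le> 3"
proof -
  let ?I = "{-a<..<len \<epsilon> \<xi> + a}"
  have I: "\<sigma> \<in> ?I" using assms by simp
  have \<nu>': "(\<nu> \<epsilon> \<xi> has_vector_derivative \<nu>s \<epsilon> \<xi> \<sigma>) (at \<sigma>)" by (rule curve_derivatives(2)[OF assms])
  have "((\<lambda>\<sigma>. \<nu> \<epsilon> \<xi> \<sigma> \<bullet> \<nu> \<epsilon> \<xi> \<sigma>) has_vector_derivative
      \<nu> \<epsilon> \<xi> \<sigma> \<bullet> \<nu>s \<epsilon> \<xi> \<sigma> + \<nu>s \<epsilon> \<xi> \<sigma> \<bullet> \<nu> \<epsilon> \<xi> \<sigma>) (at \<sigma>)"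
    by (rule bounded_bilinear.has_vector_derivative[OF bounded_bilinear_inner \<nu>' \<nu>'])
  moreover have "((\<lambda>\<sigma>. \<nu> \<epsilon> \<xi> \<sigma> \<bullet> \<nu> \<epsilon> \<xi> \<sigma>) has_vector_derivative 0) (at \<sigma>)"
  proof (rule has_vector_derivative_transform_within_open[where f="\<lambda>_. 1" and S="?I"])
    show "1 = \<nu> \<epsilon> \<xi> t \<bullet> \<nu> \<epsilon> \<xi> t" if "t \<in> ?I" for t
      using curve_frame(2)[OF assms(1,2), of t \<xi>] that by (simp add: norm_eq_1)
  qed (use I in auto)
  ultimately have "\<nu> \<epsilon> \<xi> \<sigma> \<bullet> \<nu>s \<epsilon> \<xi> \<sigma> + \<nu>s \<epsilon> \<xi> \<sigma> \<bullet> \<nu> \<epsilon> \<xi> \<sigma> = 0"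
    by (rule vector_derivative_unique_at)
  then have o: "\<nu>s \<epsilon> \<xi> \<sigma> \<bullet> \<nu> \<epsilon> \<xi> \<sigma> = 0" by (simp add: inner_commute)
  from orthonormal_expansion[OF curve_frame(2,1,3)[OF assms], of "\<nu>s \<epsilon> \<xi> \<sigma>"] o
  show "\<nu>s \<epsilon> \<xi> \<sigma> = kap \<epsilon> \<xi> \<sigma> *\<^sub>R \<gamma>s \<epsilon> \<xi> \<sigma>" by (simp add: kap_def)
  obtain w where w: "(\<gamma>s \<epsilon> \<xi> has_vector_derivative w) (at \<sigma>)" "norm w \<le> 3"
    using \<gamma>s_derivative[OF assms] by blast
  have "((\<lambda>\<sigma>. \<nu> \<epsilon> \<xi> \<sigma> \<bullet> \<gamma>s \<epsilon> \<xi> \<sigma>) has_vector_derivative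
      \<nu> \<epsilon> \<xi> \<sigma> \<bullet> w + \<nu>s \<epsilon> \<xi> \<sigma> \<bullet> \<gamma>s \<epsilon> \<xi> \<sigma>) (at \<sigma>)"
    by (rule bounded_bilinear.has_vector_derivative[OF bounded_bilinear_inner \<nu>' w(1)])
  moreover have "((\<lambda>\<sigma>. \<nu> \<epsilon> \<xi> \<sigma> \<bullet> \<gamma>s \<epsilon> \<xi> \<sigma>) has_vector_derivative 0) (at \<sigma>)"
  proof (rule has_vector_derivative_transform_within_open[where f="\<lambda>_. 0" and S="?I"])
    show "0 = \<nu> \<epsilon> \<xi> t \<bullet> \<gamma>s \<epsilon> \<xi> t" if "t \<in> ?I" for t
      using curve_frame(3)[OF assms(1,2), of t \<xi>] that by simp
  qed (use I in auto)
  ultimately have "\<nu> \<epsilon> \<xi> \<sigma> \<bullet> w + \<nu>s \<epsilon> \<xi> \<sigma> \<bullet> \<gamma>s \<epsilon> \<xi> \<sigma> = 0"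
    by (rule vector_derivative_unique_at)
  then have "\<bar>kap \<epsilon> \<xi> \<sigma>\<bar> = \<bar>\<nu> \<epsilon> \<xi> \<sigma> \<bullet> w\<bar>" by (simp add: kap_def abs_eq_iff eq_neg_iff_add_eq_0 add.commute)
  also have "\<dots> \<le> norm (\<nu> \<epsilon> \<xi> \<sigma>) * norm w" by (rule Cauchy_Schwarz_ineq2)
  also have "\<dots> \<le> 3" using curve_frame(2)[OF assms] w(2) by simp
  finally show "\<bar>kap \<epsilon> \<xi> \<sigma>\<bar> \<le> 3" .
qed

lemma kap_continuous:
  assumes "0 < \<epsilon>" "\<epsilon> \<le> \<epsilon>0"
  shows "continuous_on {-a<..<len \<epsilon> \<xi> + a} (kap \<epsilon> \<xi>)"
proof -
  have c: "continuous_on (\<Gamma>dom \<epsilon>) (dir_deriv (1, 0) F)" if "smooth_on (\<Gamma>dom \<epsilon>) F" for F :: "real \<times> real \<Rightarrow> real^2"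
    using smooth_on_iter_deriv_continuous[OF that, of "[(1,0)]"] Basis_pair_real by simp
  have "continuous_on {-a<..<len \<epsilon> \<xi> + a} (\<lambda>\<sigma>. dir_deriv (1, 0) (\<nu>F \<epsilon>) (\<sigma>, \<xi>))"
    "continuous_on {-a<..<len \<epsilon> \<xi> + a} (\<lambda>\<sigma>. dir_deriv (1, 0) (\<gamma>F \<epsilon>) (\<sigma>, \<xi>))"
    by (rule continuous_on_compose2[OF c[OF curve_smooth(2)[OF assms]]];
        auto simp: \<Gamma>dom_def intro!: continuous_intros)
      (rule continuous_on_compose2[OF c[OF curve_smooth(1)[OF assms]]];
        auto simp: \<Gamma>dom_def intro!: continuous_intros)
  then show ?thesis unfolding kap_def[abs_def] \<gamma>s_def \<nu>s_def by (intro continuous_intros)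
qed

text \<open>As the curvature is at most \<open>3\<close>, the Jacobian \<open>1 + \<rho> \<kappa>\<close> lies in \<open>[1/2, 3/2]\<close> for \<open>\<bar>\<rho>\<bar> < 1/6\<close>.\<close>
definition r1 :: real where "r1 = min r0 (1/6)"

lemma r1: "0 < r1" "r1 \<le> r0" "r1 \<le> 1/6"
  using pos by (auto simp: r1_def)

definition \<Phi> :: "real \<Rightarrow> real \<Rightarrow> real \<times> real \<Rightarrow> real^2" where
  "\<Phi> \<epsilon> \<xi> z = \<gamma> \<epsilon> \<xi> (snd z) + fst z *\<^sub>R \<nu> \<epsilon> \<xi> (snd z)"

definition strip :: "real \<Rightarrow> real \<Rightarrow> (real \<times> real) set" where
  "strip \<epsilon> \<xi> = {-r1<..<r1} \<times> {-a<..<len \<epsilon> \<xi> + a}"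

lemma stripD:
  assumes "z \<in> strip \<epsilon> \<xi>"
  shows "\<bar>fst z\<bar> < r1" "- a < snd z" "snd z < len \<epsilon> \<xi> + a" "z \<in> tube_par a r0 (len \<epsilon> \<xi>)"
  using assms r1 by (auto simp: strip_def tube_par_def)

lemma jacobian_bounds:
  assumes "0 < \<epsilon>" "\<epsilon> \<le> \<epsilon>0" "z \<in> strip \<epsilon> \<xi>"
  shows "\<bar>fst z * kap \<epsilon> \<xi> (snd z)\<bar> \<le> 3 * \<bar>fst z\<bar>" "1/2 \<le> 1 + fst z * kap \<epsilon> \<xi> (snd z)"
    "1 + fst z * kap \<epsilon> \<xi> (snd z) \<le> 3/2"
proof -
  have "\<bar>fst z\<bar> * \<bar>kap \<epsilon> \<xi> (snd z)\<bar> \<le> \<bar>fst z\<bar> * 3"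
    by (intro mult_left_mono normal_derivative(2)) (use assms stripD in auto)
  then show 1: "\<bar>fst z * kap \<epsilon> \<xi> (snd z)\<bar> \<le> 3 * \<bar>fst z\<bar>" by (simp add: abs_mult)
  have "\<bar>fst z\<bar> < 1/6" using stripD(1)[OF assms(3)] r1(3) by linarith
  then show "1/2 \<le> 1 + fst z * kap \<epsilon> \<xi> (snd z)" "1 + fst z * kap \<epsilon> \<xi> (snd z) \<le> 3/2"
    using 1 by linarith+
qed

lemma r_s_\<Phi>:
  assumes "0 < \<epsilon>" "\<epsilon> \<le> \<epsilon>0" "z \<in> strip \<epsilon> \<xi>"
  shows "r \<epsilon> \<xi> (\<Phi> \<epsilon> \<xi> z) = fst z" "s \<epsilon> \<xi> (\<Phi> \<epsilon> \<xi> z) = snd z" "\<Phi> \<epsilon> \<xi> z \<in> tube \<epsilon> \<xi>"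
proof -
  have z: "(fst z, snd z) \<in> tube_par a r0 (len \<epsilon> \<xi>)" using stripD(4)[OF assms(3)] by simp
  show "r \<epsilon> \<xi> (\<Phi> \<epsilon> \<xi> z) = fst z" "s \<epsilon> \<xi> (\<Phi> \<epsilon> \<xi> z) = snd z"
    using rs_tube[OF assms(1,2) z] by (auto simp: \<Phi>_def)
  show "\<Phi> \<epsilon> \<xi> z \<in> tube \<epsilon> \<xi>"
    unfolding tube_def by (rule image_eqI[OF _ stripD(4)[OF assms(3)]]) (simp add: \<Phi>_def case_prod_beta)
qed

text \<open>
  Differentiating \<open>r (\<Phi> (\<rho>, \<sigma>)) = \<rho>\<close> in \<open>\<rho>\<close> and \<open>\<sigma>\<close> shows that the gradient of \<open>r\<close> is \<open>\<nu>\<close>, whatever \<open>\<rho>\<close>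
  is. Differentiating in \<open>\<xi>\<close> then gives \<open>r\<^sub>\<xi> = - \<nu> \<bullet> (\<gamma>\<^sub>\<xi> + \<rho> \<nu>\<^sub>\<xi>)\<close>, and \<open>\<nu> \<bullet> \<nu>\<^sub>\<xi> = 0\<close>. The right-hand side
  does not depend on \<open>\<rho>\<close>: parallel curves have the same normal velocity.
\<close>

lemma r_xi_constant_on_normals:
  assumes e: "0 < \<epsilon>" "\<epsilon> \<le> \<epsilon>0" and z: "(\<rho>, \<sigma>) \<in> strip \<epsilon> \<xi>"
  shows "dxi 1 (r \<epsilon>) \<xi> (\<Phi> \<epsilon> \<xi> (\<rho>, \<sigma>)) = - (\<nu> \<epsilon> \<xi> \<sigma> \<bullet> dir_deriv (0, 1) (\<gamma>F \<epsilon>) (\<sigma>, \<xi>))"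
proof -
  let ?x = "\<Phi> \<epsilon> \<xi> (\<rho>, \<sigma>)" and ?R = "\<lambda>(x, \<xi>). r \<epsilon> \<xi> x"
  have \<sigma>: "- a < \<sigma>" "\<sigma> < len \<epsilon> \<xi> + a" and \<rho>: "\<bar>\<rho>\<bar> < r1" using stripD[OF z] by auto
  have xt: "?x \<in> tube \<epsilon> \<xi>" by (rule r_s_\<Phi>(3)[OF e z])
  have Rd: "?R differentiable (at (?x, \<xi>))"
    by (rule smooth_on_differentiable[OF r_smooth[OF e]]) (use xt in simp)
  \<comment> \<open>\<open>L (h, \<tau>)\<close> is the derivative of \<open>r\<close> in direction \<open>h\<close> of space and \<open>\<tau>\<close> of the parameter\<close>
  define L where "L = frechet_derivative ?R (at (?x, \<xi>))"
  have L: "linear L" unfolding L_def by (rule linear_frechet_derivative[OF Rd])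
  have curve: "((\<lambda>t. ?R (c t)) has_vector_derivative L c') (at t)"
    if "(c has_vector_derivative c') (at t)" "c t = (?x, \<xi>)" for c c' t
    using dir_deriv_has_vector_derivative[of ?R c t c'] that Rd by (simp add: dir_deriv_def L_def)
  let ?g = "\<gamma>s \<epsilon> \<xi> \<sigma>" and ?n = "\<nu> \<epsilon> \<xi> \<sigma>" and ?k = "kap \<epsilon> \<xi> \<sigma>"
  note fr = curve_frame(2,1,3)[OF e \<sigma>]
  have L1: "L (?n, 0) = 1"
  proof -
    have "((\<lambda>t. (\<Phi> \<epsilon> \<xi> (t, \<sigma>), \<xi>)) has_vector_derivative (?n, 0)) (at \<rho>)"
      unfolding \<Phi>_def by (auto intro!: derivative_eq_intros)
    from curve[OF this] have "((\<lambda>t. r \<epsilon> \<xi> (\<Phi> \<epsilon> \<xi> (t, \<sigma>))) has_vector_derivative L (?n, 0)) (at \<rho>)"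
      by simp
    moreover have "((\<lambda>t. r \<epsilon> \<xi> (\<Phi> \<epsilon> \<xi> (t, \<sigma>))) has_vector_derivative 1) (at \<rho>)"
    proof (rule has_vector_derivative_transform_within_open[where f="\<lambda>t. t" and S="{-r1<..<r1}"])
      show "t = r \<epsilon> \<xi> (\<Phi> \<epsilon> \<xi> (t, \<sigma>))" if "t \<in> {-r1<..<r1}" for t
        using r_s_\<Phi>(1)[OF e, of "(t, \<sigma>)" \<xi>] that \<sigma> by (simp add: strip_def)
    qed (use \<rho> in auto)
    ultimately show ?thesis by (rule vector_derivative_unique_at)
  qed
  have L2: "L (?g, 0) = 0"
  proof -
    have n': "(\<nu> \<epsilon> \<xi> has_vector_derivative ?k *\<^sub>R ?g) (at \<sigma>)"
      using curve_derivatives(2)[OF e \<sigma>] normal_derivative(1)[OF e \<sigma>] by simp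
    have "((\<lambda>t. \<gamma> \<epsilon> \<xi> t + \<rho> *\<^sub>R \<nu> \<epsilon> \<xi> t) has_vector_derivative ?g + \<rho> *\<^sub>R (?k *\<^sub>R ?g)) (at \<sigma>)"
      by (intro has_vector_derivative_add curve_derivatives(1)[OF e \<sigma>]
          bounded_linear.has_vector_derivative[OF bounded_linear_scaleR_right n'])
    then have "((\<lambda>t. (\<Phi> \<epsilon> \<xi> (\<rho>, t), \<xi>)) has_vector_derivative (?g + \<rho> *\<^sub>R (?k *\<^sub>R ?g), 0)) (at \<sigma>)"
      unfolding \<Phi>_def by (intro has_vector_derivative_Pair) auto
    from curve[OF this]
    have "((\<lambda>t. r \<epsilon> \<xi> (\<Phi> \<epsilon> \<xi> (\<rho>, t))) has_vector_derivative L (?g + \<rho> *\<^sub>R (?k *\<^sub>R ?g), 0)) (at \<sigma>)"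
      by simp
    moreover have "((\<lambda>t. r \<epsilon> \<xi> (\<Phi> \<epsilon> \<xi> (\<rho>, t))) has_vector_derivative 0) (at \<sigma>)"
    proof (rule has_vector_derivative_transform_within_open[where f="\<lambda>t. \<rho>" and S="{-a<..<len \<epsilon> \<xi> + a}"])
      show "\<rho> = r \<epsilon> \<xi> (\<Phi> \<epsilon> \<xi> (\<rho>, t))" if "t \<in> {-a<..<len \<epsilon> \<xi> + a}" for t
        using r_s_\<Phi>(1)[OF e, of "(\<rho>, t)" \<xi>] that \<rho> by (simp add: strip_def abs_less_iff)
    qed (use \<sigma> in auto)
    ultimately have "L (?g + \<rho> *\<^sub>R (?k *\<^sub>R ?g), 0) = 0" by (rule vector_derivative_unique_at)
    moreover have "(?g + \<rho> *\<^sub>R (?k *\<^sub>R ?g), 0) = (1 + \<rho> * ?k) *\<^sub>R (?g, 0::real)"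
      by (simp add: scaleR_add_left)
    ultimately have "L ((1 + \<rho> * ?k) *\<^sub>R (?g, 0)) = 0" by (simp only:)
    then have "(1 + \<rho> * ?k) * L (?g, 0) = 0" by (simp only: linear_cmul[OF L] real_scaleR_def)
    then show ?thesis using jacobian_bounds(2)[OF e z] by auto
  qed
  have Lh: "L (h, 0) = (h \<bullet> ?n) * L (?n, 0) + (h \<bullet> ?g) * L (?g, 0)" for h
  proof -
    have "(h, 0) = (h \<bullet> ?n) *\<^sub>R (?n, 0::real) + (h \<bullet> ?g) *\<^sub>R (?g, 0)"
      using orthonormal_expansion[OF fr, of h] by simp
    then show ?thesis by (simp only: linear_add[OF L] linear_cmul[OF L] real_scaleR_def)
  qed
  have Ln: "L (h, 0) = h \<bullet> ?n" for h
    using Lh[of h] by (simp only: L1 L2 mult_1_right mult_zero_right add_0_right)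
  let ?gx = "dir_deriv (0, 1) (\<gamma>F \<epsilon>) (\<sigma>, \<xi>)" and ?nx = "dir_deriv (0, 1) (\<nu>F \<epsilon>) (\<sigma>, \<xi>)"
  let ?X = "{t. \<sigma> < len \<epsilon> t + a}"
  have X: "open ?X" "\<xi> \<in> ?X"
  proof -
    have "continuous_on UNIV (len \<epsilon>)"
      using smooth_on_iter_deriv_continuous[OF len_smooth[OF e], of "[]"] by simp
    then show "open ?X" by (intro open_Collect_less continuous_intros) auto
    show "\<xi> \<in> ?X" using \<sigma> by simp
  qed
  have "L (?gx + \<rho> *\<^sub>R ?nx, 1) = 0"
  proof -
    have "((\<lambda>t. \<gamma> \<epsilon> t \<sigma> + \<rho> *\<^sub>R \<nu> \<epsilon> t \<sigma>) has_vector_derivative ?gx + \<rho> *\<^sub>R ?nx) (at \<xi>)"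
      by (intro has_vector_derivative_add curve_derivatives(3)[OF e \<sigma>]
          bounded_linear.has_vector_derivative[OF bounded_linear_scaleR_right curve_derivatives(4)[OF e \<sigma>]])
    then have "((\<lambda>t. (\<Phi> \<epsilon> t (\<rho>, \<sigma>), t)) has_vector_derivative (?gx + \<rho> *\<^sub>R ?nx, 1)) (at \<xi>)"
      unfolding \<Phi>_def by (intro has_vector_derivative_Pair) auto
    from curve[OF this]
    have "((\<lambda>t. r \<epsilon> t (\<Phi> \<epsilon> t (\<rho>, \<sigma>))) has_vector_derivative L (?gx + \<rho> *\<^sub>R ?nx, 1)) (at \<xi>)" by simp
    moreover have "((\<lambda>t. r \<epsilon> t (\<Phi> \<epsilon> t (\<rho>, \<sigma>))) has_vector_derivative 0) (at \<xi>)"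
    proof (rule has_vector_derivative_transform_within_open[where f="\<lambda>t. \<rho>" and S="?X"])
      show "\<rho> = r \<epsilon> t (\<Phi> \<epsilon> t (\<rho>, \<sigma>))" if "t \<in> ?X" for t
        using r_s_\<Phi>(1)[OF e, of "(\<rho>, \<sigma>)" t] that \<rho> \<sigma>(1) by (simp add: strip_def abs_less_iff)
    qed (use X in auto)
    ultimately show ?thesis by (rule vector_derivative_unique_at)
  qed
  moreover have "?nx \<bullet> ?n = 0"
  proof -
    have n': "((\<lambda>t. \<nu> \<epsilon> t \<sigma>) has_vector_derivative ?nx) (at \<xi>)" by (rule curve_derivatives(4)[OF e \<sigma>])
    have "((\<lambda>t. \<nu> \<epsilon> t \<sigma> \<bullet> \<nu> \<epsilon> t \<sigma>) has_vector_derivative ?n \<bullet> ?nx + ?nx \<bullet> ?n) (at \<xi>)"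
      by (rule bounded_bilinear.has_vector_derivative[OF bounded_bilinear_inner n' n'])
    moreover have "((\<lambda>t. \<nu> \<epsilon> t \<sigma> \<bullet> \<nu> \<epsilon> t \<sigma>) has_vector_derivative 0) (at \<xi>)"
    proof (rule has_vector_derivative_transform_within_open[where f="\<lambda>_. 1" and S="?X"])
      show "1 = \<nu> \<epsilon> t \<sigma> \<bullet> \<nu> \<epsilon> t \<sigma>" if "t \<in> ?X" for t
        using curve_frame(2)[OF e \<sigma>(1), of t] that by (simp add: norm_eq_1)
    qed (use X in auto)
    ultimately have "?n \<bullet> ?nx + ?nx \<bullet> ?n = 0" by (rule vector_derivative_unique_at)
    then show ?thesis by (simp add: inner_commute)
  qed
  moreover have "L (?gx + \<rho> *\<^sub>R ?nx, 1) = L (?gx + \<rho> *\<^sub>R ?nx, 0) + L (0, 1)"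
    by (simp flip: linear_add[OF L])
  ultimately have "L (0, 1) = - (?n \<bullet> ?gx)" by (simp add: Ln inner_add_right inner_commute eq_neg_iff_add_eq_0 add.commute)
  moreover have "dxi 1 (r \<epsilon>) \<xi> ?x = L (0, 1)"
    using dxi_derivatives(1)[OF r_smooth[OF e], of ?x \<xi> 1] xt by (simp add: dir_deriv_def L_def)
  ultimately show ?thesis by simp
qed

section \<open>Integrals over the transition layer\<close>

definition layer :: "real \<Rightarrow> real \<Rightarrow> (real^2) set" where
  "layer \<epsilon> \<xi> = {x\<in>D. \<bar>r \<epsilon> \<xi> x\<bar> < r1}"

definition region :: "real \<Rightarrow> real \<Rightarrow> (real \<times> real) set" where
  "region \<epsilon> \<xi> = {z\<in>strip \<epsilon> \<xi>. \<Phi> \<epsilon> \<xi> z \<in> D}"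

lemma len_bounds:
  assumes "0 < \<epsilon>" "\<epsilon> \<le> \<epsilon>0" shows "11/4 \<le> len \<epsilon> \<xi>" "len \<epsilon> \<xi> \<le> 4"
proof -
  have "\<bar>len \<epsilon> \<xi> - pi\<bar> \<le> \<Lambda> * \<delta>" using curve assms unfolding droplet_curve_def by auto
  then show "11/4 \<le> len \<epsilon> \<xi>" "len \<epsilon> \<xi> \<le> 4"
    using small pi_gt3 pi_less_4 pi_approx by (auto simp: abs_le_iff)
qed

lemma \<Phi>_region:
  assumes "0 < \<epsilon>" "\<epsilon> \<le> \<epsilon>0" shows "\<Phi> \<epsilon> \<xi> ` region \<epsilon> \<xi> = layer \<epsilon> \<xi>"
proof
  show "\<Phi> \<epsilon> \<xi> ` region \<epsilon> \<xi> \<subseteq> layer \<epsilon> \<xi>"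
    using r_s_\<Phi>(1)[OF assms] stripD(1) by (auto simp: region_def layer_def)
  show "layer \<epsilon> \<xi> \<subseteq> \<Phi> \<epsilon> \<xi> ` region \<epsilon> \<xi>"
  proof
    fix x assume x: "x \<in> layer \<epsilon> \<xi>"
    then have "x \<in> tube \<epsilon> \<xi>" using near_tube[OF assms, of x \<xi>] r1 by (auto simp: layer_def)
    then obtain \<rho> \<sigma> where z: "(\<rho>, \<sigma>) \<in> tube_par a r0 (len \<epsilon> \<xi>)" "x = \<gamma> \<epsilon> \<xi> \<sigma> + \<rho> *\<^sub>R \<nu> \<epsilon> \<xi> \<sigma>"
      unfolding tube_def by auto
    then have "r \<epsilon> \<xi> x = \<rho>" using rs_tube[OF assms z(1)] by simp
    then have "(\<rho>, \<sigma>) \<in> region \<epsilon> \<xi>"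
      using x z by (auto simp: region_def layer_def strip_def tube_par_def \<Phi>_def)
    then show "x \<in> \<Phi> \<epsilon> \<xi> ` region \<epsilon> \<xi>" using z(2) by (force simp: \<Phi>_def)
  qed
qed

lemma \<Phi>_continuous:
  assumes "0 < \<epsilon>" "\<epsilon> \<le> \<epsilon>0" shows "continuous_on (strip \<epsilon> \<xi>) (\<Phi> \<epsilon> \<xi>)"
proof -
  have c: "continuous_on {-a<..<len \<epsilon> \<xi> + a} (\<gamma> \<epsilon> \<xi>)" "continuous_on {-a<..<len \<epsilon> \<xi> + a} (\<nu> \<epsilon> \<xi>)"
    using curve_derivatives(1,2)[OF assms] 
    by (auto intro!: continuous_at_imp_continuous_on has_vector_derivative_continuous)
  show ?thesis unfolding \<Phi>_def[abs_def]
    by (intro continuous_intros continuous_on_compose2[OF c(1)] continuous_on_compose2[OF c(2)])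
      (auto simp: strip_def)
qed

lemma region_open:
  assumes "0 < \<epsilon>" "\<epsilon> \<le> \<epsilon>0" shows "open (region \<epsilon> \<xi>)"
proof -
  have "open (strip \<epsilon> \<xi>)" by (simp add: strip_def open_Times)
  from continuous_open_preimage[OF \<Phi>_continuous[OF assms] this D_open]
  show ?thesis by (simp add: region_def vimage_def Int_def)
qed

lemma r_continuous_x:
  assumes "0 < \<epsilon>" "\<epsilon> \<le> \<epsilon>0" shows "continuous_on D (r \<epsilon> \<xi>)"
proof -
  have "continuous_on D (\<lambda>x. case (x, \<xi>) of (x, \<xi>) \<Rightarrow> r \<epsilon> \<xi> x)"
    by (rule continuous_on_compose2[OF r_continuous[OF assms]])
      (auto intro: continuous_on_Pair continuous_on_const continuous_on_id)
  then show ?thesis by simp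
qed

lemma layer_open:
  assumes "0 < \<epsilon>" "\<epsilon> \<le> \<epsilon>0" shows "open (layer \<epsilon> \<xi>)"
proof -
  have "layer \<epsilon> \<xi> = D \<inter> r \<epsilon> \<xi> -` {-r1<..<r1}"
    by (auto simp: layer_def abs_less_iff)
  then show ?thesis
    using continuous_open_preimage[OF r_continuous_x[OF assms] D_open, of "{-r1<..<r1}" \<xi>] by simp
qed

lemma r_xi_continuous:
  assumes "0 < \<epsilon>" "\<epsilon> \<le> \<epsilon>0" shows "continuous_on (layer \<epsilon> \<xi>) (dxi l (r \<epsilon>) \<xi>)"
  by (rule dxi_continuous_on[OF r_smooth[OF assms]])
    (use near_tube[OF assms] r1 in \<open>auto simp: layer_def\<close>)

lemma layer_integral:
  assumes e: "0 < \<epsilon>" "\<epsilon> \<le> \<epsilon>0" and f: "continuous_on (layer \<epsilon> \<xi>) f"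
    and M: "\<And>x. x \<in> layer \<epsilon> \<xi> \<Longrightarrow> \<bar>f x\<bar> \<le> M"
  shows "set_integrable lebesgue (layer \<epsilon> \<xi>) f"
    and "integrable lborel (\<lambda>z. indicator (region \<epsilon> \<xi>) z * ((1 + fst z * kap \<epsilon> \<xi> (snd z)) * f (\<Phi> \<epsilon> \<xi> z)))"
    and "(LINT x:layer \<epsilon> \<xi>|lebesgue. f x) =
       (LINT z|lborel. indicator (region \<epsilon> \<xi>) z * ((1 + fst z * kap \<epsilon> \<xi> (snd z)) * f (\<Phi> \<epsilon> \<xi> z)))"
proof -
  let ?S = "region \<epsilon> \<xi>"
  have m: "(\<lambda>x. indicator (layer \<epsilon> \<xi>) x *\<^sub>R f x) \<in> borel_measurable borel"
    using layer_open[OF e] f by (intro borel_measurable_continuous_on_indicator) auto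
  have L: "layer \<epsilon> \<xi> \<in> sets borel" "bounded (layer \<epsilon> \<xi>)"
    using layer_open[OF e] D_bounded by (auto simp: layer_def intro: bounded_subset)
  have fin: "emeasure lborel (layer \<epsilon> \<xi>) < \<infinity>" using L(2) by (rule emeasure_bounded_finite)
  have "integrable lborel (\<lambda>x. indicator (layer \<epsilon> \<xi>) x *\<^sub>R f x)"
  proof (rule Bochner_Integration.integrable_bound)
    show "integrable lborel (\<lambda>x. indicator (layer \<epsilon> \<xi>) x * M)"
      using L fin by (intro integrable_mult_left integrable_real_indicator) auto
  qed (use m M in \<open>auto simp: indicator_def intro: order_trans[OF _ abs_ge_self]\<close>)
  then show int: "set_integrable lebesgue (layer \<epsilon> \<xi>) f"
    unfolding set_integrable_def using m by (simp add: integrable_completion)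
  have k: "continuous_on ?S (\<lambda>z. kap \<epsilon> \<xi> (snd z))"
    by (rule continuous_on_compose2[OF kap_continuous[OF e]])
      (auto simp: region_def strip_def intro!: continuous_intros)
  have st: "z \<in> strip \<epsilon> \<xi>" "- a < snd z" "snd z < len \<epsilon> \<xi> + a" if "z \<in> ?S" for z
    using that stripD[of z \<epsilon> \<xi>] by (auto simp: region_def)
  have img: "(\<lambda>z. \<gamma> \<epsilon> \<xi> (snd z) + fst z *\<^sub>R \<nu> \<epsilon> \<xi> (snd z)) ` ?S = layer \<epsilon> \<xi>"
    using \<Phi>_region[OF e, of \<xi>] by (simp add: \<Phi>_def[abs_def])
  have inj: "inj_on (\<lambda>z. \<gamma> \<epsilon> \<xi> (snd z) + fst z *\<^sub>R \<nu> \<epsilon> \<xi> (snd z)) ?S"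
  proof (rule inj_onI)
    fix z w assume zw: "z \<in> ?S" "w \<in> ?S"
      "\<gamma> \<epsilon> \<xi> (snd z) + fst z *\<^sub>R \<nu> \<epsilon> \<xi> (snd z) = \<gamma> \<epsilon> \<xi> (snd w) + fst w *\<^sub>R \<nu> \<epsilon> \<xi> (snd w)"
    then have "\<Phi> \<epsilon> \<xi> z = \<Phi> \<epsilon> \<xi> w" by (simp add: \<Phi>_def)
    then show "z = w"
      using r_s_\<Phi>[OF e st(1)[OF zw(1)]] r_s_\<Phi>[OF e st(1)[OF zw(2)]] by (simp add: prod_eq_iff)
  qed
  note coi = normal_coordinates_integral[where g="\<gamma> \<epsilon> \<xi>" and \<nu>="\<nu> \<epsilon> \<xi>" and g'="\<gamma>s \<epsilon> \<xi>"
      and k="kap \<epsilon> \<xi>" and S="?S" and f=f, OF region_open[OF e], unfolded img]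
  have nd: "(\<nu> \<epsilon> \<xi> has_vector_derivative kap \<epsilon> \<xi> (snd z) *\<^sub>R \<gamma>s \<epsilon> \<xi> (snd z)) (at (snd z))" if "z \<in> ?S" for z
    using curve_derivatives(2)[OF e st(2,3)[OF that]] normal_derivative(1)[OF e st(2,3)[OF that]] by simp
  have jac: "0 \<le> 1 + fst z * kap \<epsilon> \<xi> (snd z)" if "z \<in> ?S" for z
    using jacobian_bounds(2)[OF e st(1)[OF that]] by linarith
  note gd = curve_derivatives(1)[OF e st(2,3)] and fr = curve_frame(1-3)[OF e st(2,3)]
  show "integrable lborel (\<lambda>z. indicator (region \<epsilon> \<xi>) z * ((1 + fst z * kap \<epsilon> \<xi> (snd z)) * f (\<Phi> \<epsilon> \<xi> z)))"
    unfolding \<Phi>_def by (rule coi(1)[OF gd nd fr jac inj k f int])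
  show "(LINT x:layer \<epsilon> \<xi>|lebesgue. f x) =
       (LINT z|lborel. indicator (region \<epsilon> \<xi>) z * ((1 + fst z * kap \<epsilon> \<xi> (snd z)) * f (\<Phi> \<epsilon> \<xi> z)))"
    unfolding \<Phi>_def by (rule coi(2)[OF gd nd fr jac inj k f int])
qed

lemma profile_r_continuous:
  assumes "0 < \<epsilon>" "\<epsilon> \<le> \<epsilon>0"
  shows "continuous_on D (\<lambda>x. deriv U (r \<epsilon> \<xi> x / \<epsilon>))" "continuous_on D (\<lambda>x. U (r \<epsilon> \<xi> x / \<epsilon>))"
proof -
  have c: "continuous_on D (\<lambda>x. r \<epsilon> \<xi> x / \<epsilon>)"
    using r_continuous_x[OF assms] assms by (intro continuous_intros) auto
  show "continuous_on D (\<lambda>x. deriv U (r \<epsilon> \<xi> x / \<epsilon>))" "continuous_on D (\<lambda>x. U (r \<epsilon> \<xi> x / \<epsilon>))"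
    by (rule continuous_on_compose2[OF profile_continuous(2)[OF profile, of UNIV] c], simp,
        rule continuous_on_compose2[OF profile_continuous(1)[OF profile, of UNIV] c], simp)
qed

lemma r_xi_bound: "\<exists>B>0. \<forall>\<epsilon> \<xi> x. 0 < \<epsilon> \<and> \<epsilon> \<le> \<epsilon>0 \<and> x \<in> layer \<epsilon> \<xi> \<longrightarrow> \<bar>dxi 1 (r \<epsilon>) \<xi> x\<bar> \<le> B"
proof -
  obtain B where B: "\<And>\<epsilon> \<xi> x. 0 < \<epsilon> \<Longrightarrow> \<epsilon> \<le> \<epsilon>0 \<Longrightarrow> x \<in> D \<Longrightarrow> \<bar>r \<epsilon> \<xi> x\<bar> < r0 \<Longrightarrow> \<bar>dxi 1 (r \<epsilon>) \<xi> x\<bar> \<le> B"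
    using derivative_bounds[of 1] by blast
  have "\<bar>dxi 1 (r \<epsilon>) \<xi> x\<bar> \<le> \<bar>B\<bar> + 1" if "0 < \<epsilon>" "\<epsilon> \<le> \<epsilon>0" "x \<in> layer \<epsilon> \<xi>" for \<epsilon> \<xi> x
    using B[OF that(1,2), of x \<xi>] that(3) r1(2) by (auto simp: layer_def)
  then show ?thesis by (intro exI[of _ "\<bar>B\<bar> + 1"]) auto
qed

text \<open>Across the layer \<open>U' (\<rho> / \<epsilon>)\<close> has integral \<open>O(\<epsilon>)\<close>; along it lengths and Jacobians are bounded.\<close>
lemma layer_mass:
  "\<exists>C\<ge>0. \<forall>\<epsilon> \<xi>. 0 < \<epsilon> \<and> \<epsilon> \<le> \<epsilon>0 \<longrightarrow>
     set_integrable lebesgue (layer \<epsilon> \<xi>) (\<lambda>x. deriv U (r \<epsilon> \<xi> x / \<epsilon>)) \<and>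
     (LINT x:layer \<epsilon> \<xi>|lebesgue. deriv U (r \<epsilon> \<xi> x / \<epsilon>)) \<le> C * \<epsilon>"
proof (intro exI[of _ "3 * (4 + 2 * a)"] conjI allI impI)
  show "0 \<le> 3 * (4 + 2 * a)" using pos by simp
  fix \<epsilon> \<xi> assume "0 < \<epsilon> \<and> \<epsilon> \<le> \<epsilon>0"
  then have e: "0 < \<epsilon>" "\<epsilon> \<le> \<epsilon>0" by auto
  let ?f = "\<lambda>x. deriv U (r \<epsilon> \<xi> x / \<epsilon>)"
  have V: "0 < deriv U R" "deriv U R \<le> 1" for R
    using AC_profile_deriv_pos[OF profile] AC_profile_deriv_le_1[OF profile] by auto
  have cf: "continuous_on (layer \<epsilon> \<xi>) ?f"
    using profile_r_continuous(1)[OF e] by (rule continuous_on_subset) (auto simp: layer_def)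
  have bf: "\<bar>?f x\<bar> \<le> 1" for x using V[of "r \<epsilon> \<xi> x / \<epsilon>"] by simp
  note li = layer_integral[OF e cf bf]
  show "set_integrable lebesgue (layer \<epsilon> \<xi>) ?f" by (rule li(1))
  define F where "F \<rho> = 3/2 * (indicator {-r1..r1} \<rho> * deriv U (\<rho> / \<epsilon>))" for \<rho>
  define h where "h = len \<epsilon> \<xi> / 2 + a"
  have h: "0 \<le> h" "2 * h \<le> 4 + 2 * a" using len_bounds[OF e, of \<xi>] pos by (auto simp: h_def)
  note pi = profile_integral[OF profile e(1) r1(1)]
  have F: "F \<in> borel_measurable borel"
    using borel_measurable_integrable[OF pi(1)] by (simp add: F_def[abs_def])
  have "integrable lborel (\<lambda>\<rho>. (3/2 * (2 * h)) * (indicator {-r1..r1} \<rho> * deriv U (\<rho> / \<epsilon>)))"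
    by (rule integrable_mult_right) (rule pi(1))
  moreover have "(\<lambda>\<rho>. (3/2 * (2 * h)) * (indicator {-r1..r1} \<rho> * deriv U (\<rho> / \<epsilon>))) = (\<lambda>\<rho>. F \<rho> * (2 * h))"
    by (simp add: F_def fun_eq_iff)
  ultimately have F2: "integrable lborel (\<lambda>\<rho>. F \<rho> * (2 * h))" by (simp only:)
  note st = strip_integral[where F=F and h="\<lambda>_. h" and c="len \<epsilon> \<xi> / 2", OF F _ h(1) F2]
  have "(LINT x:layer \<epsilon> \<xi>|lebesgue. ?f x) =
    (LINT z|lborel. indicator (region \<epsilon> \<xi>) z * ((1 + fst z * kap \<epsilon> \<xi> (snd z)) * ?f (\<Phi> \<epsilon> \<xi> z)))"
    by (rule li(3))
  also have "\<dots> \<le> (LINT z|lborel. F (fst z) * (if \<bar>snd z - len \<epsilon> \<xi> / 2\<bar> \<le> h then 1 else 0))"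
  proof (rule integral_mono[OF li(2) st(1)])
    fix z :: "real \<times> real"
    have nn: "0 \<le> F (fst z) * (if \<bar>snd z - len \<epsilon> \<xi> / 2\<bar> \<le> h then 1 else 0)"
      using V[of "fst z / \<epsilon>"] by (simp add: F_def)
    show "indicator (region \<epsilon> \<xi>) z * ((1 + fst z * kap \<epsilon> \<xi> (snd z)) * ?f (\<Phi> \<epsilon> \<xi> z))
      \<le> F (fst z) * (if \<bar>snd z - len \<epsilon> \<xi> / 2\<bar> \<le> h then 1 else 0)"
    proof (cases "z \<in> region \<epsilon> \<xi>")
      case True
      then have z: "z \<in> strip \<epsilon> \<xi>" by (simp add: region_def)
      have "\<bar>snd z - len \<epsilon> \<xi> / 2\<bar> \<le> h" using stripD[OF z] by (auto simp: h_def abs_le_iff)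
      moreover have "(1 + fst z * kap \<epsilon> \<xi> (snd z)) * deriv U (fst z / \<epsilon>) \<le> 3/2 * deriv U (fst z / \<epsilon>)"
        using jacobian_bounds(3)[OF e z] V[of "fst z / \<epsilon>"] by (intro mult_right_mono) auto
      ultimately show ?thesis
        using True stripD(1)[OF z] r_s_\<Phi>(1)[OF e z] by (simp add: F_def abs_less_iff)
    qed (use nn in simp)
  qed simp
  also have "\<dots> = (LINT \<rho>|lborel. F \<rho> * (2 * h))" by (rule st(2)) simp
  also have "\<dots> = 3/2 * (2 * h) * (LINT \<rho>|lborel. indicator {-r1..r1} \<rho> * deriv U (\<rho> / \<epsilon>))"
    by (simp add: F_def mult_ac)
  also have "\<dots> \<le> 3/2 * (2 * h) * (2 * \<epsilon>)" using pi(2) h by (intro mult_left_mono) auto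
  also have "\<dots> \<le> 3/2 * (4 + 2 * a) * (2 * \<epsilon>)" using h e by (intro mult_right_mono mult_left_mono) auto
  finally show "(LINT x:layer \<epsilon> \<xi>|lebesgue. ?f x) \<le> 3 * (4 + 2 * a) * \<epsilon>" by simp
qed

text \<open>By the orthogonal contact the ends of the region deviate from \<open>\<sigma> = 0\<close> and \<open>\<sigma> = \<bar>\<Gamma>\<bar>\<close> only by \<open>O(\<rho>\<^sup>2)\<close>.\<close>
lemma region_ends:
  "\<exists>B\<ge>0. \<forall>\<epsilon> \<xi> z. 0 < \<epsilon> \<and> \<epsilon> \<le> \<epsilon>0 \<and> z \<in> strip \<epsilon> \<xi> \<and>
      B * (fst z)\<^sup>2 < \<bar>snd z\<bar> \<and> B * (fst z)\<^sup>2 < \<bar>snd z - len \<epsilon> \<xi>\<bar> \<longrightarrow>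
      (z \<in> region \<epsilon> \<xi> \<longleftrightarrow> 0 < snd z \<and> snd z < len \<epsilon> \<xi>)"
proof -
  obtain B where B: "\<forall>\<epsilon>\<in>{0<..\<epsilon>0}. \<forall>\<xi>. \<exists>s1 s2. (\<forall>\<rho>\<in>{-r0<..<r0}.
        \<bar>s1 \<rho>\<bar> \<le> B * \<rho>\<^sup>2 \<and> \<bar>s2 \<rho> - len \<epsilon> \<xi>\<bar> \<le> B * \<rho>\<^sup>2 \<and>
        (\<forall>\<sigma>\<in>{-a<..<len \<epsilon> \<xi> + a}.
           \<gamma> \<epsilon> \<xi> \<sigma> + \<rho> *\<^sub>R \<nu> \<epsilon> \<xi> \<sigma> \<in> D \<longleftrightarrow> s1 \<rho> < \<sigma> \<and> \<sigma> < s2 \<rho>))"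
    using coords[unfolded droplet_coords_def, THEN conjunct2, THEN conjunct1] by blast
  show ?thesis
  proof (intro exI[of _ "\<bar>B\<bar>"] conjI allI impI)
    fix \<epsilon> \<xi> and z :: "real \<times> real"
    assume A: "0 < \<epsilon> \<and> \<epsilon> \<le> \<epsilon>0 \<and> z \<in> strip \<epsilon> \<xi> \<and>
      \<bar>B\<bar> * (fst z)\<^sup>2 < \<bar>snd z\<bar> \<and> \<bar>B\<bar> * (fst z)\<^sup>2 < \<bar>snd z - len \<epsilon> \<xi>\<bar>"
    then have z: "z \<in> strip \<epsilon> \<xi>" by simp
    obtain s1 s2 where s: "\<And>\<rho>. \<rho> \<in> {-r0<..<r0} \<Longrightarrow> \<bar>s1 \<rho>\<bar> \<le> B * \<rho>\<^sup>2 \<and> \<bar>s2 \<rho> - len \<epsilon> \<xi>\<bar> \<le> B * \<rho>\<^sup>2 \<and>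
        (\<forall>\<sigma>\<in>{-a<..<len \<epsilon> \<xi> + a}. \<gamma> \<epsilon> \<xi> \<sigma> + \<rho> *\<^sub>R \<nu> \<epsilon> \<xi> \<sigma> \<in> D \<longleftrightarrow> s1 \<rho> < \<sigma> \<and> \<sigma> < s2 \<rho>)"
    proof -
      have "\<epsilon> \<in> {0<..\<epsilon>0}" using A by simp
      from spec[OF bspec[OF B this], of \<xi>] that show thesis by blast
    qed
    have \<rho>: "fst z \<in> {-r0<..<r0}" using stripD(1)[OF z] r1(2) by auto
    have BB: "B * (fst z)\<^sup>2 \<le> \<bar>B\<bar> * (fst z)\<^sup>2" by (rule mult_right_mono) auto
    have "z \<in> region \<epsilon> \<xi> \<longleftrightarrow> s1 (fst z) < snd z \<and> snd z < s2 (fst z)"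
      using s[OF \<rho>] stripD(2,3)[OF z] z by (auto simp: region_def \<Phi>_def)
    also have "\<dots> \<longleftrightarrow> 0 < snd z \<and> snd z < len \<epsilon> \<xi>"
      using s[OF \<rho>] BB A by linarith
    finally show "z \<in> region \<epsilon> \<xi> \<longleftrightarrow> 0 < snd z \<and> snd z < len \<epsilon> \<xi>" .
  qed simp
qed

text \<open>Integration over the box \<open>\<bar>\<rho>\<bar> \<le> \<epsilon> / 2\<close>, \<open>1/4 \<le> \<sigma> \<le> 3/4\<close> is enough: there \<open>U' (\<rho> / \<epsilon>)\<close> has a positive lower
  bound, and the expansion of \<open>r\<^sub>\<xi>\<close> gives \<open>\<bar>r\<^sub>\<xi>\<bar> \<ge> 1/2 - 1/4\<close>, since \<open>\<sigma> / \<bar>\<Gamma>\<bar> \<le> 1/3\<close>.\<close>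
lemma layer_energy_lower:
  "\<exists>c>0. \<exists>e1>0. \<forall>\<epsilon> \<xi>. 0 < \<epsilon> \<and> \<epsilon> \<le> \<epsilon>0 \<and> \<epsilon> \<le> e1 \<longrightarrow>
     set_integrable lebesgue (layer \<epsilon> \<xi>) (\<lambda>x. (deriv U (r \<epsilon> \<xi> x / \<epsilon>) * dxi 1 (r \<epsilon>) \<xi> x)\<^sup>2) \<and>
     c * \<epsilon> \<le> (LINT x:layer \<epsilon> \<xi>|lebesgue. (deriv U (r \<epsilon> \<xi> x / \<epsilon>) * dxi 1 (r \<epsilon>) \<xi> x)\<^sup>2)"
proof -
  have V: "0 < deriv U R" "deriv U R \<le> 1" for R
    using AC_profile_deriv_pos[OF profile] AC_profile_deriv_le_1[OF profile] by auto
  have "\<exists>x\<in>{-1/2..1/2::real}. \<forall>y\<in>{-1/2..1/2}. deriv U x \<le> deriv U y"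
    by (rule continuous_attains_inf[OF compact_Icc _ profile_continuous(2)[OF profile]]) simp
  then obtain R0 where R0: "\<forall>y\<in>{-1/2..1/2}. deriv U R0 \<le> deriv U y" by blast
  define m where "m = deriv U R0"
  have m: "0 < m" "\<And>R. \<bar>R\<bar> \<le> 1/2 \<Longrightarrow> m \<le> deriv U R"
  proof -
    show "0 < m" using V by (simp add: m_def)
    fix R :: real assume "\<bar>R\<bar> \<le> 1/2"
    then have "- 1/2 \<le> R" "R \<le> 1/2" by linarith+
    then have "R \<in> {-1/2..1/2}" by simp
    with R0 show "m \<le> deriv U R" unfolding m_def by blast
  qed
  obtain B where B: "B \<ge> 0" "\<And>\<epsilon> \<xi> z. 0 < \<epsilon> \<Longrightarrow> \<epsilon> \<le> \<epsilon>0 \<Longrightarrow> z \<in> strip \<epsilon> \<xi> \<Longrightarrow>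
      B * (fst z)\<^sup>2 < \<bar>snd z\<bar> \<Longrightarrow> B * (fst z)\<^sup>2 < \<bar>snd z - len \<epsilon> \<xi>\<bar> \<Longrightarrow>
      (z \<in> region \<epsilon> \<xi> \<longleftrightarrow> 0 < snd z \<and> snd z < len \<epsilon> \<xi>)"
    using region_ends by blast
  obtain B1 where B1: "B1 > 0" "\<And>\<epsilon> \<xi> x. 0 < \<epsilon> \<Longrightarrow> \<epsilon> \<le> \<epsilon>0 \<Longrightarrow> x \<in> layer \<epsilon> \<xi> \<Longrightarrow> \<bar>dxi 1 (r \<epsilon>) \<xi> x\<bar> \<le> B1"
    using r_xi_bound by blast
  define e1 where "e1 = min r1 (1 / (B + 1))"
  have e1: "0 < e1" "e1 \<le> 1" using r1 B by (auto simp: e1_def)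
  define c where "c = m\<^sup>2 / 64"
  show ?thesis
  proof (rule exI[of _ c], rule conjI, goal_cases)
    case 1
    show "0 < c" using m by (simp add: c_def)
  next
    case 2
    show ?case
  proof (rule exI[of _ e1], intro conjI allI impI)
    show "0 < e1" by (rule e1)
    fix \<epsilon> \<xi> assume A: "0 < \<epsilon> \<and> \<epsilon> \<le> \<epsilon>0 \<and> \<epsilon> \<le> e1"
    then have e: "0 < \<epsilon>" "\<epsilon> \<le> \<epsilon>0" by auto
    let ?f = "\<lambda>x. (deriv U (r \<epsilon> \<xi> x / \<epsilon>) * dxi 1 (r \<epsilon>) \<xi> x)\<^sup>2"
    have cf: "continuous_on (layer \<epsilon> \<xi>) ?f"
      by (intro continuous_intros r_xi_continuous[OF e] continuous_on_subset[OF profile_r_continuous(1)[OF e]])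
        (auto simp: layer_def)
    have bf: "\<bar>?f x\<bar> \<le> B1\<^sup>2" if "x \<in> layer \<epsilon> \<xi>" for x
    proof -
      have "\<bar>deriv U (r \<epsilon> \<xi> x / \<epsilon>) * dxi 1 (r \<epsilon>) \<xi> x\<bar> \<le> 1 * B1"
        unfolding abs_mult using V[of "r \<epsilon> \<xi> x / \<epsilon>"] B1(2)[OF e that] by (intro mult_mono) auto
      then have "\<bar>deriv U (r \<epsilon> \<xi> x / \<epsilon>) * dxi 1 (r \<epsilon>) \<xi> x\<bar>\<^sup>2 \<le> B1\<^sup>2" by (intro power_mono) auto
      then show ?thesis by simp
    qed
    note li = layer_integral[OF e cf bf]
    show "set_integrable lebesgue (layer \<epsilon> \<xi>) ?f" by (rule li(1))
    \<comment> \<open>\<open>m\<^sup>2 / 32\<close> is the product of the bounds \<open>1/2\<close> of the Jacobian and \<open>(m / 4)\<^sup>2\<close> of the integrand\<close>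
    define F where "F \<rho> = m\<^sup>2 / 32 * indicator {-\<epsilon>/2..\<epsilon>/2} \<rho>" for \<rho> :: real
    have F: "F \<in> borel_measurable borel" "integrable lborel (\<lambda>\<rho>. F \<rho> * (2 * (1/4)))"
    proof -
      show "F \<in> borel_measurable borel" by (simp add: F_def[abs_def])
      have "integrable lborel (\<lambda>\<rho>. m\<^sup>2 / 64 * indicator {-\<epsilon>/2..\<epsilon>/2} \<rho>)"
        by (intro integrable_mult_right integrable_real_indicator) (auto simp: emeasure_lborel_Icc_eq)
      moreover have "(\<lambda>\<rho>. m\<^sup>2 / 64 * indicator {-\<epsilon>/2..\<epsilon>/2} \<rho>) = (\<lambda>\<rho>. F \<rho> * (2 * (1/4)))"
        by (simp add: F_def fun_eq_iff)
      ultimately show "integrable lborel (\<lambda>\<rho>. F \<rho> * (2 * (1/4)))" by (simp only:)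
    qed
    note st = strip_integral[where F=F and h="\<lambda>_. 1/4" and c="1/2", OF F(1) _ _ F(2)]
    have "c * \<epsilon> = (LINT \<rho>|lborel. F \<rho> * (2 * (1/4)))"
      using e by (simp add: F_def[abs_def] c_def)
    also have "\<dots> = (LINT z|lborel. F (fst z) * (if \<bar>snd z - 1/2 :: real\<bar> \<le> 1/4 then 1 else 0))"
      by (rule st(2)[symmetric]) auto
    also have "\<dots> \<le> (LINT z|lborel. indicator (region \<epsilon> \<xi>) z * ((1 + fst z * kap \<epsilon> \<xi> (snd z)) * ?f (\<Phi> \<epsilon> \<xi> z)))"
    proof (rule integral_mono[OF st(1) li(2)])
      fix z :: "real \<times> real"
      have nn: "0 \<le> indicator (region \<epsilon> \<xi>) z * ((1 + fst z * kap \<epsilon> \<xi> (snd z)) * ?f (\<Phi> \<epsilon> \<xi> z))"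
      proof (cases "z \<in> region \<epsilon> \<xi>")
        case True
        then have "z \<in> strip \<epsilon> \<xi>" by (simp add: region_def)
        from jacobian_bounds(2)[OF e this] True show ?thesis by simp
      qed simp
      show "F (fst z) * (if \<bar>snd z - 1/2\<bar> \<le> 1/4 then 1 else 0)
        \<le> indicator (region \<epsilon> \<xi>) z * ((1 + fst z * kap \<epsilon> \<xi> (snd z)) * ?f (\<Phi> \<epsilon> \<xi> z))"
      proof (cases "\<bar>fst z\<bar> \<le> \<epsilon> / 2 \<and> \<bar>snd z - 1/2\<bar> \<le> 1/4")
        case True
        then have \<rho>: "\<bar>fst z\<bar> \<le> \<epsilon> / 2" and "\<bar>snd z - 1/2\<bar> \<le> 1/4" by blast+
        then have \<sigma>: "1/4 \<le> snd z" "snd z \<le> 3/4" by linarith+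
        have ee: "\<epsilon> \<le> r1" "\<epsilon> \<le> 1 / (B + 1)" using A by (auto simp: e1_def)
        have "- r1 < fst z" "fst z < r1" "- a < snd z" "snd z < len \<epsilon> \<xi> + a"
          using \<rho> \<sigma> ee e(1) pos(2) len_bounds[OF e, of \<xi>] by linarith+
        then have z: "z \<in> strip \<epsilon> \<xi>" by (simp add: strip_def mem_Times_iff)
        have "B * (fst z)\<^sup>2 < 1/4"
        proof -
          have "\<epsilon> \<le> 1" using A e1 by linarith
          have "(fst z)\<^sup>2 \<le> (\<epsilon> / 2)\<^sup>2" using \<rho> e(1) by (metis abs_ge_zero power2_abs power_mono)
          also have "\<dots> \<le> \<epsilon> / 4" using \<open>\<epsilon> \<le> 1\<close> e(1) by (simp add: power2_eq_square mult_left_le)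
          finally have "B * (fst z)\<^sup>2 \<le> B * (\<epsilon> / 4)" using B(1) by (rule mult_left_mono)
          also have "\<dots> \<le> B * (1 / (B + 1) / 4)"
            by (rule mult_left_mono[OF divide_right_mono[OF ee(2)] B(1)]) simp
          also have "\<dots> < 1/4" using B(1) by (simp add: field_simps)
          finally show ?thesis .
        qed
        then have "z \<in> region \<epsilon> \<xi>"
          using B(2)[OF e z] \<sigma> len_bounds[OF e, of \<xi>] by force
        then have zD: "\<Phi> \<epsilon> \<xi> z \<in> D" by (simp add: region_def)
        have rz: "r \<epsilon> \<xi> (\<Phi> \<epsilon> \<xi> z) = fst z" "s \<epsilon> \<xi> (\<Phi> \<epsilon> \<xi> z) = snd z"
          by (rule r_s_\<Phi>(1,2)[OF e z])+
        let ?q = "dxi 1 (r \<epsilon>) \<xi> (\<Phi> \<epsilon> \<xi> z)"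
        have "\<bar>?q + cos (pi * snd z / len \<epsilon> \<xi>)\<bar> \<le> 1/4"
        proof -
          have "\<bar>r \<epsilon> \<xi> (\<Phi> \<epsilon> \<xi> z)\<bar> < r0" using stripD(1)[OF z] r1(2) rz(1) by linarith
          from r_xi[OF e zD this] show ?thesis unfolding rz(2) using small by linarith
        qed
        moreover have "1/2 \<le> cos (pi * snd z / len \<epsilon> \<xi>)"
        proof -
          have "snd z / len \<epsilon> \<xi> \<le> 1/3" using \<sigma> len_bounds[OF e, of \<xi>] by (simp add: divide_le_eq)
          then have "pi * (snd z / len \<epsilon> \<xi>) \<le> pi * (1/3)" by (rule mult_left_mono) simp
          moreover have "0 \<le> pi * (snd z / len \<epsilon> \<xi>)" using \<sigma> len_bounds[OF e, of \<xi>] by simp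
          ultimately have "cos (pi / 3) \<le> cos (pi * (snd z / len \<epsilon> \<xi>))"
            by (intro cos_monotone_0_pi_le) auto
          then show ?thesis by (simp add: cos_60)
        qed
        ultimately have "1/4 \<le> \<bar>?q\<bar>" by linarith
        moreover have "m \<le> deriv U (fst z / \<epsilon>)"
          using \<rho> e(1) by (intro m(2)) (simp add: abs_mult field_simps)
        ultimately have "m * (1/4) \<le> \<bar>deriv U (fst z / \<epsilon>) * ?q\<bar>"
          unfolding abs_mult using m(1) by (intro mult_mono) auto
        then have "(m * (1/4))\<^sup>2 \<le> \<bar>deriv U (fst z / \<epsilon>) * ?q\<bar>\<^sup>2"
          using m(1) by (intro power_mono) auto
        then have "m\<^sup>2 / 16 \<le> (deriv U (fst z / \<epsilon>) * ?q)\<^sup>2" by (simp add: power_mult_distrib power_divide)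
        then have "1/2 * (m\<^sup>2 / 16) \<le> (1 + fst z * kap \<epsilon> \<xi> (snd z)) * (deriv U (fst z / \<epsilon>) * ?q)\<^sup>2"
          using jacobian_bounds(2)[OF e z] by (intro mult_mono) auto
        moreover have "F (fst z) = m\<^sup>2 / 32"
        proof -
          have "- \<epsilon> / 2 \<le> fst z" "fst z \<le> \<epsilon> / 2" using \<rho> by linarith+
          then show ?thesis by (simp add: F_def)
        qed
        ultimately show ?thesis using \<open>z \<in> region \<epsilon> \<xi>\<close> True rz by simp
      next
        case False
        then have eq0: "F (fst z) * (if \<bar>snd z - 1/2\<bar> \<le> 1/4 then 1 else 0) = 0"
          by (auto simp: F_def indicator_def abs_le_iff)
        show ?thesis unfolding eq0 by (rule nn)
      qed
    qed auto
    also have "\<dots> = (LINT x:layer \<epsilon> \<xi>|lebesgue. ?f x)" by (rule li(3)[symmetric])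
    finally show "c * \<epsilon> \<le> (LINT x:layer \<epsilon> \<xi>|lebesgue. ?f x)" .
  qed
  qed
qed

text \<open>The bound by absolute values would be \<open>O(\<epsilon>)\<close>. Replacing the Jacobian \<open>1 + \<rho> \<kappa>\<close> by \<open>1\<close> and the curved region
  by a rectangle costs a factor \<open>\<bar>\<rho>\<bar>\<close>, hence \<open>O(\<epsilon>\<^sup>2)\<close>, because \<open>\<bar>U' U''\<bar> \<le> 2 U'\<^sup>2\<close> and the integral of
  \<open>\<bar>\<rho>\<bar> U' (\<rho> / \<epsilon>)\<^sup>2\<close> is \<open>O(\<epsilon>\<^sup>2)\<close>. What remains is a product, since \<open>r\<^sub>\<xi>\<close> does not depend on \<open>\<rho>\<close>, and its
  factor in \<open>\<rho>\<close> is the integral of an exact derivative.\<close>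
lemma layer_cancellation:
  "\<exists>C\<ge>0. \<forall>\<epsilon> \<xi>. 0 < \<epsilon> \<and> \<epsilon> \<le> \<epsilon>0 \<longrightarrow>
     set_integrable lebesgue (layer \<epsilon> \<xi>)
       (\<lambda>x. deriv U (r \<epsilon> \<xi> x / \<epsilon>) * nonlin (U (r \<epsilon> \<xi> x / \<epsilon>)) * (dxi 1 (r \<epsilon>) \<xi> x) ^ 3) \<and>
     \<bar>LINT x:layer \<epsilon> \<xi>|lebesgue.
       deriv U (r \<epsilon> \<xi> x / \<epsilon>) * nonlin (U (r \<epsilon> \<xi> x / \<epsilon>)) * (dxi 1 (r \<epsilon>) \<xi> x) ^ 3\<bar> \<le> C * \<epsilon>\<^sup>2"
proof -
  have V: "0 < deriv U R" "deriv U R \<le> 1" for R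
    using AC_profile_deriv_pos[OF profile] AC_profile_deriv_le_1[OF profile] by auto
  have Nb: "\<bar>nonlin (U R)\<bar> \<le> 2 * deriv U R" for R by (rule AC_profile_second_deriv_le[OF profile])
  obtain B where B: "B \<ge> 0" "\<And>\<epsilon> \<xi> z. 0 < \<epsilon> \<Longrightarrow> \<epsilon> \<le> \<epsilon>0 \<Longrightarrow> z \<in> strip \<epsilon> \<xi> \<Longrightarrow>
      B * (fst z)\<^sup>2 < \<bar>snd z\<bar> \<Longrightarrow> B * (fst z)\<^sup>2 < \<bar>snd z - len \<epsilon> \<xi>\<bar> \<Longrightarrow>
      (z \<in> region \<epsilon> \<xi> \<longleftrightarrow> 0 < snd z \<and> snd z < len \<epsilon> \<xi>)"
    using region_ends by blast
  obtain B1 where B1: "B1 > 0" "\<And>\<epsilon> \<xi> x. 0 < \<epsilon> \<Longrightarrow> \<epsilon> \<le> \<epsilon>0 \<Longrightarrow> x \<in> layer \<epsilon> \<xi> \<Longrightarrow> \<bar>dxi 1 (r \<epsilon>) \<xi> x\<bar> \<le> B1"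
    using r_xi_bound by blast
  obtain C1 where C1: "C1 \<ge> 0" "\<And>\<epsilon>. 0 < \<epsilon> \<Longrightarrow> integrable lborel (\<lambda>\<rho>. \<bar>\<rho>\<bar> * (deriv U (\<rho> / \<epsilon>))\<^sup>2)"
     "\<And>\<epsilon>. 0 < \<epsilon> \<Longrightarrow> (LINT \<rho>|lborel. \<bar>\<rho>\<bar> * (deriv U (\<rho> / \<epsilon>))\<^sup>2) \<le> C1 * \<epsilon>\<^sup>2"
    using profile_first_moment[OF profile] by blast
  obtain C2 where C2: "C2 \<ge> 0" "\<And>\<epsilon> b. 0 < \<epsilon> \<Longrightarrow> 0 < b \<Longrightarrow>
     \<bar>LINT \<rho>|lborel. indicator {-b..b} \<rho> * (deriv U (\<rho> / \<epsilon>) * nonlin (U (\<rho> / \<epsilon>)))\<bar> \<le> C2 * \<epsilon>\<^sup>2 / b"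
    using profile_product_integral[OF profile] by blast
  define Ka where "Ka = 2 * B1 ^ 3 * (4 * B + 3 * (4 + 2 * a))"
  define C where "C = 4 * B1 ^ 3 * (C2 / r1) + Ka * C1"
  have Ka: "0 \<le> Ka" using B B1 pos by (simp add: Ka_def)
  have C: "0 \<le> C" using Ka B1 C1 C2 r1 by (simp add: C_def)
  show ?thesis
  proof (intro exI[of _ C] conjI allI impI)
    show "0 \<le> C" by (rule C)
    fix \<epsilon> \<xi> assume "0 < \<epsilon> \<and> \<epsilon> \<le> \<epsilon>0"
    then have e: "0 < \<epsilon>" "\<epsilon> \<le> \<epsilon>0" by auto
    let ?l = "len \<epsilon> \<xi>"
    let ?f = "\<lambda>x. deriv U (r \<epsilon> \<xi> x / \<epsilon>) * nonlin (U (r \<epsilon> \<xi> x / \<epsilon>)) * (dxi 1 (r \<epsilon>) \<xi> x) ^ 3"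
    have l: "0 < ?l" "?l \<le> 4" using len_bounds[OF e, of \<xi>] by auto
    have cf: "continuous_on (layer \<epsilon> \<xi>) ?f"
      unfolding nonlin_def
      by (intro continuous_intros r_xi_continuous[OF e] continuous_on_subset[OF profile_r_continuous(1)[OF e]]
          continuous_on_subset[OF profile_r_continuous(2)[OF e]])
        (auto simp: layer_def)
    have bf: "\<bar>?f x\<bar> \<le> 1 * 2 * B1 ^ 3" if "x \<in> layer \<epsilon> \<xi>" for x
    proof -
      have "\<bar>dxi 1 (r \<epsilon>) \<xi> x\<bar> ^ 3 \<le> B1 ^ 3" using B1(2)[OF e that] by (intro power_mono) auto
      moreover have "\<bar>nonlin (U (r \<epsilon> \<xi> x / \<epsilon>))\<bar> \<le> 2"
        using Nb[of "r \<epsilon> \<xi> x / \<epsilon>"] V[of "r \<epsilon> \<xi> x / \<epsilon>"] by linarith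
      ultimately show ?thesis
        unfolding abs_mult power_abs using V[of "r \<epsilon> \<xi> x / \<epsilon>"] B1(1) by (intro mult_mono) auto
    qed
    note li = layer_integral[OF e cf bf]
    show "set_integrable lebesgue (layer \<epsilon> \<xi>) ?f" by (rule li(1))
    define G where "G \<rho> = deriv U (\<rho> / \<epsilon>) * nonlin (U (\<rho> / \<epsilon>))" for \<rho>
    define F where "F \<rho> = indicator {-r1<..<r1} \<rho> * G \<rho>" for \<rho>
    define Q where "Q \<sigma> = dxi 1 (r \<epsilon>) \<xi> (\<Phi> \<epsilon> \<xi> (0, \<sigma>))" for \<sigma>
    define q where "q \<sigma> = indicator {0<..<?l} \<sigma> * (Q \<sigma>) ^ 3" for \<sigma>
    let ?f1 = "\<lambda>z. indicator (region \<epsilon> \<xi>) z * ((1 + fst z * kap \<epsilon> \<xi> (snd z)) * ?f (\<Phi> \<epsilon> \<xi> z))"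
    let ?f2 = "\<lambda>z. F (fst z) * q (snd z)"
    have Q: "dxi 1 (r \<epsilon>) \<xi> (\<Phi> \<epsilon> \<xi> z) = Q (snd z)" if "z \<in> strip \<epsilon> \<xi>" for z
    proof -
      have "(fst z, snd z) \<in> strip \<epsilon> \<xi>" "(0, snd z) \<in> strip \<epsilon> \<xi>"
        using that r1 by (auto simp: strip_def mem_Times_iff)
      from r_xi_constant_on_normals[OF e this(1)] r_xi_constant_on_normals[OF e this(2)]
      show ?thesis by (simp add: Q_def)
    qed
    \<comment> \<open>\<open>F\<close> and \<open>q\<close> are the factors across and along the layer\<close>
    have G_cont: "continuous_on UNIV G"
      unfolding G_def[abs_def] nonlin_def by (intro continuous_intros profile_scaled_continuous[OF profile])
    then have G_meas [measurable]: "G \<in> borel_measurable borel" by (rule borel_measurable_continuous_onI)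
    have F_meas [measurable]: "F \<in> borel_measurable borel" unfolding F_def[abs_def] by measurable
    have Fb: "\<bar>F \<rho>\<bar> \<le> 2 * (deriv U (\<rho> / \<epsilon>))\<^sup>2" for \<rho>
    proof -
      have "\<bar>G \<rho>\<bar> \<le> deriv U (\<rho> / \<epsilon>) * (2 * deriv U (\<rho> / \<epsilon>))"
        unfolding G_def abs_mult using V[of "\<rho> / \<epsilon>"] Nb[of "\<rho> / \<epsilon>"] by (intro mult_mono) auto
      then show ?thesis by (auto simp: F_def indicator_def power2_eq_square abs_mult)
    qed
    have F0: "F \<rho> = 0" if "\<not> \<bar>\<rho>\<bar> < r1" for \<rho> using that by (auto simp: F_def abs_less_iff)
    have mid: "(0, \<sigma>) \<in> region \<epsilon> \<xi>" if "0 < \<sigma>" "\<sigma> < ?l" for \<sigma>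
    proof -
      have "(0, \<sigma>) \<in> strip \<epsilon> \<xi>" using that r1 pos by (auto simp: strip_def)
      then show ?thesis using B(2)[OF e, of "(0, \<sigma>)" \<xi>] that by simp
    qed
    have Qb: "\<bar>Q \<sigma>\<bar> \<le> B1" if "0 < \<sigma>" "\<sigma> < ?l" for \<sigma>
      unfolding Q_def using \<Phi>_region[OF e, of \<xi>] mid[OF that] by (intro B1(2)[OF e]) auto
    have q_meas [measurable]: "q \<in> borel_measurable borel"
    proof -
      have "continuous_on {0<..<?l} (\<lambda>\<sigma>. \<Phi> \<epsilon> \<xi> (0, \<sigma>))"
        by (rule continuous_on_compose2[OF \<Phi>_continuous[OF e]])
          (use r1 pos in \<open>auto simp: strip_def intro!: continuous_intros\<close>)
      then have "continuous_on {0<..<?l} Q"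
        unfolding Q_def[abs_def]
        by (rule continuous_on_compose2[OF r_xi_continuous[OF e]])
          (use \<Phi>_region[OF e, of \<xi>] mid in auto)
      then have "continuous_on {0<..<?l} (\<lambda>\<sigma>. (Q \<sigma>) ^ 3)" by (intro continuous_intros)
      then have "(\<lambda>\<sigma>. indicator {0<..<?l} \<sigma> *\<^sub>R (Q \<sigma>) ^ 3) \<in> borel_measurable borel"
        by (intro borel_measurable_continuous_on_indicator) auto
      then show ?thesis by (simp add: q_def[abs_def])
    qed
    have qb: "\<bar>q \<sigma>\<bar> \<le> B1 ^ 3" for \<sigma>
    proof (cases "0 < \<sigma> \<and> \<sigma> < ?l")
      case True
      then have "\<bar>Q \<sigma>\<bar> ^ 3 \<le> B1 ^ 3" using Qb by (intro power_mono) auto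
      then show ?thesis using True by (simp add: q_def power_abs)
    qed (use B1(1) in \<open>auto simp: q_def\<close>)
    \<comment> \<open>any strip of half-width \<open>g = O(\<bar>\<rho>\<bar>)\<close>, weighted with \<open>F\<close>, contributes \<open>O(\<epsilon>\<^sup>2)\<close>\<close>
    have maj: "integrable lborel (\<lambda>\<rho>. \<bar>F \<rho>\<bar> * (2 * g \<rho>))
        \<and> (LINT \<rho>|lborel. \<bar>F \<rho>\<bar> * (2 * g \<rho>)) \<le> 2 * (2 * c) * (C1 * \<epsilon>\<^sup>2)"
      if g: "g \<in> borel_measurable borel" "\<And>\<rho>. \<bar>\<rho>\<bar> < r1 \<Longrightarrow> 0 \<le> g \<rho> \<and> g \<rho> \<le> c * \<bar>\<rho>\<bar>" and c: "0 \<le> c" for g c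
    proof -
      have le: "\<bar>F \<rho>\<bar> * (2 * g \<rho>) \<le> 2 * (2 * c) * (\<bar>\<rho>\<bar> * (deriv U (\<rho> / \<epsilon>))\<^sup>2)"
        and nn: "0 \<le> \<bar>F \<rho>\<bar> * (2 * g \<rho>)" for \<rho>
      proof -
        have "\<bar>F \<rho>\<bar> * (2 * g \<rho>) \<le> 2 * (2 * c) * (\<bar>\<rho>\<bar> * (deriv U (\<rho> / \<epsilon>))\<^sup>2) \<and> 0 \<le> \<bar>F \<rho>\<bar> * (2 * g \<rho>)"
        proof (cases "\<bar>\<rho>\<bar> < r1")
          case True
          then have "\<bar>F \<rho>\<bar> * (2 * g \<rho>) \<le> (2 * (deriv U (\<rho> / \<epsilon>))\<^sup>2) * (2 * (c * \<bar>\<rho>\<bar>))"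
            using g(2)[OF True] Fb by (intro mult_mono) auto
          then show ?thesis using g(2)[OF True] by (simp add: mult_ac)
        qed (use F0 c in simp)
        then show "\<bar>F \<rho>\<bar> * (2 * g \<rho>) \<le> 2 * (2 * c) * (\<bar>\<rho>\<bar> * (deriv U (\<rho> / \<epsilon>))\<^sup>2)"
          and "0 \<le> \<bar>F \<rho>\<bar> * (2 * g \<rho>)" by auto
      qed
      have i: "integrable lborel (\<lambda>\<rho>. 2 * (2 * c) * (\<bar>\<rho>\<bar> * (deriv U (\<rho> / \<epsilon>))\<^sup>2))"
        by (rule integrable_mult_right) (rule C1(2)[OF e(1)])
      have int: "integrable lborel (\<lambda>\<rho>. \<bar>F \<rho>\<bar> * (2 * g \<rho>))"
      proof (rule Bochner_Integration.integrable_bound[OF i])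
        show "(\<lambda>\<rho>. \<bar>F \<rho>\<bar> * (2 * g \<rho>)) \<in> borel_measurable lborel" using g(1) by measurable
        show "AE \<rho> in lborel. norm (\<bar>F \<rho>\<bar> * (2 * g \<rho>)) \<le> norm (2 * (2 * c) * (\<bar>\<rho>\<bar> * (deriv U (\<rho> / \<epsilon>))\<^sup>2))"
          unfolding real_norm_def
          by (rule AE_I2) (use le nn in \<open>simp only: abs_of_nonneg[OF nn]; meson abs_ge_self order_trans\<close>)
      qed
      have "(LINT \<rho>|lborel. \<bar>F \<rho>\<bar> * (2 * g \<rho>)) \<le> (LINT \<rho>|lborel. 2 * (2 * c) * (\<bar>\<rho>\<bar> * (deriv U (\<rho> / \<epsilon>))\<^sup>2))"
        by (rule integral_mono[OF int i le])
      also have "\<dots> = 2 * (2 * c) * (LINT \<rho>|lborel. \<bar>\<rho>\<bar> * (deriv U (\<rho> / \<epsilon>))\<^sup>2)" by simp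
      also have "\<dots> \<le> 2 * (2 * c) * (C1 * \<epsilon>\<^sup>2)" using C1(3)[OF e(1)] c by (intro mult_left_mono) auto
      finally show ?thesis using int by blast
    qed
    have F_int: "integrable lborel F"
    proof (rule Bochner_Integration.integrable_bound)
      show "integrable lborel (\<lambda>\<rho>. 2 * (indicator {-r1..r1} \<rho> * deriv U (\<rho> / \<epsilon>)))"
        by (rule integrable_mult_right) (rule profile_integral(1)[OF profile e(1) r1(1)])
      have "\<bar>F \<rho>\<bar> \<le> 2 * (indicator {-r1..r1} \<rho> * deriv U (\<rho> / \<epsilon>))" for \<rho>
      proof (cases "\<bar>\<rho>\<bar> < r1")
        case True
        have "(deriv U (\<rho> / \<epsilon>))\<^sup>2 \<le> deriv U (\<rho> / \<epsilon>)"
          using V[of "\<rho> / \<epsilon>"] by (simp add: power2_eq_square mult_left_le)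
        then show ?thesis using Fb[of \<rho>] True by (simp add: abs_less_iff)
      qed (use F0 V[of "\<rho> / \<epsilon>"] in simp)
      then show "AE \<rho> in lborel. norm (F \<rho>) \<le> norm (2 * (indicator {-r1..r1} \<rho> * deriv U (\<rho> / \<epsilon>)))"
        by (intro AE_I2) (simp only: real_norm_def, meson abs_ge_self order_trans)
    qed simp
    \<comment> \<open>the product part\<close>
    have q_int: "integrable lborel q"
    proof (rule Bochner_Integration.integrable_bound)
      show "integrable lborel (\<lambda>\<sigma>. indicator {0..?l} \<sigma> * B1 ^ 3)"
        by (intro integrable_mult_left integrable_real_indicator) (auto simp: emeasure_lborel_Icc_eq)
      have "\<bar>q \<sigma>\<bar> \<le> indicator {0..?l} \<sigma> * B1 ^ 3" for \<sigma>
        using qb[of \<sigma>] B1(1) by (auto simp: q_def indicator_def)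
      then show "AE \<sigma> in lborel. norm (q \<sigma>) \<le> norm (indicator {0..?l} \<sigma> * B1 ^ 3)"
        by (intro AE_I2) (simp only: real_norm_def, meson abs_ge_self order_trans)
    qed simp
    have f2: "integrable lborel ?f2" "(LINT z|lborel. ?f2 z) = (LINT \<rho>|lborel. F \<rho>) * (LINT \<sigma>|lborel. q \<sigma>)"
    proof -
      have i: "integrable (lborel \<Otimes>\<^sub>M lborel) ?f2"
      proof (rule lborel_pair.Fubini_integrable)
        show "?f2 \<in> borel_measurable (lborel \<Otimes>\<^sub>M lborel)" by measurable
        have "(LINT y|lborel. norm (?f2 (x, y))) = \<bar>F x\<bar> * (LINT y|lborel. \<bar>q y\<bar>)" for x
          by (simp add: abs_mult)
        then show "integrable lborel (\<lambda>x. LINT y|lborel. norm (?f2 (x, y)))" using F_int by simp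
        show "AE x in lborel. integrable lborel (\<lambda>y. ?f2 (x, y))" using q_int by simp
      qed
      then show "integrable lborel ?f2" by (simp add: lborel_prod)
      have "(LINT z|(lborel \<Otimes>\<^sub>M lborel). ?f2 z) = (LINT x|lborel. LINT y|lborel. ?f2 (x, y))"
        by (rule lborel_pair.integral_fst'[OF i, symmetric])
      then show "(LINT z|lborel. ?f2 z) = (LINT \<rho>|lborel. F \<rho>) * (LINT \<sigma>|lborel. q \<sigma>)"
        by (simp add: lborel_prod)
    qed
    have f2b: "\<bar>LINT z|lborel. ?f2 z\<bar> \<le> 4 * B1 ^ 3 * (C2 / r1) * \<epsilon>\<^sup>2"
    proof -
      have "(LINT \<rho>|lborel. F \<rho>) = (LINT \<rho>|lborel. indicator {-r1..r1} \<rho> * (deriv U (\<rho> / \<epsilon>) * nonlin (U (\<rho> / \<epsilon>))))"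
      proof (rule integral_cong_AE)
        have "AE \<rho> in lborel. \<rho> \<noteq> r1" "AE \<rho> in lborel. \<rho> \<noteq> - r1"
          by (rule AE_lborel_singleton)+
        then show "AE \<rho> in lborel. F \<rho> = indicator {-r1..r1} \<rho> * (deriv U (\<rho> / \<epsilon>) * nonlin (U (\<rho> / \<epsilon>)))"
          by eventually_elim (auto simp: F_def G_def indicator_def)
        show "(\<lambda>\<rho>. indicator {-r1..r1} \<rho> * (deriv U (\<rho> / \<epsilon>) * nonlin (U (\<rho> / \<epsilon>)))) \<in> borel_measurable lborel"
          using G_meas unfolding G_def[abs_def] by measurable
      qed simp
      then have a: "\<bar>LINT \<rho>|lborel. F \<rho>\<bar> \<le> C2 * \<epsilon>\<^sup>2 / r1" using C2(2)[OF e(1) r1(1)] by simp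
      have "\<bar>LINT \<sigma>|lborel. q \<sigma>\<bar> \<le> (LINT \<sigma>|lborel. \<bar>q \<sigma>\<bar>)" by (rule integral_abs_bound)
      also have "\<dots> \<le> (LINT \<sigma>|lborel. indicator {0..?l} \<sigma> * B1 ^ 3)"
      proof (rule integral_mono)
        show "integrable lborel (\<lambda>\<sigma>. \<bar>q \<sigma>\<bar>)" using q_int by (rule integrable_abs)
        show "integrable lborel (\<lambda>\<sigma>. indicator {0..?l} \<sigma> * B1 ^ 3)"
          by (intro integrable_mult_left integrable_real_indicator) (auto simp: emeasure_lborel_Icc_eq)
        show "\<bar>q \<sigma>\<bar> \<le> indicator {0..?l} \<sigma> * B1 ^ 3" for \<sigma>
          using qb[of \<sigma>] B1(1) by (auto simp: q_def indicator_def)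
      qed
      also have "\<dots> = ?l * B1 ^ 3" using l by simp
      also have "\<dots> \<le> 4 * B1 ^ 3" using l B1(1) by (intro mult_right_mono) auto
      finally have b: "\<bar>LINT \<sigma>|lborel. q \<sigma>\<bar> \<le> 4 * B1 ^ 3" .
      have "\<bar>LINT \<rho>|lborel. F \<rho>\<bar> * \<bar>LINT \<sigma>|lborel. q \<sigma>\<bar> \<le> (C2 * \<epsilon>\<^sup>2 / r1) * (4 * B1 ^ 3)"
        using a b by (intro mult_mono) (auto intro: order_trans[OF abs_ge_zero])
      then show ?thesis by (simp add: f2(2) abs_mult mult_ac)
    qed
    \<comment> \<open>the error of the replacements: two strips at the ends of \<open>\<Gamma>\<close>, from the shape of the region, and
      one with weight \<open>3 \<bar>\<rho>\<bar>\<close> along all of \<open>\<Gamma>\<close>, from the Jacobian\<close>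
    let ?E = "\<lambda>g c z. \<bar>F (fst z)\<bar> * (if \<bar>snd z - c\<bar> \<le> (g :: real \<Rightarrow> real) (fst z) then 1 else (0::real))"
    define h where "h = ?l / 2 + a"
    have h: "0 \<le> h" "h \<le> 2 + a" using l pos by (auto simp: h_def)
    let ?g1 = "\<lambda>\<rho>::real. B * \<rho>\<^sup>2"
    have sq: "\<rho>\<^sup>2 \<le> \<bar>\<rho>\<bar>" if "\<bar>\<rho>\<bar> < r1" for \<rho> :: real
    proof -
      have "\<bar>\<rho>\<bar> * \<bar>\<rho>\<bar> \<le> \<bar>\<rho>\<bar> * 1" using that r1(3) by (intro mult_left_mono) auto
      then show ?thesis by (simp add: power2_eq_square)
    qed
    have g1: "?g1 \<in> borel_measurable borel" "\<And>\<rho>. \<bar>\<rho>\<bar> < r1 \<Longrightarrow> 0 \<le> ?g1 \<rho> \<and> ?g1 \<rho> \<le> B * \<bar>\<rho>\<bar>"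
      using B(1) sq by (auto intro!: mult_left_mono)
    note m1 = maj[OF g1 B(1)]
    have s1: "integrable lborel (?E ?g1 c)" "(LINT z|lborel. ?E ?g1 c z) \<le> 2 * (2 * B) * (C1 * \<epsilon>\<^sup>2)" for c
      using strip_integral[of "\<lambda>\<rho>. \<bar>F \<rho>\<bar>" ?g1 c] m1 B(1) by auto
    let ?E3 = "\<lambda>z. (3 * \<bar>fst z\<bar> * \<bar>F (fst z)\<bar>) * (if \<bar>snd z - ?l / 2\<bar> \<le> h then 1 else (0::real))"
    have s3: "integrable lborel ?E3" "(LINT z|lborel. ?E3 z) \<le> 2 * (2 * (3 * h)) * (C1 * \<epsilon>\<^sup>2)"
    proof -
      have g3: "(\<lambda>\<rho>::real. 3 * h * \<bar>\<rho>\<bar>) \<in> borel_measurable borel"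
        "\<And>\<rho>. \<bar>\<rho>\<bar> < r1 \<Longrightarrow> 0 \<le> 3 * h * \<bar>\<rho>\<bar> \<and> 3 * h * \<bar>\<rho>\<bar> \<le> (3 * h) * \<bar>\<rho>\<bar>" using h by auto
      have h3: "0 \<le> 3 * h" using h by simp
      note m3 = maj[OF g3 h3]
      have eq: "(\<lambda>\<rho>. \<bar>F \<rho>\<bar> * (2 * (3 * h * \<bar>\<rho>\<bar>))) = (\<lambda>\<rho>. (3 * \<bar>\<rho>\<bar> * \<bar>F \<rho>\<bar>) * (2 * h))"
        by (simp add: fun_eq_iff)
      have fm: "(\<lambda>\<rho>. 3 * \<bar>\<rho>\<bar> * \<bar>F \<rho>\<bar>) \<in> borel_measurable borel" by measurable
      show "integrable lborel ?E3" "(LINT z|lborel. ?E3 z) \<le> 2 * (2 * (3 * h)) * (C1 * \<epsilon>\<^sup>2)"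
        using strip_integral[of "\<lambda>\<rho>. 3 * \<bar>\<rho>\<bar> * \<bar>F \<rho>\<bar>" "\<lambda>_. h" "?l / 2", OF fm _ h(1)] m3 unfolding eq by auto
    qed
    let ?E = "\<lambda>z. B1 ^ 3 * (?E ?g1 0 z + ?E ?g1 ?l z + ?E3 z)"
    have E_int: "integrable lborel ?E"
      by (intro integrable_mult_right Bochner_Integration.integrable_add s1(1) s3(1))
    have nn: "0 \<le> ?E z" for z
      using B1(1) by (intro mult_nonneg_nonneg add_nonneg_nonneg) auto
    have diff: "\<bar>?f1 z - ?f2 z\<bar> \<le> ?E z" for z
    proof (cases "z \<in> strip \<epsilon> \<xi>")
      case False
      then have "z \<notin> region \<epsilon> \<xi>" by (simp add: region_def)
      then have f10: "?f1 z = 0" by simp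
      have f20: "?f2 z = 0"
      proof (cases "\<bar>fst z\<bar> < r1")
        case True
        then have "\<not> (0 < snd z \<and> snd z < ?l)"
          using False pos(2) by (auto simp: strip_def mem_Times_iff abs_less_iff)
        then show ?thesis by (auto simp: q_def)
      qed (simp add: F0)
      show ?thesis unfolding f10 f20 using nn[of z] by simp
    next
      case True
      note st = stripD[OF True]
      let ?k = "fst z * kap \<epsilon> \<xi> (snd z)"
      let ?i1 = "indicator (region \<epsilon> \<xi>) z :: real" and ?i2 = "indicator {0<..<?l} (snd z) :: real"
      have Fz: "F (fst z) = G (fst z)" using st(1) by (auto simp: F_def abs_less_iff)
      have f1: "?f1 z = ?i1 * ((1 + ?k) * (F (fst z) * (Q (snd z)) ^ 3))"
        using Q[OF True] r_s_\<Phi>(1)[OF e True] by (simp add: Fz G_def)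
      have f2z: "?f2 z = ?i2 * (F (fst z) * (Q (snd z)) ^ 3)" by (simp add: q_def)
      have "?f1 z - ?f2 z = (?i1 * (1 + ?k) - ?i2) * (F (fst z) * (Q (snd z)) ^ 3)"
        unfolding f1 f2z by (simp add: algebra_simps)
      then have d: "\<bar>?f1 z - ?f2 z\<bar> = \<bar>?i1 * (1 + ?k) - ?i2\<bar> * (\<bar>F (fst z)\<bar> * \<bar>Q (snd z)\<bar> ^ 3)"
        by (simp add: abs_mult power_abs)
      let ?I = "\<lambda>c. if \<bar>snd z - c\<bar> \<le> B * (fst z)\<^sup>2 then 1 else (0::real)"
      have k3: "\<bar>?k\<bar> \<le> 3 * \<bar>fst z\<bar>" by (rule jacobian_bounds(1)[OF e True])
      have i12: "\<bar>?i1 - ?i2\<bar> \<le> ?I 0 + ?I ?l"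
      proof (cases "\<bar>snd z\<bar> \<le> B * (fst z)\<^sup>2 \<or> \<bar>snd z - ?l\<bar> \<le> B * (fst z)\<^sup>2")
        case True
        then have "1 \<le> ?I 0 + ?I ?l" by auto
        moreover have "\<bar>?i1 - ?i2\<bar> \<le> 1" by (auto simp: indicator_def)
        ultimately show ?thesis by linarith
      next
        case False
        then have "z \<in> region \<epsilon> \<xi> \<longleftrightarrow> 0 < snd z \<and> snd z < ?l"
          using B(2)[OF e True] by auto
        then have "?i1 = ?i2" by (auto simp: indicator_def)
        then show ?thesis by simp
      qed
      have "\<bar>?i1 * (1 + ?k) - ?i2\<bar> \<le> \<bar>?i1 - ?i2\<bar> + \<bar>?i1 * ?k\<bar>"
        using abs_triangle_ineq[of "?i1 - ?i2" "?i1 * ?k"] by (simp add: algebra_simps)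
      also have "\<bar>?i1 * ?k\<bar> \<le> 3 * \<bar>fst z\<bar>" using k3 by (auto simp: indicator_def)
      finally have j: "\<bar>?i1 * (1 + ?k) - ?i2\<bar> \<le> ?I 0 + ?I ?l + 3 * \<bar>fst z\<bar>" using i12 by linarith
      have hz: "\<bar>snd z - ?l / 2\<bar> \<le> h" using st(2,3) by (auto simp: h_def abs_le_iff)
      show ?thesis
      proof (cases "?i1 = 0 \<and> ?i2 = 0")
        case True
        then have "\<bar>?f1 z - ?f2 z\<bar> = 0" unfolding d by simp
        then show ?thesis using nn[of z] by linarith
      next
        case False
        have "\<bar>Q (snd z)\<bar> \<le> B1"
        proof (cases "?i1 = 0")
          case True
          then show ?thesis using False Qb by (auto simp: indicator_def split: if_splits)
        next
          case False
          then have "\<Phi> \<epsilon> \<xi> z \<in> layer \<epsilon> \<xi>"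
            using \<Phi>_region[OF e, of \<xi>] by (auto simp: indicator_def split: if_splits)
          then show ?thesis using B1(2)[OF e] Q[OF \<open>z \<in> strip \<epsilon> \<xi>\<close>] by metis
        qed
        then have "\<bar>Q (snd z)\<bar> ^ 3 \<le> B1 ^ 3" by (intro power_mono) auto
        then have "\<bar>?f1 z - ?f2 z\<bar> \<le> (?I 0 + ?I ?l + 3 * \<bar>fst z\<bar>) * (\<bar>F (fst z)\<bar> * B1 ^ 3)"
          unfolding d using j by (intro mult_mono) auto
        also have "\<dots> = ?E z" using hz by (simp add: algebra_simps)
        finally show ?thesis .
      qed
    qed
    have "\<bar>(LINT z|lborel. ?f1 z) - (LINT z|lborel. ?f2 z)\<bar> = \<bar>LINT z|lborel. ?f1 z - ?f2 z\<bar>"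
      by (simp only: Bochner_Integration.integral_diff[OF li(2) f2(1)])
    also have "\<dots> \<le> (LINT z|lborel. \<bar>?f1 z - ?f2 z\<bar>)" by (rule integral_abs_bound)
    also have "\<dots> \<le> (LINT z|lborel. ?E z)"
      by (rule integral_mono[OF integrable_abs[OF Bochner_Integration.integrable_diff[OF li(2) f2(1)]] E_int diff])
    also have "\<dots> = B1 ^ 3 * ((LINT z|lborel. \<bar>F (fst z)\<bar> * (if \<bar>snd z - 0\<bar> \<le> ?g1 (fst z) then 1 else (0::real)))
        + (LINT z|lborel. \<bar>F (fst z)\<bar> * (if \<bar>snd z - ?l\<bar> \<le> ?g1 (fst z) then 1 else (0::real)))
        + (LINT z|lborel. ?E3 z))"
      using s1(1)[of 0] s1(1)[of ?l] s3(1) by simp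
    also have "\<dots> \<le> B1 ^ 3 * (2 * (2 * B) * (C1 * \<epsilon>\<^sup>2) + 2 * (2 * B) * (C1 * \<epsilon>\<^sup>2) + 2 * (2 * (3 * h)) * (C1 * \<epsilon>\<^sup>2))"
      using s1(2)[of 0] s1(2)[of ?l] s3(2) B1(1) by (intro mult_left_mono add_mono) auto
    also have "\<dots> = 2 * B1 ^ 3 * (4 * B + 6 * h) * (C1 * \<epsilon>\<^sup>2)" by (simp add: algebra_simps)
    also have "\<dots> \<le> Ka * (C1 * \<epsilon>\<^sup>2)"
      unfolding Ka_def using h B1(1) C1(1) by (intro mult_right_mono mult_left_mono) auto
    finally have "\<bar>LINT z|lborel. ?f1 z\<bar> \<le> 4 * B1 ^ 3 * (C2 / r1) * \<epsilon>\<^sup>2 + Ka * (C1 * \<epsilon>\<^sup>2)"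
      using f2b by linarith
    also have "\<dots> = C * \<epsilon>\<^sup>2" by (simp add: C_def algebra_simps)
    finally show "\<bar>LINT x:layer \<epsilon> \<xi>|lebesgue. ?f x\<bar> \<le> C * \<epsilon>\<^sup>2"
      using li(3) by metis
  qed
qed

end

section \<open>Norms of the parameter derivatives\<close>

lemma integral_restrict_subset:
  fixes f :: "'a::euclidean_space \<Rightarrow> real"
  assumes D: "D \<in> sets lebesgue" and S: "S \<subseteq> D" and f: "set_integrable lebesgue S f"
  shows "integrable (lebesgue_on D) (\<lambda>x. indicator S x * f x)"
    and "(LINT x|lebesgue_on D. indicator S x * f x) = (LINT x:S|lebesgue. f x)"
proof -
  have eq: "(\<lambda>x. indicator D x *\<^sub>R (indicator S x * f x)) = (\<lambda>x. indicator S x *\<^sub>R f x)"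
    using S by (auto simp: indicator_def fun_eq_iff)
  have D': "D \<inter> space lebesgue \<in> sets lebesgue" using D by simp
  show "integrable (lebesgue_on D) (\<lambda>x. indicator S x * f x)"
    using f unfolding integrable_restrict_space[OF D'] eq set_integrable_def .
  show "(LINT x|lebesgue_on D. indicator S x * f x) = (LINT x:S|lebesgue. f x)"
    unfolding integral_restrict_space[OF D'] eq set_lebesgue_integral_def ..
qed

context droplet_geometry
begin

text \<open>The near and the far estimate overlap in \<open>r1 / 2 < \<bar>r\<bar> < r1\<close>, so the layer \<open>\<bar>r\<bar> < r1\<close> and its complement are
  both covered once the cut-off zone lies in \<open>\<bar>r\<bar> < r1 / 2\<close>.\<close>
lemma pointwise_expansion:
  "\<exists>K>0. \<exists>e1>0. e1 \<le> \<epsilon>0 \<and> e1 \<le> 1 \<and> (\<forall>\<epsilon> \<xi> x. 0 < \<epsilon> \<and> \<epsilon> \<le> e1 \<and> x \<in> D \<longrightarrow>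
     \<bar>dxi 1 (u \<epsilon>) \<xi> x - indicator (layer \<epsilon> \<xi>) x * (deriv U (r \<epsilon> \<xi> x / \<epsilon>) * dxi 1 (r \<epsilon>) \<xi> x) / \<epsilon>\<bar> \<le> K \<and>
     \<bar>dxi 2 (u \<epsilon>) \<xi> x - indicator (layer \<epsilon> \<xi>) x * (nonlin (U (r \<epsilon> \<xi> x / \<epsilon>)) * (dxi 1 (r \<epsilon>) \<xi> x)\<^sup>2) / \<epsilon>\<^sup>2\<bar> \<le> K / \<epsilon> \<and>
     (\<forall>l\<in>{1..3}. \<bar>dxi l (u \<epsilon>) \<xi> x\<bar> \<le> K * (indicator (layer \<epsilon> \<xi>) x * deriv U (r \<epsilon> \<xi> x / \<epsilon>) + \<epsilon>) / \<epsilon> ^ l))"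
proof -
  \<comment> \<open>then \<open>2 \<epsilon> ln\<^sup>2 \<epsilon> \<le> 32 \<surd>\<epsilon> \<le> r1 / 4\<close>\<close>
  define e2 where "e2 = min 1 ((r1 / 2 / 64)\<^sup>2)"
  have e2: "0 < e2" "e2 \<le> 1" using r1 by (auto simp: e2_def)
  have small_log: "2 * (\<epsilon> * (ln \<epsilon>)\<^sup>2) < r1 / 2" if "0 < \<epsilon>" "\<epsilon> \<le> e2" for \<epsilon>
  proof -
    have "\<epsilon> \<le> (r1 / 2 / 64)\<^sup>2" using that by (simp add: e2_def)
    then have "sqrt \<epsilon> \<le> sqrt ((r1 / 2 / 64)\<^sup>2)" by (rule real_sqrt_le_mono)
    then have "sqrt \<epsilon> \<le> r1 / 2 / 64" using r1 by (simp add: real_sqrt_abs)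
    moreover have "\<epsilon> * (ln \<epsilon>)\<^sup>2 \<le> 16 * sqrt \<epsilon>" using that e2 by (intro eps_log_square_le) auto
    ultimately show ?thesis using r1 by linarith
  qed
  obtain Cn where Cn: "Cn \<ge> 0" "\<And>\<epsilon> x \<xi>. \<xi> \<in> near (\<epsilon>, x) \<Longrightarrow>
     \<bar>dxi 1 (u \<epsilon>) \<xi> x - deriv U (r \<epsilon> \<xi> x / \<epsilon>) * dxi 1 (r \<epsilon>) \<xi> x / \<epsilon>\<bar> \<le> Cn \<and>
     \<bar>dxi 2 (u \<epsilon>) \<xi> x - nonlin (U (r \<epsilon> \<xi> x / \<epsilon>)) * (dxi 1 (r \<epsilon>) \<xi> x)\<^sup>2 / \<epsilon>\<^sup>2\<bar> \<le> Cn / \<epsilon> \<and>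
     \<bar>dxi 3 (u \<epsilon>) \<xi> x\<bar> \<le> Cn * (deriv U (r \<epsilon> \<xi> x / \<epsilon>) / \<epsilon> ^ 3 + 1 / \<epsilon>\<^sup>2)"
    using near_derivative_bounds by blast
  have h: "0 < r1 / 2" using r1 by simp
  let ?far = "\<lambda>C. C \<ge> 0 \<and> (\<forall>\<epsilon> x \<xi>. 0 < \<epsilon> \<and> \<epsilon> \<le> \<epsilon>0 \<and> \<epsilon> \<le> exp (-1) \<and> \<epsilon> \<le> e2 \<and> x \<in> D \<and> r1 / 2 < \<bar>r \<epsilon> \<xi> x\<bar> \<longrightarrow>
     (\<forall>l\<in>{1..3}. \<bar>dxi l (u \<epsilon>) \<xi> x\<bar> \<le> C * (\<epsilon> / \<epsilon> ^ l)))"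
  have "\<exists>C. ?far C" by (rule far_derivative_bounds[OF h small_log])
  then obtain Cf where cf: "?far Cf" by (rule exE)
  have Cf: "Cf \<ge> 0" using cf by (rule conjunct1)
  have Cf2: "\<bar>dxi l (u \<epsilon>) \<xi> x\<bar> \<le> Cf * (\<epsilon> / \<epsilon> ^ l)"
    if "0 < \<epsilon>" "\<epsilon> \<le> \<epsilon>0" "\<epsilon> \<le> exp (-1)" "\<epsilon> \<le> e2" "x \<in> D" "r1 / 2 < \<bar>r \<epsilon> \<xi> x\<bar>" "l \<in> {1..3}" for \<epsilon> x \<xi> l
    by (intro conjunct2[OF cf, rule_format] conjI that)
  obtain B where B: "B > 0" "\<And>\<epsilon> \<xi> x. 0 < \<epsilon> \<Longrightarrow> \<epsilon> \<le> \<epsilon>0 \<Longrightarrow> x \<in> layer \<epsilon> \<xi> \<Longrightarrow> \<bar>dxi 1 (r \<epsilon>) \<xi> x\<bar> \<le> B"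
    using r_xi_bound by blast
  define K where "K = Cn + Cf + B + 2 * B\<^sup>2 + 1"
  have K: "0 < K" "Cn \<le> K" "Cf \<le> K" "B + Cn \<le> K" "2 * B\<^sup>2 + Cn \<le> K"
    using Cn(1) Cf B(1) zero_le_power2[of B] unfolding K_def by linarith+
  define e1 where "e1 = min (min \<epsilon>0 (exp (-1))) e2"
  have e1: "0 < e1" "e1 \<le> \<epsilon>0" "e1 \<le> 1" "e1 \<le> exp (-1)" "e1 \<le> e2" using e2 pos by (auto simp: e1_def)
  have V: "0 < deriv U R" "deriv U R \<le> 1" for R
    using AC_profile_deriv_pos[OF profile] AC_profile_deriv_le_1[OF profile] by auto
  show ?thesis
  proof (rule exI[of _ K], rule conjI[OF K(1)], rule exI[of _ e1], intro conjI allI impI e1(1-3), goal_cases)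
    case (1 \<epsilon> \<xi> x)
    then have e: "0 < \<epsilon>" "\<epsilon> \<le> \<epsilon>0" "\<epsilon> \<le> 1" "\<epsilon> \<le> exp (-1)" "\<epsilon> \<le> e2" and x: "x \<in> D" using e1 by auto
    show ?case
    proof (cases "x \<in> layer \<epsilon> \<xi>")
      case True
      then have "\<xi> \<in> near (\<epsilon>, x)" using e x r1 by (auto simp: near_def layer_def)
      from Cn(2)[OF this] True show ?thesis using K(2) by simp
    next
      case False
      then have "r1 / 2 < \<bar>r \<epsilon> \<xi> x\<bar>" using x r1 by (auto simp: layer_def)
      from Cf2[OF e(1,2,4,5) x this, of 1] False show ?thesis using K(3) e by simp
    qed
  next
    case (2 \<epsilon> \<xi> x)
    then have e: "0 < \<epsilon>" "\<epsilon> \<le> \<epsilon>0" "\<epsilon> \<le> 1" "\<epsilon> \<le> exp (-1)" "\<epsilon> \<le> e2" and x: "x \<in> D" using e1 by auto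
    show ?case
    proof (cases "x \<in> layer \<epsilon> \<xi>")
      case True
      then have "\<xi> \<in> near (\<epsilon>, x)" using e x r1 by (auto simp: near_def layer_def)
      from Cn(2)[OF this] True show ?thesis using divide_right_mono[OF K(2), of \<epsilon>] e by simp
    next
      case False
      then have "r1 / 2 < \<bar>r \<epsilon> \<xi> x\<bar>" using x r1 by (auto simp: layer_def)
      from Cf2[OF e(1,2,4,5) x this, of 2] have "\<bar>dxi 2 (u \<epsilon>) \<xi> x\<bar> \<le> Cf / \<epsilon>"
        using e by (simp add: power2_eq_square)
      also have "\<dots> \<le> K / \<epsilon>" using K(3) e by (intro divide_right_mono) auto
      finally show ?thesis using False by simp
    qed
  next
    case (3 \<epsilon> \<xi> x)
    then have e: "0 < \<epsilon>" "\<epsilon> \<le> \<epsilon>0" "\<epsilon> \<le> 1" "\<epsilon> \<le> exp (-1)" "\<epsilon> \<le> e2" and x: "x \<in> D" using e1 by auto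
    show ?case
    proof (cases "x \<in> layer \<epsilon> \<xi>")
      case True
      then have "\<xi> \<in> near (\<epsilon>, x)" using e x r1 by (auto simp: near_def layer_def)
      note n = Cn(2)[OF this]
      let ?V = "deriv U (r \<epsilon> \<xi> x / \<epsilon>)" and ?q = "dxi 1 (r \<epsilon>) \<xi> x" and ?N = "nonlin (U (r \<epsilon> \<xi> x / \<epsilon>))"
      have q: "\<bar>?q\<bar> \<le> B" by (rule B(2)[OF e(1,2) True])
      have Vp: "0 < ?V" by (rule V)
      have l1: "\<bar>dxi 1 (u \<epsilon>) \<xi> x\<bar> \<le> K * (?V + \<epsilon>) / \<epsilon> ^ 1"
      proof -
        have "\<bar>?V * ?q / \<epsilon>\<bar> \<le> ?V * B / \<epsilon>"
          using q Vp e(1) by (auto simp: abs_mult intro!: divide_right_mono mult_left_mono)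
        then have "\<bar>dxi 1 (u \<epsilon>) \<xi> x\<bar> \<le> ?V * B / \<epsilon> + Cn" using n by linarith
        also have "\<dots> = (B * ?V + Cn * \<epsilon>) / \<epsilon>" using e(1) by (simp add: field_simps)
        also have "\<dots> \<le> (K * ?V + K * \<epsilon>) / \<epsilon>"
          using K(2,4) Cn(1) Vp e(1) by (intro divide_right_mono add_mono mult_right_mono) auto
        finally show ?thesis by (simp add: distrib_left)
      qed
      have l2: "\<bar>dxi 2 (u \<epsilon>) \<xi> x\<bar> \<le> K * (?V + \<epsilon>) / \<epsilon> ^ 2"
      proof -
        have "?q\<^sup>2 \<le> B\<^sup>2" using q by (metis abs_ge_zero power2_abs power_mono)
        then have "\<bar>?N\<bar> * ?q\<^sup>2 \<le> (2 * ?V) * B\<^sup>2"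
          using AC_profile_second_deriv_le[OF profile, of "r \<epsilon> \<xi> x / \<epsilon>"] Vp by (intro mult_mono) auto
        then have "\<bar>?N * ?q\<^sup>2 / \<epsilon>\<^sup>2\<bar> \<le> (2 * ?V) * B\<^sup>2 / \<epsilon>\<^sup>2"
          by (simp add: abs_mult divide_right_mono)
        then have "\<bar>dxi 2 (u \<epsilon>) \<xi> x\<bar> \<le> (2 * ?V) * B\<^sup>2 / \<epsilon>\<^sup>2 + Cn / \<epsilon>" using n by linarith
        also have "\<dots> = (2 * B\<^sup>2 * ?V + Cn * \<epsilon>) / \<epsilon>\<^sup>2" using e(1) by (simp add: field_simps power2_eq_square)
        also have "\<dots> \<le> (K * ?V + K * \<epsilon>) / \<epsilon>\<^sup>2"
          using K(2,5) Cn(1) Vp e(1) by (intro divide_right_mono add_mono mult_right_mono) auto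
        finally show ?thesis by (simp add: distrib_left)
      qed
      have l3: "\<bar>dxi 3 (u \<epsilon>) \<xi> x\<bar> \<le> K * (?V + \<epsilon>) / \<epsilon> ^ 3"
      proof -
        have "\<bar>dxi 3 (u \<epsilon>) \<xi> x\<bar> \<le> Cn * (?V / \<epsilon> ^ 3 + 1 / \<epsilon>\<^sup>2)" using n by blast
        also have "?V / \<epsilon> ^ 3 + 1 / \<epsilon>\<^sup>2 = (?V + \<epsilon>) / \<epsilon> ^ 3"
          using e(1) by (simp add: field_simps eval_nat_numeral)
        also have "Cn * ((?V + \<epsilon>) / \<epsilon> ^ 3) \<le> K * ((?V + \<epsilon>) / \<epsilon> ^ 3)"
          using K(2) Vp e(1) by (intro mult_right_mono) auto
        finally show ?thesis by simp
      qed
      have "l = 1 \<or> l = 2 \<or> l = 3" if "l \<in> {1..3}" for l :: nat using that by auto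
      then show ?thesis using l1 l2 l3 True by fastforce
    next
      case False
      then have far: "r1 / 2 < \<bar>r \<epsilon> \<xi> x\<bar>" using x r1 by (auto simp: layer_def)
      show ?thesis
      proof
        fix l :: nat assume l: "l \<in> {1..3}"
        have "\<bar>dxi l (u \<epsilon>) \<xi> x\<bar> \<le> Cf * (\<epsilon> / \<epsilon> ^ l)" by (rule Cf2[OF e(1,2,4,5) x far l])
        also have "\<dots> \<le> K * (\<epsilon> / \<epsilon> ^ l)" using K(3) e(1) by (intro mult_right_mono) auto
        finally show "\<bar>dxi l (u \<epsilon>) \<xi> x\<bar> \<le> K * (indicator (layer \<epsilon> \<xi>) x * deriv U (r \<epsilon> \<xi> x / \<epsilon>) + \<epsilon>) / \<epsilon> ^ l"
          using False by simp
      qed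
    qed
  qed
qed

lemma D_lmeasurable: "D \<in> lmeasurable" "D \<in> sets lebesgue"
  using D_open D_bounded by (auto intro: lmeasurable_open fmeasurableD)

lemma u_derivative_measurable:
  assumes u: "\<exists>G. open G \<and> closure D \<subseteq> G \<and> smooth_on (G \<times> UNIV) (\<lambda>(x, \<xi>). u \<epsilon> \<xi> x)"
  shows "dxi l (u \<epsilon>) \<xi> \<in> borel_measurable (lebesgue_on D)" and "u \<epsilon> \<xi> \<in> L2 D"
proof -
  obtain G where G: "closure D \<subseteq> G" "smooth_on (G \<times> UNIV) (\<lambda>(x, \<xi>). u \<epsilon> \<xi> x)" using u by blast
  have c: "continuous_on G (dxi l (u \<epsilon>) \<xi>)" for l by (rule dxi_continuous_on[OF G(2)]) simp
  have m: "dxi l (u \<epsilon>) \<xi> \<in> borel_measurable (lebesgue_on D)" for l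
    using continuous_on_subset[OF c, of D] G(1) closure_subset D_lmeasurable(2)
    by (intro continuous_imp_measurable_on_sets_lebesgue) auto
  show "dxi l (u \<epsilon>) \<xi> \<in> borel_measurable (lebesgue_on D)" by (rule m)
  have z: "dxi 0 (u \<epsilon>) \<xi> = u \<epsilon> \<xi>" by (simp add: dxi_def fun_eq_iff)
  have "compact (closure D)" using D_bounded by (simp add: compact_closure)
  then have "bounded (u \<epsilon> \<xi> ` closure D)"
    using continuous_on_subset[OF c[of 0] G(1)] unfolding z
    by (intro compact_imp_bounded compact_continuous_image)
  then obtain B where B: "\<forall>x\<in>closure D. \<bar>u \<epsilon> \<xi> x\<bar> \<le> B" unfolding bounded_iff by auto
  show "u \<epsilon> \<xi> \<in> L2 D"
    by (rule bounded_in_L2[OF D_lmeasurable(1), where B=B]) (use m[of 0] z B closure_subset in auto)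
qed

text \<open>Integrates the pointwise expansion. As \<open>U' \<le> 1\<close>, the square of \<open>U' + \<epsilon>\<close> is at most \<open>2 U' + 2 \<epsilon>\<^sup>2\<close>, and the
  integral of \<open>U'\<close> over the layer is \<open>O(\<epsilon>)\<close>. The lower bound uses \<open>z\<^sup>2 / 2 - K\<^sup>2 \<le> y\<^sup>2\<close> for \<open>\<bar>y - z\<bar> \<le> K\<close>, and the product
  differs from its leading part by \<open>O((U' + \<epsilon>) / \<epsilon>\<^sup>2)\<close>, with integral \<open>O(1 / \<epsilon>)\<close>.\<close>
lemma derivative_norms:
  assumes u: "\<forall>\<epsilon>\<in>{0<..\<epsilon>0}. \<exists>G. open G \<and> closure D \<subseteq> G \<and> smooth_on (G \<times> UNIV) (\<lambda>(x, \<xi>). u \<epsilon> \<xi> x)"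
  shows "\<exists>c>0. \<exists>C>0. \<exists>e1>0. e1 \<le> \<epsilon>0 \<and> e1 \<le> 1 \<and> (\<forall>\<epsilon> \<xi>. 0 < \<epsilon> \<and> \<epsilon> \<le> e1 \<longrightarrow>
     (\<forall>l\<in>{1..3}. dxi l (u \<epsilon>) \<xi> \<in> L2 D \<and> ip D (dxi l (u \<epsilon>) \<xi>) (dxi l (u \<epsilon>) \<xi>) \<le> C * \<epsilon> / \<epsilon> ^ (2 * l)) \<and>
     c / \<epsilon> \<le> ip D (dxi 1 (u \<epsilon>) \<xi>) (dxi 1 (u \<epsilon>) \<xi>) \<and>
     \<bar>ip D (dxi 2 (u \<epsilon>) \<xi>) (dxi 1 (u \<epsilon>) \<xi>)\<bar> \<le> C / \<epsilon>)"
proof -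
  let ?V = "\<lambda>\<epsilon> \<xi> x. deriv U (r \<epsilon> \<xi> x / \<epsilon>)" and ?q = "\<lambda>\<epsilon> \<xi>. dxi 1 (r \<epsilon>) \<xi>"
  let ?N = "\<lambda>\<epsilon> \<xi> x. nonlin (U (r \<epsilon> \<xi> x / \<epsilon>))" and ?\<chi> = "\<lambda>\<epsilon> \<xi>. indicator (layer \<epsilon> \<xi>) :: real^2 \<Rightarrow> real"
  obtain K e1 where K: "K > 0" and e1: "e1 > 0" "e1 \<le> \<epsilon>0" "e1 \<le> 1"
    and pw: "\<And>\<epsilon> \<xi> x. 0 < \<epsilon> \<Longrightarrow> \<epsilon> \<le> e1 \<Longrightarrow> x \<in> D \<Longrightarrow>
     \<bar>dxi 1 (u \<epsilon>) \<xi> x - ?\<chi> \<epsilon> \<xi> x * (?V \<epsilon> \<xi> x * ?q \<epsilon> \<xi> x) / \<epsilon>\<bar> \<le> K \<and>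
     \<bar>dxi 2 (u \<epsilon>) \<xi> x - ?\<chi> \<epsilon> \<xi> x * (?N \<epsilon> \<xi> x * (?q \<epsilon> \<xi> x)\<^sup>2) / \<epsilon>\<^sup>2\<bar> \<le> K / \<epsilon> \<and>
     (\<forall>l\<in>{1..3}. \<bar>dxi l (u \<epsilon>) \<xi> x\<bar> \<le> K * (?\<chi> \<epsilon> \<xi> x * ?V \<epsilon> \<xi> x + \<epsilon>) / \<epsilon> ^ l)"
    using pointwise_expansion by blast
  obtain Cm where Cm: "Cm \<ge> 0" "\<And>\<epsilon> \<xi>. 0 < \<epsilon> \<Longrightarrow> \<epsilon> \<le> \<epsilon>0 \<Longrightarrow>
     set_integrable lebesgue (layer \<epsilon> \<xi>) (?V \<epsilon> \<xi>) \<and> (LINT x:layer \<epsilon> \<xi>|lebesgue. ?V \<epsilon> \<xi> x) \<le> Cm * \<epsilon>"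
    using layer_mass by blast
  obtain c e2 where c: "c > 0" and e2: "e2 > 0" and low: "\<And>\<epsilon> \<xi>. 0 < \<epsilon> \<Longrightarrow> \<epsilon> \<le> \<epsilon>0 \<Longrightarrow> \<epsilon> \<le> e2 \<Longrightarrow>
     set_integrable lebesgue (layer \<epsilon> \<xi>) (\<lambda>x. (?V \<epsilon> \<xi> x * ?q \<epsilon> \<xi> x)\<^sup>2) \<and>
     c * \<epsilon> \<le> (LINT x:layer \<epsilon> \<xi>|lebesgue. (?V \<epsilon> \<xi> x * ?q \<epsilon> \<xi> x)\<^sup>2)"
    using layer_energy_lower by blast
  obtain Cc where Cc: "Cc \<ge> 0" "\<And>\<epsilon> \<xi>. 0 < \<epsilon> \<Longrightarrow> \<epsilon> \<le> \<epsilon>0 \<Longrightarrow>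
     set_integrable lebesgue (layer \<epsilon> \<xi>) (\<lambda>x. ?V \<epsilon> \<xi> x * ?N \<epsilon> \<xi> x * (?q \<epsilon> \<xi> x) ^ 3) \<and>
     \<bar>LINT x:layer \<epsilon> \<xi>|lebesgue. ?V \<epsilon> \<xi> x * ?N \<epsilon> \<xi> x * (?q \<epsilon> \<xi> x) ^ 3\<bar> \<le> Cc * \<epsilon>\<^sup>2"
    using layer_cancellation by blast
  obtain B where B: "B > 0" "\<And>\<epsilon> \<xi> x. 0 < \<epsilon> \<Longrightarrow> \<epsilon> \<le> \<epsilon>0 \<Longrightarrow> x \<in> layer \<epsilon> \<xi> \<Longrightarrow> \<bar>?q \<epsilon> \<xi> x\<bar> \<le> B"
    using r_xi_bound by blast
  have V: "0 < deriv U R" "deriv U R \<le> 1" for R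
    using AC_profile_deriv_pos[OF profile] AC_profile_deriv_le_1[OF profile] by auto
  define m where "m = measure lebesgue D"
  have m: "0 \<le> m" by (simp add: m_def)
  have int1: "integrable (lebesgue_on D) (\<lambda>_. k)" and LINT1: "(LINT x|lebesgue_on D. k) = k * m" for k :: real
  proof -
    show "integrable (lebesgue_on D) (\<lambda>_. k)"
      using D_lmeasurable(1) by (intro finite_measure.integrable_const finite_measure_lebesgue_on)
    show "(LINT x|lebesgue_on D. k) = k * m"
      using D_lmeasurable(2) by (simp add: m_def measure_restrict_space)
  qed
  define C where "C = K\<^sup>2 * (2 * Cm + 2 * m) + (K * K + B * K) * (Cm + m) + Cc + 1"
  have C: "0 < C" "K\<^sup>2 * (2 * Cm + 2 * m) \<le> C" "(K * K + B * K) * (Cm + m) + Cc \<le> C"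
    using K Cm m B Cc by (auto simp: C_def add_nonneg_pos)
  define e3 where "e3 = min (min e1 e2) (c / (4 * (K\<^sup>2 * m + 1)))"
  have K2m: "0 \<le> K\<^sup>2 * m" using m by simp
  have e3: "0 < e3" "e3 \<le> e1" "e3 \<le> e2" "e3 \<le> c / (4 * (K\<^sup>2 * m + 1))"
    using e1 e2 c K2m by (auto simp: e3_def)
  have main: "(\<forall>l\<in>{1..3}. dxi l (u \<epsilon>) \<xi> \<in> L2 D \<and> ip D (dxi l (u \<epsilon>) \<xi>) (dxi l (u \<epsilon>) \<xi>) \<le> C * \<epsilon> / \<epsilon> ^ (2 * l)) \<and>
     (c / 4) / \<epsilon> \<le> ip D (dxi 1 (u \<epsilon>) \<xi>) (dxi 1 (u \<epsilon>) \<xi>) \<and>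
     \<bar>ip D (dxi 2 (u \<epsilon>) \<xi>) (dxi 1 (u \<epsilon>) \<xi>)\<bar> \<le> C / \<epsilon>" if ee: "0 < \<epsilon>" "\<epsilon> \<le> e3" for \<epsilon> \<xi>
  proof -
    have e: "0 < \<epsilon>" "\<epsilon> \<le> \<epsilon>0" "\<epsilon> \<le> e1" "\<epsilon> \<le> e2" "\<epsilon> \<le> 1" using ee e3 e1 by auto
    note p = pw[OF e(1,3), of _ \<xi>]
    let ?u = "\<lambda>l. dxi l (u \<epsilon>) \<xi>"
    \<comment> \<open>the profile derivative, extended by \<open>0\<close> outside the layer\<close>
    define w where "w x = ?\<chi> \<epsilon> \<xi> x * ?V \<epsilon> \<xi> x" for x
    have sub: "layer \<epsilon> \<xi> \<subseteq> D" by (auto simp: layer_def)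
    have w: "integrable (lebesgue_on D) w" "(LINT x|lebesgue_on D. w x) \<le> Cm * \<epsilon>"
      using integral_restrict_subset[OF D_lmeasurable(2) sub, of "?V \<epsilon> \<xi>"] Cm(2)[OF e(1,2), of \<xi>]
      by (auto simp: w_def[abs_def])
    have w01: "0 \<le> w x" "w x \<le> 1" for x using V[of "r \<epsilon> \<xi> x / \<epsilon>"] by (auto simp: w_def indicator_def)
    have ub: "\<bar>?u l x\<bar> \<le> K * (w x + \<epsilon>) / \<epsilon> ^ l" if "x \<in> D" "l \<in> {1..3}" for l x
      using p[OF that(1)] that(2) by (simp add: w_def)
    have um: "?u l \<in> borel_measurable (lebesgue_on D)" for l
      by (rule u_derivative_measurable(1)[OF u[rule_format]]) (use e in simp)
    have L2: "?u l \<in> L2 D" if l: "l \<in> {1..3}" for l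
    proof (rule bounded_in_L2[OF D_lmeasurable(1) um])
      fix x assume x: "x \<in> D"
      have "K * (w x + \<epsilon>) / \<epsilon> ^ l \<le> K * (1 + 1) / \<epsilon> ^ l"
        using w01[of x] e K by (intro divide_right_mono mult_left_mono add_mono) auto
      then show "\<bar>?u l x\<bar> \<le> K * (1 + 1) / \<epsilon> ^ l" using ub[OF x l] by linarith
    qed
    have spc: "x \<in> D" if "x \<in> space (lebesgue_on D)" for x using that by (simp add: space_restrict_space)
    have up: "ip D (?u l) (?u l) \<le> C * \<epsilon> / \<epsilon> ^ (2 * l)" if l: "l \<in> {1..3}" for l
    proof -
      have i: "integrable (lebesgue_on D) (\<lambda>x. K\<^sup>2 / \<epsilon> ^ (2 * l) * (2 * w x + 2 * \<epsilon>\<^sup>2))"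
        using w(1) int1 by (intro integrable_mult_right Bochner_Integration.integrable_add) auto
      have "ip D (?u l) (?u l) \<le> (LINT x|lebesgue_on D. K\<^sup>2 / \<epsilon> ^ (2 * l) * (2 * w x + 2 * \<epsilon>\<^sup>2))"
        unfolding ip_def
      proof (rule integral_mono[OF L2_mult_integrable[OF L2[OF l] L2[OF l]] i])
        fix x assume "x \<in> space (lebesgue_on D)"
        then have x: "x \<in> D" by (rule spc)
        have "\<bar>?u l x\<bar>\<^sup>2 \<le> (K * (w x + \<epsilon>) / \<epsilon> ^ l)\<^sup>2"
          using ub[OF x l] by (intro power_mono) auto
        also have "\<dots> = K\<^sup>2 / \<epsilon> ^ (2 * l) * (w x + \<epsilon>)\<^sup>2"
          by (simp add: power_divide power_mult_distrib power_mult[symmetric] mult.commute)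
        also have "\<dots> \<le> K\<^sup>2 / \<epsilon> ^ (2 * l) * (2 * w x + 2 * \<epsilon>\<^sup>2)"
        proof (rule mult_left_mono)
          have "(w x + \<epsilon>)\<^sup>2 \<le> 2 * (w x)\<^sup>2 + 2 * \<epsilon>\<^sup>2"
            using zero_le_power2[of "w x - \<epsilon>"] by (simp add: power2_eq_square algebra_simps)
          moreover have "(w x)\<^sup>2 \<le> w x" using w01[of x] by (simp add: power2_eq_square mult_left_le)
          ultimately show "(w x + \<epsilon>)\<^sup>2 \<le> 2 * w x + 2 * \<epsilon>\<^sup>2" by linarith
        qed (use e in simp)
        finally show "?u l x * ?u l x \<le> K\<^sup>2 / \<epsilon> ^ (2 * l) * (2 * w x + 2 * \<epsilon>\<^sup>2)"
          by (simp add: power2_eq_square)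
      qed
      also have "\<dots> = K\<^sup>2 / \<epsilon> ^ (2 * l) * (2 * (LINT x|lebesgue_on D. w x) + 2 * \<epsilon>\<^sup>2 * m)"
        using w(1) int1 LINT1[of "2 * \<epsilon>\<^sup>2"] by simp
      also have "\<dots> \<le> K\<^sup>2 / \<epsilon> ^ (2 * l) * (2 * (Cm * \<epsilon>) + 2 * \<epsilon> * m)"
        using w(2) e m by (intro mult_left_mono add_mono mult_right_mono)
          (auto simp: power2_eq_square mult_left_le)
      also have "\<dots> = (K\<^sup>2 * (2 * Cm + 2 * m)) * \<epsilon> / \<epsilon> ^ (2 * l)" by (simp add: algebra_simps add_divide_distrib)
      also have "\<dots> \<le> C * \<epsilon> / \<epsilon> ^ (2 * l)"
        using C(2) e by (intro divide_right_mono mult_right_mono) auto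
      finally show ?thesis .
    qed
    have lower: "(c / 4) / \<epsilon> \<le> ip D (?u 1) (?u 1)"
    proof -
      let ?y = "\<lambda>x. ?\<chi> \<epsilon> \<xi> x * (?V \<epsilon> \<xi> x * ?q \<epsilon> \<xi> x)\<^sup>2"
      have y: "integrable (lebesgue_on D) ?y" "c * \<epsilon> \<le> (LINT x|lebesgue_on D. ?y x)"
        using integral_restrict_subset[OF D_lmeasurable(2) sub, of "\<lambda>x. (?V \<epsilon> \<xi> x * ?q \<epsilon> \<xi> x)\<^sup>2"]
          low[OF e(1,2,4), of \<xi>] by auto
      have i: "integrable (lebesgue_on D) (\<lambda>x. 1 / (2 * \<epsilon>\<^sup>2) * ?y x - K\<^sup>2)"
        using y(1) int1 by (intro Bochner_Integration.integrable_diff integrable_mult_right) auto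
      have "\<epsilon> \<le> c / (4 * (K\<^sup>2 * m + 1))" using ee e3 by linarith
      then have "\<epsilon> * (4 * (K\<^sup>2 * m + 1)) \<le> c" using K2m by (simp add: pos_le_divide_eq)
      then have "4 * (K\<^sup>2 * m * \<epsilon>) \<le> c" using e(1) by (simp add: algebra_simps)
      then have "K\<^sup>2 * m \<le> (c / 4) / \<epsilon>" using e(1) by (simp add: field_simps)
      then have "(c / 4) / \<epsilon> \<le> 1 / (2 * \<epsilon>\<^sup>2) * (c * \<epsilon>) - K\<^sup>2 * m"
        using e(1) by (simp add: power2_eq_square)
      also have "\<dots> \<le> 1 / (2 * \<epsilon>\<^sup>2) * (LINT x|lebesgue_on D. ?y x) - K\<^sup>2 * m"
        using y(2) e(1) by (intro diff_right_mono mult_left_mono) auto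
      also have "\<dots> = (LINT x|lebesgue_on D. 1 / (2 * \<epsilon>\<^sup>2) * ?y x - K\<^sup>2)"
        using y(1) int1 LINT1[of "K\<^sup>2"] by (subst Bochner_Integration.integral_diff) auto
      also have "\<dots> \<le> ip D (?u 1) (?u 1)"
        unfolding ip_def
      proof (rule integral_mono[OF i])
        show "integrable (lebesgue_on D) (\<lambda>x. ?u 1 x * ?u 1 x)" by (intro L2_mult_integrable L2) auto
        fix x assume "x \<in> space (lebesgue_on D)"
        then have x: "x \<in> D" by (rule spc)
        let ?z = "?\<chi> \<epsilon> \<xi> x * (?V \<epsilon> \<xi> x * ?q \<epsilon> \<xi> x) / \<epsilon>"
        have "\<bar>?u 1 x - ?z\<bar>\<^sup>2 \<le> K\<^sup>2" using p[OF x] by (intro power_mono) auto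
        then have "(?u 1 x - ?z)\<^sup>2 \<le> K\<^sup>2" by simp
        moreover have "?z\<^sup>2 \<le> 2 * (?u 1 x)\<^sup>2 + 2 * (?u 1 x - ?z)\<^sup>2"
          using zero_le_power2[of "2 * ?u 1 x - ?z"] by (simp add: power2_eq_square algebra_simps)
        ultimately have "?z\<^sup>2 / 2 - K\<^sup>2 \<le> (?u 1 x)\<^sup>2" by linarith
        moreover have "?z\<^sup>2 / 2 = 1 / (2 * \<epsilon>\<^sup>2) * ?y x"
          by (simp add: power_divide power_mult_distrib indicator_def)
        ultimately show "1 / (2 * \<epsilon>\<^sup>2) * ?y x - K\<^sup>2 \<le> ?u 1 x * ?u 1 x"
          unfolding power2_eq_square[of "?u 1 x"] by (simp only:)
      qed
      finally show ?thesis .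
    qed
    have cross: "\<bar>ip D (?u 2) (?u 1)\<bar> \<le> C / \<epsilon>"
    proof -
      let ?y = "\<lambda>x. ?\<chi> \<epsilon> \<xi> x * (?V \<epsilon> \<xi> x * ?N \<epsilon> \<xi> x * (?q \<epsilon> \<xi> x) ^ 3)"
      have y: "integrable (lebesgue_on D) ?y" "\<bar>LINT x|lebesgue_on D. ?y x\<bar> \<le> Cc * \<epsilon>\<^sup>2"
        using integral_restrict_subset[OF D_lmeasurable(2) sub, of "\<lambda>x. ?V \<epsilon> \<xi> x * ?N \<epsilon> \<xi> x * (?q \<epsilon> \<xi> x) ^ 3"]
          Cc(2)[OF e(1,2), of \<xi>] by auto
      have iu: "integrable (lebesgue_on D) (\<lambda>x. ?u 2 x * ?u 1 x)" by (intro L2_mult_integrable L2) auto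
      have iy: "integrable (lebesgue_on D) (\<lambda>x. 1 / \<epsilon> ^ 3 * ?y x)" using y(1) by (rule integrable_mult_right)
      have iw: "integrable (lebesgue_on D) (\<lambda>x. (K * K + B * K) / \<epsilon>\<^sup>2 * (w x + \<epsilon>))"
        using w(1) int1 by (intro integrable_mult_right Bochner_Integration.integrable_add) auto
      have diff: "\<bar>?u 2 x * ?u 1 x - 1 / \<epsilon> ^ 3 * ?y x\<bar> \<le> (K * K + B * K) / \<epsilon>\<^sup>2 * (w x + \<epsilon>)" if x: "x \<in> D" for x
      proof -
        let ?z1 = "?\<chi> \<epsilon> \<xi> x * (?V \<epsilon> \<xi> x * ?q \<epsilon> \<xi> x) / \<epsilon>"
        let ?z2 = "?\<chi> \<epsilon> \<xi> x * (?N \<epsilon> \<xi> x * (?q \<epsilon> \<xi> x)\<^sup>2) / \<epsilon>\<^sup>2"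
        have zz: "1 / \<epsilon> ^ 3 * ?y x = ?z1 * ?z2"
          by (simp add: indicator_def eval_nat_numeral mult_ac)
        have "?u 2 x * ?u 1 x - ?z1 * ?z2 = ?u 2 x * (?u 1 x - ?z1) + ?z1 * (?u 2 x - ?z2)"
          by (simp add: algebra_simps)
        then have "\<bar>?u 2 x * ?u 1 x - ?z1 * ?z2\<bar> \<le> \<bar>?u 2 x\<bar> * \<bar>?u 1 x - ?z1\<bar> + \<bar>?z1\<bar> * \<bar>?u 2 x - ?z2\<bar>"
          using abs_triangle_ineq[of "?u 2 x * (?u 1 x - ?z1)" "?z1 * (?u 2 x - ?z2)"] by (simp only: abs_mult)
        also have "\<dots> \<le> (K * (w x + \<epsilon>) / \<epsilon>\<^sup>2) * K + (B * w x / \<epsilon>) * (K / \<epsilon>)"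
        proof (intro add_mono mult_mono)
          show "\<bar>?u 2 x\<bar> \<le> K * (w x + \<epsilon>) / \<epsilon>\<^sup>2" by (rule ub[OF x]) simp
          show "\<bar>?u 1 x - ?z1\<bar> \<le> K" "\<bar>?u 2 x - ?z2\<bar> \<le> K / \<epsilon>" using p[OF x] by auto
          show "\<bar>?z1\<bar> \<le> B * w x / \<epsilon>"
          proof (cases "x \<in> layer \<epsilon> \<xi>")
            case True
            have "?V \<epsilon> \<xi> x * \<bar>?q \<epsilon> \<xi> x\<bar> \<le> ?V \<epsilon> \<xi> x * B"
              using B(2)[OF e(1,2) True] V[of "r \<epsilon> \<xi> x / \<epsilon>"] by (intro mult_left_mono) auto
            then show ?thesis
              using True e(1) V[of "r \<epsilon> \<xi> x / \<epsilon>"] by (simp add: w_def abs_mult divide_right_mono mult.commute)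
          qed (simp add: w_def)
        qed (use K B w01[of x] e(1) in auto)
        also have "\<dots> = (K * K * (w x + \<epsilon>) + B * K * w x) / \<epsilon>\<^sup>2"
          by (simp add: add_divide_distrib power2_eq_square mult_ac)
        also have "\<dots> \<le> (K * K * (w x + \<epsilon>) + B * K * (w x + \<epsilon>)) / \<epsilon>\<^sup>2"
          using K B e(1) by (intro divide_right_mono add_left_mono mult_left_mono) auto
        also have "\<dots> = (K * K + B * K) / \<epsilon>\<^sup>2 * (w x + \<epsilon>)" by (simp add: distrib_right)
        finally show ?thesis unfolding zz .
      qed
      have "\<bar>ip D (?u 2) (?u 1) - 1 / \<epsilon> ^ 3 * (LINT x|lebesgue_on D. ?y x)\<bar>
          = \<bar>LINT x|lebesgue_on D. ?u 2 x * ?u 1 x - 1 / \<epsilon> ^ 3 * ?y x\<bar>"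
        unfolding ip_def using iu iy by (subst Bochner_Integration.integral_diff) auto
      also have "\<dots> \<le> (LINT x|lebesgue_on D. \<bar>?u 2 x * ?u 1 x - 1 / \<epsilon> ^ 3 * ?y x\<bar>)" by (rule integral_abs_bound)
      also have "\<dots> \<le> (LINT x|lebesgue_on D. (K * K + B * K) / \<epsilon>\<^sup>2 * (w x + \<epsilon>))"
        by (rule integral_mono[OF integrable_abs[OF Bochner_Integration.integrable_diff[OF iu iy]] iw])
          (use diff spc in blast)
      also have "\<dots> = (K * K + B * K) / \<epsilon>\<^sup>2 * ((LINT x|lebesgue_on D. w x) + \<epsilon> * m)"
        using w(1) int1 LINT1[of \<epsilon>] by simp
      also have "\<dots> \<le> (K * K + B * K) / \<epsilon>\<^sup>2 * (Cm * \<epsilon> + \<epsilon> * m)"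
        using w(2) K B e(1) by (intro mult_left_mono add_mono divide_nonneg_nonneg add_nonneg_nonneg) auto
      also have "\<dots> = ((K * K + B * K) * (Cm + m)) / \<epsilon>"
        using e(1) by (simp add: power2_eq_square field_simps)
      finally have "\<bar>ip D (?u 2) (?u 1) - 1 / \<epsilon> ^ 3 * (LINT x|lebesgue_on D. ?y x)\<bar> \<le> ((K * K + B * K) * (Cm + m)) / \<epsilon>" .
      moreover have "\<bar>1 / \<epsilon> ^ 3 * (LINT x|lebesgue_on D. ?y x)\<bar> \<le> Cc / \<epsilon>"
      proof -
        have "\<bar>1 / \<epsilon> ^ 3 * (LINT x|lebesgue_on D. ?y x)\<bar> \<le> 1 / \<epsilon> ^ 3 * (Cc * \<epsilon>\<^sup>2)"
          unfolding abs_mult using y(2) e(1) by (intro mult_mono) auto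
        also have "\<dots> = Cc / \<epsilon>" using e(1) by (simp add: eval_nat_numeral)
        finally show ?thesis .
      qed
      ultimately have "\<bar>ip D (?u 2) (?u 1)\<bar> \<le> ((K * K + B * K) * (Cm + m)) / \<epsilon> + Cc / \<epsilon>" by linarith
      also have "\<dots> = ((K * K + B * K) * (Cm + m) + Cc) / \<epsilon>" by (simp add: add_divide_distrib)
      also have "\<dots> \<le> C / \<epsilon>" using C(3) e(1) by (intro divide_right_mono) auto
      finally show ?thesis .
    qed
    show ?thesis using L2 up lower cross by blast
  qed
  have "0 < c / 4" "e3 \<le> \<epsilon>0" "e3 \<le> 1" using c e3 e1 by auto
  then show ?thesis using C(1) e3(1) main by blast
qed

end

section \<open>The drift and noise coefficients\<close>

lemma L2norm_le_powr:
  assumes e: "0 < \<epsilon>" and C: "0 \<le> C" and g: "ip D g g \<le> C * \<epsilon> / \<epsilon> ^ (2 * l)"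
  shows "L2norm D g \<le> sqrt C * \<epsilon> powr (1/2 - real l)"
proof (rule power2_le_imp_le)
  have "(sqrt C * \<epsilon> powr (1/2 - real l))\<^sup>2 = C * (\<epsilon> powr (1/2 - real l) * \<epsilon> powr (1/2 - real l))"
    using C by (simp add: power_mult_distrib power2_eq_square[of "\<epsilon> powr (1/2 - real l)"])
  also have "\<epsilon> powr (1/2 - real l) * \<epsilon> powr (1/2 - real l) = \<epsilon> powr (1 - real (2 * l))"
    by (simp add: powr_add[symmetric])
  also have "\<dots> = \<epsilon> / \<epsilon> ^ (2 * l)"
    using e by (simp add: powr_diff powr_realpow[symmetric])
  finally show "(L2norm D g)\<^sup>2 \<le> (sqrt C * \<epsilon> powr (1/2 - real l))\<^sup>2" using g by (simp add: L2norm_sq)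
  show "0 \<le> sqrt C * \<epsilon> powr (1/2 - real l)" using C by simp
qed

text \<open>Cauchy--Schwarz throughout. The assumption \<open>small\<close> makes \<open>\<parallel>\<partial>\<^sub>\<xi>u\<parallel>\<^sup>2\<close> the dominant part of \<open>A\<close>, so that \<open>A\<^bsup>-1\<^esup> \<le> (2 / c) \<epsilon>\<close>;
  the drift splits into \<open>T1\<close>, which carries the factor \<open>(Q\<sigma>, \<sigma>)\<close>, and \<open>T2 = A\<^bsup>-2\<^esup> (\<partial>\<^sub>\<xi>u, Q \<partial>\<^sub>\<xi>\<^sup>2u)\<close>. One
  constant \<open>K\<close> serves all the bounds.\<close>
lemma drift_and_noise_bounds:
  fixes u :: "real \<Rightarrow> real^2 \<Rightarrow> real"
  assumes Q: "covariance_op D a e Q"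
    and e: "0 < \<epsilon>" "\<epsilon> \<le> 1" and k: "5/2 < k"
    and pos: "0 < c" "0 \<le> B" "0 \<le> C" "0 \<le> V"
    and u: "\<And>l. l \<in> {1..3} \<Longrightarrow> dxi l u \<xi> \<in> L2 D"
    and norms: "\<And>l. l \<in> {1..3} \<Longrightarrow> L2norm D (dxi l u \<xi>) \<le> B * \<epsilon> powr (1/2 - real l)"
    and lower: "c / \<epsilon> \<le> ip D (dxi 1 u \<xi>) (dxi 1 u \<xi>)"
    and cross: "\<bar>ip D (dxi 2 u \<xi>) (dxi 1 u \<xi>)\<bar> \<le> C / \<epsilon>"
    and v: "v \<in> L2 D" "L2norm D v \<le> V * \<epsilon> powr (k - 2)"
    and small: "V * B * \<epsilon> powr (k - 5/2) \<le> c / 2"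
    and K_def: "K = (2 / c) ^ 3 * B\<^sup>2 * (V * B + 2 * C) + (2 / c)\<^sup>2 * B\<^sup>2 + 2 / c * B"
  shows "A_coef D u \<xi> v \<noteq> 0"
    and "\<bar>dA_drift D Q u \<xi> v\<bar> \<le> K * op_norm D Q"
    and "dA_noise D u \<xi> v \<in> L2 D" and "L2norm D (dA_noise D u \<xi> v) \<le> K * \<epsilon> powr (1/2)"
    and "\<bar>dA_drift D Q u \<xi> v - inverse ((A_coef D u \<xi> v)\<^sup>2) * ip D (dxi 1 u \<xi>) (Q (dxi 2 u \<xi>))\<bar>
      \<le> K * op_norm D Q * \<epsilon> powr (min 1 (k - 5/2))"
proof -
  let ?u = "\<lambda>l. dxi l u \<xi>" and ?A = "A_coef D u \<xi> v" and ?\<eta> = "op_norm D Q" and ?h = "2 / c"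
  let ?\<sigma> = "sigma_coef D u \<xi> v"
  have \<eta>: "0 \<le> ?\<eta>" by (rule op_norm_nonneg[OF Q])
  have h: "0 < ?h" using pos by simp
  have p: "\<epsilon> powr x * \<epsilon> powr y = \<epsilon> powr (x + y)" for x y by (simp add: powr_add)
  have em1: "\<epsilon> powr (-1) = 1 / \<epsilon>" and em2: "\<epsilon> powr (-2) = 1 / \<epsilon>\<^sup>2"
    using e(1) by (simp_all add: powr_minus_divide)
  have u1: "?u 1 \<in> L2 D" and u2: "?u 2 \<in> L2 D" and u3: "?u 3 \<in> L2 D" using u by auto
  have n1: "L2norm D (?u 1) \<le> B * \<epsilon> powr (-1/2)" and n2: "L2norm D (?u 2) \<le> B * \<epsilon> powr (-3/2)"
    and n3: "L2norm D (?u 3) \<le> B * \<epsilon> powr (-5/2)"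
    using norms[of 1] norms[of 2] norms[of 3] by auto
  \<comment> \<open>the correction \<open>(v, \<partial>\<^sub>\<xi>\<^sup>2 u)\<close> is of lower order than \<open>\<parallel>\<partial>\<^sub>\<xi> u\<parallel>\<^sup>2\<close>, because \<open>k > 5/2\<close>\<close>
  have "\<bar>ip D v (?u 2)\<bar> \<le> L2norm D v * L2norm D (?u 2)" by (rule ip_Cauchy_Schwarz[OF v(1) u2])
  also have "\<dots> \<le> (V * \<epsilon> powr (k - 2)) * (B * \<epsilon> powr (-3/2))"
    using v(2) n2 pos by (intro mult_mono L2norm_nonneg) auto
  also have "\<dots> = V * B * (\<epsilon> powr (k - 2) * \<epsilon> powr (-3/2))" by simp
  also have "\<dots> = V * B * (\<epsilon> powr (k - 5/2) * \<epsilon> powr (-1))" unfolding p by simp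
  also have "\<dots> = V * B * \<epsilon> powr (k - 5/2) / \<epsilon>" unfolding em1 by simp
  also have "\<dots> \<le> (c / 2) / \<epsilon>" using small e(1) by (intro divide_right_mono) auto
  finally have "c / \<epsilon> - (c / 2) / \<epsilon> \<le> ?A" unfolding A_coef_def L2norm_sq using lower by linarith
  then have A: "(c / 2) / \<epsilon> \<le> ?A" using e(1) by (simp add: field_simps)
  have c2: "0 < (c / 2) / \<epsilon>" using pos(1) e(1) by simp
  have A0: "0 < ?A" using A c2 by linarith
  then show "?A \<noteq> 0" by simp
  have iA: "0 < inverse ?A" "inverse ?A \<le> ?h * \<epsilon>"
    using A0 le_imp_inverse_le[OF A c2] by (auto simp: field_simps)
  have \<sigma>_eq: "?\<sigma> = (\<lambda>x. inverse ?A * ?u 1 x)" by (simp add: fun_eq_iff sigma_coef_def)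
  have \<sigma>: "?\<sigma> \<in> L2 D" unfolding \<sigma>_eq by (rule L2_cmult[OF u1])
  have \<sigma>n: "L2norm D ?\<sigma> \<le> ?h * B * \<epsilon> powr (1/2)"
  proof -
    have "L2norm D ?\<sigma> = inverse ?A * L2norm D (?u 1)" unfolding \<sigma>_eq L2norm_cmult using iA by simp
    also have "\<dots> \<le> (?h * \<epsilon>) * (B * \<epsilon> powr (-1/2))"
      using iA n1 h e(1) by (intro mult_mono L2norm_nonneg) auto
    also have "\<dots> = ?h * B * (\<epsilon> powr 1 * \<epsilon> powr (-1/2))" using e(1) by simp
    also have "\<dots> = ?h * B * \<epsilon> powr (1/2)" unfolding p by simp
    finally show ?thesis .
  qed
  have \<sigma>\<sigma>: "\<bar>ip D (Q ?\<sigma>) ?\<sigma>\<bar> \<le> ?\<eta> * (?h\<^sup>2 * B\<^sup>2 * \<epsilon>)"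
  proof -
    have "Q ?\<sigma> \<in> L2 D" using Q \<sigma> by (simp add: covariance_op_def)
    then have "\<bar>ip D (Q ?\<sigma>) ?\<sigma>\<bar> \<le> L2norm D (Q ?\<sigma>) * L2norm D ?\<sigma>" by (rule ip_Cauchy_Schwarz[OF _ \<sigma>])
    also have "\<dots> \<le> (?\<eta> * L2norm D ?\<sigma>) * L2norm D ?\<sigma>"
      by (intro mult_right_mono op_norm_bound[OF Q \<sigma>] L2norm_nonneg)
    also have "\<dots> = ?\<eta> * (L2norm D ?\<sigma>)\<^sup>2" by (simp add: power2_eq_square)
    also have "\<dots> \<le> ?\<eta> * (?h * B * \<epsilon> powr (1/2))\<^sup>2"
      using \<sigma>n \<eta> by (intro mult_left_mono power_mono L2norm_nonneg)
    also have "(?h * B * \<epsilon> powr (1/2))\<^sup>2 = ?h\<^sup>2 * B\<^sup>2 * \<epsilon>"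
      using e(1) by (simp only: power_mult_distrib power2_eq_square[of "\<epsilon> powr (1/2)"] p) simp
    finally show ?thesis .
  qed
  let ?m = "min 1 (k - 5/2)"
  have em: "\<epsilon> \<le> \<epsilon> powr ?m" "\<epsilon> powr (k - 5/2) \<le> \<epsilon> powr ?m" "\<epsilon> powr ?m \<le> 1"
    using powr_mono'[of ?m 1 \<epsilon>] powr_mono'[of ?m "k - 5/2" \<epsilon>] powr_mono'[of 0 ?m \<epsilon>] e k by auto
  define T1 where "T1 = inverse ?A * (1/2 * ip D v (?u 3) - 3/2 * ip D (?u 2) (?u 1)) * ip D (Q ?\<sigma>) ?\<sigma>"
  define T2 where "T2 = inverse (?A\<^sup>2) * ip D (?u 1) (Q (?u 2))"
  have drift: "dA_drift D Q u \<xi> v = T1 + T2"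
    unfolding dA_drift_def Let_def T1_def T2_def by (simp add: \<sigma>_eq ip_cmult power2_eq_square)
  have T2: "\<bar>T2\<bar> \<le> ?h\<^sup>2 * B\<^sup>2 * ?\<eta>"
  proof -
    have "Q (?u 2) \<in> L2 D" using Q u2 by (simp add: covariance_op_def)
    then have "\<bar>ip D (?u 1) (Q (?u 2))\<bar> \<le> L2norm D (?u 1) * L2norm D (Q (?u 2))"
      by (rule ip_Cauchy_Schwarz[OF u1])
    also have "\<dots> \<le> L2norm D (?u 1) * (?\<eta> * L2norm D (?u 2))"
      by (intro mult_left_mono op_norm_bound[OF Q u2] L2norm_nonneg)
    also have "\<dots> \<le> (B * \<epsilon> powr (-1/2)) * (?\<eta> * (B * \<epsilon> powr (-3/2)))"
      using n1 n2 \<eta> pos by (intro mult_mono mult_left_mono mult_nonneg_nonneg L2norm_nonneg) auto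
    also have "\<dots> = B\<^sup>2 * ?\<eta> * (\<epsilon> powr (-1/2) * \<epsilon> powr (-3/2))" by (simp add: power2_eq_square)
    also have "\<dots> = B\<^sup>2 * ?\<eta> * \<epsilon> powr (-2)" unfolding p by simp
    finally have i: "\<bar>ip D (?u 1) (Q (?u 2))\<bar> \<le> B\<^sup>2 * ?\<eta> * \<epsilon> powr (-2)" .
    have "\<bar>T2\<bar> = (inverse ?A)\<^sup>2 * \<bar>ip D (?u 1) (Q (?u 2))\<bar>"
      by (simp add: T2_def abs_mult power_inverse)
    also have "\<dots> \<le> (?h * \<epsilon>)\<^sup>2 * (B\<^sup>2 * ?\<eta> * \<epsilon> powr (-2))"
      using i iA by (intro mult_mono power_mono) auto
    also have "\<dots> = ?h\<^sup>2 * B\<^sup>2 * ?\<eta>"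
      unfolding em2 using e(1) by (simp add: power_mult_distrib power_divide)
    finally show ?thesis .
  qed
  have T1: "\<bar>T1\<bar> \<le> ?h ^ 3 * B\<^sup>2 * (V * B + 2 * C) * ?\<eta> * \<epsilon> powr ?m"
  proof -
    have "\<bar>ip D v (?u 3)\<bar> \<le> L2norm D v * L2norm D (?u 3)" by (rule ip_Cauchy_Schwarz[OF v(1) u3])
    also have "\<dots> \<le> (V * \<epsilon> powr (k - 2)) * (B * \<epsilon> powr (-5/2))"
      using v(2) n3 pos by (intro mult_mono L2norm_nonneg) auto
    also have "\<dots> = V * B * (\<epsilon> powr (k - 2) * \<epsilon> powr (-5/2))" by simp
    also have "\<dots> = V * B * (\<epsilon> powr (k - 5/2) * \<epsilon> powr (-2))" unfolding p by simp
    also have "\<dots> = V * B * \<epsilon> powr (k - 5/2) / \<epsilon>\<^sup>2"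
      unfolding em2 by simp
    also have "\<dots> \<le> V * B * \<epsilon> powr ?m / \<epsilon>\<^sup>2"
      using em pos by (intro divide_right_mono mult_left_mono) auto
    finally have i3: "\<bar>ip D v (?u 3)\<bar> \<le> V * B * \<epsilon> powr ?m / \<epsilon>\<^sup>2" .
    have "C / \<epsilon> = C * \<epsilon> / \<epsilon>\<^sup>2" using e(1) by (simp add: power2_eq_square)
    also have "\<dots> \<le> C * \<epsilon> powr ?m / \<epsilon>\<^sup>2"
      using em pos by (intro divide_right_mono mult_left_mono) auto
    finally have "\<bar>ip D (?u 2) (?u 1)\<bar> \<le> C * \<epsilon> powr ?m / \<epsilon>\<^sup>2" using cross by linarith
    then have "\<bar>1/2 * ip D v (?u 3) - 3/2 * ip D (?u 2) (?u 1)\<bar>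
        \<le> V * B * \<epsilon> powr ?m / \<epsilon>\<^sup>2 + 2 * (C * \<epsilon> powr ?m / \<epsilon>\<^sup>2)"
      using i3 by linarith
    also have "\<dots> = (V * B + 2 * C) * \<epsilon> powr ?m / \<epsilon>\<^sup>2" by (simp add: distrib_right add_divide_distrib)
    finally have i: "\<bar>1/2 * ip D v (?u 3) - 3/2 * ip D (?u 2) (?u 1)\<bar> \<le> (V * B + 2 * C) * \<epsilon> powr ?m / \<epsilon>\<^sup>2" .
    have "\<bar>T1\<bar> = inverse ?A * \<bar>1/2 * ip D v (?u 3) - 3/2 * ip D (?u 2) (?u 1)\<bar> * \<bar>ip D (Q ?\<sigma>) ?\<sigma>\<bar>"
      unfolding T1_def abs_mult using iA(1) by simp
    also have "\<dots> \<le> (?h * \<epsilon>) * ((V * B + 2 * C) * \<epsilon> powr ?m / \<epsilon>\<^sup>2) * (?\<eta> * (?h\<^sup>2 * B\<^sup>2 * \<epsilon>))"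
      using iA i \<sigma>\<sigma> h e(1) pos by (intro mult_mono mult_nonneg_nonneg divide_nonneg_nonneg add_nonneg_nonneg) auto
    also have "\<dots> = ?h ^ 3 * B\<^sup>2 * (V * B + 2 * C) * ?\<eta> * \<epsilon> powr ?m"
    proof -
      have "(h' * \<epsilon>) * (P * E / \<epsilon>\<^sup>2) * (y * (h'\<^sup>2 * B2 * \<epsilon>)) = h' ^ 3 * B2 * P * y * E" for h' P E y B2 :: real
        using e(1) by (simp add: power2_eq_square power3_eq_cube)
      then show ?thesis .
    qed
    finally show ?thesis .
  qed
  have q1: "0 \<le> ?h ^ 3 * B\<^sup>2 * (V * B + 2 * C)" and q2: "0 \<le> ?h\<^sup>2 * B\<^sup>2" and q3: "0 \<le> ?h * B"
    using h pos by (auto intro!: mult_nonneg_nonneg add_nonneg_nonneg)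
  have KK: "?h ^ 3 * B\<^sup>2 * (V * B + 2 * C) \<le> K" "?h * B \<le> K" unfolding K_def using q1 q2 q3 by linarith+
  have "\<bar>T1\<bar> \<le> ?h ^ 3 * B\<^sup>2 * (V * B + 2 * C) * ?\<eta> * 1"
    using T1 mult_left_mono[OF em(3) mult_nonneg_nonneg[OF q1 \<eta>]] by linarith
  then have "\<bar>T1 + T2\<bar> \<le> (?h ^ 3 * B\<^sup>2 * (V * B + 2 * C) + ?h\<^sup>2 * B\<^sup>2) * ?\<eta>"
    using T2 by (simp add: distrib_right)
  also have "\<dots> \<le> K * ?\<eta>" unfolding K_def using q3 \<eta> by (intro mult_right_mono) auto
  finally show "\<bar>dA_drift D Q u \<xi> v\<bar> \<le> K * ?\<eta>" unfolding drift .
  have "\<bar>T1\<bar> \<le> K * ?\<eta> * \<epsilon> powr ?m"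
    using T1 mult_right_mono[OF mult_right_mono[OF KK(1) \<eta>], of "\<epsilon> powr ?m"] by simp
  then show "\<bar>dA_drift D Q u \<xi> v - inverse (?A\<^sup>2) * ip D (?u 1) (Q (?u 2))\<bar> \<le> K * ?\<eta> * \<epsilon> powr ?m"
    unfolding drift T2_def by simp
  have noise: "dA_noise D u \<xi> v = ?\<sigma>" by (simp add: fun_eq_iff dA_noise_def sigma_coef_def)
  show "dA_noise D u \<xi> v \<in> L2 D" unfolding noise by (rule \<sigma>)
  show "L2norm D (dA_noise D u \<xi> v) \<le> K * \<epsilon> powr (1/2)"
    unfolding noise using \<sigma>n mult_right_mono[OF KK(2), of "\<epsilon> powr (1/2)"] by simp
qed

section \<open>The droplets of the rescaled domain\<close>

text \<open>The factors \<open>1 / \<delta>\<close> and \<open>\<delta>\<close> cancel: rescaling keeps arc length.\<close>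
lemma norm_scaled_par_velocity:
  assumes p: "smooth_on UNIV p" "\<And>\<xi>. norm (vector_derivative p (at \<xi>)) = 1" and \<delta>: "0 < \<delta>"
  shows "norm (vector_derivative (scaled_par \<delta> p) (at \<xi>)) = 1"
proof -
  have "iter_deriv [] p differentiable (at (\<delta> * \<xi>))"
    using p(1) unfolding smooth_on_def by (metis UNIV_I empty_set empty_subsetI)
  then have "(p has_vector_derivative vector_derivative p (at (\<delta> * \<xi>))) (at (\<delta> * \<xi>))"
    by (simp add: vector_derivative_works)
  moreover have "((\<lambda>\<xi>. \<delta> * \<xi>) has_vector_derivative \<delta>) (at \<xi>)"
    by (auto intro!: derivative_eq_intros)
  ultimately have "((\<lambda>\<xi>. p (\<delta> * \<xi>)) has_vector_derivative \<delta> *\<^sub>R vector_derivative p (at (\<delta> * \<xi>))) (at \<xi>)"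
    using vector_diff_chain_at[of "\<lambda>\<xi>. \<delta> * \<xi>" \<delta> \<xi> p] by (simp add: o_def)
  then have "((\<lambda>\<xi>. (1 / \<delta>) *\<^sub>R p (\<delta> * \<xi>)) has_vector_derivative
      (1 / \<delta>) *\<^sub>R \<delta> *\<^sub>R vector_derivative p (at (\<delta> * \<xi>))) (at \<xi>)"
    by (rule has_vector_derivative_scaleR[OF DERIV_const, simplified])
  then have "vector_derivative (scaled_par \<delta> p) (at \<xi>) = (1 / \<delta>) *\<^sub>R \<delta> *\<^sub>R vector_derivative p (at (\<delta> * \<xi>))"
    unfolding scaled_par_def[abs_def] by (rule vector_derivative_at)
  then show ?thesis using p(2)[of "\<delta> * \<xi>"] \<delta> by simp
qed

lemma scaled_droplet_norms:
  assumes dom: "smooth_domain \<Omega> p n L" and prof: "AC_profile U" "cutoff \<zeta>"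
    and \<delta>: "0 < \<delta>" "\<Lambda> * \<delta> \<le> 1/4" and e0: "0 < \<epsilon>0"
    and fam: "droplet_family (scaled_dom \<delta> \<Omega>) (scaled_par \<delta> p) (scaled_normal \<delta> n) L' U \<zeta> \<Lambda> K \<delta> \<epsilon>0 u c"
  shows "\<exists>c>0. \<exists>C>0. \<exists>e1>0. e1 \<le> \<epsilon>0 \<and> e1 \<le> 1 \<and> (\<forall>\<epsilon> \<xi>. 0 < \<epsilon> \<and> \<epsilon> \<le> e1 \<longrightarrow>
     u \<epsilon> \<xi> \<in> L2 (scaled_dom \<delta> \<Omega>) \<and>
     (\<forall>l\<in>{1..3}. dxi l (u \<epsilon>) \<xi> \<in> L2 (scaled_dom \<delta> \<Omega>) \<and>
        ip (scaled_dom \<delta> \<Omega>) (dxi l (u \<epsilon>) \<xi>) (dxi l (u \<epsilon>) \<xi>) \<le> C * \<epsilon> / \<epsilon> ^ (2 * l)) \<and>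
     c / \<epsilon> \<le> ip (scaled_dom \<delta> \<Omega>) (dxi 1 (u \<epsilon>) \<xi>) (dxi 1 (u \<epsilon>) \<xi>) \<and>
     \<bar>ip (scaled_dom \<delta> \<Omega>) (dxi 2 (u \<epsilon>) \<xi>) (dxi 1 (u \<epsilon>) \<xi>)\<bar> \<le> C / \<epsilon>)"
proof -
  let ?D = "scaled_dom \<delta> \<Omega>"
  have ext: "\<forall>\<epsilon>\<in>{0<..\<epsilon>0}. \<exists>G. open G \<and> closure ?D \<subseteq> G \<and> smooth_on (G \<times> UNIV) (\<lambda>(x, \<xi>). u \<epsilon> \<xi> x)"
    using fam unfolding droplet_family_def by blast
  obtain a r0 \<gamma> \<nu> len r s J uI uB1 uB2 up um where w: "0 < a \<and> 0 < r0 \<and>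
        droplet_curve ?D (scaled_par \<delta> p) (scaled_normal \<delta> n) \<Lambda> \<delta> {0<..\<epsilon>0} a \<gamma> \<nu> len \<and>
        droplet_coords ?D \<Lambda> \<delta> {0<..\<epsilon>0} a r0 \<gamma> \<nu> len r s \<and>
        droplet_expansion ?D U \<zeta> {0<..\<epsilon>0} a len r s J uI uB1 uB2 up um u"
    using fam unfolding droplet_family_def by (elim conjE exE) auto
  interpret droplet_geometry ?D "scaled_par \<delta> p" "scaled_normal \<delta> n" \<Lambda> \<delta> \<epsilon>0 a r0 \<gamma> \<nu> len r s J uI uB1 uB2 up um U \<zeta> u
  proof unfold_locales
    show "AC_profile U" "cutoff \<zeta>" "0 < \<epsilon>0" "\<Lambda> * \<delta> \<le> 1/4" by (fact prof e0 \<delta>)+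
    show "open ?D" unfolding scaled_dom_def using dom \<delta> by (intro open_scaling) (auto simp: smooth_domain_def)
    show "bounded ?D" unfolding scaled_dom_def using dom by (intro bounded_scaling) (auto simp: smooth_domain_def)
    show "norm (vector_derivative (scaled_par \<delta> p) (at \<xi>)) \<le> 1" for \<xi>
      using dom \<delta>(1) by (subst norm_scaled_par_velocity) (auto simp: smooth_domain_def)
    show "norm (scaled_normal \<delta> n \<xi>) \<le> 1" for \<xi>
      using dom by (auto simp: smooth_domain_def scaled_normal_def)
  qed (use w in auto)
  obtain c C e1 where cC: "c > 0" "C > 0" "e1 > 0" "e1 \<le> \<epsilon>0" "e1 \<le> 1"
    and main: "\<forall>\<epsilon> \<xi>. 0 < \<epsilon> \<and> \<epsilon> \<le> e1 \<longrightarrow>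
     (\<forall>l\<in>{1..3}. dxi l (u \<epsilon>) \<xi> \<in> L2 ?D \<and> ip ?D (dxi l (u \<epsilon>) \<xi>) (dxi l (u \<epsilon>) \<xi>) \<le> C * \<epsilon> / \<epsilon> ^ (2 * l)) \<and>
     c / \<epsilon> \<le> ip ?D (dxi 1 (u \<epsilon>) \<xi>) (dxi 1 (u \<epsilon>) \<xi>) \<and>
     \<bar>ip ?D (dxi 2 (u \<epsilon>) \<xi>) (dxi 1 (u \<epsilon>) \<xi>)\<bar> \<le> C / \<epsilon>"
    using derivative_norms[OF ext] by (elim exE conjE) (rule that; assumption)
  have uL2: "u \<epsilon> \<xi> \<in> L2 ?D" if "0 < \<epsilon>" "\<epsilon> \<le> e1" for \<epsilon> \<xi>
    using that cC by (intro u_derivative_measurable(2) ext[rule_format]) auto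
  show ?thesis
    by (rule exI[of _ c], rule conjI[OF cC(1)], rule exI[of _ C], rule conjI[OF cC(2)], rule exI[of _ e1],
        intro conjI cC(3-5)) (use main uL2 in simp)
qed

theorem theorem2p7:
  fixes \<Omega> :: "(real^2) set" and p n :: "real \<Rightarrow> real^2" and L :: real
    and U \<zeta> :: "real \<Rightarrow> real"
    and k \<eta> C\<^sub>0 \<Lambda> :: real and K :: nat
  assumes "smooth_domain \<Omega> p n L"
    and "AC_profile U" and "cutoff \<zeta>"
    and "k > 5/2" and "real K > k" and "\<eta> > 0" and "C\<^sub>0 > 0" and "\<Lambda> > 0"
  shows "\<exists>\<delta>\<^sub>0>0. \<forall>\<delta> \<epsilon>\<^sub>0 D L\<^sub>\<delta> p\<^sub>\<delta> n\<^sub>\<delta> u c.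
    0 < \<delta> \<and> \<delta> < \<delta>\<^sub>0 \<and> 0 < \<epsilon>\<^sub>0 \<and> \<epsilon>\<^sub>0 \<le> 1/2 * C1star \<Omega> * \<delta>\<^sup>2 \<and>
    D = scaled_dom \<delta> \<Omega> \<and> L\<^sub>\<delta> = L / \<delta> \<and> p\<^sub>\<delta> = scaled_par \<delta> p \<and> n\<^sub>\<delta> = scaled_normal \<delta> n \<and>
    droplet_family D p\<^sub>\<delta> n\<^sub>\<delta> L\<^sub>\<delta> U \<zeta> \<Lambda> K \<delta> \<epsilon>\<^sub>0 u c \<longrightarrow>
    (\<exists>C>0. \<exists>\<epsilon>\<^sub>1>0. \<epsilon>\<^sub>1 \<le> \<epsilon>\<^sub>0 \<and> (\<forall>\<epsilon>. 0 < \<epsilon> \<and> \<epsilon> \<le> \<epsilon>\<^sub>1 \<longrightarrow>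
      (\<forall>(M :: 'w measure) F T a e \<beta> Q W w \<tau> \<xi> v b \<A>.
        prob_space M \<and> filtration (space M) F \<and> (\<forall>t. subalgebra M (F t)) \<and> T > 0 \<and>
        Q_Wiener M F T D a e \<beta> Q W \<and>
        SPDE_solution M F T D p\<^sub>\<delta> n\<^sub>\<delta> \<epsilon> W w \<and>
        (AE \<omega> in M. w 0 \<omega> \<in> mfd_tube D L\<^sub>\<delta> (u \<epsilon>) (\<eta> * \<epsilon> powr (k - 2))) \<and>
        stopping_time F \<tau> \<and>
        (\<forall>\<omega>\<in>space M. 0 \<le> \<tau> \<omega> \<and> \<tau> \<omega> \<le> T) \<and>
        (AE \<omega> in M. \<forall>t\<in>{0..<\<tau> \<omega>}. w t \<omega> \<in> mfd_tube D L\<^sub>\<delta> (u \<epsilon>) (C\<^sub>0 * \<epsilon> powr (k - 2))) \<and>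
        fermi_decomposition M F T D L\<^sub>\<delta> (u \<epsilon>) \<tau> w \<xi> v \<and>
        ito_differential M T D a e \<beta> \<tau> \<xi> b
          (\<lambda>t \<omega>. sigma_coef D (u \<epsilon>) (\<xi> t \<omega>) (v t \<omega>)) \<and>
        ito_differential M T D a e \<beta> \<tau> \<A>
          (\<lambda>t \<omega>. dA_drift D Q (u \<epsilon>) (\<xi> t \<omega>) (v t \<omega>))
          (\<lambda>t \<omega>. dA_noise D (u \<epsilon>) (\<xi> t \<omega>) (v t \<omega>))
        \<longrightarrow>
        (\<exists>\<alpha> g. ito_differential M T D a e \<beta> \<tau> \<A> \<alpha> g \<and>
          (AE \<omega> in M. \<forall>t\<in>{0..<\<tau> \<omega>}.
            A_coef D (u \<epsilon>) (\<xi> t \<omega>) (v t \<omega>) \<noteq> 0 \<and>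
            \<alpha> t \<omega> = dA_drift D Q (u \<epsilon>) (\<xi> t \<omega>) (v t \<omega>) \<and>
            g t \<omega> = dA_noise D (u \<epsilon>) (\<xi> t \<omega>) (v t \<omega>) \<and>
            \<bar>\<alpha> t \<omega>\<bar> \<le> C * op_norm D Q \<and>
            g t \<omega> \<in> L2 D \<and> L2norm D (g t \<omega>) \<le> C * \<epsilon> powr (1/2) \<and>
            \<bar>\<alpha> t \<omega> - inverse ((A_coef D (u \<epsilon>) (\<xi> t \<omega>) (v t \<omega>))\<^sup>2)
                * ip D (dxi 1 (u \<epsilon>) (\<xi> t \<omega>)) (Q (dxi 2 (u \<epsilon>) (\<xi> t \<omega>)))\<bar>
              \<le> C * op_norm D Q * \<epsilon> powr (min 1 (k - 5/2)))))))"
  \<comment> \<open>for \<open>\<delta> < 1 / (4 \<Lambda>)\<close> all geometric errors \<open>\<Lambda> \<delta>\<close> are at most \<open>1/4\<close>\<close>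
proof (rule exI[of _ "1 / (4 * \<Lambda>)"], intro conjI allI impI, goal_cases)
  case 1
  show ?case using \<open>\<Lambda> > 0\<close> by simp
next
  case (2 \<delta> \<epsilon>\<^sub>0 D L\<^sub>\<delta> p\<^sub>\<delta> n\<^sub>\<delta> u c)
  have \<delta>: "0 < \<delta>" "\<delta> < 1 / (4 * \<Lambda>)" and e0: "0 < \<epsilon>\<^sub>0" and D: "D = scaled_dom \<delta> \<Omega>"
    and fam: "droplet_family (scaled_dom \<delta> \<Omega>) (scaled_par \<delta> p) (scaled_normal \<delta> n) L\<^sub>\<delta> U \<zeta> \<Lambda> K \<delta> \<epsilon>\<^sub>0 u c"
    using 2 by auto
  have "\<Lambda> * \<delta> \<le> 1/4" using \<delta> \<open>\<Lambda> > 0\<close> by (simp add: field_simps)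
  from scaled_droplet_norms[OF assms(1-3) \<delta>(1) this e0 fam, folded D]
  obtain c' C e1 where cC: "c' > 0" "C > 0" "e1 > 0" "e1 \<le> \<epsilon>\<^sub>0" "e1 \<le> 1"
    and norms: "\<forall>\<epsilon> \<xi>. 0 < \<epsilon> \<and> \<epsilon> \<le> e1 \<longrightarrow> u \<epsilon> \<xi> \<in> L2 D \<and>
     (\<forall>l\<in>{1..3}. dxi l (u \<epsilon>) \<xi> \<in> L2 D \<and> ip D (dxi l (u \<epsilon>) \<xi>) (dxi l (u \<epsilon>) \<xi>) \<le> C * \<epsilon> / \<epsilon> ^ (2 * l)) \<and>
     c' / \<epsilon> \<le> ip D (dxi 1 (u \<epsilon>) \<xi>) (dxi 1 (u \<epsilon>) \<xi>) \<and>
     \<bar>ip D (dxi 2 (u \<epsilon>) \<xi>) (dxi 1 (u \<epsilon>) \<xi>)\<bar> \<le> C / \<epsilon>"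
    by (elim exE conjE) (rule that; assumption)
  define B where "B = sqrt C"
  have B: "0 < B" using cC by (simp add: B_def)
  define q where "q = k - 5/2"
  have q: "0 < q" using assms(4) by (simp add: q_def)
  \<comment> \<open>\<open>\<epsilon>\<^bsup>k - 5/2\<^esup> \<le> X\<close> makes \<open>\<parallel>\<partial>\<^sub>\<xi>u\<parallel>\<^sup>2\<close> the dominant part of \<open>A\<close>\<close>
  define X where "X = c' / (2 * (C\<^sub>0 * B))"
  have X: "0 < X" using cC B assms(7) by (simp add: X_def)
  define e2 where "e2 = min e1 (X powr (1 / q))"
  have e2: "0 < e2" "e2 \<le> e1" "e2 \<le> X powr (1 / q)" using cC X by (auto simp: e2_def)
  define K' where "K' = (2 / c') ^ 3 * B\<^sup>2 * (C\<^sub>0 * B + 2 * C) + (2 / c')\<^sup>2 * B\<^sup>2 + 2 / c' * B"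
  have K': "0 < K'" unfolding K'_def using cC B assms(7) by (intro add_pos_pos mult_pos_pos) auto
  have small: "C\<^sub>0 * B * \<epsilon> powr (k - 5/2) \<le> c' / 2" if "0 < \<epsilon>" "\<epsilon> \<le> e2" for \<epsilon>
  proof -
    have "\<epsilon> powr q \<le> (X powr (1 / q)) powr q" using that e2 q by (intro powr_mono2) auto
    also have "\<dots> = X" using X q by (simp add: powr_powr)
    finally have "C\<^sub>0 * B * \<epsilon> powr q \<le> C\<^sub>0 * B * X" using B assms(7) by (intro mult_left_mono) auto
    also have "\<dots> = c' / 2" using B assms(7) by (simp add: X_def)
    finally show ?thesis by (simp add: q_def)
  qed
  show ?case
  proof (rule exI[of _ K'], rule conjI[OF K'], rule exI[of _ e2], intro conjI allI impI, goal_cases)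
    case 1 show ?case by (rule e2)
  next
    case 2 show ?case using e2 cC by simp
  next
    case (3 \<epsilon> M F T a e \<beta> Q W w \<tau> \<xi> v b \<A>)
    then have e: "0 < \<epsilon>" "\<epsilon> \<le> e1" "\<epsilon> \<le> e2" "\<epsilon> \<le> 1" using e2 cC by auto
    have Q: "covariance_op D a e Q" using 3 unfolding Q_Wiener_def by blast
    have tube: "AE \<omega> in M. \<forall>t\<in>{0..<\<tau> \<omega>}. w t \<omega> \<in> mfd_tube D L\<^sub>\<delta> (u \<epsilon>) (C\<^sub>0 * \<epsilon> powr (k - 2))"
      and fermi: "fermi_decomposition M F T D L\<^sub>\<delta> (u \<epsilon>) \<tau> w \<xi> v"
      and ito: "ito_differential M T D a e \<beta> \<tau> \<A>
          (\<lambda>t \<omega>. dA_drift D Q (u \<epsilon>) (\<xi> t \<omega>) (v t \<omega>))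
          (\<lambda>t \<omega>. dA_noise D (u \<epsilon>) (\<xi> t \<omega>) (v t \<omega>))"
      using 3 by blast+
    have split: "AE \<omega> in M. \<forall>t\<in>{0..<\<tau> \<omega>}. (\<forall>x. w t \<omega> x = u \<epsilon> (\<xi> t \<omega>) x + v t \<omega> x) \<and>
        L2norm D (v t \<omega>) = dist_mfd D L\<^sub>\<delta> (u \<epsilon>) (w t \<omega>)"
    proof (rule AE_mp)
      show "AE \<omega> in M. continuous_on {0..<\<tau> \<omega>} (\<lambda>t. \<xi> t \<omega>) \<and>
        (\<forall>t\<in>{0..<\<tau> \<omega>}. (\<forall>x. w t \<omega> x = u \<epsilon> (\<xi> t \<omega>) x + v t \<omega> x) \<and>
           ip D (v t \<omega>) (dxi 1 (u \<epsilon>) (\<xi> t \<omega>)) = 0 \<and>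
           L2norm D (v t \<omega>) = dist_mfd D L\<^sub>\<delta> (u \<epsilon>) (w t \<omega>))"
        using fermi unfolding fermi_decomposition_def by (rule conjunct2)
    qed (rule AE_I2, blast)
    note nrm = norms[rule_format, OF conjI[OF e(1,2)]]
    show ?case
    proof (rule exI, rule exI, rule conjI[OF ito], rule AE_mp[OF AE_conjI[OF tube split]], rule AE_I2,
        rule impI, rule ballI, goal_cases)
      case (1 \<omega> t)
      then have w: "w t \<omega> \<in> L2 D" "dist_mfd D L\<^sub>\<delta> (u \<epsilon>) (w t \<omega>) < C\<^sub>0 * \<epsilon> powr (k - 2)"
        and wx: "\<And>x. w t \<omega> x = u \<epsilon> (\<xi> t \<omega>) x + v t \<omega> x"
        and vd: "L2norm D (v t \<omega>) = dist_mfd D L\<^sub>\<delta> (u \<epsilon>) (w t \<omega>)"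
        unfolding mfd_tube_def by auto
      have "v t \<omega> = (\<lambda>x. w t \<omega> x - u \<epsilon> (\<xi> t \<omega>) x)" using wx by (simp add: fun_eq_iff)
      then have v: "v t \<omega> \<in> L2 D" using L2_diff[OF w(1), of "u \<epsilon> (\<xi> t \<omega>)"] nrm[of "\<xi> t \<omega>"] by simp
      have vn: "L2norm D (v t \<omega>) \<le> C\<^sub>0 * \<epsilon> powr (k - 2)" using vd w(2) by simp
      have c0: "0 \<le> B" "0 \<le> C" "0 \<le> C\<^sub>0" using B cC assms(7) by auto
      have n: "L2norm D (dxi l (u \<epsilon>) (\<xi> t \<omega>)) \<le> B * \<epsilon> powr (1/2 - real l)" if "l \<in> {1..3}" for l
        unfolding B_def using nrm[of "\<xi> t \<omega>"] that by (intro L2norm_le_powr e(1) c0(2)) blast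
      have uL: "dxi l (u \<epsilon>) (\<xi> t \<omega>) \<in> L2 D" if "l \<in> {1..3}" for l using nrm[of "\<xi> t \<omega>"] that by blast
      have lo: "c' / \<epsilon> \<le> ip D (dxi 1 (u \<epsilon>) (\<xi> t \<omega>)) (dxi 1 (u \<epsilon>) (\<xi> t \<omega>))"
        and cr: "\<bar>ip D (dxi 2 (u \<epsilon>) (\<xi> t \<omega>)) (dxi 1 (u \<epsilon>) (\<xi> t \<omega>))\<bar> \<le> C / \<epsilon>"
        using nrm[of "\<xi> t \<omega>"] by blast+
      note bounds = drift_and_noise_bounds[OF Q e(1,4) assms(4) cC(1) c0 uL n lo cr v vn small[OF e(1,3)] K'_def]
      show ?case by (intro conjI bounds refl)
    qed
  qed
qed

end
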